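(* For each left cell $\mathfrak C$ of $\mathfrak S_n$, the character $\chi_{\mathfrak C}$ is irreducible. Two left cells $\mathfrak C,\mathfrak C'$ afford the same character if and only if $\mathfrak C,\mathfrak C'\subseteq\mathfrak R(\lambda)$ for some $\lambda\in\Lambda_n$. The total number of left cells equals $\sum_{\lambda\in\Lambda_n}d_\lambda$.
   Context: Let $W=\mathfrak S_n$ with generators $s_i=(i,i+1)$, length $l$, $\varepsilon_w=(-1)^{l(w)}$. $A=\mathbb Z[v,v^{-1}]$; $\mathcal H$ the Iwahori–Hecke algebra with basis $\{T_w\}$, $T_sT_w=T_{sw}$ if $l(sw)>l(w)$, $T_sT_w=T_{sw}+(v-v^{-1})T_w$ otherwise. With the involution $\overline{\sum a_wT_w}=\sum a_w(v^{-1})T_{w^{-1}}^{-1}$, $C_w$ (resp. $C'_w$) is the unique bar-invariant element with $C_w-T_w\in\sum v\mathbb Z[v]T_y$ (resp. $C'_w-T_w\in\sum v^{-1}\mathbb Z[v^{-1}]T_y$). $C'_xC'_y=\sum h_{x,y,z}C'_z$. $x\leftarrow_{\mathcal L}y$ iff $h_{s,y,x}\ne0$ for some generator $s$; $\le_{\mathcal L}$ its reflexive–transitive closure; left cells are classes of $\sim_{\mathcal L}$. For a left cell $\mathfrak C$, $[\mathfrak C]_A=\mathfrak I/\hat{\mathfrak I}$ where $\mathfrak I$ is the $A$-span of $C_w$ with $w\le_{\mathcal L}z$ for some $z\in\mathfrak C$ and $\hat{\mathfrak I}$ the span of those with additionally $w\notin\mathfrak C$; it is a left $\mathcal H$-module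 with basis $b_x$ (image of $\varepsilon_xC_x$), $x\in\mathfrak C$, and $C_w.b_x=\varepsilon_w\sum_{y\in\mathfrak C}h_{w,x,y}b_y$. $\chi_{\mathfrak C}$ is the character of $K\otimes_A[\mathfrak C]_A$, $K=\mathbb R(v)$. $\Lambda_n$: partitions of $n$ with dominance order $\trianglelefteq$; $\mathfrak S_\lambda$ Young subgroup generated by the $s_k$, $k\notin\{\lambda_1+\dots+\lambda_i\}$, with longest element $w_\lambda$. Irreducible characters $\chi_\lambda$ of $\mathcal H_K$ labelled so that the induced character from the sign representation $T_u\mapsto\varepsilon_uv^{-l(u)}$ of the parabolic subalgebra of $\mathfrak S_\lambda$ is $\chi_\lambda$ plus a sum of $\chi_\mu$, $\lambda\triangleleft\mu$. $d_\lambda=\chi_\lambda(T_1)$, $a(\lambda)=l(w_\lambda)$. For each $\lambda$ fix an orthogonal matrix representation $\mathfrak X_\lambda$ affording $\chi_\lambda$ ($\mathfrak X_\lambda(T_{w^{-1}})=P^{-1}\mathfrak X_\lambda(T_w)^{tr}P$, $P$ invertible diagonal with entries in $1+v\mathbb R[v]$); $v^{a(\lambda)}\mathfrak X^{ij}_\lambda(T_w)$ is regular at $v=0$ with value $\varepsilon_wc^{ij}_{w,\lambda}$ there, and the $\mathfrak X_\lambda$ are chosen with all $c^{ij}_{w,\lambda}\in\mathbb Z$. Then for each $\lambda,i,j$ there is a unique $w=\mathbf w_\lambda(i,j)$ with $c^{ij}_{w,\lambda}\ne0$, giving a bijection onto $\mathfrak S_n$; $\mathfrak R(\lambda)=\{\mathbf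 w_\lambda(i,j):1\le i,j\le d_\lambda\}$. *)

theory Defs
  imports "HOL-Library.Poly_Mapping" "HOL-Combinatorics.Permutations"
          "HOL-Computational_Algebra.Polynomial" "HOL-Computational_Algebra.Fraction_Field"
begin

type_synonym perm = "nat \<Rightarrow> nat"
type_synonym laur = "int \<Rightarrow>\<^sub>0 int"   \<comment> \<open>A = Z[v,v^-1] as group ring Z[Z]\<close>
type_synonym ratf = "real poly fract"

definition Sym :: "nat \<Rightarrow> perm set" where
  "Sym n = {w. w permutes {..<n}}"

definition sgens :: "nat \<Rightarrow> perm set" where
  "sgens n = {transpose i (Suc i) | i. Suc i < n}"

definition wprod :: "perm list \<Rightarrow> perm" where
  "wprod ss = foldr (\<circ>) ss id"

definition len :: "nat \<Rightarrow> perm \<Rightarrow> nat" where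
  "len n w = (LEAST k. \<exists>ss. length ss = k \<and> set ss \<subseteq> sgens n \<and> wprod ss = w)"

definition sgnp :: "nat \<Rightarrow> perm \<Rightarrow> int" where
  "sgnp n w = (-1) ^ len n w"

definition rword :: "nat \<Rightarrow> perm \<Rightarrow> perm list" where
  "rword n w = (SOME ss. set ss \<subseteq> sgens n \<and> length ss = len n w \<and> wprod ss = w)"

definition vA :: laur where "vA = Poly_Mapping.single 1 1"
definition vAinv :: laur where "vAinv = Poly_Mapping.single (-1) 1"
definition deltaA :: laur where "deltaA = vA - vAinv"

lift_definition barA :: "laur \<Rightarrow> laur" is "\<lambda>f k. f (- k)"
proof -
  fix f :: "int \<Rightarrow> int" assume "finite {x. f x \<noteq> 0}"
  then have "finite (uminus ` {x. f x \<noteq> 0})" by simp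
  moreover have "{x. f (- x) \<noteq> 0} = uminus ` {x. f x \<noteq> 0}"
    by (auto intro: image_eqI[where x="- _"])
  ultimately show "finite {x. f (- x) \<noteq> 0}" by simp
qed

definition in_vZv :: "laur \<Rightarrow> bool" where
  "in_vZv a \<longleftrightarrow> (\<forall>k\<in>Poly_Mapping.keys a. 1 \<le> k)"

definition in_viZvi :: "laur \<Rightarrow> bool" where
  "in_viZvi a \<longleftrightarrow> (\<forall>k\<in>Poly_Mapping.keys a. k \<le> -1)"

section \<open>Iwahori-Hecke algebra: elements are coefficient functions w.r.t. the basis T_w\<close>

definition Tb :: "perm \<Rightarrow> perm \<Rightarrow> 'a::zero_neq_one" where
  "Tb w = (\<lambda>y. if y = w then 1 else 0)"

text \<open>Left multiplication by T_s (delta = v - v^-1 in the coefficient ring).\<close>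
definition mulTs :: "nat \<Rightarrow> 'a::comm_ring_1 \<Rightarrow> perm \<Rightarrow> (perm \<Rightarrow> 'a) \<Rightarrow> perm \<Rightarrow> 'a" where
  "mulTs n \<delta> s h = (\<lambda>y. h (s \<circ> y) + (if len n (s \<circ> y) < len n y then \<delta> * h y else 0))"

definition mulT :: "nat \<Rightarrow> 'a::comm_ring_1 \<Rightarrow> perm \<Rightarrow> (perm \<Rightarrow> 'a) \<Rightarrow> perm \<Rightarrow> 'a" where
  "mulT n \<delta> x h = foldr (mulTs n \<delta>) (rword n x) h"

definition hmult :: "nat \<Rightarrow> 'a::comm_ring_1 \<Rightarrow> (perm \<Rightarrow> 'a) \<Rightarrow> (perm \<Rightarrow> 'a) \<Rightarrow> perm \<Rightarrow> 'a" where
  "hmult n \<delta> h h' = (\<lambda>y. \<Sum>x\<in>Sym n. h x * mulT n \<delta> x h' y)"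

text \<open>bar(T_w) = T_{w^-1}^-1 = T_{s1}^-1 ... T_{sk}^-1 for a reduced word, T_s^-1 = T_s - delta.\<close>
definition barT :: "nat \<Rightarrow> perm \<Rightarrow> perm \<Rightarrow> laur" where
  "barT n w = foldr (\<lambda>s g. (\<lambda>y. mulTs n deltaA s g y - deltaA * g y)) (rword n w) (Tb id)"

definition barH :: "nat \<Rightarrow> (perm \<Rightarrow> laur) \<Rightarrow> perm \<Rightarrow> laur" where
  "barH n h = (\<lambda>y. \<Sum>w\<in>Sym n. barA (h w) * barT n w y)"

definition supp_in :: "nat \<Rightarrow> (perm \<Rightarrow> 'a::zero) \<Rightarrow> bool" where
  "supp_in n h \<longleftrightarrow> (\<forall>y. y \<notin> Sym n \<longrightarrow> h y = 0)"

definition KL_C :: "nat \<Rightarrow> perm \<Rightarrow> perm \<Rightarrow> laur" where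
  "KL_C n w = (THE c. supp_in n c \<and> barH n c = c \<and> (\<forall>y. in_vZv (c y - Tb w y)))"

definition KL_C' :: "nat \<Rightarrow> perm \<Rightarrow> perm \<Rightarrow> laur" where
  "KL_C' n w = (THE c. supp_in n c \<and> barH n c = c \<and> (\<forall>y. in_viZvi (c y - Tb w y)))"

definition coords :: "nat \<Rightarrow> (perm \<Rightarrow> perm \<Rightarrow> laur) \<Rightarrow> (perm \<Rightarrow> laur) \<Rightarrow> perm \<Rightarrow> laur" where
  "coords n B h = (THE f. supp_in n f \<and> h = (\<lambda>y. \<Sum>z\<in>Sym n. f z * B z y))"

definition hcoef :: "nat \<Rightarrow> perm \<Rightarrow> perm \<Rightarrow> perm \<Rightarrow> laur" where
  "hcoef n x y z = coords n (KL_C' n) (hmult n deltaA (KL_C' n x) (KL_C' n y)) z"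

definition leftedge :: "nat \<Rightarrow> perm \<Rightarrow> perm \<Rightarrow> bool" where
  "leftedge n x y \<longleftrightarrow> x \<in> Sym n \<and> y \<in> Sym n \<and> (\<exists>s\<in>sgens n. hcoef n s y x \<noteq> 0)"

definition leL :: "nat \<Rightarrow> perm \<Rightarrow> perm \<Rightarrow> bool" where
  "leL n x y \<longleftrightarrow> (leftedge n)\<^sup>*\<^sup>* x y"

definition simL :: "nat \<Rightarrow> perm \<Rightarrow> perm \<Rightarrow> bool" where
  "simL n x y \<longleftrightarrow> leL n x y \<and> leL n y x"

definition left_cells :: "nat \<Rightarrow> perm set set" where
  "left_cells n = {{y \<in> Sym n. simL n x y} | x. x \<in> Sym n}"

definition vK :: ratf where "vK = Fract [:0, 1:] 1"
definition deltaK :: ratf where "deltaK = vK - inverse vK"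

definition embA :: "laur \<Rightarrow> ratf" where
  "embA a = (\<Sum>k\<in>Poly_Mapping.keys a. of_int (Poly_Mapping.lookup a k) * vK powi k)"

definition matmul :: "'i set \<Rightarrow> ('i \<Rightarrow> 'i \<Rightarrow> ratf) \<Rightarrow> ('i \<Rightarrow> 'i \<Rightarrow> ratf) \<Rightarrow> 'i \<Rightarrow> 'i \<Rightarrow> ratf" where
  "matmul I A B = (\<lambda>i j. \<Sum>k\<in>I. A i k * B k j)"

text \<open>X w is the matrix of T_w (rows/columns indexed by I); X is an algebra homomorphism
  iff X(T_1) = 1 and X respects the multiplication rule for T_s T_w.\<close>
definition is_rep :: "nat \<Rightarrow> 'i set \<Rightarrow> (perm \<Rightarrow> 'i \<Rightarrow> 'i \<Rightarrow> ratf) \<Rightarrow> bool" where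
  "is_rep n I X \<longleftrightarrow> finite I \<and>
     (\<forall>i\<in>I. \<forall>j\<in>I. X id i j = (if i = j then 1 else 0)) \<and>
     (\<forall>s\<in>sgens n. \<forall>w\<in>Sym n. \<forall>i\<in>I. \<forall>j\<in>I.
        matmul I (X s) (X w) i j =
          (if len n w < len n (s \<circ> w) then X (s \<circ> w) i j
           else X (s \<circ> w) i j + deltaK * X w i j))"

definition vecs :: "'i set \<Rightarrow> ('i \<Rightarrow> ratf) set" where
  "vecs I = {u. \<forall>i. i \<notin> I \<longrightarrow> u i = 0}"

definition act :: "'i set \<Rightarrow> ('i \<Rightarrow> 'i \<Rightarrow> ratf) \<Rightarrow> ('i \<Rightarrow> ratf) \<Rightarrow> 'i \<Rightarrow> ratf" where
  "act I M u = (\<lambda>i. if i \<in> I then \<Sum>j\<in>I. M i j * u j else 0)"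

definition invariant_subspace :: "nat \<Rightarrow> 'i set \<Rightarrow> (perm \<Rightarrow> 'i \<Rightarrow> 'i \<Rightarrow> ratf) \<Rightarrow> ('i \<Rightarrow> ratf) set \<Rightarrow> bool" where
  "invariant_subspace n I X U \<longleftrightarrow> U \<subseteq> vecs I \<and> (\<lambda>_. 0) \<in> U \<and>
     (\<forall>u\<in>U. \<forall>u'\<in>U. (\<lambda>i. u i + u' i) \<in> U) \<and> (\<forall>c. \<forall>u\<in>U. (\<lambda>i. c * u i) \<in> U) \<and>
     (\<forall>w\<in>Sym n. \<forall>u\<in>U. act I (X w) u \<in> U)"

definition irreducible_rep :: "nat \<Rightarrow> 'i set \<Rightarrow> (perm \<Rightarrow> 'i \<Rightarrow> 'i \<Rightarrow> ratf) \<Rightarrow> bool" where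
  "irreducible_rep n I X \<longleftrightarrow> is_rep n I X \<and> I \<noteq> {} \<and>
     (\<forall>U. invariant_subspace n I X U \<longrightarrow> U = {\<lambda>_. 0} \<or> U = vecs I)"

text \<open>Character: T_w \<mapsto> trace X(T_w) (a character of H_K is determined by these values).\<close>
definition hk_char :: "nat \<Rightarrow> 'i set \<Rightarrow> (perm \<Rightarrow> 'i \<Rightarrow> 'i \<Rightarrow> ratf) \<Rightarrow> perm \<Rightarrow> ratf" where
  "hk_char n I X = (\<lambda>w. if w \<in> Sym n then \<Sum>i\<in>I. X w i i else 0)"

definition irr_char :: "nat \<Rightarrow> (perm \<Rightarrow> ratf) \<Rightarrow> bool" where
  "irr_char n \<chi> \<longleftrightarrow> (\<exists>(d::nat) X. irreducible_rep n {..<d} X \<and> \<chi> = hk_char n {..<d} X)"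

text \<open>Matrix of T_w on K \<otimes> [C]_A = K \<otimes> I/I^ in the basis b_x (image of eps_x C_x):
  entry (y,x) is the coefficient of b_y in T_w . b_x, i.e. eps_x eps_y times the
  C_y-coordinate of T_w C_x.\<close>
definition cell_rep :: "nat \<Rightarrow> perm set \<Rightarrow> perm \<Rightarrow> perm \<Rightarrow> perm \<Rightarrow> ratf" where
  "cell_rep n C = (\<lambda>w y x. embA (of_int (sgnp n x * sgnp n y) *
       coords n (KL_C n) (hmult n deltaA (Tb w) (KL_C n x)) y))"

definition cell_char :: "nat \<Rightarrow> perm set \<Rightarrow> perm \<Rightarrow> ratf" where
  "cell_char n C = hk_char n C (cell_rep n C)"

definition partitions :: "nat \<Rightarrow> nat list set" where
  "partitions n = {la. sorted_wrt (\<ge>) la \<and> 0 \<notin> set la \<and> sum_list la = n}"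

text \<open>dominates la mu means la \<unlhd> mu.\<close>
definition dominates :: "nat list \<Rightarrow> nat list \<Rightarrow> bool" where
  "dominates la mu \<longleftrightarrow> (\<forall>k. sum_list (take k la) \<le> sum_list (take k mu))"

text \<open>0-indexed: transpose i (i+1) corresponds to s_{i+1}.\<close>
definition young_gens :: "nat \<Rightarrow> nat list \<Rightarrow> perm set" where
  "young_gens n la = {transpose i (Suc i) | i. Suc i < n \<and>
      Suc i \<notin> {sum_list (take m la) | m. 1 \<le> m}}"

definition young :: "nat \<Rightarrow> nat list \<Rightarrow> perm set" where
  "young n la = {wprod ss | ss. set ss \<subseteq> young_gens n la}"

definition a_fun :: "nat \<Rightarrow> nat list \<Rightarrow> nat" where
  "a_fun n la = Max (len n ` young n la)"

definition dist_reps :: "nat \<Rightarrow> nat list \<Rightarrow> perm set" where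
  "dist_reps n la = {x \<in> Sym n. \<forall>t\<in>young_gens n la. len n x < len n (x \<circ> t)}"

text \<open>Character of H \<otimes>_{H_la} sgn, sgn(T_u) = eps_u v^{-l(u)}, computed in the basis
  T_x \<otimes> 1 (x distinguished left coset representatives; T_{xu} = T_x T_u).\<close>
definition ind_sign_char :: "nat \<Rightarrow> nat list \<Rightarrow> perm \<Rightarrow> ratf" where
  "ind_sign_char n la = (\<lambda>w. if w \<in> Sym n then
     embA (\<Sum>x\<in>dist_reps n la. \<Sum>u\<in>young n la.
        hmult n deltaA (Tb w) (Tb x) (x \<circ> u) * of_int (sgnp n u) * vAinv ^ len n u)
     else 0)"

definition regular0 :: "ratf \<Rightarrow> bool" where
  "regular0 f \<longleftrightarrow> (\<exists>p q. poly q 0 \<noteq> 0 \<and> f = Fract p q)"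

definition value0 :: "ratf \<Rightarrow> real" where
  "value0 f = (THE c. \<exists>p q. poly q 0 \<noteq> 0 \<and> f = Fract p q \<and> c = poly p 0 / poly q 0)"

definition Rset :: "nat \<Rightarrow> (nat list \<Rightarrow> perm \<Rightarrow> nat \<Rightarrow> nat \<Rightarrow> ratf) \<Rightarrow> (nat list \<Rightarrow> nat) \<Rightarrow> nat list \<Rightarrow> perm set" where
  "Rset n X d la = {w \<in> Sym n. \<exists>i<d la. \<exists>j<d la. value0 (vK ^ a_fun n la * X la w i j) \<noteq> 0}"

end

theory Submission
  imports Defs "HOL-Library.Function_Algebras"
begin

text \<open>
  Faithfulness of the sum of all irreducible representations and Schur's relations, evaluated at
  v = 0, show that the integers c of w, i, j are orthonormal in both directions; hence each is 0 or a
  sign, and the permutations correspond bijectively to the triples (la; i, j). The label of a character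
  identifies w_la with a diagonal triple (la; i0, i0), and each element with triple (la; k, i0) is
  maximal in its left coset of the Young subgroup, so that C_{w(k,i0)} = g_k C_{w_la} for some g_k.

  The element g_k C_{w_la} g_l^flat is bar invariant and has prescribed values at v = 0 under all
  representations not strictly above la. The matrix of values of these representations on the C_w of
  shape not strictly above la is invertible at v = 0, so bar invariance forces
  g_k C_{w_la} g_l^flat to be C_{w(k,l)} up to sign and up to shapes strictly above la. Consequently
  T_w acts on the column (la; -, l) by the same matrix, up to signs, for every l, and that matrix
  intertwines injectively with the irreducible representation labelled la. So each column
  carries the character chi_la, and irreducibility makes it a single left cell.
\<close>

section \<open>Length and inversions\<close>

text \<open>The obstacle is that Kazhdan-Lusztig coordinates are known only through a uniqueness
  property. What makes them accessible is that a bar-invariant Laurent polynomial without negative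
  exponents is an integer: a linear system that is invertible at v = 0 therefore determines such
  coordinates from real numbers. Two further obstacles shape the proof. Over K = R(v), which is not
  algebraically closed, Schur's lemma yields only a division algebra of endomorphisms; scalars are
  obtained by pairing a sign vector for the Young subgroup of a partition with a trivial covector
  for that of the conjugate partition, as for Specht modules, and by counting partitions. And
  orthonormality at v = 0 requires each Schur element, times v^(2a), to have the value exactly 1
  there. This value f is a sum of squares, and the symmetrizing trace of the quasi-idempotent of the
  sign representation gives f (1 - g) = 1 with g a natural number, which leaves f = 1. Positivity
  enters a second time because K is formally real, so that a vanishing sum of squares has vanishing
  terms; this takes the place of an inner product in the proof of faithfulness.\<close>

abbreviation st :: "nat \<Rightarrow> perm" where "st i \<equiv> transpose i (Suc i)"

lemma st_in_Sym [simp]: "Suc i < n \<Longrightarrow> st i \<in> Sym n"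
  by (simp add: Sym_def permutes_swap_id)

lemma sgensE:
  assumes "s \<in> sgens n" obtains i where "Suc i < n" "s = st i"
  using assms by (auto simp: sgens_def)

lemma sgens_in_Sym [simp]: "s \<in> sgens n \<Longrightarrow> s \<in> Sym n"
  by (auto simp: sgens_def)

lemma st_in_sgens [simp]: "Suc i < n \<Longrightarrow> st i \<in> sgens n"
  by (auto simp: sgens_def)

lemma sgens_invol [simp]: "s \<in> sgens n \<Longrightarrow> s \<circ> s = id"
  by (auto simp: sgens_def)

lemma sgens_cancel_left [simp]: "s \<in> sgens n \<Longrightarrow> s \<circ> (s \<circ> w) = w"
  by (auto simp: sgens_def o_assoc)

lemma sgens_cancel_right [simp]: "s \<in> sgens n \<Longrightarrow> (w \<circ> s) \<circ> s = w"
  by (auto simp: sgens_def o_assoc[symmetric])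

lemma inv_sgens [simp]: "s \<in> sgens n \<Longrightarrow> inv s = s"
  by (auto simp: sgens_def)

lemma id_in_Sym [simp]: "id \<in> Sym n"
  by (simp add: Sym_def permutes_id)

lemma comp_in_Sym [simp]: "u \<in> Sym n \<Longrightarrow> w \<in> Sym n \<Longrightarrow> u \<circ> w \<in> Sym n"
  by (simp add: Sym_def permutes_compose)

lemma inv_in_Sym [simp]: "w \<in> Sym n \<Longrightarrow> inv w \<in> Sym n"
  by (simp add: Sym_def permutes_inv)

lemma finite_Sym [simp]: "finite (Sym n)"
  by (simp add: Sym_def finite_permutations)

lemma Sym_bij: "w \<in> Sym n \<Longrightarrow> bij w"
  by (simp add: Sym_def permutes_bij)

lemma Sym_inj: "w \<in> Sym n \<Longrightarrow> w p = w q \<longleftrightarrow> p = q"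
  by (metis Sym_bij bij_pointE)

lemma Sym_less: "w \<in> Sym n \<Longrightarrow> w p < n \<longleftrightarrow> p < n"
  by (auto simp: Sym_def dest: permutes_in_image[where x = p])

lemma Sym_inv_inv [simp]: "w \<in> Sym n \<Longrightarrow> inv (inv w) = w"
  by (simp add: Sym_bij inv_inv_eq)

lemma Sym_comp_inv [simp]: "w \<in> Sym n \<Longrightarrow> w \<circ> inv w = id" "w \<in> Sym n \<Longrightarrow> inv w \<circ> w = id"
  by (auto simp: Sym_def permutes_inv_o)

lemma Sym_inv_apply: "w \<in> Sym n \<Longrightarrow> w (inv w p) = p" "w \<in> Sym n \<Longrightarrow> inv w (w p) = p"
  by (auto simp: Sym_def permutes_inverses)

lemma Sym_inv_comp: "u \<in> Sym n \<Longrightarrow> w \<in> Sym n \<Longrightarrow> inv (u \<circ> w) = inv w \<circ> inv u"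
  by (simp add: Sym_bij o_inv_distrib)

lemma sgens_comp_in_Sym_iff [simp]: "s \<in> sgens n \<Longrightarrow> s \<circ> w \<in> Sym n \<longleftrightarrow> w \<in> Sym n"
  by (metis comp_in_Sym sgens_cancel_left sgens_in_Sym)

lemma comp_sgens_in_Sym_iff [simp]: "s \<in> sgens n \<Longrightarrow> w \<circ> s \<in> Sym n \<longleftrightarrow> w \<in> Sym n"
  by (metis comp_in_Sym sgens_cancel_right sgens_in_Sym)

lemma bij_betw_inv_Sym: "bij_betw inv (Sym n) (Sym n)"
  by (rule bij_betwI[where g = inv]) auto

lemma sum_Sym_inv: "(\<Sum>w\<in>Sym n. f (inv w)) = (\<Sum>w\<in>Sym n. f w)"
  using sum.reindex_bij_betw[OF bij_betw_inv_Sym, of f] .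

lemma sum_Sym_left: "s \<in> sgens n \<Longrightarrow> (\<Sum>w\<in>Sym n. f (s \<circ> w)) = (\<Sum>w\<in>Sym n. f w)"
  by (rule sum.reindex_bij_witness[of _ "\<lambda>w. s \<circ> w" "\<lambda>w. s \<circ> w"]) simp_all

lemma wprod_Nil [simp]: "wprod [] = id" and wprod_Cons [simp]: "wprod (s # ss) = s \<circ> wprod ss"
  by (simp_all add: wprod_def)

lemma wprod_append [simp]: "wprod (ss @ ts) = wprod ss \<circ> wprod ts"
  by (induction ss) (auto simp: o_assoc)

lemma wprod_in_Sym [simp]: "set ss \<subseteq> sgens n \<Longrightarrow> wprod ss \<in> Sym n"
  by (induction ss) auto

lemma wprod_rev: "set ss \<subseteq> sgens n \<Longrightarrow> wprod (rev ss) = inv (wprod ss)"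
  by (induction ss) (auto simp: Sym_inv_comp[of _ n])

text \<open>Only pairs of positions in one fibre of \<open>b\<close> are counted. For constant
  \<open>b\<close> this is the full inversion set, which computes the length; for block functions it
  supplies the exponents in \<open>tsfun\<close>.\<close>

definition binv :: "nat \<Rightarrow> (nat \<Rightarrow> 'b) \<Rightarrow> perm \<Rightarrow> (nat \<times> nat) set" where
  "binv n b w = {(p, q). p < q \<and> q < n \<and> b p = b q \<and> w q < w p}"

lemma finite_binv [simp]: "finite (binv n b w)"
  by (rule finite_subset[of _ "{..<n} \<times> {..<n}"]) (auto simp: binv_def)

lemma st_mono: "p < q \<Longrightarrow> (p, q) \<noteq> (i, Suc i) \<Longrightarrow> st i p < st i q"
  by (auto simp: transpose_def)

text \<open>Applying \<open>st i\<close> to both positions matches the inversions of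
  \<open>w\<close> with those of \<open>w \<circ> st i\<close> other than the newly created pair
  \<open>(i, Suc i)\<close>; fibres are respected because \<open>b i = b (Suc i)\<close>.\<close>

lemma card_binv_comp_st:
  assumes "Suc i < n" "b i = b (Suc i)" "w i < w (Suc i)"
  shows "card (binv n b (w \<circ> st i)) = Suc (card (binv n b w))"
proof -
  define f where "f = (\<lambda>(p, q). (st i p, st i q))"
  have b: "b (st i p) = b p" for p using assms(2) by (auto simp: transpose_def)
  have lt: "st i p < n \<longleftrightarrow> p < n" for p using assms(1) by (auto simp: transpose_def)
  have sub: "f ` binv n b w \<subseteq> binv n b (w \<circ> st i) - {(i, Suc i)}"
  proof (rule image_subsetI, clarify)
    fix p q assume pq: "(p, q) \<in> binv n b w"
    then have "(p, q) \<noteq> (i, Suc i)" using assms(3) by (auto simp: binv_def)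
    with pq have "f (p, q) \<in> binv n b (w \<circ> st i)"
      using st_mono[of p q i] by (auto simp: binv_def f_def b lt)
    moreover have "f (p, q) \<noteq> (i, Suc i)"
    proof
      assume "f (p, q) = (i, Suc i)"
      then have "p = Suc i" "q = i" by (auto simp: f_def transpose_def split: if_splits)
      with pq show False by (simp add: binv_def)
    qed
    ultimately show "f (p, q) \<in> binv n b (w \<circ> st i) - {(i, Suc i)}" by simp
  qed
  have "binv n b (w \<circ> st i) - {(i, Suc i)} \<subseteq> f ` binv n b w"
  proof
    fix x assume x: "x \<in> binv n b (w \<circ> st i) - {(i, Suc i)}"
    obtain p q where xpq: "x = (p, q)" by (cases x)
    with x have pq: "(p, q) \<in> binv n b (w \<circ> st i)" "(p, q) \<noteq> (i, Suc i)" by auto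
    show "x \<in> f ` binv n b w" unfolding xpq
    proof (rule ccontr)
      assume "(p, q) \<notin> f ` binv n b w"
      moreover have "(st i p, st i q) \<in> binv n b w"
        using pq st_mono[of p q i] by (auto simp: binv_def b lt)
      then have "f (st i p, st i q) \<in> f ` binv n b w" by blast
      ultimately show False by (simp add: f_def)
    qed
  qed
  with sub have eq: "f ` binv n b w = binv n b (w \<circ> st i) - {(i, Suc i)}" by blast
  have "inj f"
  proof (rule injI)
    fix x y assume e: "f x = f y"
    have "f (f z) = z" for z by (cases z) (simp add: f_def)
    then show "x = y" using e by metis
  qed
  then have "card (binv n b w) = card (binv n b (w \<circ> st i) - {(i, Suc i)})"
    unfolding eq[symmetric] by (metis card_image inj_on_subset subset_UNIV)
  moreover have "(i, Suc i) \<in> binv n b (w \<circ> st i)"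
    using assms by (auto simp: binv_def)
  ultimately show ?thesis
    using card.remove[OF finite_binv, of "(i, Suc i)" n b "w \<circ> st i"] by metis
qed

text \<open>Only the comparison between the values \<open>i\<close> and \<open>Suc i\<close>
  changes, and these occur at positions in different fibres, so no counted pair is affected.\<close>

lemma binv_st_comp:
  assumes "w \<in> Sym n" "b (inv w i) \<noteq> b (inv w (Suc i))"
  shows "binv n b (st i \<circ> w) = binv n b w"
proof -
  have "st i (w q) < st i (w p) \<longleftrightarrow> w q < w p" if "b p = b q" for p q
  proof -
    have "(w p, w q) \<noteq> (i, Suc i)" "(w q, w p) \<noteq> (i, Suc i)"
      using assms that Sym_inv_apply(2)[OF assms(1)] by (metis prod.inject)+
    then show ?thesis using st_mono[of "w q" "w p" i] st_mono[of "w p" "w q" i] 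
      by (metis linorder_neqE_nat order_less_asym)
  qed
  then show ?thesis by (auto simp: binv_def)
qed

abbreviation ninv :: "nat \<Rightarrow> perm \<Rightarrow> nat" where
  "ninv n w \<equiv> card (binv n (\<lambda>_. ()) w)"

lemma Sym_id_if_no_descent:
  assumes "w \<in> Sym n" "\<And>i. Suc i < n \<Longrightarrow> w i \<le> w (Suc i)"
  shows "w = id"
proof -
  have "i \<le> w i" if "i < n" for i using that
  proof (induction i)
    case (Suc i)
    have "w i \<noteq> w (Suc i)" using assms(1) by (simp add: Sym_inj)
    with Suc assms(2)[of i] show ?case by linarith
  qed auto
  then show ?thesis using assms(1) permutes_natset_ge[of w "{..<n}"]
    by (auto simp: Sym_def)
qed

lemma Sym_descent:
  assumes "w \<in> Sym n" "w \<noteq> id" obtains i where "Suc i < n" "w (Suc i) < w i"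
  using Sym_id_if_no_descent[OF assms(1)] assms(2) by (meson linorder_not_le)

lemma ninv_desc:
  assumes "Suc i < n" "w (Suc i) < w i"
  shows "Suc (ninv n (w \<circ> st i)) = ninv n w"
  using card_binv_comp_st[of i n "\<lambda>_. ()" "w \<circ> st i"] assms by (simp add: comp_assoc)

lemma ninv_comp_st_le:
  assumes "Suc i < n" "w \<in> Sym n" shows "ninv n (w \<circ> st i) \<le> Suc (ninv n w)"
proof (cases "w i < w (Suc i)")
  case True then show ?thesis using card_binv_comp_st[of i n "\<lambda>_. ()" w] assms by simp
next
  case False
  then have "w (Suc i) < w i" using Sym_inj[OF assms(2), of i "Suc i"] by linarith
  with ninv_desc[of i n w] assms show ?thesis by simp
qed

lemma binv_id [simp]: "binv n b id = {}" "binv n b (\<lambda>a. a) = {}"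
  by (auto simp: binv_def)

lemma ninv_wprod_le: "set ss \<subseteq> sgens n \<Longrightarrow> ninv n (wprod ss) \<le> length ss"
proof (induction ss rule: rev_induct)
  case Nil
  then show ?case by simp
next
  case (snoc s ss)
  then obtain i where "Suc i < n" "s = st i" by (auto elim: sgensE)
  then show ?case using snoc ninv_comp_st_le[of i n "wprod ss"] by (auto simp del: o_apply)
qed

text \<open>Removing descents one at a time lowers the inversion number by one at each step, which
  produces a word of this length; \<open>ninv_wprod_le\<close> shows that none is shorter.\<close>

lemma ex_word_ninv:
  "w \<in> Sym n \<Longrightarrow> \<exists>ss. set ss \<subseteq> sgens n \<and> length ss = ninv n w \<and> wprod ss = w"
proof (induction "ninv n w" arbitrary: w rule: less_induct)
  case less
  show ?case
  proof (cases "w = id")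
    case True
    then show ?thesis by (intro exI[of _ "[]"]) auto
  next
    case False
    then obtain i where i: "Suc i < n" "w (Suc i) < w i" using Sym_descent less.prems by blast
    from ninv_desc[of i n w] i have d: "Suc (ninv n (w \<circ> st i)) = ninv n w" by simp
    moreover have "w \<circ> st i \<in> Sym n" using less.prems i by simp
    ultimately obtain ss where ss: "set ss \<subseteq> sgens n" "length ss = ninv n (w \<circ> st i)" "wprod ss = w \<circ> st i"
      using less.hyps by (metis lessI)
    then have "set (ss @ [st i]) \<subseteq> sgens n" "length (ss @ [st i]) = ninv n w" "wprod (ss @ [st i]) = w"
      using d i by (auto simp: comp_assoc)
    then show ?thesis by blast
  qed
qed

lemma len_eq_ninv: assumes "w \<in> Sym n" shows "len n w = ninv n w"
  unfolding len_def
proof (rule Least_equality)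
  show "\<exists>ss. length ss = ninv n w \<and> set ss \<subseteq> sgens n \<and> wprod ss = w"
    using ex_word_ninv[OF assms] by blast
qed (use ninv_wprod_le in blast)

lemma len_le_length: "set ss \<subseteq> sgens n \<Longrightarrow> len n (wprod ss) \<le> length ss"
  by (simp add: len_eq_ninv ninv_wprod_le)

lemma rword:
  assumes "w \<in> Sym n"
  shows "set (rword n w) \<subseteq> sgens n" "length (rword n w) = len n w" "wprod (rword n w) = w"
proof -
  have "\<exists>ss. set ss \<subseteq> sgens n \<and> length ss = len n w \<and> wprod ss = w"
    using ex_word_ninv[OF assms] len_eq_ninv[OF assms] by metis
  from someI_ex[OF this] show "set (rword n w) \<subseteq> sgens n" "length (rword n w) = len n w"
    "wprod (rword n w) = w" unfolding rword_def by auto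
qed

lemma len_inv: assumes "w \<in> Sym n" shows "len n (inv w) = len n w"
proof -
  have "len n (inv u) \<le> len n u" if "u \<in> Sym n" for u
    using rword[OF that] len_le_length[of "rev (rword n u)" n] wprod_rev[of "rword n u" n] by simp
  from this[OF assms] this[OF inv_in_Sym[OF assms]] assms show ?thesis by simp
qed

lemma len_id [simp]: "len n id = 0"
  using len_le_length[of "[]" n] by simp

lemma len_comp_st:
  assumes "w \<in> Sym n" "Suc i < n"
  shows "w i < w (Suc i) \<Longrightarrow> len n (w \<circ> st i) = Suc (len n w)"
    and "w (Suc i) < w i \<Longrightarrow> Suc (len n (w \<circ> st i)) = len n w"
    and "len n (w \<circ> st i) < len n w \<longleftrightarrow> w (Suc i) < w i"
    and "len n w < len n (w \<circ> st i) \<longleftrightarrow> w i < w (Suc i)"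
proof -
  have a: "len n (w \<circ> st i) = Suc (len n w)" if "w i < w (Suc i)"
    using card_binv_comp_st[of i n "\<lambda>_. ()" w] that assms by (simp add: len_eq_ninv)
  have b: "Suc (len n (w \<circ> st i)) = len n w" if "w (Suc i) < w i"
    using ninv_desc[of i n w] that assms by (simp add: len_eq_ninv)
  have c: "w i \<noteq> w (Suc i)" using Sym_inj[OF assms(1)] by simp
  show "w i < w (Suc i) \<Longrightarrow> len n (w \<circ> st i) = Suc (len n w)"
    "w (Suc i) < w i \<Longrightarrow> Suc (len n (w \<circ> st i)) = len n w"
    "len n (w \<circ> st i) < len n w \<longleftrightarrow> w (Suc i) < w i"
    "len n w < len n (w \<circ> st i) \<longleftrightarrow> w i < w (Suc i)"
    using a b c by (metis lessI less_asym linorder_neqE_nat)+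
qed

lemma len_right_cases:
  assumes "w \<in> Sym n" "t \<in> sgens n"
  shows "len n (w \<circ> t) = Suc (len n w) \<or> Suc (len n (w \<circ> t)) = len n w"
proof -
  from assms(2) obtain i where i: "Suc i < n" "t = st i" by (auto elim: sgensE)
  have "w i \<noteq> w (Suc i)" using Sym_inj[OF assms(1)] by simp
  then show ?thesis using len_comp_st(1,2)[OF assms(1) i(1)] i(2) by (metis linorder_neqE_nat)
qed

lemma len_left_cases:
  assumes "w \<in> Sym n" "s \<in> sgens n"
  shows "len n (s \<circ> w) = Suc (len n w) \<or> Suc (len n (s \<circ> w)) = len n w"
proof -
  have "len n (s \<circ> w) = len n (inv w \<circ> s)"
    using len_inv[of "s \<circ> w" n] assms by (simp add: Sym_inv_comp[of _ n])
  then show ?thesis using len_right_cases[of "inv w" n s] assms by (simp add: len_inv)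
qed

lemma len_left_inv:
  assumes "w \<in> Sym n" "s \<in> sgens n" shows "len n (inv w \<circ> s) = len n (s \<circ> w)"
  using len_inv[of "s \<circ> w" n] assms by (simp add: Sym_inv_comp[of _ n])

text \<open>Left multiplication by \<open>s\<close> exchanges the values \<open>i\<close> and
  \<open>i+1\<close>, so it can alter the comparison of \<open>w j\<close> with
  \<open>w (Suc j)\<close> only if these are the two values, and then
  \<open>s \<circ> w = w \<circ> t\<close>. This is the combinatorial reason why left and right
  multiplication commute.\<close>

lemma descent_right_indep:
  assumes "w \<in> Sym n" "s \<in> sgens n" "t \<in> sgens n" "s \<circ> w \<noteq> w \<circ> t"
  shows "len n (s \<circ> w \<circ> t) < len n (s \<circ> w) \<longleftrightarrow> len n (w \<circ> t) < len n w"
proof -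
  from assms obtain i j where ij: "Suc i < n" "s = st i" "Suc j < n" "t = st j" by (auto elim!: sgensE)
  have ne: "False" if "{w j, w (Suc j)} = {i, Suc i}"
  proof -
    have inj: "w p = w q \<longleftrightarrow> p = q" for p q using Sym_inj[OF assms(1)] .
    have "s \<circ> w = w \<circ> t"
    proof
      fix p show "(s \<circ> w) p = (w \<circ> t) p"
        using that inj[of p j] inj[of p "Suc j"] inj[of j "Suc j"]
        unfolding ij doubleton_eq_iff
        by (auto simp: transpose_def)
    qed
    with assms(4) show False by simp
  qed
  then have "(w j, w (Suc j)) \<noteq> (i, Suc i)" "(w (Suc j), w j) \<noteq> (i, Suc i)"
    by (metis insert_commute prod.inject)+
  then have "st i (w (Suc j)) < st i (w j) \<longleftrightarrow> w (Suc j) < w j"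
    using st_mono[of "w (Suc j)" "w j" i] st_mono[of "w j" "w (Suc j)" i]
    by (metis linorder_neqE_nat order_less_asym)
  then show ?thesis using len_comp_st(3)[of w n j] len_comp_st(3)[of "s \<circ> w" n j] assms ij
    by (simp del: o_apply) simp
qed

text \<open>The previous lemma applied to the inverse permutation, since inversion preserves length
  and exchanges the two sides.\<close>

lemma descent_left_indep:
  assumes "w \<in> Sym n" "s \<in> sgens n" "t \<in> sgens n" "s \<circ> w \<noteq> w \<circ> t"
  shows "len n (s \<circ> w \<circ> t) < len n (w \<circ> t) \<longleftrightarrow> len n (s \<circ> w) < len n w"
proof -
  have "t \<circ> inv w \<noteq> inv w \<circ> s"
  proof
    assume "t \<circ> inv w = inv w \<circ> s"
    then have "inv (w \<circ> t) = inv (s \<circ> w)" using assms by (simp add: Sym_inv_comp[of _ n])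
    then have "inv (inv (w \<circ> t)) = inv (inv (s \<circ> w))" by simp
    then have "w \<circ> t = s \<circ> w" using assms Sym_inv_inv[of "w \<circ> t" n] Sym_inv_inv[of "s \<circ> w" n] 
      by simp
    with assms show False by simp
  qed
  from descent_right_indep[OF _ assms(3,2) this] assms
  have "len n (t \<circ> inv w \<circ> s) < len n (t \<circ> inv w) \<longleftrightarrow> len n (inv w \<circ> s) < len n (inv w)" by simp
  moreover have "len n (t \<circ> inv w \<circ> s) = len n (s \<circ> w \<circ> t)"
    using len_inv[of "s \<circ> w \<circ> t" n] assms by (simp add: Sym_inv_comp[of _ n] o_assoc)
  moreover have "len n (t \<circ> inv w) = len n (w \<circ> t)"
    using len_inv[of "w \<circ> t" n] assms by (simp add: Sym_inv_comp[of _ n])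
  moreover have "len n (inv w \<circ> s) = len n (s \<circ> w)" using len_left_inv assms by simp
  ultimately show ?thesis using assms by (simp add: len_inv)
qed

section \<open>The Hecke algebra\<close>

declare o_apply [simp del] id_apply [simp del] foldr.simps [simp del]

lemma foldr_app [simp]: "foldr f [] a = a" "foldr f (x # xs) a = f x (foldr f xs a)"
    "foldr f (xs @ ys) a = foldr f xs (foldr f ys a)"
  by (simp_all add: foldr.simps o_apply id_apply)

text \<open>Operators on coefficient functions are compared through their values on the
  \<open>Tb w\<close>. As functions may be nonzero off \<open>Sym n\<close>, the comparison
  \<open>lin_ext\<close> also asks for \<open>supp_in\<close>.\<close>

definition lin :: "((perm \<Rightarrow> 'a::comm_ring_1) \<Rightarrow> perm \<Rightarrow> 'a) \<Rightarrow> bool" where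
  "lin F \<longleftrightarrow> (\<forall>f g. F (\<lambda>y. f y + g y) = (\<lambda>y. F f y + F g y)) \<and>
     (\<forall>c f. F (\<lambda>y. c * f y) = (\<lambda>y. c * F f y))"

lemma lin_add: "lin F \<Longrightarrow> F (\<lambda>y. f y + g y) = (\<lambda>y. F f y + F g y)"
  and lin_scale: "lin F \<Longrightarrow> F (\<lambda>y. c * f y) = (\<lambda>y. c * F f y)"
  by (auto simp: lin_def)

lemma lin_zero: "lin F \<Longrightarrow> F (\<lambda>_. 0) = (\<lambda>_. 0)"
  using lin_scale[of F 0 "\<lambda>_. 0"] by simp

lemma lin_diff: "lin F \<Longrightarrow> F (\<lambda>y. f y - g y) = (\<lambda>y. F f y - F g y)"
  using lin_add[of F f "\<lambda>y. (-1) * g y"] lin_scale[of F "-1" g] by simp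

lemma lin_sum:
  assumes "lin F" "finite A"
  shows "F (\<lambda>y. \<Sum>x\<in>A. c x * f x y) = (\<lambda>y. \<Sum>x\<in>A. c x * F (f x) y)"
  using assms(2) by (induction A) (simp_all add: lin_zero[OF assms(1)] lin_add[OF assms(1)] lin_scale[OF assms(1)])

lemma lin_comp: "lin F \<Longrightarrow> lin G \<Longrightarrow> lin (\<lambda>h. F (G h))"
  by (simp add: lin_def foldr.simps id_apply)

lemma lin_foldr: "(\<And>s. lin (F s)) \<Longrightarrow> lin (foldr F ss)"
proof (induction ss)
  case Nil then show ?case by (simp add: lin_def foldr.simps id_apply)
next
  case (Cons s ss) then show ?case using lin_comp[of "F s" "foldr F ss"] by (simp add: foldr.simps comp_def)
qed

lemma supp_in_Tb [simp]: "w \<in> Sym n \<Longrightarrow> supp_in n (Tb w)"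
  by (auto simp: supp_in_def Tb_def)

lemma Tb_sum:
  assumes "supp_in n h" shows "(\<Sum>x\<in>Sym n. h x * Tb x y) = (h y :: 'a::comm_ring_1)"
proof (cases "y \<in> Sym n")
  case True
  have "(\<Sum>x\<in>Sym n. h x * Tb x y) = (\<Sum>x\<in>Sym n. if x = y then h x else 0)"
    by (intro sum.cong) (auto simp: Tb_def)
  with True show ?thesis by (simp add: sum.delta)
next
  case False
  then have "(\<Sum>x\<in>Sym n. h x * Tb x y) = 0" by (intro sum.neutral) (auto simp: Tb_def)
  with False assms show ?thesis by (simp add: supp_in_def)
qed

lemma lin_expand:
  assumes "lin F" "supp_in n h" shows "F h = (\<lambda>y. \<Sum>x\<in>Sym n. h x * F (Tb x) y)"
  using lin_sum[OF assms(1) finite_Sym, of h Tb n] Tb_sum[OF assms(2)] by simp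

lemma lin_ext:
  assumes "lin F" "lin G" "\<And>x. x \<in> Sym n \<Longrightarrow> F (Tb x) = G (Tb x)" "supp_in n h"
  shows "F h = G h"
  unfolding lin_expand[OF assms(1,4)] lin_expand[OF assms(2,4)]
  by (intro ext sum.cong) (auto simp: assms(3))

definition rmul :: "nat \<Rightarrow> 'a::comm_ring_1 \<Rightarrow> perm \<Rightarrow> (perm \<Rightarrow> 'a) \<Rightarrow> perm \<Rightarrow> 'a" where
  "rmul n \<delta> t h = (\<lambda>y. h (y \<circ> t) + (if len n (y \<circ> t) < len n y then \<delta> * h y else 0))"

lemma lin_mulTs [simp]: "lin (mulTs n \<delta> s)"
  by (auto simp: lin_def mulTs_def algebra_simps fun_eq_iff)

lemma lin_rmul [simp]: "lin (rmul n \<delta> s)"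
  by (auto simp: lin_def rmul_def algebra_simps fun_eq_iff)

lemma supp_mulTs [simp]: "s \<in> sgens n \<Longrightarrow> supp_in n h \<Longrightarrow> supp_in n (mulTs n \<delta> s h)"
  by (simp add: supp_in_def mulTs_def)

lemma supp_rmul [simp]: "s \<in> sgens n \<Longrightarrow> supp_in n h \<Longrightarrow> supp_in n (rmul n \<delta> s h)"
  by (simp add: supp_in_def rmul_def)

lemma supp_in_eqI:
  "supp_in n f \<Longrightarrow> supp_in n g \<Longrightarrow> (\<And>y. y \<in> Sym n \<Longrightarrow> f y = g y) \<Longrightarrow> f = g"
  by (metis supp_in_def ext)

lemma supp_in_lin [simp]:
  "supp_in n f \<Longrightarrow> supp_in n g \<Longrightarrow> supp_in n (\<lambda>y. f y + g y :: 'a::comm_ring_1)"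
  "supp_in n f \<Longrightarrow> supp_in n g \<Longrightarrow> supp_in n (\<lambda>y. f y - g y :: 'a::comm_ring_1)"
  "supp_in n f \<Longrightarrow> supp_in n (\<lambda>y. c * f y :: 'a::comm_ring_1)"
  "supp_in n f \<Longrightarrow> supp_in n (\<lambda>y. - f y :: 'a::comm_ring_1)"
  by (simp_all add: supp_in_def)

lemma supp_in_sum [simp]:
  "(\<And>x. x \<in> A \<Longrightarrow> supp_in n (f x)) \<Longrightarrow> supp_in n (\<lambda>y. \<Sum>x\<in>A. c x * f x y :: 'a::comm_ring_1)"
  by (simp add: supp_in_def)

lemma mulTs_Tb:
  fixes \<delta> :: "'a::comm_ring_1"
  assumes "s \<in> sgens n" "w \<in> Sym n"
  shows "mulTs n \<delta> s (Tb w) =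
    (if len n w < len n (s \<circ> w) then Tb (s \<circ> w) else (\<lambda>y. Tb (s \<circ> w) y + \<delta> * Tb w y))"
proof
  fix y
  have "s \<circ> y = w \<longleftrightarrow> y = s \<circ> w" using sgens_cancel_left[OF assms(1)] by metis
  then have e: "Tb w (s \<circ> y) = (Tb (s \<circ> w) y :: 'a)" unfolding Tb_def by simp
  have d: "len n (s \<circ> w) < len n w \<longleftrightarrow> \<not> len n w < len n (s \<circ> w)"
    using len_left_cases[OF assms(2,1)] by linarith
  show "mulTs n \<delta> s (Tb w) y = (if len n w < len n (s \<circ> w) then Tb (s \<circ> w) else (\<lambda>y. Tb (s \<circ> w) y + \<delta> * Tb w y)) y"
    unfolding mulTs_def e using d by (cases "y = w") (simp_all add: Tb_def[of w])
qed

lemma rmul_Tb: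
  fixes \<delta> :: "'a::comm_ring_1"
  assumes "s \<in> sgens n" "w \<in> Sym n"
  shows "rmul n \<delta> s (Tb w) =
    (if len n w < len n (w \<circ> s) then Tb (w \<circ> s) else (\<lambda>y. Tb (w \<circ> s) y + \<delta> * Tb w y))"
proof
  fix y
  have "y \<circ> s = w \<longleftrightarrow> y = w \<circ> s" using sgens_cancel_right[OF assms(1)] by metis
  then have e: "Tb w (y \<circ> s) = (Tb (w \<circ> s) y :: 'a)" unfolding Tb_def by simp
  have d: "len n (w \<circ> s) < len n w \<longleftrightarrow> \<not> len n w < len n (w \<circ> s)"
    using len_right_cases[OF assms(2,1)] by linarith
  show "rmul n \<delta> s (Tb w) y = (if len n w < len n (w \<circ> s) then Tb (w \<circ> s) else (\<lambda>y. Tb (w \<circ> s) y + \<delta> * Tb w y)) y"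
    unfolding rmul_def e using d by (cases "y = w") (simp_all add: Tb_def[of w])
qed

lemma mulTs_mulTs:
  assumes "s \<in> sgens n" "supp_in n h"
  shows "mulTs n \<delta> s (mulTs n \<delta> s h) = (\<lambda>y. h y + \<delta> * mulTs n \<delta> s h y)"
proof (rule supp_in_eqI[of n])
  fix y assume y: "y \<in> Sym n"
  show "mulTs n \<delta> s (mulTs n \<delta> s h) y = h y + \<delta> * mulTs n \<delta> s h y"
    using len_left_cases[OF y assms(1)] by (auto simp: mulTs_def sgens_cancel_left[OF assms(1)] algebra_simps)
qed (use assms in simp_all)

lemma rmul_rmul:
  assumes "s \<in> sgens n" "supp_in n h"
  shows "rmul n \<delta> s (rmul n \<delta> s h) = (\<lambda>y. h y + \<delta> * rmul n \<delta> s h y)"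
proof (rule supp_in_eqI[of n])
  fix y assume y: "y \<in> Sym n"
  show "rmul n \<delta> s (rmul n \<delta> s h) y = h y + \<delta> * rmul n \<delta> s h y"
    using len_right_cases[OF y assms(1)] by (auto simp: rmul_def sgens_cancel_right[OF assms(1)] algebra_simps)
qed (use assms in simp_all)

text \<open>If \<open>s \<circ> y = y \<circ> t\<close>, both sides involve the same two
  coefficients in the same way; otherwise left descents are unaffected by \<open>t\<close> and right
  descents by \<open>s\<close>. On this commutation rest both the well-definedness of
  \<open>mulT\<close> and associativity.\<close>

lemma mulTs_rmul:
  assumes "s \<in> sgens n" "t \<in> sgens n" "supp_in n h"
  shows "mulTs n \<delta> s (rmul n \<delta> t h) = rmul n \<delta> t (mulTs n \<delta> s h)"
proof (rule supp_in_eqI[of n])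
  fix y assume y: "y \<in> Sym n"
  show "mulTs n \<delta> s (rmul n \<delta> t h) y = rmul n \<delta> t (mulTs n \<delta> s h) y"
  proof (cases "s \<circ> y = y \<circ> t")
    case True
    then have "s \<circ> (y \<circ> t) = y" "s \<circ> y \<circ> t = y"
      using sgens_cancel_left[OF assms(1)] sgens_cancel_right[OF assms(2)] by metis+
    then show ?thesis by (simp add: mulTs_def rmul_def True)
  next
    case False
    show ?thesis
      using descent_right_indep[OF y assms(1,2) False] descent_left_indep[OF y assms(1,2) False]
      by (simp add: mulTs_def rmul_def comp_assoc algebra_simps)
  qed
qed (use assms in simp_all)

section \<open>Reduced words and multiplication by basis elements\<close>

definition red :: "nat \<Rightarrow> perm list \<Rightarrow> bool" where
  "red n ss \<longleftrightarrow> set ss \<subseteq> sgens n \<and> length ss = len n (wprod ss)"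

lemma red_rword: "w \<in> Sym n \<Longrightarrow> red n (rword n w)"
  using rword by (simp add: red_def)

lemma red_ConsD: assumes "red n (s # ss)" shows "red n ss" "len n (wprod ss) < len n (s \<circ> wprod ss)"
proof -
  have a: "set ss \<subseteq> sgens n" "s \<in> sgens n" "Suc (length ss) = len n (s \<circ> wprod ss)"
    using assms by (auto simp: red_def)
  then have "len n (s \<circ> wprod ss) \<le> Suc (len n (wprod ss))"
    using len_left_cases[of "wprod ss" n s] by auto
  moreover have "len n (wprod ss) \<le> length ss" using len_le_length a by blast
  ultimately show "red n ss" "len n (wprod ss) < len n (s \<circ> wprod ss)" using a by (auto simp: red_def)
qed

lemma red_rev: "red n ss \<Longrightarrow> red n (rev ss)"
  by (auto simp: red_def wprod_rev len_inv)

lemma red_ConsI: "red n ss \<Longrightarrow> s \<in> sgens n \<Longrightarrow> len n (wprod ss) < len n (s \<circ> wprod ss) \<Longrightarrow> red n (s # ss)"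
  using len_left_cases[of "wprod ss" n s] by (auto simp: red_def)

lemma red_append: "red n ss \<Longrightarrow> red n ts \<Longrightarrow>
   len n (wprod ss \<circ> wprod ts) = len n (wprod ss) + len n (wprod ts) \<Longrightarrow> red n (ss @ ts)"
  by (auto simp: red_def)

abbreviation "Lw n \<delta> ss \<equiv> foldr (mulTs n \<delta>) ss"
abbreviation "Rw n \<delta> ss \<equiv> foldr (rmul n \<delta>) ss"

lemma lin_Lw [simp]: "lin (Lw n \<delta> ss)" and lin_Rw [simp]: "lin (Rw n \<delta> ss)"
  by (auto intro: lin_foldr)

lemma supp_Lw [simp]: "set ss \<subseteq> sgens n \<Longrightarrow> supp_in n h \<Longrightarrow> supp_in n (Lw n \<delta> ss h)"
  by (induction ss) auto

lemma supp_Rw [simp]: "set ss \<subseteq> sgens n \<Longrightarrow> supp_in n h \<Longrightarrow> supp_in n (Rw n \<delta> ss h)"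
  by (induction ss) auto

lemma mulTs_Rw:
  "s \<in> sgens n \<Longrightarrow> set ts \<subseteq> sgens n \<Longrightarrow> supp_in n h \<Longrightarrow>
   mulTs n \<delta> s (Rw n \<delta> ts h) = Rw n \<delta> ts (mulTs n \<delta> s h)"
  by (induction ts) (auto simp: mulTs_rmul)

lemma Lw_Rw:
  "set ss \<subseteq> sgens n \<Longrightarrow> set ts \<subseteq> sgens n \<Longrightarrow> supp_in n h \<Longrightarrow>
   Lw n \<delta> ss (Rw n \<delta> ts h) = Rw n \<delta> ts (Lw n \<delta> ss h)"
  by (induction ss) (auto simp: mulTs_Rw)

lemma Lw_Tb_id: "red n ss \<Longrightarrow> Lw n \<delta> ss (Tb id) = Tb (wprod ss)"
proof (induction ss)
  case (Cons s ss)
  then have "set ss \<subseteq> sgens n" "s \<in> sgens n" by (auto simp: red_def)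
  then show ?case using Cons red_ConsD[OF Cons.prems] by (simp add: mulTs_Tb)
qed auto

lemma Rw_Tb_id: "red n ss \<Longrightarrow> Rw n \<delta> ss (Tb id) = Tb (wprod (rev ss))"
proof (induction ss)
  case (Cons s ss)
  then have ss: "set ss \<subseteq> sgens n" "s \<in> sgens n" by (auto simp: red_def)
  have "inv (s \<circ> wprod ss) = inv (wprod ss) \<circ> s" using ss by (simp add: Sym_inv_comp[of _ n])
  then have "len n (inv (wprod ss) \<circ> s) = len n (s \<circ> wprod ss)"
    using ss len_inv[of "s \<circ> wprod ss" n] by simp
  then show ?case using Cons red_ConsD[OF Cons.prems] ss 
    by (simp add: rmul_Tb wprod_rev len_inv del: wprod_append)
      (simp add: wprod_rev)
qed auto

lemma Tb_eq_Rw: "y \<in> Sym n \<Longrightarrow> Tb y = Rw n \<delta> (rev (rword n y)) (Tb id)"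
  using Rw_Tb_id[OF red_rev[OF red_rword], of y n \<delta>] rword by simp

text \<open>A basis element is \<open>Tb id\<close> acted on by right multiplications. These commute
  with left multiplications, and on \<open>Tb id\<close> a reduced word yields \<open>Tb\<close> of
  its product; hence the operator depends on the product only.\<close>

lemma Lw_unique:
  assumes "red n ss" "red n ts" "wprod ss = wprod ts" "supp_in n h"
  shows "Lw n \<delta> ss h = Lw n \<delta> ts h"
proof (rule lin_ext[OF lin_Lw lin_Lw _ assms(4)])
  fix y assume y: "y \<in> Sym n"
  have "Lw n \<delta> us (Tb y) = Rw n \<delta> (rev (rword n y)) (Tb (wprod us))" if "red n us" for us
    using Lw_Rw[of us n "rev (rword n y)" "Tb id" \<delta>] Lw_Tb_id[OF that, of \<delta>] that rword(1)[OF y]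
    unfolding Tb_eq_Rw[OF y, of \<delta>] by (simp add: red_def)
  with assms show "Lw n \<delta> ss (Tb y) = Lw n \<delta> ts (Tb y)" by metis
qed

lemma mulT_wprod: "red n ss \<Longrightarrow> supp_in n h \<Longrightarrow> mulT n \<delta> (wprod ss) h = Lw n \<delta> ss h"
  unfolding mulT_def by (rule Lw_unique) (auto simp: red_def rword)

lemma lin_mulT [simp]: "lin (mulT n \<delta> x)"
  by (simp add: mulT_def[abs_def])

lemma supp_mulT [simp]: "x \<in> Sym n \<Longrightarrow> supp_in n h \<Longrightarrow> supp_in n (mulT n \<delta> x h)"
  by (simp add: mulT_def rword)

lemma mulT_id [simp]: "mulT n \<delta> id h = h"
proof -
  have "length (rword n id) = 0" using rword(2)[of id n] by simp
  then show ?thesis by (simp add: mulT_def)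
qed

lemma mulT_add:
  assumes "x \<in> Sym n" "y \<in> Sym n" "len n (x \<circ> y) = len n x + len n y" "supp_in n h"
  shows "mulT n \<delta> (x \<circ> y) h = mulT n \<delta> x (mulT n \<delta> y h)"
proof -
  have "red n (rword n x @ rword n y)" using assms by (intro red_append) (auto simp: red_rword rword)
  from mulT_wprod[OF this assms(4), of \<delta>] assms show ?thesis by (simp add: rword mulT_def)
qed

lemma len_sgen [simp]: "s \<in> sgens n \<Longrightarrow> len n s = 1"
  using len_right_cases[of id n s] by auto

lemma mulT_sgen: "s \<in> sgens n \<Longrightarrow> supp_in n h \<Longrightarrow> mulT n \<delta> s h = mulTs n \<delta> s h"
  using mulT_wprod[of n "[s]" h \<delta>] by (simp add: red_def)

lemma mulT_up:
  assumes "s \<in> sgens n" "x \<in> Sym n" "len n x < len n (s \<circ> x)" "supp_in n h"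
  shows "mulT n \<delta> (s \<circ> x) h = mulTs n \<delta> s (mulT n \<delta> x h)"
  using mulT_add[of s n x h \<delta>] assms len_left_cases[of x n s] by (auto simp: mulT_sgen)

lemma mulT_Tb_add:
  assumes "x \<in> Sym n" "y \<in> Sym n" "len n (x \<circ> y) = len n x + len n y"
  shows "mulT n \<delta> x (Tb y) = Tb (x \<circ> y)"
proof -
  have "mulT n \<delta> u (Tb id) = Tb u" if "u \<in> Sym n" for u
    using Lw_Tb_id[OF red_rword[OF that]] that by (simp add: mulT_def rword)
  then show ?thesis using mulT_add[OF assms, of "Tb id" \<delta>] assms by simp
qed

lemma mulT_Tb_id: "x \<in> Sym n \<Longrightarrow> mulT n \<delta> x (Tb id) = Tb x"
  using mulT_Tb_add[of x n id] by simp

text \<open>The word is reversed because \<open>foldr\<close> applies its last letter first, whereas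
  right multiplication by \<open>T_x\<close> must start with the first letter of
  \<open>x\<close>.\<close>

definition rmulT :: "nat \<Rightarrow> 'a::comm_ring_1 \<Rightarrow> perm \<Rightarrow> (perm \<Rightarrow> 'a) \<Rightarrow> perm \<Rightarrow> 'a" where
  "rmulT n \<delta> x h = Rw n \<delta> (rev (rword n x)) h"

lemma lin_rmulT [simp]: "lin (rmulT n \<delta> x)"
  by (simp add: rmulT_def[abs_def])

lemma mulT_rmulT:
  "x \<in> Sym n \<Longrightarrow> z \<in> Sym n \<Longrightarrow> supp_in n h \<Longrightarrow>
   mulT n \<delta> x (rmulT n \<delta> z h) = rmulT n \<delta> z (mulT n \<delta> x h)"
  by (simp add: mulT_def rmulT_def Lw_Rw rword)

lemma mulTs_rmulT:
  "s \<in> sgens n \<Longrightarrow> z \<in> Sym n \<Longrightarrow> supp_in n h \<Longrightarrow>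
   mulTs n \<delta> s (rmulT n \<delta> z h) = rmulT n \<delta> z (mulTs n \<delta> s h)"
  by (simp add: rmulT_def mulTs_Rw rword)

lemma rmulT_Tb_id: "z \<in> Sym n \<Longrightarrow> rmulT n \<delta> z (Tb id) = Tb z"
  by (simp add: rmulT_def Tb_eq_Rw[symmetric])

lemma rmulT_Tb: "w \<in> Sym n \<Longrightarrow> x \<in> Sym n \<Longrightarrow> rmulT n \<delta> x (Tb w) = mulT n \<delta> w (Tb x)"
  using mulT_rmulT[of w n x "Tb id" \<delta>] by (simp add: mulT_Tb_id rmulT_Tb_id)

lemma supp_hmult [simp]: "supp_in n h \<Longrightarrow> supp_in n (hmult n \<delta> g h)"
  unfolding hmult_def by (rule supp_in_sum) simp

text \<open>An expansion along the right factor instead of the left one. With both forms at hand,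
  associativity becomes the commutation of left with right multiplications.\<close>

lemma hmult_alt:
  assumes "supp_in n g" "supp_in n h"
  shows "hmult n \<delta> g h = (\<lambda>y. \<Sum>x\<in>Sym n. h x * rmulT n \<delta> x g y)"
proof
  fix y
  have "hmult n \<delta> g h y = (\<Sum>w\<in>Sym n. \<Sum>x\<in>Sym n. g w * (h x * mulT n \<delta> w (Tb x) y))"
    unfolding hmult_def by (subst lin_expand[OF lin_mulT assms(2)]) (simp add: sum_distrib_left)
  also have "\<dots> = (\<Sum>x\<in>Sym n. \<Sum>w\<in>Sym n. g w * (h x * mulT n \<delta> w (Tb x) y))"
    by (rule sum.swap)
  also have "\<dots> = (\<Sum>x\<in>Sym n. h x * (\<Sum>w\<in>Sym n. g w * rmulT n \<delta> x (Tb w) y))"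
    by (auto intro!: sum.cong simp: sum_distrib_left rmulT_Tb mult.left_commute)
  also have "\<dots> = (\<Sum>x\<in>Sym n. h x * rmulT n \<delta> x g y)"
    by (subst lin_expand[OF lin_rmulT assms(1)]) simp
  finally show "hmult n \<delta> g h y = \<dots>" .
qed

lemma hmult_mulTs:
  assumes "s \<in> sgens n" "supp_in n g" "supp_in n h"
  shows "hmult n \<delta> (mulTs n \<delta> s g) h = mulTs n \<delta> s (hmult n \<delta> g h)"
  using assms by (simp add: hmult_alt lin_sum[OF lin_mulTs] mulTs_rmulT)

lemma hmult_rmul:
  assumes "t \<in> sgens n" "supp_in n h"
  shows "hmult n \<delta> g (rmul n \<delta> t h) = rmul n \<delta> t (hmult n \<delta> g h)"
proof -
  have "mulT n \<delta> x (rmul n \<delta> t h) = rmul n \<delta> t (mulT n \<delta> x h)" if "x \<in> Sym n" for x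
    using Lw_Rw[of "rword n x" n "[t]" h \<delta>] assms that by (simp add: mulT_def rword)
  then show ?thesis by (simp add: hmult_def lin_sum[OF lin_rmul])
qed

lemma lin_hmult_right: "lin (hmult n \<delta> g)"
  by (simp add: lin_def hmult_def lin_add[OF lin_mulT] lin_scale[OF lin_mulT] algebra_simps
      sum.distrib sum_distrib_left)

lemma lin_hmult_left: "lin (\<lambda>g. hmult n \<delta> g h)"
  by (simp add: lin_def hmult_def algebra_simps sum.distrib sum_distrib_left)

lemma hmult_assoc:
  assumes "supp_in n f" "supp_in n g" "supp_in n h"
  shows "hmult n \<delta> (hmult n \<delta> f g) h = hmult n \<delta> f (hmult n \<delta> g h)"
proof -
  have "hmult n \<delta> (hmult n \<delta> f g) h = (\<lambda>y. \<Sum>z\<in>Sym n. h z * rmulT n \<delta> z (hmult n \<delta> f g) y)"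
    using assms by (simp add: hmult_alt[of n "hmult n \<delta> f g"])
  also have "\<dots> = (\<lambda>y. \<Sum>z\<in>Sym n. h z * (\<Sum>x\<in>Sym n. f x * mulT n \<delta> x (rmulT n \<delta> z g) y))"
    using assms(2) by (simp add: hmult_def lin_sum[OF lin_rmulT] mulT_rmulT)
  also have "\<dots> = (\<lambda>y. \<Sum>x\<in>Sym n. f x * (\<Sum>z\<in>Sym n. h z * mulT n \<delta> x (rmulT n \<delta> z g) y))"
    by (simp add: sum_distrib_left mult.left_commute) (subst sum.swap, simp)
  also have "\<dots> = (\<lambda>y. \<Sum>x\<in>Sym n. f x * mulT n \<delta> x (hmult n \<delta> g h) y)"
    using assms by (simp add: hmult_alt[of n g h] lin_sum[OF lin_mulT])
  finally show ?thesis by (simp add: hmult_def)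
qed

lemma hmult_Tb_left:
  assumes "x \<in> Sym n" shows "hmult n \<delta> (Tb x) h = mulT n \<delta> x h"
proof
  fix y
  have "hmult n \<delta> (Tb x) h y = (\<Sum>u\<in>Sym n. if u = x then mulT n \<delta> u h y else 0)"
    unfolding hmult_def by (intro sum.cong) (auto simp: Tb_def)
  then show "hmult n \<delta> (Tb x) h y = mulT n \<delta> x h y" using assms by (simp add: sum.delta)
qed

lemma hmult_Tb_id_right: "supp_in n h \<Longrightarrow> hmult n \<delta> h (Tb id) = h"
  by (simp add: hmult_def mulT_Tb_id Tb_sum)

section \<open>The anti-automorphism inverting indices, and the trace form\<close>

definition flat :: "nat \<Rightarrow> (perm \<Rightarrow> 'a::comm_ring_1) \<Rightarrow> perm \<Rightarrow> 'a" where
  "flat n h = (\<lambda>y. if y \<in> Sym n then h (inv y) else 0)"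

lemma supp_flat [simp]: "supp_in n (flat n h)"
  by (simp add: supp_in_def flat_def)

lemma flat_flat: "supp_in n h \<Longrightarrow> flat n (flat n h) = h"
  by (auto simp: flat_def supp_in_def fun_eq_iff)

lemma lin_flat [simp]: "lin (flat n)"
  by (auto simp: lin_def flat_def)

lemma flat_Tb: "w \<in> Sym n \<Longrightarrow> flat n (Tb w) = Tb (inv w)"
proof -
  assume w: "w \<in> Sym n"
  have "inv y = w \<longleftrightarrow> y = inv w" if "y \<in> Sym n" for y using that w by auto
  then show ?thesis using w by (intro ext) (auto simp: flat_def Tb_def)
qed

lemma flat_mulTs:
  assumes "s \<in> sgens n" "supp_in n h"
  shows "flat n (mulTs n \<delta> s h) = rmul n \<delta> s (flat n h)"
proof (rule supp_in_eqI[of n])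
  fix y assume y: "y \<in> Sym n"
  have "inv (y \<circ> s) = s \<circ> inv y" using y assms by (simp add: Sym_inv_comp[of _ n])
  moreover have "len n (s \<circ> inv y) = len n (y \<circ> s)" using len_inv[of "y \<circ> s" n] calculation y assms by simp
  ultimately show "flat n (mulTs n \<delta> s h) y = rmul n \<delta> s (flat n h) y"
    using y assms by (simp add: flat_def mulTs_def rmul_def len_inv)
qed (use assms in simp_all)

lemma flat_Lw:
  "set ss \<subseteq> sgens n \<Longrightarrow> supp_in n h \<Longrightarrow> flat n (Lw n \<delta> ss h) = Rw n \<delta> ss (flat n h)"
  by (induction ss) (auto simp: flat_mulTs)

lemma flat_mulT:
  assumes "x \<in> Sym n" "supp_in n h" shows "flat n (mulT n \<delta> x h) = rmulT n \<delta> (inv x) (flat n h)"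
proof (rule lin_ext[OF lin_comp[OF lin_flat lin_mulT] lin_comp[OF lin_rmulT lin_flat] _ assms(2)])
  fix w assume w: "w \<in> Sym n"
  have r: "red n (rword n w @ [])" using red_rword w by simp
  have a: "flat n (mulT n \<delta> x (Tb w)) = Rw n \<delta> (rword n x) (Tb (inv w))"
    using assms w by (simp add: mulT_def flat_Lw rword flat_Tb)
  have "Rw n \<delta> (rword n x) (Tb (inv w)) = Rw n \<delta> (rword n x) (Lw n \<delta> (rword n (inv w)) (Tb id))"
    using w by (simp add: Lw_Tb_id red_rword rword)
  also have "\<dots> = Lw n \<delta> (rword n (inv w)) (Rw n \<delta> (rword n x) (Tb id))"
    using w assms by (simp add: Lw_Rw rword)
  also have "Rw n \<delta> (rword n x) (Tb id) = Tb (inv x)"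
    using assms by (simp add: Rw_Tb_id red_rword wprod_rev[of _ n] rword)
  also have "Lw n \<delta> (rword n (inv w)) (Tb (inv x)) = rmulT n \<delta> (inv x) (Tb (inv w))"
    using w assms by (simp add: rmulT_Tb mulT_def)
  finally show "flat n (mulT n \<delta> x (Tb w)) = rmulT n \<delta> (inv x) (flat n (Tb w))"
    using a w by (simp add: flat_Tb)
qed

lemma flat_hmult:
  assumes "supp_in n g" "supp_in n h"
  shows "flat n (hmult n \<delta> g h) = hmult n \<delta> (flat n h) (flat n g)"
proof -
  have "flat n (hmult n \<delta> g h) = (\<lambda>y. \<Sum>x\<in>Sym n. g x * rmulT n \<delta> (inv x) (flat n h) y)"
    using assms by (simp add: hmult_def lin_sum[OF lin_flat] flat_mulT)
  also have "\<dots> = (\<lambda>y. \<Sum>x\<in>Sym n. flat n g (inv x) * rmulT n \<delta> (inv x) (flat n h) y)"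
    by (simp add: flat_def)
  also have "\<dots> = (\<lambda>y. \<Sum>x\<in>Sym n. flat n g x * rmulT n \<delta> x (flat n h) y)"
    by (subst sum_Sym_inv[of "\<lambda>x. flat n g x * rmulT n \<delta> x (flat n h) _"]) simp
  finally show ?thesis by (simp add: hmult_alt)
qed

text \<open>\<open>T_s\<close> is self-adjoint for the form in which the \<open>T_w\<close> are
  orthonormal. This form is the coefficient at \<open>id\<close> of the product of
  \<open>flat n h\<close> and \<open>g\<close>, that is, the symmetrizing trace.\<close>

lemma mulTs_adjoint:
  assumes "s \<in> sgens n"
  shows "(\<Sum>y\<in>Sym n. mulTs n \<delta> s h y * g y) = (\<Sum>y\<in>Sym n. h y * mulTs n \<delta> s g y)"
proof -
  have "(\<Sum>y\<in>Sym n. h (s \<circ> y) * g y) = (\<Sum>y\<in>Sym n. h y * g (s \<circ> y))"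
    using sum_Sym_left[OF assms, of "\<lambda>y. h y * g (s \<circ> y)"] assms by simp
  moreover have "(\<Sum>y\<in>Sym n. (if len n (s \<circ> y) < len n y then \<delta> * h y else 0) * g y) =
     (\<Sum>y\<in>Sym n. h y * (if len n (s \<circ> y) < len n y then \<delta> * g y else 0))"
    by (rule sum.cong) auto
  ultimately show ?thesis by (simp add: mulTs_def distrib_left distrib_right sum.distrib)
qed

lemma Lw_adjoint:
  "set ss \<subseteq> sgens n \<Longrightarrow>
   (\<Sum>y\<in>Sym n. Lw n \<delta> ss h y * g y) = (\<Sum>y\<in>Sym n. h y * Lw n \<delta> (rev ss) g y)"
  by (induction ss arbitrary: g) (simp_all add: mulTs_adjoint)

lemma mulT_adjoint:
  assumes "x \<in> Sym n" "supp_in n g"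
  shows "(\<Sum>y\<in>Sym n. mulT n \<delta> x h y * g y) = (\<Sum>y\<in>Sym n. h y * mulT n \<delta> (inv x) g y)"
proof -
  have "mulT n \<delta> (inv x) g = Lw n \<delta> (rev (rword n x)) g"
    using mulT_wprod[OF red_rev[OF red_rword[OF assms(1)]] assms(2), of \<delta>] assms(1)
    by (simp add: wprod_rev[of _ n] rword)
  then show ?thesis using Lw_adjoint[of "rword n x" n \<delta> h g] assms
    by (simp add: rword mulT_def)
qed

lemma sum_mult_Tb: "z \<in> Sym n \<Longrightarrow> (\<Sum>y\<in>Sym n. h y * Tb z y) = (h z :: 'a::comm_ring_1)"
  by (simp add: Tb_def if_distrib[of "\<lambda>x. _ * x"] sum.delta cong: if_cong)

lemma mulT_coeff_id:
  assumes "x \<in> Sym n" "supp_in n h" shows "mulT n \<delta> x h id = h (inv x)"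
  using mulT_adjoint[of x n "Tb id" \<delta> h] assms by (simp add: sum_mult_Tb mulT_Tb_id)

text \<open>Cyclicity of the symmetrizing trace: both sides are the coefficient of
  \<open>T_1\<close> in a product of \<open>T_w\<close>, \<open>T_x\<close> and
  \<open>T_(z^-1)\<close>, taken in cyclically shifted order.\<close>

lemma mulT_Tb_coeff_rotate:
  assumes "w \<in> Sym n" "x \<in> Sym n" "z \<in> Sym n"
  shows "mulT n \<delta> w (Tb x) z = mulT n \<delta> x (Tb (inv z)) (inv w)"
proof -
  have adj: "mulT n \<delta> a (Tb b) c = mulT n \<delta> (inv a) (Tb c) b" if "a \<in> Sym n" "b \<in> Sym n" "c \<in> Sym n" for a b c
    using mulT_adjoint[of a n "Tb c" \<delta> "Tb b"] that 
    by (simp add: sum_mult_Tb mult.commute[of "Tb b _"])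
  have fl: "mulT n \<delta> a (Tb b) (inv c) = mulT n \<delta> (inv b) (Tb (inv a)) c"
    if "a \<in> Sym n" "b \<in> Sym n" "c \<in> Sym n" for a b c
  proof -
    have "flat n (mulT n \<delta> a (Tb b)) c = mulT n \<delta> (inv b) (Tb (inv a)) c"
      using that by (simp add: flat_mulT flat_Tb rmulT_Tb)
    then show ?thesis using that by (simp add: flat_def)
  qed
  have i: "inv x \<in> Sym n" "inv z \<in> Sym n" "inv w \<in> Sym n" and
    ii: "inv (inv x) = x" "inv (inv z) = z" "inv (inv w) = w"
    using assms Sym_inv_inv inv_in_Sym by blast+
  show ?thesis
    using fl[OF assms(2) i(2) assms(1)] adj[OF assms(3) i(1) assms(1)] fl[OF i(2) assms(1,2)]
      adj[OF assms] ii by metis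
qed

section \<open>Bar involution and Kazhdan--Lusztig basis\<close>

lemma laur_expand: "(a :: laur) = (\<Sum>k\<in>Poly_Mapping.keys a. Poly_Mapping.single k (Poly_Mapping.lookup a k))"
proof (rule poly_mapping_eqI)
  fix j
  have "(\<Sum>k\<in>Poly_Mapping.keys a. Poly_Mapping.lookup (Poly_Mapping.single k (Poly_Mapping.lookup a k)) j) =
     (\<Sum>k\<in>Poly_Mapping.keys a. if k = j then Poly_Mapping.lookup a k else 0)"
    by (intro sum.cong) (auto simp: lookup_single)
  then show "Poly_Mapping.lookup a j = Poly_Mapping.lookup (\<Sum>k\<in>Poly_Mapping.keys a. Poly_Mapping.single k (Poly_Mapping.lookup a k)) j"
    by (simp add: lookup_sum sum.delta in_keys_iff)
qed

lemma laur_induct [case_names single add]: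
  assumes "\<And>k c. P (Poly_Mapping.single k c)" "\<And>a b. P a \<Longrightarrow> P b \<Longrightarrow> P (a + b)"
  shows "P (a :: laur)"
proof -
  have "P (\<Sum>k\<in>A. Poly_Mapping.single k (f k))" if "finite A" for A f
    using that
  proof (induction A)
    case empty
    then show ?case using assms(1)[of 0 0] by simp
  qed (use assms in simp)
  then show ?thesis by (subst laur_expand) simp
qed

lemma lookup_barA [simp]: "Poly_Mapping.lookup (barA a) k = Poly_Mapping.lookup a (- k)"
  by transfer simp

lemma barA_single [simp]: "barA (Poly_Mapping.single k c) = Poly_Mapping.single (- k) c"
  by (rule poly_mapping_eqI) (simp add: lookup_single when_def equation_minus_iff eq_commute[of k])

lemma barA_add [simp]: "barA (a + b) = barA a + barA b"
  and barA_diff [simp]: "barA (a - b) = barA a - barA b"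
  and barA_uminus [simp]: "barA (- a) = - barA a"
  and barA_zero [simp]: "barA 0 = 0"
  and barA_barA [simp]: "barA (barA a) = a"
  by (auto intro!: poly_mapping_eqI simp: lookup_add lookup_minus)

lemma barA_one [simp]: "barA 1 = 1"
  using barA_single[of 0 1] by simp

lemma barA_mult [simp]: "barA (a * b) = barA a * barA b"
proof (induction a rule: laur_induct)
  case (single k c)
  show ?case
  proof (induction b rule: laur_induct)
    case (single k' c')
    show ?case by (simp add: mult_single)
  qed (simp add: algebra_simps)
qed (simp add: algebra_simps)

lemma barA_sum [simp]: "barA (\<Sum>x\<in>A. f x) = (\<Sum>x\<in>A. barA (f x))"
  by (induction A rule: infinite_finite_induct) auto

lemma barA_vA [simp]: "barA vA = vAinv" "barA vAinv = vA" "barA deltaA = - deltaA"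
  by (simp_all add: vA_def vAinv_def deltaA_def)

lemma vA_vAinv [simp]: "vA * vAinv = 1" "vAinv * vA = 1"
  by (simp_all add: vA_def vAinv_def mult_single)

lemma in_vZv_iff: "in_vZv a \<longleftrightarrow> (\<forall>k\<le>0. Poly_Mapping.lookup a k = 0)"
  unfolding in_vZv_def Ball_def in_keys_iff by (metis int_one_le_iff_zero_less linorder_not_less)

definition in_Zv :: "laur \<Rightarrow> bool" where
  "in_Zv a \<longleftrightarrow> (\<forall>k<0. Poly_Mapping.lookup a k = 0)"

lemma in_vZv_Zv: "in_vZv a \<Longrightarrow> in_Zv a"
  by (simp add: in_vZv_iff in_Zv_def)

lemma in_vZv_zero [simp]: "in_vZv 0"
  and in_vZv_add: "in_vZv a \<Longrightarrow> in_vZv b \<Longrightarrow> in_vZv (a + b)"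
  and in_vZv_diff: "in_vZv a \<Longrightarrow> in_vZv b \<Longrightarrow> in_vZv (a - b)"
  by (auto simp: in_vZv_iff lookup_add lookup_minus)

lemma in_Zv_one [simp]: "in_Zv 1"
  by (simp add: in_Zv_def lookup_one)

lemma in_vZv_mult: assumes "in_vZv a" "in_Zv b" shows "in_vZv (a * b)"
  unfolding in_vZv_def
proof
  fix k assume "k \<in> Poly_Mapping.keys (a * b)"
  then obtain i j where ij: "k = i + j" "i \<in> Poly_Mapping.keys a" "j \<in> Poly_Mapping.keys b"
    using keys_mult[of a b] by blast
  then have "1 \<le> i" "0 \<le> j" using assms by (auto simp: in_vZv_def in_Zv_def in_keys_iff not_le[symmetric])
  with ij show "1 \<le> k" by simp
qed

lemma in_vZv_sum: "(\<And>x. x \<in> A \<Longrightarrow> in_vZv (f x)) \<Longrightarrow> in_vZv (\<Sum>x\<in>A. f x)"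
  by (induction A rule: infinite_finite_induct) (auto intro: in_vZv_add)

lemma in_vZv_vA [simp]: "in_vZv vA"
  by (simp add: in_vZv_def vA_def)

lemma in_viZvi_barA: "in_viZvi a \<longleftrightarrow> in_vZv (barA a)"
proof
  assume a: "in_viZvi a"
  have "Poly_Mapping.lookup a (- k) = 0" if "k \<le> 0" for k
    using a that by (auto simp: in_viZvi_def in_keys_iff dest!: bspec[where x = "- k"])
  then show "in_vZv (barA a)" by (simp add: in_vZv_iff)
next
  assume a: "in_vZv (barA a)"
  have "Poly_Mapping.lookup a k = 0" if "k > -1" for k
    using a that by (auto simp: in_vZv_iff dest!: spec[where x = "- k"])
  then show "in_viZvi a" unfolding in_viZvi_def Ball_def in_keys_iff by (metis linorder_not_less)
qed

lemma bar_inv_vZv: "barA a = a \<Longrightarrow> in_vZv a \<Longrightarrow> a = 0"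
proof (rule poly_mapping_eqI)
  fix k assume a: "barA a = a" "in_vZv a"
  have "Poly_Mapping.lookup a k = Poly_Mapping.lookup a (- k)" using lookup_barA[of a k] a by simp
  then show "Poly_Mapping.lookup a k = Poly_Mapping.lookup 0 k"
    using a(2) by (cases "k \<le> 0") (auto simp: in_vZv_iff)
qed

text \<open>\<open>q\<close> is the part of \<open>a\<close> with positive exponents;
  anti-invariance kills the constant term and determines the negative part.\<close>

lemma anti_inv_decomp:
  assumes "barA a = - a" shows "\<exists>q. in_vZv q \<and> q - barA q = a"
proof -
  define q where "q = (\<Sum>k\<in>{k \<in> Poly_Mapping.keys a. 0 < k}. Poly_Mapping.single k (Poly_Mapping.lookup a k))"
  have lq: "Poly_Mapping.lookup q j = (if 0 < j then Poly_Mapping.lookup a j else 0)" for j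
  proof -
    have "Poly_Mapping.lookup q j = (\<Sum>k\<in>{k \<in> Poly_Mapping.keys a. 0 < k}. if k = j then Poly_Mapping.lookup a k else 0)"
      unfolding q_def lookup_sum by (intro sum.cong) (auto simp: lookup_single)
    then show ?thesis by (simp add: sum.delta in_keys_iff)
  qed
  have la: "Poly_Mapping.lookup a (- j) = - Poly_Mapping.lookup a j" for j
    using lookup_barA[of a j] assms by simp
  have "in_vZv q" by (simp add: in_vZv_iff lq)
  moreover have "q - barA q = a"
    by (rule poly_mapping_eqI) (use la[of 0] in \<open>auto simp: lookup_minus lq la not_less\<close>)
  ultimately show ?thesis by blast
qed

section \<open>The bar involution of the algebra\<close>

definition mulTi :: "nat \<Rightarrow> perm \<Rightarrow> (perm \<Rightarrow> laur) \<Rightarrow> perm \<Rightarrow> laur" where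
  "mulTi n s g = (\<lambda>y. mulTs n deltaA s g y - deltaA * g y)"

definition rmuli :: "nat \<Rightarrow> perm \<Rightarrow> (perm \<Rightarrow> laur) \<Rightarrow> perm \<Rightarrow> laur" where
  "rmuli n s g = (\<lambda>y. rmul n deltaA s g y - deltaA * g y)"

lemma barT_eq: "barT n w = foldr (mulTi n) (rword n w) (Tb id)"
  by (simp add: barT_def mulTi_def[abs_def])

lemma lin_mulTi [simp]: "lin (mulTi n s)"
  by (auto simp: lin_def mulTi_def mulTs_def algebra_simps fun_eq_iff)

lemma lin_rmuli [simp]: "lin (rmuli n s)"
  by (auto simp: lin_def rmuli_def rmul_def algebra_simps fun_eq_iff)

lemma supp_mulTi [simp]: "s \<in> sgens n \<Longrightarrow> supp_in n h \<Longrightarrow> supp_in n (mulTi n s h)"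
  by (simp add: mulTi_def)

abbreviation "Liw n ss \<equiv> foldr (mulTi n) ss"

lemma supp_Liw [simp]: "set ss \<subseteq> sgens n \<Longrightarrow> supp_in n h \<Longrightarrow> supp_in n (Liw n ss h)"
  by (induction ss) auto

lemma mulTs_mulTi: "s \<in> sgens n \<Longrightarrow> supp_in n h \<Longrightarrow> mulTs n deltaA s (mulTi n s h) = h"
  and mulTi_mulTs: "s \<in> sgens n \<Longrightarrow> supp_in n h \<Longrightarrow> mulTi n s (mulTs n deltaA s h) = h"
  unfolding mulTi_def by (simp_all add: lin_diff[OF lin_mulTs] lin_scale[OF lin_mulTs] mulTs_mulTs)

lemma Lw_Liw: "set ss \<subseteq> sgens n \<Longrightarrow> supp_in n h \<Longrightarrow> Lw n deltaA (rev ss) (Liw n ss h) = h"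
  by (induction ss) (auto simp: mulTs_mulTi)

lemma Liw_Lw: "set ss \<subseteq> sgens n \<Longrightarrow> supp_in n h \<Longrightarrow> Liw n ss (Lw n deltaA (rev ss) h) = h"
  by (induction ss arbitrary: h) (auto simp: mulTi_mulTs)

text \<open>Inverse multiplications along a word undo ordinary multiplications along the reversed
  word, so independence of the word transfers from \<open>Lw_unique\<close>.\<close>

lemma Liw_unique:
  assumes "red n ss" "red n ts" "wprod ss = wprod ts" "supp_in n h"
  shows "Liw n ss h = Liw n ts h"
proof -
  have s: "set ss \<subseteq> sgens n" "set ts \<subseteq> sgens n" using assms by (auto simp: red_def)
  have "wprod (rev ss) = wprod (rev ts)" using s assms by (simp add: wprod_rev)
  then have "Lw n deltaA (rev ss) (Liw n ts h) = Lw n deltaA (rev ts) (Liw n ts h)"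
    using Lw_unique[OF red_rev[OF assms(1)] red_rev[OF assms(2)], of "Liw n ts h" deltaA] s assms(4) by simp
  also have "\<dots> = h" using Lw_Liw s assms(4) by blast
  finally show ?thesis using Liw_Lw[OF s(1), of "Liw n ts h"] s assms(4) by simp
qed

lemma barT_wprod: "red n ss \<Longrightarrow> barT n (wprod ss) = Liw n ss (Tb id)"
  unfolding barT_eq by (rule Liw_unique) (auto simp: red_def rword)

lemma barT_id [simp]: "barT n id = Tb id"
  using barT_wprod[of n "[]"] by (simp add: red_def)

lemma supp_barT [simp]: "w \<in> Sym n \<Longrightarrow> supp_in n (barT n w)"
  by (simp add: barT_eq rword)

lemma barT_up:
  assumes "s \<in> sgens n" "w \<in> Sym n" "len n w < len n (s \<circ> w)"
  shows "barT n (s \<circ> w) = mulTi n s (barT n w)"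
proof -
  have "red n (s # rword n w)" using assms by (intro red_ConsI) (simp_all add: red_rword rword)
  from barT_wprod[OF this] show ?thesis using assms by (simp add: rword barT_eq)
qed

lemma mulTi_rmuli:
  assumes "s \<in> sgens n" "t \<in> sgens n" "supp_in n h"
  shows "mulTi n s (rmuli n t h) = rmuli n t (mulTi n s h)"
  unfolding mulTi_def rmuli_def
  using mulTs_rmul[OF assms, of deltaA]
  by (simp add: lin_diff[OF lin_mulTs] lin_scale[OF lin_mulTs] lin_diff[OF lin_rmul] lin_scale[OF lin_rmul] algebra_simps)

lemma Liw_rmuli:
  "set ss \<subseteq> sgens n \<Longrightarrow> t \<in> sgens n \<Longrightarrow> supp_in n h \<Longrightarrow> Liw n ss (rmuli n t h) = rmuli n t (Liw n ss h)"
  by (induction ss) (auto simp: mulTi_rmuli)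

lemma mulTi_Tb_id: "t \<in> sgens n \<Longrightarrow> mulTi n t (Tb id) = rmuli n t (Tb id)"
  using len_left_cases[of id n t] by (simp add: mulTi_def rmuli_def mulTs_Tb rmul_Tb)

lemma barT_up_right:
  assumes "t \<in> sgens n" "w \<in> Sym n" "len n w < len n (w \<circ> t)"
  shows "barT n (w \<circ> t) = rmuli n t (barT n w)"
proof -
  have "len n (w \<circ> t) = Suc (len n w)" using len_right_cases[OF assms(2,1)] assms(3) by auto
  then have "red n (rword n w @ [t])" using assms by (auto simp: red_def rword)
  from barT_wprod[OF this] have "barT n (w \<circ> t) = Liw n (rword n w) (rmuli n t (Tb id))"
    using assms by (simp add: rword mulTi_Tb_id)
  then show ?thesis using assms by (simp add: Liw_rmuli rword barT_eq)
qed

text \<open>The bar image of \<open>T_w\<close> is \<open>T_w\<close> plus terms of smaller length;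
  triangularity is measured by length throughout.\<close>

lemma barT_triangular:
  assumes "w \<in> Sym n" "y \<in> Sym n" "len n w \<le> len n y"
  shows "barT n w y = (if y = w then 1 else 0)"
proof -
  have "red n ss \<Longrightarrow> len n (wprod ss) \<le> len n y \<Longrightarrow> y \<in> Sym n \<Longrightarrow>
     barT n (wprod ss) y = (if y = wprod ss then 1 else 0)" for ss y
  proof (induction ss arbitrary: y)
    case Nil
    then show ?case by (simp add: Tb_def)
  next
    case (Cons s ss)
    let ?w = "wprod ss"
    have s: "s \<in> sgens n" "?w \<in> Sym n" using Cons.prems by (auto simp: red_def)
    have r: "red n ss" "len n ?w < len n (s \<circ> ?w)" using red_ConsD[OF Cons.prems(1)] .
    have ly: "len n ?w < len n y" using Cons.prems(2) r(2) by simp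
    have sy: "s \<circ> y \<in> Sym n" using s Cons.prems(3) by simp
    have "barT n ?w y = 0" using Cons.IH[OF r(1) _ Cons.prems(3)] ly by auto
    moreover have "len n ?w \<le> len n (s \<circ> y)" using ly len_left_cases[OF Cons.prems(3) s(1)] by auto
    then have "barT n ?w (s \<circ> y) = (if s \<circ> y = ?w then 1 else 0)" using Cons.IH[OF r(1) _ sy] by simp
    moreover have "s \<circ> y = ?w \<longleftrightarrow> y = s \<circ> ?w" using sgens_cancel_left[OF s(1)] by metis
    ultimately show ?case using barT_up[OF s r(2)] by (simp add: mulTi_def mulTs_def)
  qed
  from this[OF red_rword, of w y] assms show ?thesis by (simp add: rword)
qed

lemma supp_barH [simp]: "supp_in n (barH n h)"
  unfolding barH_def by (rule supp_in_sum) simp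

lemma barH_add: "barH n (\<lambda>y. f y + g y) = (\<lambda>y. barH n f y + barH n g y)"
  and barH_diff: "barH n (\<lambda>y. f y - g y) = (\<lambda>y. barH n f y - barH n g y)"
  and barH_scale: "barH n (\<lambda>y. c * f y) = (\<lambda>y. barA c * barH n f y)"
  and barH_uminus: "barH n (\<lambda>y. - f y) = (\<lambda>y. - barH n f y)"
  by (simp_all add: barH_def algebra_simps sum.distrib sum_subtractf sum_distrib_left sum_negf)

lemma barH_zero: "barH n (\<lambda>_. 0) = (\<lambda>_. 0)"
  by (simp add: barH_def)

lemma barH_sum:
  "finite A \<Longrightarrow> barH n (\<lambda>y. \<Sum>x\<in>A. c x * f x y) = (\<lambda>y. \<Sum>x\<in>A. barA (c x) * barH n (f x) y)"
  by (induction A rule: finite_induct) (simp_all add: barH_zero barH_add barH_scale)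

lemma barH_Tb: "w \<in> Sym n \<Longrightarrow> barH n (Tb w) = barT n w"
proof
  fix y assume w: "w \<in> Sym n"
  have "barH n (Tb w) y = (\<Sum>u\<in>Sym n. if u = w then barT n u y else 0)"
    unfolding barH_def by (intro sum.cong) (auto simp: Tb_def)
  then show "barH n (Tb w) y = barT n w y" using w by (simp add: sum.delta)
qed

text \<open>\<open>F\<close> precedes the bar map and \<open>G\<close> follows it. Both sides are
  semilinear in \<open>h\<close>, so the identity can be checked on the basis.\<close>

lemma barH_semilin_ext:
  assumes "lin F" "lin G" "\<And>x. x \<in> Sym n \<Longrightarrow> barH n (F (Tb x)) = G (barT n x)" "supp_in n h"
  shows "barH n (F h) = G (barH n h)"
proof -
  have "barH n (F h) = (\<lambda>y. \<Sum>x\<in>Sym n. barA (h x) * barH n (F (Tb x)) y)"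
    by (subst lin_expand[OF assms(1,4)]) (simp add: barH_sum)
  also have "\<dots> = (\<lambda>y. \<Sum>x\<in>Sym n. barA (h x) * G (barT n x) y)"
    by (simp add: assms(3))
  also have "\<dots> = G (\<lambda>y. \<Sum>x\<in>Sym n. barA (h x) * barT n x y)"
    by (simp add: lin_sum[OF assms(2)])
  finally show ?thesis by (simp add: barH_def)
qed

lemma barH_mulTs:
  assumes "s \<in> sgens n" "supp_in n h"
  shows "barH n (mulTs n deltaA s h) = mulTi n s (barH n h)"
proof (rule barH_semilin_ext[OF lin_mulTs lin_mulTi _ assms(2)])
  fix x assume x: "x \<in> Sym n"
  have sx: "s \<circ> x \<in> Sym n" using x assms by simp
  show "barH n (mulTs n deltaA s (Tb x)) = mulTi n s (barT n x)"
  proof (cases "len n x < len n (s \<circ> x)")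
    case True
    then show ?thesis using x assms sx by (simp add: mulTs_Tb barH_Tb barT_up)
  next
    case False
    then have "len n (s \<circ> x) < len n (s \<circ> (s \<circ> x))" using len_left_cases[OF x assms(1)] assms(1) by auto
    from barT_up[OF assms(1) sx this] have "barT n x = mulTi n s (barT n (s \<circ> x))" using assms(1) by simp
    then have "mulTs n deltaA s (barT n x) = barT n (s \<circ> x)" using mulTs_mulTi[OF assms(1), of "barT n (s \<circ> x)"] sx by simp
    then show ?thesis using False x assms sx
      by (simp add: mulTs_Tb barH_add barH_scale barH_Tb mulTi_def)
  qed
qed

lemma barH_rmul:
  assumes "s \<in> sgens n" "supp_in n h"
  shows "barH n (rmul n deltaA s h) = rmuli n s (barH n h)"
proof (rule barH_semilin_ext[OF lin_rmul lin_rmuli _ assms(2)])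
  fix x assume x: "x \<in> Sym n"
  have sx: "x \<circ> s \<in> Sym n" using x assms by simp
  show "barH n (rmul n deltaA s (Tb x)) = rmuli n s (barT n x)"
  proof (cases "len n x < len n (x \<circ> s)")
    case True
    then show ?thesis using x assms sx by (simp add: rmul_Tb barH_Tb barT_up_right)
  next
    case False
    then have "len n (x \<circ> s) < len n ((x \<circ> s) \<circ> s)" using len_right_cases[OF x assms(1)] assms(1) by auto
    from barT_up_right[OF assms(1) sx this] have e: "barT n x = rmuli n s (barT n (x \<circ> s))" using assms(1) by simp
    have "rmul n deltaA s (barT n x) = barT n (x \<circ> s)"
      unfolding e using assms(1) sx
      by (simp add: rmuli_def lin_diff[OF lin_rmul] lin_scale[OF lin_rmul] rmul_rmul)
    then show ?thesis using False x assms sx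
      by (simp add: rmul_Tb barH_add barH_scale barH_Tb rmuli_def)
  qed
qed

lemma barH_mulTi:
  assumes "s \<in> sgens n" "supp_in n h"
  shows "barH n (mulTi n s h) = mulTs n deltaA s (barH n h)"
  using barH_mulTs[OF assms] by (simp add: mulTi_def barH_diff barH_scale)

lemma barH_Liw:
  "set ss \<subseteq> sgens n \<Longrightarrow> supp_in n h \<Longrightarrow> barH n (Liw n ss h) = Lw n deltaA ss (barH n h)"
  by (induction ss) (auto simp: barH_mulTi)

lemma barH_Lw:
  "set ss \<subseteq> sgens n \<Longrightarrow> supp_in n h \<Longrightarrow> barH n (Lw n deltaA ss h) = Liw n ss (barH n h)"
  by (induction ss) (auto simp: barH_mulTs)

lemma barH_barT: "w \<in> Sym n \<Longrightarrow> barH n (barT n w) = Tb w"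
  using mulT_Tb_id[of w n deltaA] unfolding barT_eq[of n w] by (simp add: barH_Liw rword barH_Tb mulT_def)

lemma barH_barH: assumes "supp_in n h" shows "barH n (barH n h) = h"
proof -
  have "barH n (barH n h) = (\<lambda>y. \<Sum>x\<in>Sym n. h x * Tb x y)"
    unfolding barH_def[of n h] by (simp add: barH_sum barH_barT)
  then show ?thesis using Tb_sum[OF assms] by simp
qed

lemma hmult_Liw:
  "set ss \<subseteq> sgens n \<Longrightarrow> supp_in n g \<Longrightarrow> supp_in n h \<Longrightarrow>
   hmult n deltaA (Liw n ss g) h = Liw n ss (hmult n deltaA g h)"
proof (induction ss)
  case (Cons s ss)
  have "hmult n deltaA (mulTi n s k) h = mulTi n s (hmult n deltaA k h)" if "supp_in n k" for k
    using that Cons.prems unfolding mulTi_def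
    by (simp add: lin_diff[OF lin_hmult_left] lin_scale[OF lin_hmult_left] hmult_mulTs)
  then show ?case using Cons by simp
qed simp

lemma hmult_Tb_id_left: "hmult n \<delta> (Tb id) h = h"
  by (simp add: hmult_Tb_left)

lemma barH_hmult:
  assumes "supp_in n g" "supp_in n h"
  shows "barH n (hmult n deltaA g h) = hmult n deltaA (barH n g) (barH n h)"
proof -
  have b: "barH n (mulT n deltaA x h) = hmult n deltaA (barT n x) (barH n h)" if "x \<in> Sym n" for x
    using that assms by (simp add: mulT_def barH_Lw rword barT_eq hmult_Liw hmult_Tb_id_left)
  have "barH n (hmult n deltaA g h) = (\<lambda>y. \<Sum>x\<in>Sym n. barA (g x) * hmult n deltaA (barT n x) (barH n h) y)"
    by (simp add: hmult_def[of n deltaA g h] barH_sum b)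
  also have "\<dots> = hmult n deltaA (\<lambda>y. \<Sum>x\<in>Sym n. barA (g x) * barT n x y) (barH n h)"
    using lin_sum[OF lin_hmult_left finite_Sym, where c = "\<lambda>x. barA (g x)" and f = "barT n"] by simp
  finally show ?thesis by (simp add: barH_def)
qed

lemma flat_barT: "w \<in> Sym n \<Longrightarrow> flat n (barT n w) = barT n (inv w)"
proof -
  have "red n ss \<Longrightarrow> flat n (barT n (wprod ss)) = barT n (wprod (rev ss))" for ss
  proof (induction ss)
    case Nil
    have "inv (id :: perm) = id" by simp
    then show ?case using flat_Tb[of id n] by simp
  next
    case (Cons s ss)
    let ?w = "wprod ss"
    have s: "s \<in> sgens n" "?w \<in> Sym n" "set ss \<subseteq> sgens n" using Cons.prems by (auto simp: red_def)
    have r: "red n ss" "len n ?w < len n (s \<circ> ?w)" using red_ConsD[OF Cons.prems(1)] .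
    have "flat n (barT n (s \<circ> ?w)) = rmuli n s (flat n (barT n ?w))"
      using s unfolding barT_up[OF s(1,2) r(2)] mulTi_def rmuli_def
      by (simp add: lin_diff[OF lin_flat] lin_scale[OF lin_flat] flat_mulTs)
    also have "\<dots> = rmuli n s (barT n (inv ?w))" using Cons.IH[OF r(1)] wprod_rev[OF s(3)] by simp
    also have "\<dots> = barT n (inv ?w \<circ> s)"
      using s r len_left_inv[of ?w n s] by (intro barT_up_right[symmetric]) (simp_all add: len_inv)
    finally show ?case using wprod_rev[OF s(3)] by simp
  qed
  moreover assume w: "w \<in> Sym n"
  ultimately show ?thesis using red_rword[OF w] wprod_rev[of "rword n w" n] rword[OF w] by metis
qed

lemma barH_flat: "supp_in n h \<Longrightarrow> barH n (flat n h) = flat n (barH n h)"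
  by (rule barH_semilin_ext[OF lin_flat lin_flat]) (auto simp: flat_Tb barH_Tb flat_barT)

text \<open>Terms of smaller length do not reach \<open>z\<close> and terms of larger length are
  absent, so at the top length bar is plain conjugation of coefficients.\<close>

lemma barH_top:
  assumes "supp_in n h" "\<And>y. y \<in> Sym n \<Longrightarrow> k < len n y \<Longrightarrow> h y = 0" "z \<in> Sym n" "k \<le> len n z"
  shows "barH n h z = barA (h z)"
proof -
  have "barA (h w) * barT n w z = (if w = z then barA (h z) else 0)" if "w \<in> Sym n" for w
    using assms(2)[OF that] barT_triangular[OF that assms(3)] assms(4) by (cases "k < len n w") auto
  then have "barH n h z = (\<Sum>w\<in>Sym n. if w = z then barA (h z) else 0)"
    unfolding barH_def by (intro sum.cong) auto
  then show ?thesis using assms(3) by (simp add: sum.delta)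
qed

text \<open>At an element of maximal length in the support the coefficient is itself bar invariant,
  yet it has only positive or only negative exponents.\<close>

lemma bar_invariant_zero:
  assumes "supp_in n c" "barH n c = c" "(\<forall>y. in_vZv (c y)) \<or> (\<forall>y. in_viZvi (c y))"
  shows "c = (\<lambda>_. 0)"
proof (rule ccontr)
  assume "c \<noteq> (\<lambda>_. 0)"
  then obtain y0 where "c y0 \<noteq> 0" by auto
  then have ne: "{y \<in> Sym n. c y \<noteq> 0} \<noteq> {}" using assms(1) by (auto simp: supp_in_def)
  define k where "k = Max (len n ` {y \<in> Sym n. c y \<noteq> 0})"
  have "k \<in> len n ` {y \<in> Sym n. c y \<noteq> 0}" unfolding k_def using ne by (intro Max_in) auto
  then obtain z where z: "z \<in> Sym n" "c z \<noteq> 0" "len n z = k" by auto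
  have "c y = 0" if "y \<in> Sym n" "k < len n y" for y
  proof (rule ccontr)
    assume "c y \<noteq> 0"
    then have "len n y \<le> k" unfolding k_def using that by (intro Max_ge) auto
    with that show False by simp
  qed
  from barH_top[OF assms(1) this z(1)] z(3) have b: "barA (c z) = c z" using assms(2) by simp
  have "in_vZv (c z)" using assms(3) b in_viZvi_barA[of "c z"] by metis
  with b z(2) bar_inv_vZv show False by blast
qed

text \<open>The Kazhdan--Lusztig construction relative to a bar-stable submodule Q with a unitriangular
  family E indexed by S; it is applied to the whole algebra and to the eigenspace of a right
  multiplication.\<close>

locale kl_setup =
  fixes n :: nat and Q :: "(perm \<Rightarrow> laur) \<Rightarrow> bool" and S :: "perm set" and E :: "perm \<Rightarrow> perm \<Rightarrow> laur"
  assumes Qsupp: "Q f \<Longrightarrow> supp_in n f"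
    and Qzero: "Q (\<lambda>_. 0)"
    and Qadd: "Q f \<Longrightarrow> Q g \<Longrightarrow> Q (\<lambda>y. f y + g y)"
    and Qscale: "Q f \<Longrightarrow> Q (\<lambda>y. c * f y)"
    and Qbar: "Q f \<Longrightarrow> Q (barH n f)"
    and SE: "z \<in> S \<Longrightarrow> z \<in> Sym n" "z \<in> S \<Longrightarrow> Q (E z)" "z \<in> S \<Longrightarrow> E z z = 1"
      "z \<in> S \<Longrightarrow> y \<noteq> z \<Longrightarrow> in_vZv (E z y)"
      "z \<in> S \<Longrightarrow> y \<noteq> z \<Longrightarrow> y \<in> Sym n \<Longrightarrow> len n z \<le> len n y \<Longrightarrow> E z y = 0"
    and top: "Q f \<Longrightarrow> (\<And>y. y \<in> Sym n \<Longrightarrow> len n z < len n y \<Longrightarrow> f y = 0) \<Longrightarrow> z \<in> Sym n \<Longrightarrow> f z \<noteq> 0 \<Longrightarrow> z \<in> S"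
begin

lemma Qdiff: "Q f \<Longrightarrow> Q g \<Longrightarrow> Q (\<lambda>y. f y - g y)"
  using Qadd[of f "\<lambda>y. (-1) * g y"] Qscale[of g "-1"] by simp

lemma Qsum: "finite A \<Longrightarrow> (\<And>x. x \<in> A \<Longrightarrow> Q (f x)) \<Longrightarrow> Q (\<lambda>y. \<Sum>x\<in>A. c x * f x y)"
  by (induction A rule: finite_induct) (simp_all add: Qzero Qadd Qscale)

text \<open>Induction on the length bound: the coefficients of \<open>g\<close> at length
  \<open>k\<close> are anti-invariant, so each has the form \<open>q - barA q\<close>. Subtracting
  the contribution of the matching combination of the \<open>E z\<close> leaves a remainder
  supported in smaller lengths.\<close>

lemma solve:
  "Q g \<Longrightarrow> barH n g = (\<lambda>y. - g y) \<Longrightarrow> (\<And>y. y \<in> Sym n \<Longrightarrow> k \<le> len n y \<Longrightarrow> g y = 0) \<Longrightarrow>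
   \<exists>p. Q p \<and> (\<forall>y. in_vZv (p y)) \<and> (\<forall>y\<in>Sym n. k \<le> len n y \<longrightarrow> p y = 0) \<and>
     (\<forall>y. p y - barH n p y = g y)"
proof (induction k arbitrary: g)
  case 0
  then have "g y = 0" for y using Qsupp[OF 0(1)] by (cases "y \<in> Sym n") (auto simp: supp_in_def)
  then show ?case using Qzero by (intro exI[of _ "\<lambda>_. 0"]) (simp add: barH_zero)
next
  case (Suc k)
  have gsupp: "supp_in n g" using Qsupp Suc.prems(1) .
  have gk: "g y = 0" if "y \<in> Sym n" "k < len n y" for y using Suc.prems(3) that by simp
  have "barA (g z) = - g z" if "z \<in> Sym n" "len n z = k" for z
    using barH_top[OF gsupp gk that(1)] that(2) Suc.prems(2) by simp
  then have "\<exists>q. in_vZv q \<and> q - barA q = g z" if "z \<in> Sym n" "len n z = k" for z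
    using anti_inv_decomp that by blast
  then obtain q where q: "in_vZv (q z)" "q z - barA (q z) = g z" if "z \<in> Sym n" "len n z = k" for z
    by metis
  define Z where "Z = {z \<in> S. len n z = k}"
  have Z: "finite Z" "z \<in> Z \<Longrightarrow> z \<in> Sym n" "z \<in> Z \<Longrightarrow> z \<in> S" "z \<in> Z \<Longrightarrow> len n z = k" for z
    using SE(1) finite_subset[OF _ finite_Sym[of n], of Z] by (auto simp: Z_def)
  define p0 where "p0 = (\<lambda>y. \<Sum>z\<in>Z. q z * E z y)"
  have Qp0: "Q p0" unfolding p0_def using Z SE(2) by (intro Qsum) auto
  have p0v: "in_vZv (p0 y)" for y unfolding p0_def
  proof (intro in_vZv_sum in_vZv_mult)
    fix z assume z: "z \<in> Z"
    show "in_vZv (q z)" using q(1) Z z by blast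
    show "in_Zv (E z y)" using SE(3,4)[of z] Z(3)[OF z] in_vZv_Zv by (cases "y = z") auto
  qed
  have p0top: "p0 y = (if y \<in> Z then q y else 0)" if "y \<in> Sym n" "k \<le> len n y" for y
  proof -
    have "q z * E z y = (if z = y then q y else 0)" if "z \<in> Z" for z
      using SE(3,5)[of z] Z(2-4)[of z] that \<open>y \<in> Sym n\<close> \<open>k \<le> len n y\<close> by (cases "y = z") auto
    then have "p0 y = (\<Sum>z\<in>Z. if z = y then q y else 0)" unfolding p0_def by (intro sum.cong) auto
    then show ?thesis using Z(1) by (simp add: sum.delta)
  qed
  have p0k: "p0 y = 0" if "y \<in> Sym n" "k < len n y" for y
    using p0top[of y] that Z(4)[of y] by auto
  have bp0: "barH n p0 z = barA (p0 z)" if "z \<in> Sym n" "k \<le> len n z" for z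
    using barH_top[OF Qsupp[OF Qp0] p0k that] by simp
  define g' where "g' = (\<lambda>y. g y - (p0 y - barH n p0 y))"
  have "Q g'" unfolding g'_def using Suc.prems(1) Qp0 by (intro Qdiff Qbar)
  moreover have "barH n g' = (\<lambda>y. - g' y)"
    unfolding g'_def barH_diff barH_barH[OF Qsupp[OF Qp0]] Suc.prems(2) by (intro ext) (simp add: algebra_simps)
  moreover have "g' y = 0" if y: "y \<in> Sym n" "k \<le> len n y" for y
  proof (cases "len n y = k")
    case True
    show ?thesis
    proof (cases "y \<in> S")
      case True
      then have "y \<in> Z" using \<open>len n y = k\<close> by (simp add: Z_def)
      then show ?thesis using q(2)[OF y(1) \<open>len n y = k\<close>] p0top[OF y] bp0[OF y] by (simp add: g'_def)
    next
      case False
      \<comment> \<open>Off \<open>S\<close> there is no \<open>E y\<close> to correct with, but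
        there \<open>top\<close> forces the leading coefficient to vanish.\<close>
      then have "g y = 0" using top[OF Suc.prems(1) _ y(1)] gk \<open>len n y = k\<close> by blast
      then show ?thesis using p0top[OF y] bp0[OF y] Z(3)[of y] False by (auto simp: g'_def)
    qed
  next
    case False
    then show ?thesis using y gk[of y] p0k[of y] bp0[OF y] by (simp add: g'_def)
  qed
  ultimately obtain p' where p': "Q p'" "\<And>y. in_vZv (p' y)" "\<And>y. y \<in> Sym n \<Longrightarrow> k \<le> len n y \<Longrightarrow> p' y = 0"
    "\<And>y. p' y - barH n p' y = g' y" using Suc.IH by blast
  show ?case
  proof (intro exI[of _ "\<lambda>y. p0 y + p' y"] conjI allI ballI impI)
    show "Q (\<lambda>y. p0 y + p' y)" using Qp0 p' by (intro Qadd)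
    show "in_vZv (p0 y + p' y)" for y using p0v p' by (intro in_vZv_add)
    show "p0 y + p' y = 0" if "y \<in> Sym n" "Suc k \<le> len n y" for y using p0k p' that by simp
    show "p0 y + p' y - barH n (\<lambda>y. p0 y + p' y) y = g y" for y
      using p'(4)[of y] by (simp add: barH_add g'_def algebra_simps)
  qed
qed

lemma kl_exists:
  assumes "w \<in> S"
  shows "\<exists>c. Q c \<and> barH n c = c \<and> (\<forall>y. in_vZv (c y - Tb w y)) \<and>
    (\<forall>y\<in>Sym n. len n w \<le> len n y \<longrightarrow> c y = Tb w y)"
proof -
  have w: "w \<in> Sym n" "Q (E w)" using SE assms by auto
  have Ek: "E w y = 0" if "y \<in> Sym n" "len n w < len n y" for y using SE(5)[OF assms] that by force
  \<comment> \<open>\<open>E w + p\<close> is bar invariant exactly when \<open>p\<close> minus its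
    bar image equals the bar image of \<open>E w\<close> minus \<open>E w\<close>; this difference
    is the right-hand side handed to \<open>solve\<close>.\<close>
  define g where "g = (\<lambda>y. barH n (E w) y - E w y)"
  have "Q g" unfolding g_def using w by (intro Qdiff Qbar)
  moreover have "barH n g = (\<lambda>y. - g y)" unfolding g_def using Qsupp[OF w(2)] by (simp add: barH_diff barH_barH)
  moreover have "g y = 0" if "y \<in> Sym n" "len n w \<le> len n y" for y
    using barH_top[OF Qsupp[OF w(2)] Ek that] SE(5)[OF assms, of y] SE(3)[OF assms] that
    by (cases "y = w") (auto simp: g_def)
  ultimately obtain p where p: "Q p" "\<And>y. in_vZv (p y)" "\<And>y. y \<in> Sym n \<Longrightarrow> len n w \<le> len n y \<Longrightarrow> p y = 0"
    "\<And>y. p y - barH n p y = g y" using solve[of g "len n w"] by blast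
  show ?thesis
  proof (intro exI[of _ "\<lambda>y. E w y + p y"] conjI allI ballI impI)
    show "Q (\<lambda>y. E w y + p y)" using w p by (intro Qadd)
    show "barH n (\<lambda>y. E w y + p y) = (\<lambda>y. E w y + p y)"
    proof
      fix y
      show "barH n (\<lambda>y. E w y + p y) y = E w y + p y"
        using p(4)[of y] by (simp add: barH_add g_def algebra_simps)
    qed
    show "in_vZv (E w y + p y - Tb w y)" for y
      using SE(4)[OF assms, of y] SE(3)[OF assms] p(2)[of y]
      by (cases "y = w") (auto simp: Tb_def intro: in_vZv_add)
    show "E w y + p y = Tb w y" if "y \<in> Sym n" "len n w \<le> len n y" for y
      using p(3)[OF that] SE(5)[OF assms, of y] SE(3)[OF assms] that by (cases "y = w") (auto simp: Tb_def)
  qed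
qed

end

interpretation kl_all: kl_setup n "supp_in n" "Sym n" Tb for n
proof
  show "supp_in n (\<lambda>_. 0)" by (simp add: supp_in_def)
  show "in_vZv (Tb z y)" if "y \<noteq> z" for z y using that by (simp add: Tb_def)
  show "Tb z y = 0" if "y \<noteq> z" for z y using that by (simp add: Tb_def)
  show "Tb z z = 1" for z by (simp add: Tb_def)
qed simp_all

lemma KL_unique:
  assumes "supp_in n c" "barH n c = c" "\<And>y. in_vZv (c y - Tb w y)"
    "supp_in n c'" "barH n c' = c'" "\<And>y. in_vZv (c' y - Tb w y)"
  shows "c = c'"
proof -
  have "in_vZv (c y - c' y)" for y using in_vZv_diff[OF assms(3)[of y] assms(6)[of y]] by simp
  then have "(\<lambda>y. c y - c' y) = (\<lambda>_. 0)"
    using assms by (intro bar_invariant_zero[of n]) (simp_all add: barH_diff)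
  then show ?thesis by (metis eq_iff_diff_eq_0 ext)
qed

lemma KL_C:
  assumes "w \<in> Sym n"
  shows "supp_in n (KL_C n w)" "barH n (KL_C n w) = KL_C n w" "in_vZv (KL_C n w y - Tb w y)"
    "y \<in> Sym n \<Longrightarrow> len n w \<le> len n y \<Longrightarrow> KL_C n w y = Tb w y"
proof -
  obtain c where c: "supp_in n c" "barH n c = c" "\<forall>y. in_vZv (c y - Tb w y)"
    "\<forall>y\<in>Sym n. len n w \<le> len n y \<longrightarrow> c y = Tb w y" using kl_all.kl_exists[OF assms] by blast
  have "KL_C n w = c" unfolding KL_C_def using c KL_unique by (intro the_equality) blast+
  with c show "supp_in n (KL_C n w)" "barH n (KL_C n w) = KL_C n w" "in_vZv (KL_C n w y - Tb w y)"
    "y \<in> Sym n \<Longrightarrow> len n w \<le> len n y \<Longrightarrow> KL_C n w y = Tb w y" by auto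
qed

lemma KL_C_eqI:
  assumes "w \<in> Sym n" "supp_in n c" "barH n c = c" "\<And>y. in_vZv (c y - Tb w y)"
  shows "c = KL_C n w"
  using KL_unique[OF assms(2-4) KL_C(1-3)[OF assms(1)]] by simp

section \<open>Right descents\<close>

text \<open>The eigenspace of right multiplication by \<open>T_t\<close> for \<open>-v^-1\<close>,
  the eigenvalue of \<open>T_t\<close> in the sign representation.\<close>

definition Fr :: "nat \<Rightarrow> perm \<Rightarrow> (perm \<Rightarrow> laur) \<Rightarrow> bool" where
  "Fr n t f \<longleftrightarrow> supp_in n f \<and> rmul n deltaA t f = (\<lambda>y. - vAinv * f y)"

lemma Fr_up:
  assumes "Fr n t f" "len n y < len n (y \<circ> t)" shows "f (y \<circ> t) = - vAinv * f y"
proof -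
  have "rmul n deltaA t f y = - vAinv * f y" using assms(1) by (simp add: Fr_def)
  with assms(2) show ?thesis by (simp add: rmul_def)
qed

lemma Fr_lin:
  "Fr n t (\<lambda>_. 0)" "Fr n t f \<Longrightarrow> Fr n t g \<Longrightarrow> Fr n t (\<lambda>y. f y + g y)"
  "Fr n t f \<Longrightarrow> Fr n t (\<lambda>y. c * f y)"
  by (auto simp: Fr_def supp_in_def lin_zero[OF lin_rmul] lin_add[OF lin_rmul] lin_scale[OF lin_rmul] algebra_simps)

lemma Fr_sum: "finite A \<Longrightarrow> (\<And>x. x \<in> A \<Longrightarrow> Fr n t (f x)) \<Longrightarrow> Fr n t (\<lambda>y. \<Sum>x\<in>A. c x * f x y)"
  by (induction A rule: finite_induct) (simp_all add: Fr_lin)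

lemma Fr_hmult: "t \<in> sgens n \<Longrightarrow> Fr n t f \<Longrightarrow> Fr n t (hmult n deltaA g f)"
  using lin_scale[OF lin_hmult_right, of n deltaA g "- vAinv" f]
  by (simp add: Fr_def hmult_rmul[symmetric])

lemma Fr_mulT: "t \<in> sgens n \<Longrightarrow> x \<in> Sym n \<Longrightarrow> Fr n t f \<Longrightarrow> Fr n t (mulT n deltaA x f)"
  using Fr_hmult[of t n f "Tb x"] by (simp add: hmult_Tb_left)

lemma delta_vAinv: "deltaA - vA = - vAinv" "deltaA + vAinv = vA"
  by (simp_all add: deltaA_def)

lemma Fr_barH: assumes "t \<in> sgens n" "Fr n t f" shows "Fr n t (barH n f)"
proof -
  have "rmuli n t (barH n f) = (\<lambda>y. - vA * barH n f y)"
    using barH_rmul[OF assms(1), of f] assms(2) barH_scale[of n "- vAinv" f] by (simp add: Fr_def)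
  then have "rmul n deltaA t (barH n f) = (\<lambda>y. (deltaA - vA) * barH n f y)"
    unfolding rmuli_def by (simp add: fun_eq_iff algebra_simps)
  then show ?thesis by (simp add: Fr_def delta_vAinv)
qed

text \<open>If \<open>z \<circ> t\<close> were longer, its coefficient would be \<open>-v^-1\<close>
  times that of \<open>z\<close>, while it vanishes by maximality.\<close>

lemma Fr_top:
  assumes "t \<in> sgens n" "Fr n t f" "\<And>y. y \<in> Sym n \<Longrightarrow> len n z < len n y \<Longrightarrow> f y = 0" "z \<in> Sym n" "f z \<noteq> 0"
  shows "len n (z \<circ> t) < len n z"
proof (rule ccontr)
  assume "\<not> len n (z \<circ> t) < len n z"
  then have up: "len n z < len n (z \<circ> t)" using len_right_cases[OF assms(4,1)] by auto
  from Fr_up[OF assms(2) this] assms(3)[OF _ up] assms(1,4) have "vAinv * f z = 0" by simp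
  then have "vA * (vAinv * f z) = 0" by simp
  then have "f z = 0" by (simp add: mult.assoc[symmetric])
  with assms(5) show False by simp
qed

text \<open>The Kazhdan-Lusztig construction is rerun inside the eigenspace, with
  \<open>T_z - v T_(zt)\<close> as unitriangular family. Uniqueness in the whole algebra identifies
  the outcome with \<open>KL_C n w\<close>, which therefore is an eigenvector.\<close>

lemma Fr_KL_C:
  assumes t: "t \<in> sgens n" and w: "w \<in> Sym n" "len n (w \<circ> t) < len n w"
  shows "Fr n t (KL_C n w)"
proof -
  define E :: "perm \<Rightarrow> perm \<Rightarrow> laur" where "E = (\<lambda>z y. Tb z y - vA * Tb (z \<circ> t) y)"
  interpret kl_setup n "Fr n t" "{z \<in> Sym n. len n (z \<circ> t) < len n z}" E
  proof
    show "supp_in n f" if "Fr n t f" for f using that by (simp add: Fr_def)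
  next
    fix z y assume z: "z \<in> {z \<in> Sym n. len n (z \<circ> t) < len n z}"
    then have zs: "z \<in> Sym n" "z \<circ> t \<in> Sym n" "z \<circ> t \<noteq> z" using t by auto
    show "z \<in> Sym n" using z by simp
    show "E z z = 1" using zs by (simp add: E_def Tb_def)
    have "rmul n deltaA t (E z) = (\<lambda>y. Tb (z \<circ> t) y + deltaA * Tb z y - vA * Tb z y)"
      unfolding E_def using zs z t by (simp add: lin_diff[OF lin_rmul] lin_scale[OF lin_rmul] rmul_Tb)
    also have "\<dots> = (\<lambda>y. - vAinv * E z y)"
    proof
      fix y
      have e1: "- vAinv * E z y = (vAinv * vA) * Tb (z \<circ> t) y - vAinv * Tb z y"
        unfolding E_def by (simp add: right_diff_distrib mult.assoc[symmetric])
      have e2: "deltaA * Tb z y - vA * Tb z y = - vAinv * Tb z y"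
        unfolding left_diff_distrib[symmetric] delta_vAinv ..
      show "Tb (z \<circ> t) y + deltaA * Tb z y - vA * Tb z y = - vAinv * E z y"
        unfolding e1 using e2 by (simp add: add_diff_eq[symmetric] del: add_diff_eq)
    qed
    finally show "Fr n t (E z)" using zs by (simp add: Fr_def E_def)
    assume y: "y \<noteq> z"
    show "in_vZv (E z y)" using y by (auto simp: E_def Tb_def intro: in_vZv_diff[of 0 vA, simplified])
    assume "len n z \<le> len n y"
    then have "y \<noteq> z \<circ> t" using z by auto
    with y show "E z y = 0" by (simp add: E_def Tb_def)
  qed (use Fr_top[OF t] Fr_barH[OF t] in \<open>auto simp: Fr_lin\<close>)
  show ?thesis using w KL_C_eqI[OF w(1)] kl_exists[of w] Qsupp by blast
qed

section \<open>Coordinates in unitriangular bases\<close>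

definition tri :: "nat \<Rightarrow> (perm \<Rightarrow> perm \<Rightarrow> laur) \<Rightarrow> bool" where
  "tri n B \<longleftrightarrow> (\<forall>z\<in>Sym n. supp_in n (B z) \<and> (\<forall>y\<in>Sym n. len n z \<le> len n y \<longrightarrow> B z y = Tb z y))"

lemma tri_KL_C: "tri n (KL_C n)"
  using KL_C by (simp add: tri_def)

lemma tri_sum_top:
  assumes "tri n B" "\<And>z. z \<in> Sym n \<Longrightarrow> len n y < len n z \<Longrightarrow> f z = 0" "y \<in> Sym n"
  shows "(\<Sum>z\<in>Sym n. f z * B z y) = f y"
proof -
  have "f z * B z y = (if z = y then f y else 0)" if "z \<in> Sym n" for z
    using assms that by (cases "len n y < len n z") (auto simp: tri_def Tb_def)
  then have "(\<Sum>z\<in>Sym n. f z * B z y) = (\<Sum>z\<in>Sym n. if z = y then f y else 0)" by (intro sum.cong) auto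
  then show ?thesis using assms(3) by (simp add: sum.delta)
qed

lemma nonzero_top:
  fixes f :: "perm \<Rightarrow> 'a::zero"
  assumes "supp_in n f" "f \<noteq> (\<lambda>_. 0)"
  obtains z where "z \<in> Sym n" "f z \<noteq> 0" "\<And>y. y \<in> Sym n \<Longrightarrow> len n z < len n y \<Longrightarrow> f y = 0"
proof -
  obtain y0 where "f y0 \<noteq> 0" using assms(2) by auto
  then have y0: "y0 \<in> Sym n \<and> f y0 \<noteq> 0" using assms(1) by (auto simp: supp_in_def)
  have "\<exists>z. (z \<in> Sym n \<and> f z \<noteq> 0) \<and> (\<forall>y. y \<in> Sym n \<and> f y \<noteq> 0 \<longrightarrow> len n y \<le> len n z)"
    using y0 by (intro ex_has_greatest_nat[where b = "Max (len n ` Sym n) + 1"]) (auto simp: less_Suc_eq_le)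
  then show ?thesis using that by (metis not_le)
qed

lemma tri_unique:
  assumes "tri n B" "supp_in n f" "\<And>y. y \<in> Sym n \<Longrightarrow> (\<Sum>z\<in>Sym n. f z * B z y) = 0"
  shows "f = (\<lambda>_. 0)"
proof (rule ccontr)
  assume "f \<noteq> (\<lambda>_. 0)"
  then obtain z where z: "z \<in> Sym n" "f z \<noteq> 0" "\<And>y. y \<in> Sym n \<Longrightarrow> len n z < len n y \<Longrightarrow> f y = 0"
    using nonzero_top assms(2) by blast
  from tri_sum_top[OF assms(1) z(3,1)] assms(3)[OF z(1)] z(2) show False by simp
qed

lemma tri_exists:
  assumes "tri n B" "supp_in n h"
  shows "\<exists>f. supp_in n f \<and> h = (\<lambda>y. \<Sum>z\<in>Sym n. f z * B z y)"
proof -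
  have "supp_in n h \<Longrightarrow> (\<And>y. y \<in> Sym n \<Longrightarrow> k \<le> len n y \<Longrightarrow> h y = 0) \<Longrightarrow>
     \<exists>f. supp_in n f \<and> h = (\<lambda>y. \<Sum>z\<in>Sym n. f z * B z y)" for k h
  proof (induction k arbitrary: h)
    case 0
    then have "h y = 0" for y by (cases "y \<in> Sym n") (auto simp: supp_in_def)
    then show ?case by (intro exI[of _ "\<lambda>_. 0"]) (auto simp: supp_in_def)
  next
    case (Suc k)
    define f0 where "f0 = (\<lambda>z. if z \<in> Sym n \<and> len n z = k then h z else 0)"
    have f0: "supp_in n f0" by (simp add: f0_def supp_in_def)
    define h' where "h' = (\<lambda>y. h y - (\<Sum>z\<in>Sym n. f0 z * B z y))"
    have "supp_in n h'" unfolding h'_def using Suc.prems(1) assms(1) by (simp add: tri_def)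
    moreover have "h' y = 0" if "y \<in> Sym n" "k \<le> len n y" for y
    proof -
      have "(\<Sum>z\<in>Sym n. f0 z * B z y) = f0 y" using that by (intro tri_sum_top[OF assms(1)]) (auto simp: f0_def)
      then show ?thesis using that Suc.prems(2)[of y] by (auto simp: h'_def f0_def)
    qed
    ultimately obtain f' where f': "supp_in n f'" "h' = (\<lambda>y. \<Sum>z\<in>Sym n. f' z * B z y)" using Suc.IH by blast
    have "h y = (\<Sum>z\<in>Sym n. (f0 z + f' z) * B z y)" for y
      using fun_cong[OF f'(2), of y] by (simp add: h'_def algebra_simps sum.distrib)
    then show ?case using f0 f'(1) by (intro exI[of _ "\<lambda>y. f0 y + f' y"]) auto
  qed
  from this[OF assms(2), of "Suc (Max (len n ` Sym n))"] show ?thesis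
    by (metis Max_ge finite_Sym finite_imageI imageI not_less_eq_eq)
qed

lemma coordsI:
  assumes "tri n B" "supp_in n f" "h = (\<lambda>y. \<Sum>z\<in>Sym n. f z * B z y)"
  shows "coords n B h = f"
  unfolding coords_def
proof (rule the_equality)
  fix g assume g: "supp_in n g \<and> h = (\<lambda>y. \<Sum>z\<in>Sym n. g z * B z y)"
  have "(\<Sum>z\<in>Sym n. (g z - f z) * B z y) = 0" for y
    using fun_cong[OF conjunct2[OF g], of y] assms(3) by (simp add: algebra_simps sum_subtractf)
  with g assms(2) have "(\<lambda>z. g z - f z) = (\<lambda>_. 0)" by (intro tri_unique[OF assms(1)]) auto
  then show "g = f" by (metis eq_iff_diff_eq_0 ext)
qed (use assms in auto)

lemma coords:
  assumes "tri n B" "supp_in n h"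
  shows "supp_in n (coords n B h)" "h = (\<lambda>y. \<Sum>z\<in>Sym n. coords n B h z * B z y)"
  using tri_exists[OF assms] coordsI[OF assms(1)] by metis+

abbreviation "cC n \<equiv> coords n (KL_C n)"

lemma cC_sum: "supp_in n h \<Longrightarrow> (\<Sum>z\<in>Sym n. cC n h z * KL_C n z y) = h y"
  using coords(2)[OF tri_KL_C, of n h] by metis

lemma coords_add:
  assumes "tri n B" "supp_in n f" "supp_in n g"
  shows "coords n B (\<lambda>y. f y + c * g y) = (\<lambda>z. coords n B f z + c * coords n B g z)"
proof (rule coordsI[OF assms(1)])
  show "(\<lambda>y. f y + c * g y) = (\<lambda>y. \<Sum>z\<in>Sym n. (coords n B f z + c * coords n B g z) * B z y)"
  proof
    fix y
    have "f y + c * g y = (\<Sum>z\<in>Sym n. coords n B f z * B z y) + c * (\<Sum>z\<in>Sym n. coords n B g z * B z y)"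
      using coords(2)[OF assms(1,2)] coords(2)[OF assms(1,3)] by metis
    then show "f y + c * g y = (\<Sum>z\<in>Sym n. (coords n B f z + c * coords n B g z) * B z y)"
      by (simp add: algebra_simps sum.distrib sum_distrib_left)
  qed
qed (use coords(1)[OF assms(1)] assms in simp)

lemma coords_basis: "tri n B \<Longrightarrow> z \<in> Sym n \<Longrightarrow> coords n B (B z) = Tb z"
  by (rule coordsI) (auto simp: sum_mult_Tb mult.commute[of "Tb z _"])

lemma cC_bar_invariant:
  assumes "supp_in n h" "barH n h = h" shows "barA (cC n h z) = cC n h z"
proof -
  have "barH n h = (\<lambda>y. \<Sum>z\<in>Sym n. barA (cC n h z) * KL_C n z y)"
    by (subst coords(2)[OF tri_KL_C assms(1)]) (simp add: barH_sum KL_C(2))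
  moreover have "supp_in n (\<lambda>z. barA (cC n h z))"
    using coords(1)[OF tri_KL_C assms(1)] by (simp add: supp_in_def)
  ultimately have "cC n h = (\<lambda>z. barA (cC n h z))"
    using assms(2) by (intro coordsI[OF tri_KL_C]) auto
  then show ?thesis by metis
qed

text \<open>Removing from \<open>f\<close> its components along the \<open>C_z\<close> with right
  descent \<open>t\<close> leaves an eigenvector \<open>f'\<close>. If it were nonzero,
  \<open>Fr_top\<close> would give its leading term the descent \<open>t\<close>, but such terms
  have been removed.\<close>

lemma Fr_cC_zero:
  assumes t: "t \<in> sgens n" and f: "Fr n t f" and y: "y \<in> Sym n" "len n y < len n (y \<circ> t)"
  shows "cC n f y = 0"
proof -
  define S where "S = {z \<in> Sym n. len n (z \<circ> t) < len n z}"
  have fs: "supp_in n f" using f by (simp add: Fr_def)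
  define c where "c = (\<lambda>z. if z \<in> S then 0 else cC n f z)"
  have "supp_in n c" using coords(1)[OF tri_KL_C fs] by (simp add: c_def supp_in_def)
  define f' where "f' = (\<lambda>y. f y + (-1) * (\<Sum>z\<in>S. cC n f z * KL_C n z y))"
  have "Fr n t f'" unfolding f'_def
    using f by (intro Fr_lin Fr_sum Fr_KL_C t) (auto simp: S_def)
  have f'e: "f' y = (\<Sum>z\<in>Sym n. c z * KL_C n z y)" for y
  proof -
    have "(\<Sum>z\<in>Sym n. c z * KL_C n z y) = (\<Sum>z\<in>Sym n - S. cC n f z * KL_C n z y)"
      by (rule sum.mono_neutral_cong_right) (auto simp: c_def)
    also have "\<dots> = (\<Sum>z\<in>Sym n. cC n f z * KL_C n z y) - (\<Sum>z\<in>S. cC n f z * KL_C n z y)"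
      by (rule sum_diff) (auto simp: S_def)
    finally show ?thesis using cC_sum[OF fs] by (simp add: f'_def)
  qed
  have "c = (\<lambda>_. 0)"
  proof (rule ccontr)
    assume "c \<noteq> (\<lambda>_. 0)"
    then obtain z where z: "z \<in> Sym n" "c z \<noteq> 0" "\<And>y. y \<in> Sym n \<Longrightarrow> len n z < len n y \<Longrightarrow> c y = 0"
      using nonzero_top \<open>supp_in n c\<close> by blast
    have top: "f' y = c y" if "y \<in> Sym n" "len n z \<le> len n y" for y
      unfolding f'e using z(3) that by (intro tri_sum_top[OF tri_KL_C]) auto
    have "len n (z \<circ> t) < len n z"
      using Fr_top[OF t \<open>Fr n t f'\<close> _ z(1)] top z by auto
    then show False using z by (simp add: c_def S_def)
  qed
  then have "c y = 0" by simp
  then show ?thesis using y by (auto simp: c_def S_def split: if_splits)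
qed

subsection \<open>The dual basis and the left preorder\<close>

text \<open>The semilinear ring involution that sends \<open>T_w\<close> to its multiple by the sign
  of \<open>w\<close> and conjugates coefficients. It exchanges the two Kazhdan-Lusztig bases up to
  sign.\<close>

definition jH :: "nat \<Rightarrow> (perm \<Rightarrow> laur) \<Rightarrow> perm \<Rightarrow> laur" where
  "jH n h = (\<lambda>y. of_int (sgnp n y) * barA (h y))"

lemma sgnp_sgnp [simp]: "of_int (sgnp n y) * (of_int (sgnp n y) * a) = (a :: 'a :: comm_ring_1)"
    "of_int (sgnp n y) * of_int (sgnp n y) = (1 :: 'a)"
    "barA (of_int (sgnp n y)) = of_int (sgnp n y)"
  by (cases "even (len n y)"; simp add: sgnp_def)+

lemma sgnp_left: "s \<in> sgens n \<Longrightarrow> y \<in> Sym n \<Longrightarrow> sgnp n (s \<circ> y) = - sgnp n y"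
  using len_left_cases[of y n s] by (auto simp: sgnp_def) (metis minus_minus mult_minus1 power_Suc)

lemma supp_jH [simp]: "supp_in n h \<Longrightarrow> supp_in n (jH n h)"
  by (simp add: supp_in_def jH_def)

lemma jH_mulTs:
  assumes "s \<in> sgens n" "supp_in n h"
  shows "jH n (mulTs n deltaA s h) = (\<lambda>y. - mulTs n deltaA s (jH n h) y)"
proof (rule supp_in_eqI[of n])
  fix y assume y: "y \<in> Sym n"
  show "jH n (mulTs n deltaA s h) y = - mulTs n deltaA s (jH n h) y"
    using sgnp_left[OF assms(1) y] by (simp add: jH_def mulTs_def algebra_simps)
qed (use assms in simp_all)

lemma jH_sum: "finite A \<Longrightarrow> jH n (\<lambda>y. \<Sum>x\<in>A. c x * f x y) = (\<lambda>y. \<Sum>x\<in>A. barA (c x) * jH n (f x) y)"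
  by (simp add: jH_def sum_distrib_left mult.left_commute)

lemma jH_barT: "w \<in> Sym n \<Longrightarrow> jH n (barT n w) = (\<lambda>y. of_int (sgnp n w) * barT n w y)"
proof -
  have "red n ss \<Longrightarrow> jH n (barT n (wprod ss)) = (\<lambda>y. of_int (sgnp n (wprod ss)) * barT n (wprod ss) y)" for ss
  proof (induction ss)
    case Nil
    then show ?case by (auto simp: jH_def Tb_def sgnp_def)
  next
    case (Cons s ss)
    let ?w = "wprod ss"
    have s: "s \<in> sgens n" "?w \<in> Sym n" using Cons.prems by (auto simp: red_def)
    have r: "red n ss" "len n ?w < len n (s \<circ> ?w)" using red_ConsD[OF Cons.prems(1)] .
    have "jH n (mulTi n s (barT n ?w)) y = - mulTi n s (jH n (barT n ?w)) y" for y
      using fun_cong[OF jH_mulTs[OF s(1), of "barT n ?w"], of y] s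
      by (simp add: mulTi_def jH_def[of n "\<lambda>y. mulTs n deltaA s _ y - _ y"] algebra_simps) (simp add: jH_def algebra_simps)
    then show ?case using Cons.IH[OF r(1)] barT_up[OF s r(2)] sgnp_left[OF s]
      by (simp add: lin_scale[OF lin_mulTi])
  qed
  moreover assume "w \<in> Sym n"
  ultimately show ?thesis using red_rword rword by metis
qed

lemma barH_jH: assumes "supp_in n h" shows "barH n (jH n h) = jH n (barH n h)"
proof -
  have "jH n (barH n h) = (\<lambda>y. \<Sum>w\<in>Sym n. h w * jH n (barT n w) y)"
    unfolding barH_def by (simp add: jH_sum)
  also have "\<dots> = (\<lambda>y. \<Sum>w\<in>Sym n. barA (jH n h w) * barT n w y)"
    by (intro ext sum.cong) (simp_all add: jH_barT, simp add: jH_def)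
  finally show ?thesis by (simp add: barH_def)
qed

text \<open>\<open>jH\<close> commutes with bar and turns positive exponents into negative ones, so
  the right-hand side has the properties characterising \<open>KL_C' n w\<close>.\<close>

lemma KL_C'_eq:
  assumes w: "w \<in> Sym n" shows "KL_C' n w = (\<lambda>y. of_int (sgnp n w) * jH n (KL_C n w) y)" (is "_ = ?c")
  unfolding KL_C'_def
proof (rule the_equality)
  have e: "?c y - Tb w y = of_int (sgnp n w * sgnp n y) * barA (KL_C n w y - Tb w y)" for y
    by (cases "y = w") (auto simp: jH_def Tb_def algebra_simps)
  have v: "in_viZvi (?c y - Tb w y)" for y
  proof -
    have "in_vZv (of_int (sgnp n w * sgnp n y) * (KL_C n w y - Tb w y))"
      using KL_C(3)[OF w, of y] by (auto simp: sgnp_def in_vZv_iff power_mult_distrib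
          lookup_minus minus_one_power_iff)
    then show ?thesis unfolding e in_viZvi_barA by (auto simp: simp del: of_int_mult) (simp add: algebra_simps)
  qed
  have bar: "barH n ?c = ?c"
    using KL_C(1,2)[OF w] by (simp add: barH_scale barH_jH)
  show "supp_in n ?c \<and> barH n ?c = ?c \<and> (\<forall>y. in_viZvi (?c y - Tb w y))"
    using KL_C(1)[OF w] v bar by simp
  fix c assume c: "supp_in n c \<and> barH n c = c \<and> (\<forall>y. in_viZvi (c y - Tb w y))"
  have "in_viZvi (c y - ?c y)" for y
    using in_vZv_diff[of "barA (c y - Tb w y)" "barA (?c y - Tb w y)"] c v[of y]
    unfolding in_viZvi_barA by (simp add: algebra_simps)
  then have "(\<lambda>y. c y - ?c y) = (\<lambda>_. 0)"
    using c bar KL_C(1)[OF w] by (intro bar_invariant_zero[of n]) (simp_all add: barH_diff)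
  then show "c = ?c" by (metis eq_iff_diff_eq_0 ext)
qed

lemma tri_KL_C': "tri n (KL_C' n)"
  unfolding tri_def
proof (intro ballI conjI impI)
  fix z y assume z: "z \<in> Sym n" "y \<in> Sym n" "len n z \<le> len n y"
  then show "KL_C' n z y = Tb z y"
    using KL_C(4)[OF z] by (auto simp: KL_C'_eq jH_def Tb_def)
qed (simp add: KL_C'_eq KL_C(1))

lemma KL_C'_sgen:
  assumes s: "s \<in> sgens n" shows "KL_C' n s = (\<lambda>y. Tb s y + vAinv * Tb id y)"
proof -
  have ne: "s \<noteq> id" using len_sgen[OF s] by auto
  have "(\<lambda>y. Tb s y - vA * Tb id y) = KL_C n s"
  proof (rule KL_C_eqI)
    have "barT n s = (\<lambda>y. Tb s y - deltaA * Tb id y)"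
      using barT_up[OF s, of id] s by (simp add: mulTi_def mulTs_Tb)
    then show "barH n (\<lambda>y. Tb s y - vA * Tb id y) = (\<lambda>y. Tb s y - vA * Tb id y)"
      using s by (simp add: barH_diff barH_scale barH_Tb deltaA_def algebra_simps)
    show "in_vZv (Tb s y - vA * Tb id y - Tb s y)" for y
      using in_vZv_diff[OF in_vZv_zero in_vZv_vA] by (simp add: Tb_def)
  qed (use s in simp_all)
  then have C: "KL_C n s y = Tb s y - vA * Tb id y" for y by metis
  show ?thesis
  proof
    fix y
    consider "y = s" | "y = id" | "y \<noteq> s" "y \<noteq> id" by blast
    then show "KL_C' n s y = Tb s y + vAinv * Tb id y"
      using s ne by cases (simp_all add: KL_C'_eq jH_def C Tb_def sgnp_def)
  qed
qed

text \<open>Since \<open>C_s = T_s - v\<close>, the element on the right is the product of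
  \<open>C_s\<close> and \<open>C_y\<close>; \<open>jH\<close> carries it, up to sign, to the
  product of \<open>C'_s\<close> and \<open>C'_y\<close>. From here on the left preorder is read in
  the basis \<open>C\<close>.\<close>

lemma leftedge_iff:
  "leftedge n x y \<longleftrightarrow> x \<in> Sym n \<and> y \<in> Sym n \<and>
     (\<exists>s\<in>sgens n. cC n (\<lambda>u. mulTs n deltaA s (KL_C n y) u - vA * KL_C n y u) x \<noteq> 0)"
proof -
  have "hcoef n s y x \<noteq> 0 \<longleftrightarrow> cC n (\<lambda>u. mulTs n deltaA s (KL_C n y) u - vA * KL_C n y u) x \<noteq> 0"
    if xy: "x \<in> Sym n" "y \<in> Sym n" and s: "s \<in> sgens n" for s
  proof -
    define h where "h = (\<lambda>u. mulTs n deltaA s (KL_C n y) u - vA * KL_C n y u)"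
    have hs: "supp_in n h" unfolding h_def using s KL_C(1)[OF xy(2)] by simp
    define f where "f = (\<lambda>z. - of_int (sgnp n y) * (of_int (sgnp n z) * barA (cC n h z)))"
    have jh: "jH n h u = (\<Sum>z\<in>Sym n. barA (cC n h z) * jH n (KL_C n z) u)" for u
      by (subst coords(2)[OF tri_KL_C hs]) (simp add: jH_sum)
    have jh': "jH n h u = - mulTs n deltaA s (jH n (KL_C n y)) u - vAinv * jH n (KL_C n y) u" for u
      using fun_cong[OF jH_mulTs[OF s KL_C(1)[OF xy(2)]], of u]
      by (simp add: h_def jH_def algebra_simps)
    have "hmult n deltaA (KL_C' n s) (KL_C' n y) u = (\<Sum>z\<in>Sym n. f z * KL_C' n z u)" for u
    proof -
      have "hmult n deltaA (KL_C' n s) (KL_C' n y) u = mulTs n deltaA s (KL_C' n y) u + vAinv * KL_C' n y u"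
        using s xy tri_KL_C'[of n] unfolding KL_C'_sgen[OF s]
        by (simp add: lin_add[OF lin_hmult_left] lin_scale[OF lin_hmult_left] hmult_Tb_left mulT_sgen tri_def)
      also have "\<dots> = - of_int (sgnp n y) * jH n h u"
        unfolding KL_C'_eq[OF xy(2)] jh' by (simp add: lin_scale[OF lin_mulTs] algebra_simps)
      also have "\<dots> = (\<Sum>z\<in>Sym n. f z * KL_C' n z u)"
        unfolding jh sum_distrib_left by (intro sum.cong) (auto simp: f_def KL_C'_eq algebra_simps)
      finally show ?thesis .
    qed
    moreover have "supp_in n f" using coords(1)[OF tri_KL_C hs] by (simp add: f_def supp_in_def)
    ultimately have "hcoef n s y x = f x" unfolding hcoef_def by (subst coordsI[OF tri_KL_C']) auto
    moreover have "f x = 0 \<longleftrightarrow> cC n h x = 0"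
    proof
      assume "f x = 0"
      then have "of_int (sgnp n x) * (of_int (sgnp n y) * f x) = 0" by simp
      then have "barA (cC n h x) = 0" by (simp add: f_def algebra_simps)
      then show "cC n h x = 0" by (metis barA_barA barA_zero)
    qed (simp add: f_def)
    ultimately show ?thesis by (simp add: h_def)
  qed
  then show ?thesis by (auto simp: leftedge_def)
qed

section \<open>Young subgroups\<close>

text \<open>Only length-increasing steps have to be checked: the assumption on \<open>c\<close> is
  the quadratic relation of \<open>T_s\<close>, and it supplies the decreasing steps.\<close>

lemma mulTs_eigenI:
  assumes "s \<in> sgens n" "supp_in n f" "c * c = 1 + \<delta> * c"
    "\<And>y. y \<in> Sym n \<Longrightarrow> len n y < len n (s \<circ> y) \<Longrightarrow> f (s \<circ> y) = c * f y"
  shows "mulTs n \<delta> s f = (\<lambda>y. c * f y)"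
proof (rule supp_in_eqI[of n])
  fix y assume y: "y \<in> Sym n"
  show "mulTs n \<delta> s f y = c * f y"
  proof (cases "len n y < len n (s \<circ> y)")
    case True
    then show ?thesis using assms(4)[OF y] by (simp add: mulTs_def)
  next
    case False
    then have l: "len n (s \<circ> y) < len n y" using len_left_cases[OF y assms(1)] by auto
    then have fy: "f y = c * f (s \<circ> y)" using assms(4)[of "s \<circ> y"] assms(1) y by simp
    have "c * f y = (c * c) * f (s \<circ> y)" by (simp add: fy mult.assoc)
    also have "\<dots> = f (s \<circ> y) + \<delta> * f y" unfolding assms(3) fy by (simp add: algebra_simps)
    finally show ?thesis using l by (simp add: mulTs_def)
  qed
qed (use assms in simp_all)

lemma rmul_eigenI:
  assumes "s \<in> sgens n" "supp_in n f" "c * c = 1 + \<delta> * c"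
    "\<And>y. y \<in> Sym n \<Longrightarrow> len n y < len n (y \<circ> s) \<Longrightarrow> f (y \<circ> s) = c * f y"
  shows "rmul n \<delta> s f = (\<lambda>y. c * f y)"
proof (rule supp_in_eqI[of n])
  fix y assume y: "y \<in> Sym n"
  show "rmul n \<delta> s f y = c * f y"
  proof (cases "len n y < len n (y \<circ> s)")
    case True
    then show ?thesis using assms(4)[OF y] by (simp add: rmul_def)
  next
    case False
    then have l: "len n (y \<circ> s) < len n y" using len_right_cases[OF y assms(1)] by auto
    then have fy: "f y = c * f (y \<circ> s)" using assms(4)[of "y \<circ> s"] assms(1) y by simp
    have "c * f y = (c * c) * f (y \<circ> s)" by (simp add: fy mult.assoc)
    also have "\<dots> = f (y \<circ> s) + \<delta> * f y" unfolding assms(3) fy by (simp add: algebra_simps)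
    finally show ?thesis using l by (simp add: rmul_def)
  qed
qed (use assms in simp_all)

text \<open>Encodes the Young subgroup of all permutations that preserve the fibres of b.\<close>

locale blocks =
  fixes n :: nat and b :: "nat \<Rightarrow> nat"
  assumes b_mono: "i \<le> j \<Longrightarrow> j < n \<Longrightarrow> b i \<le> b j"
begin

definition J :: "perm set" where "J = {st i | i. Suc i < n \<and> b i = b (Suc i)}"

text \<open>The Young subgroup described by its fibres; \<open>J\<close> consists of its simple
  generators and \<open>D\<close> of its minimal-length left coset representatives.
  \<open>young_Y\<close>, \<open>young_gens_J\<close> and \<open>dist_reps_D\<close> match these
  with the notions given by partial sums.\<close>

definition Y :: "perm set" where "Y = {w \<in> Sym n. \<forall>p<n. b (w p) = b p}"

definition D :: "perm set" where "D = {x \<in> Sym n. \<forall>t\<in>J. len n x < len n (x \<circ> t)}"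

lemma J_sgens: "t \<in> J \<Longrightarrow> t \<in> sgens n"
  by (auto simp: J_def)

lemma Y_Sym: "u \<in> Y \<Longrightarrow> u \<in> Sym n" and D_Sym: "x \<in> D \<Longrightarrow> x \<in> Sym n"
  by (auto simp: Y_def D_def)

lemma finite_Y [simp]: "finite Y" and finite_D [simp]: "finite D"
  by (auto simp: Y_def D_def)

lemma Y_id [simp]: "id \<in> Y"
  by (simp add: Y_def id_apply)

lemma Y_comp: "u \<in> Y \<Longrightarrow> w \<in> Y \<Longrightarrow> u \<circ> w \<in> Y"
  by (auto simp: Y_def o_apply Sym_less)

lemma Y_inv: assumes "u \<in> Y" shows "inv u \<in> Y"
proof -
  have "b (inv u p) = b p" if "p < n" for p
  proof -
    have "inv u p < n" using assms that by (simp add: Y_Sym Sym_less)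
    then have "b (u (inv u p)) = b (inv u p)" using assms by (simp add: Y_def)
    then show ?thesis by (simp only: Sym_inv_apply(1)[OF Y_Sym[OF assms]])
  qed
  then show ?thesis using assms by (simp add: Y_def)
qed

lemma J_Y: "t \<in> J \<Longrightarrow> t \<in> Y"
  by (auto simp: J_def Y_def transpose_def)

text \<open>As \<open>u\<close> preserves \<open>b\<close> and \<open>b\<close> is monotone, a
  descent at \<open>i\<close> gives \<open>b (Suc i) \<le> b i\<close>, so both positions lie in one
  fibre.\<close>

lemma Y_descent:
  assumes "u \<in> Y" "u \<noteq> id"
  obtains i where "Suc i < n" "b i = b (Suc i)" "u (Suc i) < u i" "st i \<in> J"
    "Suc (len n (u \<circ> st i)) = len n u"
proof -
  obtain i where i: "Suc i < n" "u (Suc i) < u i" using Sym_descent Y_Sym assms by blast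
  have "u i < n" using i(1) Sym_less[OF Y_Sym[OF assms(1)], of i] by simp
  then have "b (u (Suc i)) \<le> b (u i)" using i b_mono[of "u (Suc i)" "u i"] by simp
  moreover have "b (u i) = b i" "b (u (Suc i)) = b (Suc i)" using assms(1) i(1) by (auto simp: Y_def)
  moreover have "b i \<le> b (Suc i)" using b_mono[of i "Suc i"] i(1) by simp
  ultimately have "b i = b (Suc i)" by simp
  with i that show ?thesis using len_comp_st(2)[OF Y_Sym[OF assms(1)] i] by (auto simp: J_def)
qed

lemma Y_induct [consumes 1, case_names id comp]:
  assumes "u \<in> Y" "P id"
    "\<And>u t. u \<in> Y \<Longrightarrow> t \<in> J \<Longrightarrow> len n (u \<circ> t) = Suc (len n u) \<Longrightarrow> P u \<Longrightarrow> P (u \<circ> t)"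
  shows "P u"
  using assms(1)
proof (induction "len n u" arbitrary: u rule: less_induct)
  case less
  show ?case
  proof (cases "u = id")
    case False
    then obtain i where i: "st i \<in> J" "Suc (len n (u \<circ> st i)) = len n u" using Y_descent less.prems by metis
    have u': "u \<circ> st i \<in> Y" using Y_comp[OF less.prems J_Y[OF i(1)]] .
    have "P (u \<circ> st i)" using less.hyps[OF _ u'] i(2) by simp
    moreover have "u \<circ> st i \<circ> st i = u" by (simp add: comp_assoc)
    ultimately show ?thesis using assms(3)[OF u' i(1)] i(2) by metis
  qed (use assms in simp)
qed

lemma D_less:
  assumes "x \<in> D" "p < q" "q < n" "b p = b q" shows "x p < x q"
  using assms(2-4)
proof (induction q)
  case (Suc q)
  have "b p \<le> b q" "b q \<le> b (Suc q)" using b_mono[of p q] b_mono[of q "Suc q"] Suc.prems by auto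
  then have e: "b p = b q" "b q = b (Suc q)" using Suc.prems by auto
  then have "st q \<in> J" using Suc.prems by (auto simp: J_def)
  then have "len n x < len n (x \<circ> st q)" using assms(1) by (auto simp: D_def)
  then have "x q < x (Suc q)" using len_comp_st(4)[of x n q] assms(1) Suc.prems by (simp add: D_Sym)
  moreover have "p < q \<Longrightarrow> x p < x q" using Suc e by simp
  ultimately show ?case using Suc.prems(1) by (metis less_Suc_eq order_less_trans)
qed simp

text \<open>\<open>x\<close> is increasing on each fibre, so composing with it preserves the
  comparisons that decide whether a step of \<open>u\<close> goes up.\<close>

lemma len_D_Y: assumes "x \<in> D" "u \<in> Y" shows "len n (x \<circ> u) = len n x + len n u"
  using assms(2)
proof (induction rule: Y_induct)
  case (comp u t)
  obtain i where i: "Suc i < n" "t = st i" "b i = b (Suc i)" using comp(2) by (auto simp: J_def)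
  have "u i < u (Suc i)" using len_comp_st(4)[OF Y_Sym[OF comp(1)] i(1)] comp(3) i by simp
  moreover have "u (Suc i) < n" "b (u i) = b (u (Suc i))"
    using comp(1) i Sym_less[OF Y_Sym[OF comp(1)]] by (auto simp: Y_def)
  ultimately have "x (u i) < x (u (Suc i))" using D_less[OF assms(1)] by blast
  then have "len n (x \<circ> u \<circ> st i) = Suc (len n (x \<circ> u))"
    using len_comp_st(1)[of "x \<circ> u" n i] i(1) D_Sym[OF assms(1)] Y_Sym[OF comp(1)] by (simp add: o_apply)
  then show ?case using comp i by (simp add: o_assoc)
qed simp

text \<open>A nontrivial \<open>z\<close> in \<open>Y\<close> has a descent inside a fibre, so
  \<open>x'\<close> and \<open>x' \<circ> z\<close> cannot both be increasing on fibres.\<close>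

lemma D_Y_unique:
  assumes "x \<in> D" "x' \<in> D" "u \<in> Y" "u' \<in> Y" "x \<circ> u = x' \<circ> u'"
  shows "x = x' \<and> u = u'"
proof -
  have S: "x \<in> Sym n" "x' \<in> Sym n" "u \<in> Sym n" "u' \<in> Sym n" using assms by (auto simp: Y_Sym D_Sym)
  define z where "z = u' \<circ> inv u"
  have z: "z \<in> Y" using assms unfolding z_def by (intro Y_comp Y_inv)
  have xz: "x = x' \<circ> z"
  proof -
    have "x \<circ> u \<circ> inv u = x' \<circ> u' \<circ> inv u" using assms(5) by simp
    then show ?thesis using S by (simp add: z_def comp_assoc)
  qed
  have "z = id"
  proof (rule ccontr)
    assume "z \<noteq> id"
    then obtain i where i: "Suc i < n" "b i = b (Suc i)" "z (Suc i) < z i" using Y_descent z by metis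
    have "z i < n" "b (z i) = b (z (Suc i))" using z i Sym_less[OF Y_Sym[OF z]] by (auto simp: Y_def)
    then have "x' (z (Suc i)) < x' (z i)" using D_less[OF assms(2)] i(3) by simp
    moreover have "x i < x (Suc i)" using D_less[OF assms(1)] i by simp
    ultimately show False by (simp add: xz o_apply)
  qed
  then have "x = x'" "u' \<circ> inv u \<circ> u = u" using xz by (simp_all add: z_def)
  then show ?thesis using S by (simp add: comp_assoc)
qed

lemma D_Y_exists: assumes "w \<in> Sym n" shows "\<exists>x\<in>D. \<exists>u\<in>Y. w = x \<circ> u"
  using assms
proof (induction "len n w" arbitrary: w rule: less_induct)
  case less
  show ?case
  proof (cases "w \<in> D")
    case True
    then show ?thesis using Y_id by (metis comp_id)
  next
    case False
    then obtain t where t: "t \<in> J" "\<not> len n w < len n (w \<circ> t)" using less.prems by (auto simp: D_def)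
    have ts: "t \<in> sgens n" using t J_sgens by blast
    have "len n (w \<circ> t) < len n w" using len_right_cases[OF less.prems ts] t(2) by auto
    then obtain x u where xu: "x \<in> D" "u \<in> Y" "w \<circ> t = x \<circ> u" using less.hyps[of "w \<circ> t"] less.prems ts by auto
    then have "w = x \<circ> (u \<circ> t)" using sgens_cancel_right[OF ts, of w] by (metis comp_assoc)
    then show ?thesis using xu Y_comp[OF xu(2) J_Y[OF t(1)]] by blast
  qed
qed

lemma sum_D_Y: "(\<Sum>w\<in>Sym n. f w) = (\<Sum>x\<in>D. \<Sum>u\<in>Y. f (x \<circ> u))"
proof -
  have "bij_betw (\<lambda>(x, u). x \<circ> u) (D \<times> Y) (Sym n)"
    unfolding bij_betw_def
  proof
    show "inj_on (\<lambda>(x, u). x \<circ> u) (D \<times> Y)" using D_Y_unique by (auto simp: inj_on_def)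
    show "(\<lambda>(x, u). x \<circ> u) ` (D \<times> Y) = Sym n"
    proof
      show "(\<lambda>(x, u). x \<circ> u) ` (D \<times> Y) \<subseteq> Sym n" using D_Sym Y_Sym by auto
      show "Sym n \<subseteq> (\<lambda>(x, u). x \<circ> u) ` (D \<times> Y)" using D_Y_exists by fastforce
    qed
  qed
  from sum.reindex_bij_betw[OF this, of f] show ?thesis
    by (simp add: sum.cartesian_product case_prod_unfold)
qed

text \<open>Maximal length forces an element of \<open>Y\<close> to be decreasing on every fibre,
  and two such elements differ by an element of \<open>Y\<close> without descents.\<close>

lemma ex_longest: "\<exists>w\<in>Y. len n w = Max (len n ` Y) \<and> (\<forall>u\<in>Y. u \<noteq> w \<longrightarrow> len n u < len n w)"
proof -
  have "Max (len n ` Y) \<in> len n ` Y" using Y_id by (intro Max_in finite_imageI finite_Y) blast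
  then obtain w where w: "w \<in> Y" "len n w = Max (len n ` Y)" by auto
  have mx: "len n u \<le> len n w" if "u \<in> Y" for u using w(2) that by (simp add: Max_ge)
  have dec: "v q < v p" if v: "v \<in> Y" "len n v = len n w" and pq: "p < q" "q < n" "b p = b q" for v p q
    using pq
  proof (induction q)
    case (Suc q)
    have "b p \<le> b q" "b q \<le> b (Suc q)" using b_mono[of p q] b_mono[of q "Suc q"] Suc.prems by auto
    then have e: "b p = b q" "b q = b (Suc q)" using Suc.prems by auto
    then have tJ: "st q \<in> J" using Suc.prems by (auto simp: J_def)
    have "\<not> v q < v (Suc q)"
      using len_comp_st(4)[OF Y_Sym[OF v(1)], of q] Suc.prems mx[OF Y_comp[OF v(1) J_Y[OF tJ]]] v(2) by auto
    then have "v (Suc q) < v q" using Sym_inj[OF Y_Sym[OF v(1)], of q "Suc q"] by auto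
    moreover have "p < q \<Longrightarrow> v q < v p" using Suc e by simp
    ultimately show ?case using Suc.prems(1) by (metis less_Suc_eq order_less_trans)
  qed simp
  have "u = w" if u: "u \<in> Y" "len n u = len n w" for u
  proof -
    define z where "z = inv w \<circ> u"
    have z: "z \<in> Y" using w u unfolding z_def by (intro Y_comp Y_inv)
    have wz: "u = w \<circ> z" unfolding z_def o_assoc using Sym_comp_inv(1)[OF Y_Sym[OF w(1)]] by simp
    have "z = id"
    proof (rule ccontr)
      assume "z \<noteq> id"
      then obtain i where i: "Suc i < n" "b i = b (Suc i)" "z (Suc i) < z i" using Y_descent z by metis
      have "z i < n" "b (z i) = b (z (Suc i))" using z i Sym_less[OF Y_Sym[OF z]] by (auto simp: Y_def)
      then have "w (z i) < w (z (Suc i))" using dec[OF w(1) refl] i(3) by simp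
      moreover have "u (Suc i) < u i" using dec[OF u] i by simp
      ultimately show False by (simp add: wz o_apply)
    qed
    then show ?thesis using wz by simp
  qed
  then show ?thesis using w mx by (metis le_neq_implies_less)
qed

definition wl :: perm where
  "wl = (SOME w. w \<in> Y \<and> len n w = Max (len n ` Y) \<and> (\<forall>u\<in>Y. u \<noteq> w \<longrightarrow> len n u < len n w))"

lemma wl: "wl \<in> Y" "len n wl = Max (len n ` Y)" "u \<in> Y \<Longrightarrow> u \<noteq> wl \<Longrightarrow> len n u < len n wl"
proof -
  have "\<exists>w. w \<in> Y \<and> len n w = Max (len n ` Y) \<and> (\<forall>u\<in>Y. u \<noteq> w \<longrightarrow> len n u < len n w)"
    using ex_longest by blast
  from someI_ex[OF this] show "wl \<in> Y" "len n wl = Max (len n ` Y)" "u \<in> Y \<Longrightarrow> u \<noteq> wl \<Longrightarrow> len n u < len n wl"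
    unfolding wl_def[symmetric] by auto
qed

lemma wl_descent: "t \<in> J \<Longrightarrow> len n (wl \<circ> t) < len n wl"
proof -
  assume t: "t \<in> J"
  have "wl \<circ> t \<noteq> wl" using len_right_cases[OF Y_Sym[OF wl(1)] J_sgens[OF t]] by auto
  then show ?thesis using wl(3)[OF Y_comp[OF wl(1) J_Y[OF t]]] by simp
qed

text \<open>The quasi-idempotent of the sign representation of the Young subgroup, in which
  \<open>T_u\<close> acts by \<open>(-v^-1)^(l(u))\<close>.\<close>

definition eb :: "perm \<Rightarrow> laur" where
  "eb = (\<lambda>y. if y \<in> Y then (- vAinv) ^ len n y else 0)"

lemma supp_eb [simp]: "supp_in n eb"
  using Y_Sym by (auto simp: supp_in_def eb_def)

lemma flat_eb: "flat n eb = eb"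
proof
  fix y
  have "inv y \<in> Y \<longleftrightarrow> y \<in> Y" if "y \<in> Sym n" using Y_inv[of y] Y_inv[of "inv y"] that by auto
  then show "flat n eb y = eb y" using Y_Sym[of y] by (auto simp: flat_def eb_def len_inv)
qed

lemma vAinv_quad: "(- vAinv) * (- vAinv) = 1 + deltaA * (- vAinv)"
  by (simp add: deltaA_def algebra_simps)

lemma Fr_eb: assumes "t \<in> J" shows "Fr n t eb"
proof -
  have "eb (y \<circ> t) = - vAinv * eb y" if "y \<in> Sym n" "len n y < len n (y \<circ> t)" for y
  proof -
    have "y \<circ> t \<in> Y \<longleftrightarrow> y \<in> Y"
      using Y_comp[OF _ J_Y[OF assms], of y] Y_comp[OF _ J_Y[OF assms], of "y \<circ> t"]
        sgens_cancel_right[OF J_sgens[OF assms], of y] by auto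
    moreover have "len n (y \<circ> t) = Suc (len n y)" using len_right_cases[OF that(1) J_sgens[OF assms]] that(2) by auto
    ultimately show ?thesis by (simp add: eb_def)
  qed
  then show ?thesis unfolding Fr_def
    using rmul_eigenI[OF J_sgens[OF assms] supp_eb vAinv_quad] by simp
qed

lemma mulTs_eb: assumes "t \<in> J" shows "mulTs n deltaA t eb = (\<lambda>y. - vAinv * eb y)"
proof -
  have "flat n (mulTs n deltaA t eb) = flat n (\<lambda>y. - vAinv * eb y)"
    using Fr_eb[OF assms] J_sgens[OF assms] lin_scale[OF lin_flat, of n "- vAinv" eb]
    by (simp add: flat_mulTs flat_eb Fr_def)
  then have "flat n (flat n (mulTs n deltaA t eb)) = flat n (flat n (\<lambda>y. - vAinv * eb y))" by simp
  then show ?thesis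
    using flat_flat[of n "mulTs n deltaA t eb"] flat_flat[of n "\<lambda>y. - vAinv * eb y"] J_sgens[OF assms]
      supp_in_lin(3)[OF supp_eb, of "- vAinv"] by simp
qed

lemma Fr_Y:
  assumes "\<And>t. t \<in> J \<Longrightarrow> Fr n t h" "x \<in> D" "u \<in> Y"
  shows "h (x \<circ> u) = (- vAinv) ^ len n u * h x"
  using assms(3)
proof (induction rule: Y_induct)
  case (comp u t)
  have "len n (x \<circ> u) < len n (x \<circ> u \<circ> t)"
    using len_D_Y[OF assms(2) comp(1)] len_D_Y[OF assms(2) Y_comp[OF comp(1) J_Y[OF comp(2)]]] comp(3)
    by (simp add: o_assoc)
  from Fr_up[OF assms(1)[OF comp(2)] this] comp show ?case by (simp add: o_assoc)
qed simp

definition Dpart :: "(perm \<Rightarrow> laur) \<Rightarrow> perm \<Rightarrow> laur" where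
  "Dpart h = (\<lambda>x. if x \<in> D then h x else 0)"

lemma supp_Dpart [simp]: "supp_in n (Dpart h)"
  using D_Sym by (auto simp: supp_in_def Dpart_def)

lemma mulT_eb:
  assumes "x \<in> D" "x' \<in> D" "u \<in> Y"
  shows "mulT n deltaA x eb (x' \<circ> u) = (if x = x' then (- vAinv) ^ len n u else 0)"
proof -
  have "mulT n deltaA x eb (x' \<circ> u) = (\<Sum>w\<in>Sym n. eb w * mulT n deltaA x (Tb w) (x' \<circ> u))"
    by (subst lin_expand[OF lin_mulT supp_eb]) simp
  also have "\<dots> = (\<Sum>w\<in>Y. eb w * mulT n deltaA x (Tb w) (x' \<circ> u))"
    using Y_Sym by (intro sum.mono_neutral_right) (auto simp: eb_def)
  also have "\<dots> = (\<Sum>w\<in>Y. if w = u then (if x = x' then (- vAinv) ^ len n u else 0) else 0)"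
  proof (rule sum.cong)
    fix w assume w: "w \<in> Y"
    have "mulT n deltaA x (Tb w) = Tb (x \<circ> w)"
      using mulT_Tb_add[OF D_Sym[OF assms(1)] Y_Sym[OF w]] len_D_Y[OF assms(1) w] by blast
    moreover have iff: "x' \<circ> u = x \<circ> w \<longleftrightarrow> x = x' \<and> w = u" using D_Y_unique[OF assms(2,1,3) w] by blast
    ultimately show "eb w * mulT n deltaA x (Tb w) (x' \<circ> u) = (if w = u then (if x = x' then (- vAinv) ^ len n u else 0) else 0)"
      using w by (simp only: Tb_def iff eb_def) simp
  qed simp
  finally show ?thesis using assms(3) by (simp add: sum.delta)
qed

text \<open>Such an \<open>h\<close> is determined by its values on \<open>D\<close>, because
  passing from \<open>x\<close> to \<open>x \<circ> u\<close> multiplies the coefficient by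
  \<open>(- vAinv) ^ len n u\<close>; multiplying by \<open>eb\<close> on the right reproduces this
  rule.\<close>

lemma Fr_factor:
  assumes h: "supp_in n h" "\<And>t. t \<in> J \<Longrightarrow> Fr n t h"
  shows "h = hmult n deltaA (Dpart h) eb"
proof (rule supp_in_eqI[OF h(1)])
  fix y assume "y \<in> Sym n"
  then obtain x u where y: "x \<in> D" "u \<in> Y" "y = x \<circ> u" using D_Y_exists by blast
  have "hmult n deltaA (Dpart h) eb y = (\<Sum>x'\<in>D. h x' * mulT n deltaA x' eb y)"
    unfolding hmult_def using D_Sym by (intro sum.mono_neutral_cong_right) (auto simp: Dpart_def)
  also have "\<dots> = (\<Sum>x'\<in>D. if x' = x then h x * (- vAinv) ^ len n u else 0)"
    using y by (intro sum.cong) (auto simp: mulT_eb)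
  finally show "h y = hmult n deltaA (Dpart h) eb y"
    using y Fr_Y[OF h(2) y(1,2)] by (simp add: sum.delta mult.commute)
qed simp

lemma mulT_Y_eb: assumes "u \<in> Y" shows "mulT n deltaA u eb = (\<lambda>y. (- vAinv) ^ len n u * eb y)"
proof -
  have "inv u \<in> Y" using Y_inv assms by simp
  then have "mulT n deltaA (inv (inv u)) eb = (\<lambda>y. (- vAinv) ^ len n (inv u) * eb y)"
  proof (induction rule: Y_induct)
    case (comp w t)
    have S: "w \<in> Sym n" "t \<in> sgens n" using comp Y_Sym J_sgens by auto
    have i: "inv (w \<circ> t) = t \<circ> inv w" using S by (simp add: Sym_inv_comp[of _ n])
    have "len n (inv w) < len n (t \<circ> inv w)" using comp(3) len_inv[of "w \<circ> t" n] S by (simp add: i len_inv)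
    then have "mulT n deltaA (t \<circ> inv w) eb = mulTs n deltaA t (mulT n deltaA (inv w) eb)"
      using S by (intro mulT_up) auto
    also have "\<dots> = (\<lambda>y. (- vAinv) ^ len n w * (- vAinv * eb y))"
      using comp(4) mulTs_eb[OF comp(2)] lin_scale[OF lin_mulTs, of n deltaA t "(- vAinv) ^ len n w" eb] by simp
    finally show ?case using comp(3) by (simp add: i ac_simps)
  next
    case id
    have "inv (id :: perm) = id" by simp
    then show ?case by simp
  qed
  then show ?thesis using Sym_inv_inv[OF Y_Sym[OF assms]] len_inv[OF Y_Sym[OF assms]] by simp
qed

text \<open>The Poincare polynomial of the Young subgroup in \<open>v^-2\<close>; it is the scalar
  by which \<open>eb\<close> fails to be idempotent.\<close>

definition piY :: laur where "piY = (\<Sum>u\<in>Y. vAinv ^ (2 * len n u))"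

lemma eb_eb: "hmult n deltaA eb eb = (\<lambda>y. piY * eb y)"
proof
  fix y
  have "hmult n deltaA eb eb y = (\<Sum>u\<in>Y. (- vAinv) ^ len n u * ((- vAinv) ^ len n u * eb y))"
    unfolding hmult_def using Y_Sym
    by (intro sum.mono_neutral_cong_right) (auto simp: eb_def mulT_Y_eb[unfolded eb_def])
  also have "\<dots> = piY * eb y"
    unfolding piY_def sum_distrib_right
    by (intro sum.cong) (simp_all add: mult.assoc[symmetric] power_mult_distrib[symmetric] power_mult power2_eq_square)
  finally show "hmult n deltaA eb eb y = piY * eb y" .
qed

lemma D_int_Y: "x \<in> D \<Longrightarrow> x \<circ> wl \<in> Sym n"
  using D_Sym Y_Sym wl(1) by simp

lemma vA_vAinv_power: "(- vA) ^ k * (- vAinv) ^ k = 1" "(- vAinv) ^ k * (- vA) ^ k = 1"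
  by (simp_all add: power_mult_distrib[symmetric])

text \<open>By \<open>Fr_factor\<close> only the values on \<open>D\<close> matter. At
  \<open>x\<close> other than \<open>id\<close> they vanish because \<open>x \<circ> wl\<close> is
  longer than \<open>wl\<close>, and at \<open>id\<close> the value is forced by the coefficient 1
  at \<open>wl\<close>.\<close>

lemma KL_C_wl: "KL_C n wl = (\<lambda>y. (- vA) ^ len n wl * eb y)"
proof -
  let ?C = "KL_C n wl"
  have w: "wl \<in> Sym n" using Y_Sym wl by simp
  have F: "Fr n t ?C" if "t \<in> J" for t using Fr_KL_C[OF J_sgens[OF that] w wl_descent[OF that]] .
  have z: "?C x = 0" if x: "x \<in> D" "x \<noteq> id" for x
  proof -
    have "len n x \<noteq> 0"
    proof
      assume "len n x = 0"
      then have "x = id" using rword[OF D_Sym[OF x(1)]] by (metis length_0_conv wprod_Nil)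
      with x show False by simp
    qed
    then have "len n wl < len n (x \<circ> wl)" using len_D_Y[OF x(1) wl(1)] by simp
    then have "?C (x \<circ> wl) = 0" using KL_C(4)[OF w D_int_Y[OF x(1)]] by (auto simp: Tb_def)
    then have "(- vAinv) ^ len n wl * ?C x = 0" using Fr_Y[OF F x(1) wl(1)] by simp
    then have "(- vA) ^ len n wl * ((- vAinv) ^ len n wl * ?C x) = 0" by simp
    then show ?thesis using vA_vAinv_power(1) by (simp add: mult.assoc[symmetric])
  qed
  have idD: "id \<in> D" using J_sgens by (auto simp: D_def)
  have "?C (id \<circ> wl) = 1" using KL_C(4)[OF w w] by (simp add: Tb_def)
  then have "(- vAinv) ^ len n wl * ?C id = 1" using Fr_Y[OF F idD wl(1)] by simp
  then have "(- vA) ^ len n wl * ((- vAinv) ^ len n wl * ?C id) = (- vA) ^ len n wl" by simp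
  then have C1: "?C id = (- vA) ^ len n wl" using vA_vAinv_power(1) by (simp add: mult.assoc[symmetric])
  have "Dpart ?C = (\<lambda>y. (- vA) ^ len n wl * Tb id y)"
  proof
    fix y show "Dpart ?C y = (- vA) ^ len n wl * Tb id y"
      using z[of y] C1 idD by (cases "y = id") (simp_all add: Dpart_def Tb_def)
  qed
  then have "hmult n deltaA (Dpart ?C) eb = (\<lambda>y. (- vA) ^ len n wl * eb y)"
    by (simp add: lin_scale[OF lin_hmult_left] hmult_Tb_id_left)
  then show ?thesis using Fr_factor[OF KL_C(1)[OF w] F] by metis
qed

end

section \<open>Values at v = 0\<close>

text \<open>A relation rather than a function: it asserts regularity at v = 0 together with the
  value, so regularity travels along through sums, products and inverses.\<close>

definition isval :: "ratf \<Rightarrow> real \<Rightarrow> bool" where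
  "isval f c \<longleftrightarrow> (\<exists>p q. poly q 0 \<noteq> 0 \<and> f = Fract p q \<and> c = poly p 0 / poly q 0)"

lemma isvalI: "poly q 0 \<noteq> 0 \<Longrightarrow> f = Fract p q \<Longrightarrow> c = poly p 0 / poly q 0 \<Longrightarrow> isval f c"
  unfolding isval_def by blast

lemma isvalE:
  assumes "isval f c" obtains p q where "poly q 0 \<noteq> 0" "f = Fract p q" "c = poly p 0 / poly q 0"
  using assms unfolding isval_def by blast

lemma isval_unique: assumes "isval f a" "isval f b" shows "a = b"
proof -
  obtain p q where 1: "poly q 0 \<noteq> 0" "f = Fract p q" "a = poly p 0 / poly q 0" using isvalE[OF assms(1)] .
  obtain p' q' where 2: "poly q' 0 \<noteq> 0" "f = Fract p' q'" "b = poly p' 0 / poly q' 0" using isvalE[OF assms(2)] .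
  note pq = 1 2
  then have "q \<noteq> 0" "q' \<noteq> 0" by auto
  with pq have "p * q' = p' * q" by (metis eq_fract(1))
  then have "poly p 0 * poly q' 0 = poly p' 0 * poly q 0" by (metis poly_mult)
  with pq show ?thesis by (simp add: frac_eq_eq)
qed

lemma value0_isval: "isval f c \<Longrightarrow> value0 f = c"
  unfolding value0_def isval_def[symmetric] by (rule the_equality) (auto dest: isval_unique)

lemma regular0_isval: "regular0 f \<Longrightarrow> isval f (value0 f)"
proof -
  assume "regular0 f"
  then obtain c where "isval f c" by (auto simp: regular0_def isval_def)
  with value0_isval show ?thesis by blast
qed

lemma isval_Fract: "isval (Fract p 1) (poly p 0)"
  using isvalI[of 1 "Fract p 1" p "poly p 0"] by simp

lemma isval_add: assumes "isval f a" "isval g b" shows "isval (f + g) (a + b)"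
proof -
  obtain p q where 1: "poly q 0 \<noteq> 0" "f = Fract p q" "a = poly p 0 / poly q 0" using isvalE[OF assms(1)] .
  obtain p' q' where 2: "poly q' 0 \<noteq> 0" "g = Fract p' q'" "b = poly p' 0 / poly q' 0" using isvalE[OF assms(2)] .
  note pq = 1 2
  then have "q \<noteq> 0" "q' \<noteq> 0" by auto
  with pq show ?thesis
    by (intro isvalI[of "q * q'" _ "p * q' + p' * q"]) (simp_all add: add_frac_eq)
qed

lemma isval_mult: assumes "isval f a" "isval g b" shows "isval (f * g) (a * b)"
proof -
  obtain p q where 1: "poly q 0 \<noteq> 0" "f = Fract p q" "a = poly p 0 / poly q 0" using isvalE[OF assms(1)] .
  obtain p' q' where 2: "poly q' 0 \<noteq> 0" "g = Fract p' q'" "b = poly p' 0 / poly q' 0" using isvalE[OF assms(2)] .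
  note pq = 1 2
  then show ?thesis by (intro isvalI[of "q * q'" _ "p * p'"]) simp_all
qed

lemma isval_inverse: assumes "isval f a" "a \<noteq> 0" shows "isval (inverse f) (inverse a)"
proof -
  obtain p q where pq: "poly q 0 \<noteq> 0" "f = Fract p q" "a = poly p 0 / poly q 0" using isvalE[OF assms(1)] .
  with assms(2) show ?thesis by (intro isvalI[of p _ q]) simp_all
qed

lemma isval_zero: "isval 0 0" and isval_one: "isval 1 1"
  using isval_Fract[of 0] isval_Fract[of 1] by (simp_all add: Zero_fract_def One_fract_def)

lemma isval_uminus: "isval f a \<Longrightarrow> isval (- f) (- a)"
  using isval_mult[of "Fract (-1) 1" "-1" f a] isval_Fract[of "-1"]
  by (simp add: minus_fract[symmetric] One_fract_def[symmetric] del: minus_fract)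

lemma isval_sum: "(\<And>x. x \<in> A \<Longrightarrow> isval (f x) (g x)) \<Longrightarrow> isval (\<Sum>x\<in>A. f x) (\<Sum>x\<in>A. g x)"
  by (induction A rule: infinite_finite_induct) (auto intro: isval_zero isval_add)

lemma isval_power: "isval f a \<Longrightarrow> isval (f ^ k) (a ^ k)"
  by (induction k) (auto intro: isval_one isval_mult)

lemma isval_of_nat: "isval (of_nat k) (of_nat k)"
  by (induction k) (auto intro: isval_zero isval_add isval_one)

lemma isval_of_int: "isval (of_int k) (of_int k)"
proof (cases "0 \<le> k")
  case True
  then show ?thesis using isval_of_nat[of "nat k"] by simp
next
  case False
  then show ?thesis using isval_uminus[OF isval_of_nat[of "nat (- k)"]] by simp
qed

lemma isval_vK: "isval vK 0"
  unfolding vK_def using isval_Fract[of "[:0, 1:]"] by simp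

lemma vK_nz [simp]: "vK \<noteq> 0"
  by (simp add: vK_def Zero_fract_def eq_fract)

lemma isval_vK_pow: "k > 0 \<Longrightarrow> isval (vK ^ k) 0"
  using isval_power[OF isval_vK, of k] by (simp add: zero_power)

section \<open>Laurent polynomials inside the field of rational functions\<close>

lemma embA_zero [simp]: "embA 0 = 0"
  by (simp add: embA_def)

lemma embA_single: "embA (Poly_Mapping.single k c) = of_int c * vK powi k"
  by (cases "c = 0") (simp_all add: embA_def)

lemma embA_add [simp]: "embA (a + b) = embA a + embA b"
  unfolding embA_def by (rule setsum_keys_plus_distrib) (simp_all add: distrib_right)

lemma embA_mult [simp]: "embA (a * b) = embA a * embA b"
proof (induction a rule: laur_induct)
  case (single k c)
  show ?case
  proof (induction b rule: laur_induct)
    case (single k' c')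
    show ?case by (simp add: mult_single embA_single power_int_add)
  qed (simp add: algebra_simps)
qed (simp add: algebra_simps)

lemma embA_one [simp]: "embA 1 = 1"
  using embA_single[of 0 1] by simp

lemma embA_uminus [simp]: "embA (- a) = - embA a"
  using embA_add[of a "- a"] by (simp add: eq_neg_iff_add_eq_0 add.commute)

lemma embA_diff [simp]: "embA (a - b) = embA a - embA b"
  using embA_add[of a "- b"] by simp

lemma embA_sum [simp]: "embA (\<Sum>x\<in>A. f x) = (\<Sum>x\<in>A. embA (f x))"
  by (induction A rule: infinite_finite_induct) auto

lemma embA_power [simp]: "embA (a ^ k) = embA a ^ k"
  by (induction k) auto

lemma embA_of_int [simp]: "embA (of_int k) = of_int k"
proof -
  have "Poly_Mapping.single 0 k = (of_int k :: laur)" by (rule poly_mapping_eqI) (simp add: lookup_of_int lookup_single when_def id_apply)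
  then show ?thesis using embA_single[of 0 k] by simp
qed

lemma embA_v [simp]: "embA vA = vK" "embA vAinv = inverse vK" "embA deltaA = deltaK"
  by (simp_all add: vA_def vAinv_def deltaA_def deltaK_def embA_single)

lemma isval_embA:
  assumes "in_Zv a" shows "isval (embA a) (of_int (Poly_Mapping.lookup a 0))"
proof -
  have "isval (of_int (Poly_Mapping.lookup a k) * vK powi k) (if k = 0 then of_int (Poly_Mapping.lookup a k) else 0)"
    if "k \<in> Poly_Mapping.keys a" for k
  proof -
    have "0 \<le> k" using assms that by (auto simp: in_Zv_def in_keys_iff not_le[symmetric])
    then obtain j where j: "k = int j" using nonneg_int_cases by blast
    show ?thesis
    proof (cases "j = 0")
      case False
      then show ?thesis using isval_mult[OF isval_of_int isval_vK_pow[of j]] j by simp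
    qed (use j isval_of_int in simp)
  qed
  then have "isval (embA a) (\<Sum>k\<in>Poly_Mapping.keys a. if k = 0 then of_int (Poly_Mapping.lookup a k) else 0)"
    unfolding embA_def by (rule isval_sum)
  then show ?thesis by (simp add: sum.delta in_keys_iff split: if_splits)
qed

lemma lookup_shift: "Poly_Mapping.lookup (Poly_Mapping.single j 1 * a) k = Poly_Mapping.lookup (a :: laur) (k - j)"
proof (induction a rule: laur_induct)
  case (single i c)
  then show ?case by (simp add: mult_single lookup_single when_def algebra_simps)
qed (simp add: algebra_simps lookup_add)

text \<open>A linear system over the Laurent polynomials whose matrix is invertible at v = 0:
  the lowest coefficient of a solution cannot cancel.\<close>

lemma system_at_zero:
  fixes a :: "'w \<Rightarrow> laur" and m :: "'w \<Rightarrow> 'w \<Rightarrow> ratf"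
  assumes "finite W"
    and m: "\<And>x w. x \<in> W \<Longrightarrow> w \<in> W \<Longrightarrow> isval (m x w) (if w = x then \<sigma> x else 0)"
    and \<sigma>: "\<And>x. x \<in> W \<Longrightarrow> \<sigma> x \<noteq> 0"
    and eq: "\<And>x. x \<in> W \<Longrightarrow> (\<Sum>w\<in>W. embA (a w) * m x w) = g x"
    and g: "\<And>x. x \<in> W \<Longrightarrow> isval (g x) (\<gamma> x)"
    and w: "w \<in> W"
  shows "in_Zv (a w)" "of_int (Poly_Mapping.lookup (a w) 0) * \<sigma> w = \<gamma> w"
    "(\<And>x. x \<in> W \<Longrightarrow> g x = 0) \<Longrightarrow> a w = 0"
proof -
  define K where "K = (\<Union>w\<in>W. Poly_Mapping.keys (a w))"
  have fK: "finite K" using assms(1) by (simp add: K_def)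
  \<comment> \<open>Dividing the system by \<open>v^k\<close>, with \<open>k\<close> a lower bound
    of all exponents, keeps the unknowns regular; at v = 0 the diagonal matrix then reads off the
    coefficients of \<open>v^k\<close>.\<close>
  have low: "isval (vK powi (- k) * g x) (of_int (Poly_Mapping.lookup (a x) k) * \<sigma> x)"
    if k: "\<And>j. j \<in> K \<Longrightarrow> k \<le> j" and x: "x \<in> W" for k x
  proof -
    define a' where "a' = (\<lambda>w. Poly_Mapping.single (- k) 1 * a w)"
    have l: "Poly_Mapping.lookup (a' w) j = Poly_Mapping.lookup (a w) (j + k)" for w j
      by (simp add: a'_def lookup_shift)
    have "in_Zv (a' w)" if "w \<in> W" for w
      unfolding in_Zv_def l
    proof (intro allI impI)
      fix j :: int assume "j < 0"
      then have "j + k \<notin> K" using k by force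
      then show "Poly_Mapping.lookup (a w) (j + k) = 0" using that by (auto simp: K_def in_keys_iff)
    qed
    then have "isval (\<Sum>w\<in>W. embA (a' w) * m x w)
       (\<Sum>w\<in>W. of_int (Poly_Mapping.lookup (a' w) 0) * (if w = x then \<sigma> x else 0))"
      using m x by (intro isval_sum isval_mult isval_embA) auto
    moreover have "(\<Sum>w\<in>W. embA (a' w) * m x w) = vK powi (- k) * g x"
      by (simp add: a'_def embA_single sum_distrib_left mult.assoc flip: eq[OF x])
    moreover have "(\<Sum>w\<in>W. of_int (Poly_Mapping.lookup (a' w) 0) * (if w = x then \<sigma> x else 0)) =
       of_int (Poly_Mapping.lookup (a x) k) * \<sigma> x"
      using x assms(1) by (simp add: if_distrib[of "\<lambda>y. _ * y"] sum.delta l cong: if_cong)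
    ultimately show ?thesis by simp
  qed
  \<comment> \<open>For \<open>k = Min K\<close> some coefficient of \<open>v^k\<close> is nonzero,
    whereas the right-hand side divided by \<open>v^k\<close> vanishes at v = 0 if
    \<open>k < 0\<close>, and also if \<open>g\<close> is zero.\<close>
  have bad: False if ne: "K \<noteq> {}" and c: "Min K < 0 \<or> (\<forall>x\<in>W. g x = 0)"
  proof -
    have "Min K \<in> K" using fK ne by simp
    then obtain x where x: "x \<in> W" "Poly_Mapping.lookup (a x) (Min K) \<noteq> 0" by (auto simp: K_def in_keys_iff)
    have v: "isval (vK powi (- Min K) * g x) (of_int (Poly_Mapping.lookup (a x) (Min K)) * \<sigma> x)"
      using fK x(1) by (intro low) auto
    have "isval (vK powi (- Min K) * g x) 0"
    proof (cases "Min K < 0")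
      case True
      then obtain j where "- Min K = int j" "j > 0" by (metis neg_0_less_iff_less zero_less_imp_eq_int)
      then show ?thesis using isval_mult[OF isval_vK_pow[of j] g[OF x(1)]] by simp
    next
      case False
      then show ?thesis using c x(1) isval_zero by simp
    qed
    from isval_unique[OF v this] x \<sigma>[OF x(1)] show False by simp
  qed
  have K0: "0 \<le> j" if "j \<in> K" for j
    using bad that Min_le[OF fK that] by fastforce
  show "in_Zv (a w)" unfolding in_Zv_def using K0 w by (force simp: K_def in_keys_iff)
  have "isval (vK powi (- 0) * g w) (of_int (Poly_Mapping.lookup (a w) 0) * \<sigma> w)"
    using low[of 0 w] K0 w by simp
  then show "of_int (Poly_Mapping.lookup (a w) 0) * \<sigma> w = \<gamma> w" using isval_unique g[OF w] by simp
  show "a w = 0" if "\<And>x. x \<in> W \<Longrightarrow> g x = 0"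
  proof -
    have "K = {}" using bad that by blast
    then have "Poly_Mapping.keys (a w) = {}" using w by (auto simp: K_def)
    then show ?thesis by simp
  qed
qed

section \<open>Matrix representations\<close>

definition mm :: "nat \<Rightarrow> (nat \<Rightarrow> nat \<Rightarrow> ratf) \<Rightarrow> (nat \<Rightarrow> nat \<Rightarrow> ratf) \<Rightarrow> nat \<Rightarrow> nat \<Rightarrow> ratf" where
  "mm d A B = (\<lambda>i j. \<Sum>k<d. A i k * B k j)"

definition mv :: "nat \<Rightarrow> (nat \<Rightarrow> nat \<Rightarrow> ratf) \<Rightarrow> (nat \<Rightarrow> ratf) \<Rightarrow> nat \<Rightarrow> ratf" where
  "mv d A u = (\<lambda>i. \<Sum>j<d. A i j * u j)"

definition idm :: "nat \<Rightarrow> nat \<Rightarrow> nat \<Rightarrow> ratf" where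
  "idm d = (\<lambda>i j. if i = j \<and> i < d then 1 else 0)"

definition trunc :: "nat \<Rightarrow> nat \<Rightarrow> (nat \<Rightarrow> nat \<Rightarrow> ratf) \<Rightarrow> bool" where
  "trunc d e A \<longleftrightarrow> (\<forall>i j. \<not> (i < d \<and> j < e) \<longrightarrow> A i j = 0)"

text \<open>The matrices of a representation are truncated to the index range, so that identities between
  them are identities of functions.\<close>

definition Mx :: "nat \<Rightarrow> (perm \<Rightarrow> nat \<Rightarrow> nat \<Rightarrow> ratf) \<Rightarrow> perm \<Rightarrow> nat \<Rightarrow> nat \<Rightarrow> ratf" where
  "Mx d X w = (\<lambda>i j. if i < d \<and> j < d then X w i j else 0)"

definition ev :: "nat \<Rightarrow> nat \<Rightarrow> (perm \<Rightarrow> nat \<Rightarrow> nat \<Rightarrow> ratf) \<Rightarrow> (perm \<Rightarrow> ratf) \<Rightarrow> nat \<Rightarrow> nat \<Rightarrow> ratf" where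
  "ev n d X h = (\<lambda>i j. \<Sum>w\<in>Sym n. h w * Mx d X w i j)"

lemma mm_assoc: "mm e (mm d A B) C = mm d A (mm e B C)"
proof (intro ext)
  fix i j
  have "mm e (mm d A B) C i j = (\<Sum>l<e. \<Sum>k<d. A i k * B k l * C l j)"
    by (simp add: mm_def sum_distrib_right)
  also have "\<dots> = (\<Sum>k<d. \<Sum>l<e. A i k * B k l * C l j)" by (rule sum.swap)
  finally show "mm e (mm d A B) C i j = mm d A (mm e B C) i j"
    by (simp add: mm_def sum_distrib_left mult.assoc)
qed

lemma mm_mv: "mv e (mm d A B) u = mv d A (mv e B u)"
proof
  fix i
  have "mv e (mm d A B) u i = (\<Sum>l<e. \<Sum>k<d. A i k * B k l * u l)"
    by (simp add: mm_def mv_def sum_distrib_right)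
  also have "\<dots> = (\<Sum>k<d. \<Sum>l<e. A i k * B k l * u l)" by (rule sum.swap)
  finally show "mv e (mm d A B) u i = mv d A (mv e B u) i"
    by (simp add: mv_def sum_distrib_left mult.assoc)
qed

lemma mm_sum_left: "finite S \<Longrightarrow> mm d (\<lambda>i j. \<Sum>x\<in>S. c x * A x i j) B = (\<lambda>i j. \<Sum>x\<in>S. c x * mm d (A x) B i j)"
proof (intro ext)
  fix i j
  have "mm d (\<lambda>i j. \<Sum>x\<in>S. c x * A x i j) B i j = (\<Sum>k<d. \<Sum>x\<in>S. c x * (A x i k * B k j))"
    by (simp add: mm_def sum_distrib_right mult.assoc)
  also have "\<dots> = (\<Sum>x\<in>S. \<Sum>k<d. c x * (A x i k * B k j))" by (rule sum.swap)
  finally show "mm d (\<lambda>i j. \<Sum>x\<in>S. c x * A x i j) B i j = (\<Sum>x\<in>S. c x * mm d (A x) B i j)"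
    by (simp add: mm_def sum_distrib_left)
qed

lemma mm_sum_right: "finite S \<Longrightarrow> mm d B (\<lambda>i j. \<Sum>x\<in>S. c x * A x i j) = (\<lambda>i j. \<Sum>x\<in>S. c x * mm d B (A x) i j)"
proof (intro ext)
  fix i j
  have "mm d B (\<lambda>i j. \<Sum>x\<in>S. c x * A x i j) i j = (\<Sum>k<d. \<Sum>x\<in>S. c x * (B i k * A x k j))"
    by (simp add: mm_def sum_distrib_left mult.left_commute)
  also have "\<dots> = (\<Sum>x\<in>S. \<Sum>k<d. c x * (B i k * A x k j))" by (rule sum.swap)
  finally show "mm d B (\<lambda>i j. \<Sum>x\<in>S. c x * A x i j) i j = (\<Sum>x\<in>S. c x * mm d B (A x) i j)"
    by (simp add: mm_def sum_distrib_left)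
qed

lemma mm_scale: "mm d (\<lambda>i j. c * A i j) B = (\<lambda>i j. c * mm d A B i j)"
  "mm d A (\<lambda>i j. c * B i j) = (\<lambda>i j. c * mm d A B i j)"
  by (simp_all add: mm_def sum_distrib_left mult.assoc mult.left_commute)

lemma mv_lin: "mv d A (\<lambda>i. u i + u' i) = (\<lambda>i. mv d A u i + mv d A u' i)"
  "mv d A (\<lambda>i. c * u i) = (\<lambda>i. c * mv d A u i)"
  by (simp_all add: mv_def algebra_simps sum.distrib sum_distrib_left)

lemma mm_idm: "trunc d e A \<Longrightarrow> mm d (idm d) A = A" "trunc e d A \<Longrightarrow> mm d A (idm d) = A"
proof -
  assume A: "trunc d e A"
  show "mm d (idm d) A = A"
  proof (intro ext)
    fix i j
    have "mm d (idm d) A i j = (\<Sum>k<d. if k = i then A i j else 0)"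
      unfolding mm_def by (intro sum.cong) (auto simp: idm_def)
    then show "mm d (idm d) A i j = A i j" using A by (auto simp: trunc_def sum.delta)
  qed
next
  assume A: "trunc e d A"
  show "mm d A (idm d) = A"
  proof (intro ext)
    fix i j
    have "mm d A (idm d) i j = (\<Sum>k<d. if k = j then A i j else 0)"
      unfolding mm_def by (intro sum.cong) (auto simp: idm_def)
    then show "mm d A (idm d) i j = A i j" using A by (auto simp: trunc_def sum.delta)
  qed
qed

lemma trunc_mm: "trunc d e A \<Longrightarrow> trunc e' f B \<Longrightarrow> trunc d f (mm k A B)"
  by (auto simp: trunc_def mm_def)

lemma trunc_Mx [simp]: "trunc d d (Mx d X w)"
  by (simp add: trunc_def Mx_def)

lemma trunc_ev [simp]: "trunc d d (ev n d X h)"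
  by (auto simp: trunc_def ev_def Mx_def intro!: sum.neutral)

lemma mm_tr: "(\<Sum>i<d. mm e A B i i) = (\<Sum>k<e. mm d B A k k)"
  unfolding mm_def by (subst sum.swap) (simp add: mult.commute)

lemma ev_lin:
  "ev n d X (\<lambda>y. f y + g y) = (\<lambda>i j. ev n d X f i j + ev n d X g i j)"
  "ev n d X (\<lambda>y. c * f y) = (\<lambda>i j. c * ev n d X f i j)"
  by (simp_all add: ev_def algebra_simps sum.distrib sum_distrib_left)

lemma ev_sum: "finite A \<Longrightarrow> ev n d X (\<lambda>y. \<Sum>x\<in>A. c x * f x y) = (\<lambda>i j. \<Sum>x\<in>A. c x * ev n d X (f x) i j)"
proof (induction A rule: finite_induct)
  case empty then show ?case by (simp add: ev_def)
qed (simp add: ev_lin)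

lemma ev_Tb: "w \<in> Sym n \<Longrightarrow> ev n d X (Tb w) = Mx d X w"
  by (simp add: ev_def Tb_def if_distrib[of "\<lambda>x. x * _"] sum.delta cong: if_cong)

lemma rep_id: "is_rep n {..<d} X \<Longrightarrow> Mx d X id = idm d"
  by (auto simp: is_rep_def Mx_def idm_def fun_eq_iff)

lemma rep_s:
  assumes "is_rep n {..<d} X" "s \<in> sgens n" "w \<in> Sym n"
  shows "mm d (Mx d X s) (Mx d X w) = ev n d X (mulTs n deltaK s (Tb w))"
proof (intro ext)
  fix i j
  show "mm d (Mx d X s) (Mx d X w) i j = ev n d X (mulTs n deltaK s (Tb w)) i j"
  proof (cases "i < d \<and> j < d")
    case True
    have "mm d (Mx d X s) (Mx d X w) i j = matmul {..<d} (X s) (X w) i j"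
      using True by (simp add: mm_def Mx_def matmul_def)
    also have "\<dots> = (if len n w < len n (s \<circ> w) then X (s \<circ> w) i j
           else X (s \<circ> w) i j + deltaK * X w i j)"
      using assms True by (simp add: is_rep_def)
    also have "\<dots> = ev n d X (mulTs n deltaK s (Tb w)) i j"
      using True assms by (simp add: mulTs_Tb ev_Tb ev_lin Mx_def)
    finally show ?thesis .
  next
    case False
    then show ?thesis using trunc_mm[OF trunc_Mx[of d X s] trunc_Mx[of d X w], of d] trunc_ev unfolding trunc_def by metis
  qed
qed

lemma rep_mulTs:
  assumes "is_rep n {..<d} X" "s \<in> sgens n" "supp_in n h"
  shows "ev n d X (mulTs n deltaK s h) = mm d (Mx d X s) (ev n d X h)"
proof -
  have "ev n d X (mulTs n deltaK s h) = (\<lambda>i j. \<Sum>w\<in>Sym n. h w * ev n d X (mulTs n deltaK s (Tb w)) i j)"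
    by (subst lin_expand[OF lin_mulTs assms(3)]) (simp add: ev_sum)
  also have "\<dots> = (\<lambda>i j. \<Sum>w\<in>Sym n. h w * mm d (Mx d X s) (Mx d X w) i j)"
    using assms by (simp add: rep_s)
  finally show ?thesis by (simp add: ev_def mm_sum_right)
qed

lemma rep_mulT:
  assumes "is_rep n {..<d} X" "x \<in> Sym n" "supp_in n h"
  shows "ev n d X (mulT n deltaK x h) = mm d (Mx d X x) (ev n d X h)"
proof -
  have "red n ss \<Longrightarrow> ev n d X (mulT n deltaK (wprod ss) h) = mm d (Mx d X (wprod ss)) (ev n d X h)" for ss
  proof (induction ss)
    case Nil
    then show ?case using mm_idm(1)[OF trunc_ev] by (simp add: rep_id[OF assms(1)])
  next
    case (Cons s ss)
    let ?w = "wprod ss"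
    have s: "s \<in> sgens n" "?w \<in> Sym n" using Cons.prems by (auto simp: red_def)
    have r: "red n ss" "len n ?w < len n (s \<circ> ?w)" using red_ConsD[OF Cons.prems(1)] .
    have "ev n d X (mulT n deltaK (s \<circ> ?w) h) = mm d (Mx d X s) (mm d (Mx d X ?w) (ev n d X h))"
      using s r assms Cons.IH by (simp add: mulT_up rep_mulTs)
    also have "\<dots> = mm d (mm d (Mx d X s) (Mx d X ?w)) (ev n d X h)" by (simp add: mm_assoc)
    also have "mm d (Mx d X s) (Mx d X ?w) = Mx d X (s \<circ> ?w)"
      using rep_s[OF assms(1) s] r(2) s by (simp add: mulTs_Tb ev_Tb)
    finally show ?case by simp
  qed
  from this[OF red_rword[OF assms(2)]] rword[OF assms(2)] show ?thesis by simp
qed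

lemma rep_hmult:
  assumes "is_rep n {..<d} X" "supp_in n g" "supp_in n h"
  shows "ev n d X (hmult n deltaK g h) = mm d (ev n d X g) (ev n d X h)"
  using assms by (simp add: hmult_def ev_sum rep_mulT) (simp add: ev_def[of n d X g] mm_sum_left)

lemma rep_mult:
  assumes "is_rep n {..<d} X" "x \<in> Sym n" "y \<in> Sym n"
  shows "mm d (Mx d X x) (Mx d X y) = ev n d X (mulT n deltaK x (Tb y))"
  using rep_mulT[OF assms(1,2), of "Tb y"] assms by (simp add: ev_Tb)

lemma rep_mult_add:
  assumes "is_rep n {..<d} X" "x \<in> Sym n" "y \<in> Sym n" "len n (x \<circ> y) = len n x + len n y"
  shows "mm d (Mx d X x) (Mx d X y) = Mx d X (x \<circ> y)"
  using rep_mult[OF assms(1-3)] assms by (simp add: mulT_Tb_add ev_Tb)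

lemma hk_char_eq: "hk_char n {..<d} X w = (if w \<in> Sym n then \<Sum>i<d. Mx d X w i i else 0)"
  by (simp add: hk_char_def Mx_def)

lemma act_eq: "act {..<d} (X w) u = mv d (Mx d X w) u"
  by (auto simp: act_def mv_def Mx_def fun_eq_iff)

subsection \<open>Schur's lemma\<close>

definition inter :: "nat \<Rightarrow> nat \<Rightarrow> (perm \<Rightarrow> nat \<Rightarrow> nat \<Rightarrow> ratf) \<Rightarrow> nat \<Rightarrow> (perm \<Rightarrow> nat \<Rightarrow> nat \<Rightarrow> ratf) \<Rightarrow>
    (nat \<Rightarrow> nat \<Rightarrow> ratf) \<Rightarrow> bool" where
  "inter n d X e Y Z \<longleftrightarrow> trunc d e Z \<and> (\<forall>w\<in>Sym n. mm d (Mx d X w) Z = mm e Z (Mx e Y w))"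

abbreviation "evec k \<equiv> (\<lambda>i. if i = k then 1 else 0 :: ratf)"

lemma mv_evec: "k < d \<Longrightarrow> mv d A (evec k) = (\<lambda>i. A i k)"
  by (simp add: mv_def if_distrib[of "\<lambda>x. _ * x"] sum.delta cong: if_cong)

lemma evec_vecs: "k < d \<Longrightarrow> evec k \<in> vecs {..<d}"
  by (auto simp: vecs_def)

lemma mv_vecs: "trunc d e A \<Longrightarrow> mv k A u \<in> vecs {..<d}"
  by (auto simp: vecs_def mv_def trunc_def)

lemma mv_zero [simp]: "mv d A (\<lambda>_. 0) = (\<lambda>_. 0)"
  by (simp add: mv_def)

lemma kernel_invariant:
  assumes "inter n d X e Y Z"
  shows "invariant_subspace n {..<e} Y {u \<in> vecs {..<e}. mv e Z u = (\<lambda>_. 0)}"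
  unfolding invariant_subspace_def
proof (intro conjI ballI allI)
  fix w u assume w: "w \<in> Sym n" and u: "u \<in> {u \<in> vecs {..<e}. mv e Z u = (\<lambda>_. 0)}"
  have "mv e Z (mv e (Mx e Y w) u) = mv d (Mx d X w) (mv e Z u)"
    using assms w by (simp add: inter_def flip: mm_mv)
  with u show "act {..<e} (Y w) u \<in> {u \<in> vecs {..<e}. mv e Z u = (\<lambda>_. 0)}"
    by (simp add: act_eq mv_vecs[OF trunc_Mx])
qed (auto simp: vecs_def mv_lin)

lemma image_invariant:
  assumes "inter n d X e Y Z"
  shows "invariant_subspace n {..<d} X (mv e Z ` vecs {..<e})"
  unfolding invariant_subspace_def
proof (intro conjI ballI allI)
  have Z: "trunc d e Z" using assms by (simp add: inter_def)
  show "mv e Z ` vecs {..<e} \<subseteq> vecs {..<d}" using mv_vecs[OF Z] by auto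
  show "(\<lambda>_. 0) \<in> mv e Z ` vecs {..<e}" by (rule image_eqI[of _ _ "\<lambda>_. 0"]) (auto simp: vecs_def)
  fix x assume x: "x \<in> mv e Z ` vecs {..<e}"
  then obtain u where u: "u \<in> vecs {..<e}" "x = mv e Z u" by auto
  show "(\<lambda>i. c * x i) \<in> mv e Z ` vecs {..<e}" for c
    using u by (intro image_eqI[of _ _ "\<lambda>i. c * u i"]) (auto simp: mv_lin vecs_def)
  show "(\<lambda>i. x i + y i) \<in> mv e Z ` vecs {..<e}" if "y \<in> mv e Z ` vecs {..<e}" for y
  proof -
    from that obtain u' where u': "u' \<in> vecs {..<e}" "y = mv e Z u'" by auto
    then show ?thesis using u by (intro image_eqI[of _ _ "\<lambda>i. u i + u' i"]) (auto simp: mv_lin vecs_def)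
  qed
  show "act {..<d} (X w) x \<in> mv e Z ` vecs {..<e}" if w: "w \<in> Sym n" for w
  proof -
    have "act {..<d} (X w) x = mv e Z (mv e (Mx e Y w) u)"
      using assms w u by (simp add: inter_def act_eq flip: mm_mv)
    then show ?thesis using mv_vecs[OF trunc_Mx] by blast
  qed
qed

lemma schur_inj:
  assumes "irreducible_rep n {..<e} Y" "inter n d X e Y Z" "Z \<noteq> (\<lambda>_ _. 0)"
    "u \<in> vecs {..<e}" "mv e Z u = (\<lambda>_. 0)"
  shows "u = (\<lambda>_. 0)"
proof -
  have "{u \<in> vecs {..<e}. mv e Z u = (\<lambda>_. 0)} \<noteq> vecs {..<e}"
  proof
    assume a: "{u \<in> vecs {..<e}. mv e Z u = (\<lambda>_. 0)} = vecs {..<e}"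
    have "Z i k = 0" for i k
    proof (cases "k < e")
      case True
      then have "mv e Z (evec k) = (\<lambda>_. 0)" using a evec_vecs[of k e] by blast
      then show ?thesis using mv_evec[OF True, of Z] by metis
    next
      case False
      then show ?thesis using assms(2) by (simp add: inter_def trunc_def)
    qed
    with assms(3) show False by auto
  qed
  then have "{u \<in> vecs {..<e}. mv e Z u = (\<lambda>_. 0)} = {\<lambda>_. 0}"
    using assms(1) kernel_invariant[OF assms(2)] unfolding irreducible_rep_def by blast
  then show ?thesis using assms(4,5) by blast
qed

text \<open>The image of \<open>Z\<close> is a nonzero invariant subspace, so \<open>Z\<close> is
  bijective; \<open>W\<close> is its inverse matrix, and the traces agree by conjugation.\<close>

lemma schur_char:
  assumes irr: "irreducible_rep n {..<d} X" and Z: "inter n d X e Y Z" and "e > 0"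
    and inj: "\<And>u. u \<in> vecs {..<e} \<Longrightarrow> mv e Z u = (\<lambda>_. 0) \<Longrightarrow> u = (\<lambda>_. 0)" and w: "w \<in> Sym n"
  shows "(\<Sum>i<d. Mx d X w i i) = (\<Sum>i<e. Mx e Y w i i)"
proof -
  have Zt: "trunc d e Z" using Z by (simp add: inter_def)
  have "mv e Z (evec 0) \<noteq> (\<lambda>_. 0)"
    using inj[OF evec_vecs[OF assms(3)]] by (metis zero_neq_one)
  moreover have "mv e Z (evec 0) \<in> mv e Z ` vecs {..<e}" using evec_vecs[OF assms(3)] by blast
  ultimately have surj: "mv e Z ` vecs {..<e} = vecs {..<d}"
    using irr image_invariant[OF Z] unfolding irreducible_rep_def by blast
  have "\<exists>u\<in>vecs {..<e}. mv e Z u = evec k" if "k < d" for k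
    using surj evec_vecs[OF that] by (metis (no_types, lifting) imageE)
  then obtain U where U: "U k \<in> vecs {..<e}" "mv e Z (U k) = evec k" if "k < d" for k by metis
  define W where "W = (\<lambda>i k. if k < d then U k i else 0)"
  have Wt: "trunc e d W" using U(1) by (auto simp: trunc_def W_def vecs_def)
  have ZW: "mm e Z W = idm d"
  proof (intro ext)
    fix i k
    show "mm e Z W i k = idm d i k"
    proof (cases "k < d")
      case True
      then have "mm e Z W i k = mv e Z (U k) i" by (simp add: mm_def mv_def W_def)
      then show ?thesis using U(2)[OF True] True by (auto simp: idm_def)
    qed (simp add: mm_def W_def idm_def)
  qed
  have WZ: "mm d W Z = idm e"
  proof (intro ext)
    fix i k
    show "mm d W Z i k = idm e i k"
    proof (cases "k < e")
      case True
      define u where "u = (\<lambda>i. mm d W Z i k - idm e i k)"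
      have "u \<in> vecs {..<e}" using Wt by (auto simp: u_def vecs_def mm_def trunc_def idm_def)
      moreover have "mv e Z u = (\<lambda>_. 0)"
      proof
        fix i
        have "mv e Z u i = mm e Z (mm d W Z) i k - mm e Z (idm e) i k"
          by (simp add: mv_def u_def mm_def algebra_simps sum_subtractf)
        also have "mm e Z (mm d W Z) = Z" using ZW mm_idm(1)[OF Zt] by (simp flip: mm_assoc)
        finally show "mv e Z u i = 0" using mm_idm(2)[OF Zt] by simp
      qed
      ultimately have "u = (\<lambda>_. 0)" by (rule inj)
      then show ?thesis unfolding u_def by (metis eq_iff_diff_eq_0)
    next
      case False
      then show ?thesis using Zt by (auto simp: mm_def trunc_def idm_def)
    qed
  qed
  have "Mx d X w = mm d (Mx d X w) (mm e Z W)" using ZW mm_idm(2)[OF trunc_Mx] by simp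
  also have "\<dots> = mm e (mm e Z (Mx e Y w)) W" using Z w by (simp add: inter_def flip: mm_assoc)
  finally have "(\<Sum>i<d. Mx d X w i i) = (\<Sum>i<d. mm e (mm e Z (Mx e Y w)) W i i)" by simp
  also have "\<dots> = (\<Sum>k<e. mm d W (mm e Z (Mx e Y w)) k k)" by (rule mm_tr)
  also have "mm d W (mm e Z (Mx e Y w)) = Mx e Y w"
    using WZ mm_idm(1)[OF trunc_Mx] by (simp flip: mm_assoc)
  finally show ?thesis .
qed

text \<open>The bases \<open>T_w\<close> and \<open>T_(w^-1)\<close> are dual for the symmetrizing
  trace. Moving \<open>T_x\<close> from one tensor factor to the other is the adjunction
  \<open>adj\<close> followed by an application of \<open>flat\<close>.\<close>

lemma inter_average:
  assumes X: "is_rep n {..<d} X" and Y: "is_rep n {..<e} Y" and "j < d" "k < e"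
  shows "inter n d X e Y (\<lambda>i l. \<Sum>w\<in>Sym n. Mx d X w i j * Mx e Y (inv w) k l)"
  unfolding inter_def
proof (intro conjI ballI ext)
  show "trunc d e (\<lambda>i l. \<Sum>w\<in>Sym n. Mx d X w i j * Mx e Y (inv w) k l)"
    by (auto simp: trunc_def Mx_def)
  fix x i l assume x: "x \<in> Sym n"
  have adj: "mulT n deltaK x (Tb w) z = mulT n deltaK (inv x) (Tb z) w" if "w \<in> Sym n" "z \<in> Sym n" for w z
    using mulT_adjoint[of x n "Tb z" deltaK "Tb w"] x that by (simp add: sum_mult_Tb mult.commute[of "Tb w _"])
  have "mm d (Mx d X x) (\<lambda>i l. \<Sum>w\<in>Sym n. Mx d X w i j * Mx e Y (inv w) k l) i l =
     (\<Sum>m<d. \<Sum>w\<in>Sym n. Mx d X x i m * Mx d X w m j * Mx e Y (inv w) k l)"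
    by (simp add: mm_def sum_distrib_left mult.assoc)
  also have "\<dots> = (\<Sum>w\<in>Sym n. mm d (Mx d X x) (Mx d X w) i j * Mx e Y (inv w) k l)"
    by (subst sum.swap) (simp add: mm_def sum_distrib_right)
  also have "\<dots> = (\<Sum>w\<in>Sym n. \<Sum>z\<in>Sym n. mulT n deltaK x (Tb w) z * Mx d X z i j * Mx e Y (inv w) k l)"
    using x X by (intro sum.cong) (simp_all add: rep_mult, simp add: ev_def sum_distrib_right)
  also have "\<dots> = (\<Sum>z\<in>Sym n. \<Sum>w\<in>Sym n. Mx d X z i j * (mulT n deltaK (inv x) (Tb z) w * Mx e Y (inv w) k l))"
    by (subst sum.swap) (auto intro!: sum.cong simp: adj)
  also have "\<dots> = (\<Sum>z\<in>Sym n. Mx d X z i j * (\<Sum>w\<in>Sym n. mulT n deltaK (inv x) (Tb z) w * Mx e Y (inv w) k l))"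
    by (simp add: sum_distrib_left)
  also have "\<dots> = (\<Sum>z\<in>Sym n. Mx d X z i j * mm e (Mx e Y (inv z)) (Mx e Y x) k l)"
  proof (rule sum.cong[OF refl])
    fix z assume z: "z \<in> Sym n"
    have "(\<Sum>w\<in>Sym n. mulT n deltaK (inv x) (Tb z) w * Mx e Y (inv w) k l) =
       (\<Sum>w\<in>Sym n. flat n (mulT n deltaK (inv x) (Tb z)) (inv w) * Mx e Y (inv w) k l)"
      by (rule sum.cong) (auto simp: flat_def)
    also have "\<dots> = (\<Sum>w\<in>Sym n. flat n (mulT n deltaK (inv x) (Tb z)) w * Mx e Y w k l)"
      by (rule sum_Sym_inv)
    also have "flat n (mulT n deltaK (inv x) (Tb z)) = mulT n deltaK (inv z) (Tb x)"
      using x z by (simp add: flat_mulT flat_Tb rmulT_Tb)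
    finally show "Mx d X z i j * (\<Sum>w\<in>Sym n. mulT n deltaK (inv x) (Tb z) w * Mx e Y (inv w) k l) =
      Mx d X z i j * mm e (Mx e Y (inv z)) (Mx e Y x) k l"
      using rep_mult[OF Y, of "inv z" x] x z by (simp add: ev_def)
  qed
  also have "\<dots> = (\<Sum>z\<in>Sym n. \<Sum>m<e. Mx d X z i j * Mx e Y (inv z) k m * Mx e Y x m l)"
    by (simp add: mm_def sum_distrib_left mult.assoc)
  also have "\<dots> = mm e (\<lambda>i l. \<Sum>w\<in>Sym n. Mx d X w i j * Mx e Y (inv w) k l) (Mx e Y x) i l"
    by (subst sum.swap) (simp add: mm_def sum_distrib_right)
  finally show "mm d (Mx d X x) (\<lambda>i l. \<Sum>w\<in>Sym n. Mx d X w i j * Mx e Y (inv w) k l) i l =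
    mm e (\<lambda>i l. \<Sum>w\<in>Sym n. Mx d X w i j * Mx e Y (inv w) k l) (Mx e Y x) i l" .
qed

lemma schur_zero:
  assumes "irreducible_rep n {..<d} X" "irreducible_rep n {..<e} Y"
    "hk_char n {..<d} X \<noteq> hk_char n {..<e} Y"
  shows "(\<Sum>w\<in>Sym n. Mx d X w i j * Mx e Y (inv w) k l) = 0"
proof (cases "j < d \<and> k < e")
  case True
  define Z where "Z = (\<lambda>i l. \<Sum>w\<in>Sym n. Mx d X w i j * Mx e Y (inv w) k l)"
  have Z: "inter n d X e Y Z"
    unfolding Z_def using True assms by (intro inter_average) (auto simp: irreducible_rep_def)
  have "Z = (\<lambda>_ _. 0)"
  proof (rule ccontr)
    assume nz: "Z \<noteq> (\<lambda>_ _. 0)"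
    have "e > 0" using True by simp
    have "(\<Sum>i<d. Mx d X w i i) = (\<Sum>i<e. Mx e Y w i i)" if "w \<in> Sym n" for w
      using schur_char[OF assms(1) Z \<open>e > 0\<close> schur_inj[OF assms(2) Z nz] that] by blast
    then have "hk_char n {..<d} X = hk_char n {..<e} Y" by (auto simp: hk_char_eq fun_eq_iff)
    with assms(3) show False by simp
  qed
  then show ?thesis unfolding Z_def by metis
next
  case False
  then show ?thesis by (auto simp: Mx_def intro!: sum.neutral)
qed

text \<open>Absolute irreducibility in the form used for Schur's relations. Over this field, which
  is not algebraically closed, it has to be established separately; see
  \<open>all_scalar_endos\<close>.\<close>

definition scalar_endos :: "nat \<Rightarrow> nat \<Rightarrow> (perm \<Rightarrow> nat \<Rightarrow> nat \<Rightarrow> ratf) \<Rightarrow> bool" where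
  "scalar_endos n d X \<longleftrightarrow> (\<forall>Z. inter n d X d X Z \<longrightarrow> (\<exists>c. Z = (\<lambda>i j. c * idm d i j)))"

definition schur_elt :: "nat \<Rightarrow> (perm \<Rightarrow> nat \<Rightarrow> nat \<Rightarrow> ratf) \<Rightarrow> ratf" where
  "schur_elt n X = (\<Sum>w\<in>Sym n. X w 0 0 * X (inv w) 0 0)"

text \<open>For fixed \<open>j\<close> and \<open>k\<close> the averaged matrix is scalar. Replacing
  \<open>w\<close> by its inverse exchanges the two index pairs, so the same holds for fixed
  \<open>i\<close> and \<open>l\<close>; together these leave a single constant.\<close>

lemma schur_rel:
  assumes X: "is_rep n {..<d} X" and sc: "scalar_endos n d X" and ijkl: "i < d" "j < d" "k < d" "l < d"
  shows "(\<Sum>w\<in>Sym n. Mx d X w i j * Mx d X (inv w) k l) = (if i = l \<and> j = k then schur_elt n X else 0)"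
proof -
  define S where "S = (\<lambda>i j k l. \<Sum>w\<in>Sym n. Mx d X w i j * Mx d X (inv w) k l)"
  have sym: "S i j k l = S k l i j" for i j k l
  proof -
    have "S i j k l = (\<Sum>w\<in>Sym n. Mx d X (inv w) i j * Mx d X (inv (inv w)) k l)"
      unfolding S_def by (rule sum_Sym_inv[symmetric])
    also have "\<dots> = S k l i j" unfolding S_def by (rule sum.cong) (auto simp: mult.commute)
    finally show ?thesis .
  qed
  have "\<exists>c. (\<lambda>i l. S i j k l) = (\<lambda>i l. c * idm d i l)" if "j < d" "k < d" for j k
    using sc inter_average[OF X X that] unfolding scalar_endos_def S_def by blast
  then obtain z where z: "S i j k l = z j k * idm d i l" if "j < d" "k < d" for i j k l
    by metis
  have "S i j k l = (if i = l \<and> j = k then S 0 0 0 0 else 0)"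
  proof (cases "i = l \<and> j = k")
    case True
    have d0: "0 < d" using ijkl by simp
    have zz: "z a a = z 0 0" if "a < d" for a
      using z[OF that that, of 0 0] sym[of 0 a a 0] z[OF d0 d0, of a a] d0 that by (simp add: idm_def)
    show ?thesis using True z[OF ijkl(2,3), of i l] zz[OF ijkl(2)] z[OF d0 d0, of 0 0] ijkl d0 by (simp add: idm_def)
  next
    case False
    then show ?thesis using z[OF ijkl(2,3), of i l] sym[of i j k l] z[OF ijkl(4,1), of k j] by (auto simp: idm_def)
  qed
  moreover have "S 0 0 0 0 = schur_elt n X" using ijkl by (simp add: S_def schur_elt_def Mx_def)
  ultimately show ?thesis by (simp add: S_def)
qed

section \<open>Faithfulness of the sum of all irreducible representations\<close>

declare o_apply [simp] id_apply [simp] foldr.simps [simp]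

abbreviation (input) scl :: "ratf \<Rightarrow> (perm \<Rightarrow> ratf) \<Rightarrow> perm \<Rightarrow> ratf" where
  "scl c f \<equiv> (\<lambda>y. c * f y)"

interpretation V: vector_space scl
  by unfold_locales (auto simp: plus_fun_def algebra_simps)

lemma sum_fun_apply: "(\<Sum>i\<in>A. f i) y = (\<Sum>i\<in>A. f i y)"
  by (induction A rule: infinite_finite_induct) (auto simp: plus_fun_def zero_fun_def)

lemma span_Tb: assumes "supp_in n f" shows "f \<in> V.span (Tb ` Sym n)"
proof -
  have "f = (\<Sum>x\<in>Sym n. scl (f x) (Tb x))"
    by (rule ext) (simp add: sum_fun_apply Tb_sum[OF assms])
  also have "\<dots> \<in> V.span (Tb ` Sym n)"
    by (intro V.span_sum V.span_scale V.span_base) auto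
  finally show ?thesis .
qed

text \<open>A nonzero stable subspace of least dimension is irreducible, and the matrices in one of
  its bases form the representation \<open>Y\<close>.\<close>

lemma irreducible_submodule:
  assumes N: "V.subspace N" "\<And>f. f \<in> N \<Longrightarrow> supp_in n f"
    "\<And>w f. w \<in> Sym n \<Longrightarrow> f \<in> N \<Longrightarrow> mulT n deltaK w f \<in> N" "f0 \<in> N" "f0 \<noteq> 0"
  shows "\<exists>k Y e. irreducible_rep n {..<k::nat} Y \<and> (\<forall>j<k. e j \<in> N \<and> e j \<noteq> 0) \<and>
    (\<forall>w\<in>Sym n. \<forall>j<k. mulT n deltaK w (e j) = (\<lambda>y. \<Sum>i<k. Y w i j * e i y))"
proof -
  define stab where "stab = (\<lambda>U. V.subspace U \<and> U \<subseteq> N \<and> (\<exists>f\<in>U. f \<noteq> 0) \<and>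
     (\<forall>w\<in>Sym n. \<forall>f\<in>U. mulT n deltaK w f \<in> U))"
  define P where "P = (\<lambda>k. \<exists>U B. stab U \<and> finite B \<and> V.independent B \<and> V.span B = U \<and> card B = k)"
  have basis: "\<exists>B. finite B \<and> V.independent B \<and> V.span B = U" if "stab U" for U
  proof -
    obtain B where B: "B \<subseteq> U" "V.independent B" "U \<subseteq> V.span B" using V.maximal_independent_subset[of U] by blast
    have "B \<subseteq> V.span (Tb ` Sym n)" using B(1) that span_Tb N(2) by (auto simp: stab_def)
    then have "finite B" using V.independent_span_bound[OF _ B(2), of "Tb ` Sym n"] by simp
    moreover have "V.span B = U" using B that V.span_minimal[OF B(1)] by (auto simp: stab_def)
    ultimately show ?thesis using B by blast
  qed
  have "stab N" unfolding stab_def using N by blast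
  then have "\<exists>k. P k" unfolding P_def using basis by blast
  then obtain k where k: "P k" "\<And>k'. P k' \<Longrightarrow> k \<le> k'" using exists_least_iff[of P] by (metis not_le)
  then obtain U B where U: "stab U" and B: "finite B" "V.independent B" "V.span B = U" "card B = k"
    by (auto simp: P_def)
  obtain e where e: "bij_betw e {..<k} B"
    using ex_bij_betw_nat_finite[OF B(1)] B(4) by (auto simp: atLeast0LessThan)
  have eB: "e j \<in> B" if "j < k" for j using e that by (auto simp: bij_betw_def)
  have eU: "e j \<in> U" if "j < k" for j using eB[OF that] B(3) V.span_base by blast
  define r where "r = (\<lambda>f i. V.representation B f (e i))"
  have rep: "f = (\<lambda>y. \<Sum>i<k. r f i * e i y)" if "f \<in> U" for f
  proof -
    have "f = (\<Sum>b\<in>B. scl (V.representation B f b) b)"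
      using V.sum_representation_eq[OF B(2) _ B(1)] that B(3) by auto
    also have "\<dots> = (\<Sum>i<k. scl (r f i) (e i))"
      unfolding r_def by (rule sum.reindex_bij_betw[OF e, symmetric])
    finally show ?thesis by (auto simp: sum_fun_apply fun_eq_iff)
  qed
  have uniq: "\<forall>i<k. u i = 0" if "(\<lambda>y. \<Sum>i<k. u i * e i y) = (\<lambda>_. 0)" for u
  proof (rule ccontr)
    assume "\<not> (\<forall>i<k. u i = 0)"
    then obtain i where i: "i < k" "u i \<noteq> 0" by blast
    define c where "c = (\<lambda>b. u (the_inv_into {..<k} e b))"
    have ce: "c (e j) = u j" if "j < k" for j
      using that e by (simp add: c_def the_inv_into_f_f bij_betw_def)
    have "(\<Sum>b\<in>B. scl (c b) b) = (\<Sum>j<k. scl (c (e j)) (e j))" by (rule sum.reindex_bij_betw[OF e, symmetric])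
    also have "\<dots> = (\<lambda>y. \<Sum>j<k. u j * e j y)" by (rule ext) (simp add: sum_fun_apply ce)
    finally have "(\<Sum>b\<in>B. scl (c b) b) = 0" using that by (simp add: zero_fun_def)
    then have "c (e i) = 0" using V.independentD[OF B(2,1) subset_refl _ eB[OF i(1)], of c] by blast
    with ce i show False by simp
  qed
  have runiq: "r f i = u i" if "f = (\<lambda>y. \<Sum>i<k. u i * e i y)" "f \<in> U" "i < k" for f u i
  proof -
    have "(\<lambda>y. \<Sum>i<k. (r f i - u i) * e i y) = (\<lambda>y. f y - f y)"
      unfolding left_diff_distrib sum_subtractf using rep[OF that(2)] that(1) by metis
    then show ?thesis using uniq[of "\<lambda>i. r f i - u i"] that(3) by simp
  qed
  have st: "mulT n deltaK w f \<in> U" if "w \<in> Sym n" "f \<in> U" for w f using U that by (simp add: stab_def)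
  have US: "supp_in n f" if "f \<in> U" for f using U N(2) that by (auto simp: stab_def)
  define Y where "Y = (\<lambda>w i j. r (mulT n deltaK w (e j)) i)"
  have Ye: "mulT n deltaK w (e j) = (\<lambda>y. \<Sum>i<k. Y w i j * e i y)" if "w \<in> Sym n" "j < k" for w j
    unfolding Y_def using rep[OF st[OF that(1) eU[OF that(2)]]] .
  have Yc: "mulT n deltaK w (\<lambda>y. \<Sum>j<k. u j * e j y) = (\<lambda>y. \<Sum>i<k. (\<Sum>j<k. Y w i j * u j) * e i y)"
    if "w \<in> Sym n" for w u
  proof
    fix y
    have "mulT n deltaK w (\<lambda>y. \<Sum>j<k. u j * e j y) y = (\<Sum>j<k. u j * (\<Sum>i<k. Y w i j * e i y))"
      using lin_sum[OF lin_mulT, of "{..<k}" n deltaK w u e] Ye[OF that] by simp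
    also have "\<dots> = (\<Sum>j<k. \<Sum>i<k. Y w i j * u j * e i y)" by (simp add: sum_distrib_left algebra_simps)
    also have "\<dots> = (\<Sum>i<k. \<Sum>j<k. Y w i j * u j * e i y)" by (rule sum.swap)
    finally show "mulT n deltaK w (\<lambda>y. \<Sum>j<k. u j * e j y) y = (\<Sum>i<k. (\<Sum>j<k. Y w i j * u j) * e i y)"
      by (simp add: sum_distrib_right)
  qed
  have rp: "is_rep n {..<k} Y"
    unfolding is_rep_def
  proof (intro conjI ballI)
    fix i j assume ij: "i \<in> {..<k}" "j \<in> {..<k}"
    have ej: "e j = (\<lambda>y. \<Sum>i<k. (if i = j then 1 else 0) * e i y)"
      using ij by (simp add: if_distrib[of "\<lambda>x. x * _"] sum.delta cong: if_cong)
    have "r (e j) i = (if i = j then 1 else 0)"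
      by (rule runiq[OF ej]) (use eU ij in auto)
    then show "Y id i j = (if i = j then 1 else 0)" by (simp add: Y_def)
    fix s w assume s: "s \<in> sgens n" and w: "w \<in> Sym n"
    have sS: "s \<in> Sym n" using s by simp
    have swS: "s \<circ> w \<in> Sym n" using s w by simp
    define f where "f = mulT n deltaK s (mulT n deltaK w (e j))"
    have fU: "f \<in> U" unfolding f_def using eU ij st sS w by auto
    have "f = (\<lambda>y. \<Sum>i<k. matmul {..<k} (Y s) (Y w) i j * e i y)"
      unfolding f_def matmul_def using Yc[OF sS, of "\<lambda>m. Y w m j"] Ye[OF w, of j] ij by simp
    then have a: "r f i = matmul {..<k} (Y s) (Y w) i j"
      using runiq[OF _ fU, of "\<lambda>i. matmul {..<k} (Y s) (Y w) i j" i] ij by simp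
    have es: "supp_in n (e j)" using US eU ij by simp
    have fs: "f = mulTs n deltaK s (mulT n deltaK w (e j))"
      unfolding f_def using mulT_sgen[OF s supp_mulT[OF w es]] .
    show "matmul {..<k} (Y s) (Y w) i j = (if len n w < len n (s \<circ> w) then Y (s \<circ> w) i j
           else Y (s \<circ> w) i j + deltaK * Y w i j)"
    proof (cases "len n w < len n (s \<circ> w)")
      case True
      then have "f = mulT n deltaK (s \<circ> w) (e j)" using mulT_up[OF s w True es] fs by simp
      then show ?thesis using a True by (simp add: Y_def)
    next
      case False
      then have lt: "len n (s \<circ> w) < len n (s \<circ> (s \<circ> w))" using len_left_cases[OF w s] s by auto
      from mulT_up[OF s swS lt es] have e1: "mulT n deltaK w (e j) = mulTs n deltaK s (mulT n deltaK (s \<circ> w) (e j))"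
        using s by simp
      have "f = (\<lambda>y. mulT n deltaK (s \<circ> w) (e j) y + deltaK * mulT n deltaK w (e j) y)"
        unfolding fs e1 using mulTs_mulTs[OF s, of "mulT n deltaK (s \<circ> w) (e j)"] es swS by simp
      also have "\<dots> = (\<lambda>y. \<Sum>i<k. (Y (s \<circ> w) i j + deltaK * Y w i j) * e i y)"
        using Ye[OF swS, of j] Ye[OF w, of j] ij
        by (simp add: distrib_right sum.distrib sum_distrib_left mult.assoc)
      finally have "r f i = Y (s \<circ> w) i j + deltaK * Y w i j"
        using runiq[OF _ fU, of "\<lambda>i. Y (s \<circ> w) i j + deltaK * Y w i j" i] ij by simp
      then show ?thesis using a False by simp
    qed
  qed simp
  have "irreducible_rep n {..<k} Y"
    unfolding irreducible_rep_def
  proof (intro conjI allI impI)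
    show "is_rep n {..<k} Y" by (rule rp)
    show "{..<k} \<noteq> {}"
    proof
      assume "{..<k} = {}"
      then have "k = 0" by (metis empty_iff gr0I lessThan_iff)
      then have "B = {}" using B by simp
      then show False using U B(3) by (auto simp: stab_def)
    qed
    fix W assume W: "invariant_subspace n {..<k} Y W"
    show "W = {\<lambda>_. 0} \<or> W = vecs {..<k}"
    proof (cases "W = {\<lambda>_. 0}")
      case False
      have W0: "(\<lambda>_. 0) \<in> W" "W \<subseteq> vecs {..<k}" using W by (auto simp: invariant_subspace_def)
      then obtain u0 where u0: "u0 \<in> W" "u0 \<noteq> (\<lambda>_. 0)" using False by blast
      \<comment> \<open>An invariant subspace \<open>W\<close> of coordinate vectors corresponds to
        the stable subspace \<open>U'\<close> of the algebra; minimality of \<open>k\<close> makes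
        \<open>U'\<close> all of \<open>U\<close>.\<close>
      define cmb where "cmb = (\<lambda>u y. \<Sum>i<k. u i * e i y)"
      define U' where "U' = cmb ` W"
      have cmbU: "cmb u \<in> U" for u
      proof -
        have "cmb u = (\<Sum>i<k. scl (u i) (e i))" by (rule ext) (simp add: sum_fun_apply cmb_def)
        also have "\<dots> \<in> V.span B" using eB by (intro V.span_sum V.span_scale V.span_base) auto
        finally show ?thesis using B(3) by simp
      qed
      have sub: "V.subspace U'"
      proof (rule V.subspaceI)
        show "0 \<in> U'" unfolding U'_def
          by (rule image_eqI[OF _ W0(1)]) (auto simp: cmb_def zero_fun_def)
        fix f g assume "f \<in> U'" "g \<in> U'"
        then obtain u u' where u: "f = cmb u" "g = cmb u'" "u \<in> W" "u' \<in> W" by (auto simp: U'_def)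
        then show "f + g \<in> U'" unfolding U'_def
          by (intro image_eqI[of _ _ "\<lambda>i. u i + u' i"])
            (use W in \<open>auto simp: cmb_def plus_fun_def distrib_right sum.distrib invariant_subspace_def\<close>)
      next
        fix c f assume "f \<in> U'"
        then obtain u where u: "f = cmb u" "u \<in> W" by (auto simp: U'_def)
        then show "scl c f \<in> U'" unfolding U'_def
          by (intro image_eqI[of _ _ "\<lambda>i. c * u i"])
            (use W in \<open>auto simp: cmb_def sum_distrib_left mult.assoc invariant_subspace_def\<close>)
      qed
      have "stab U'" unfolding stab_def
      proof (intro conjI ballI)
        show "U' \<subseteq> N" using cmbU U by (auto simp: U'_def stab_def)
        show "\<exists>f\<in>U'. f \<noteq> 0"
        proof (rule bexI[of _ "cmb u0"])
          show "cmb u0 \<noteq> 0"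
          proof
            assume "cmb u0 = 0"
            then have "\<forall>i<k. u0 i = 0" using uniq[of u0] by (simp add: cmb_def zero_fun_def)
            then have "u0 i = 0" for i using W0 u0(1) by (cases "i < k") (auto simp: vecs_def)
            then show False using u0(2) by auto
          qed
        qed (use u0 in \<open>simp add: U'_def\<close>)
        fix w f assume w: "w \<in> Sym n" and "f \<in> U'"
        then obtain u where u: "f = cmb u" "u \<in> W" by (auto simp: U'_def)
        have "act {..<k} (Y w) u \<in> W" using W w u by (auto simp: invariant_subspace_def)
        moreover have "mulT n deltaK w f = cmb (act {..<k} (Y w) u)"
          unfolding u cmb_def Yc[OF w] by (simp add: act_def)
        ultimately show "mulT n deltaK w f \<in> U'" by (simp add: U'_def)
      qed (rule sub)
      then obtain B' where B': "finite B'" "V.independent B'" "V.span B' = U'" using basis by blast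
      then have "P (card B')" using \<open>stab U'\<close> by (auto simp: P_def)
      then have kB': "k \<le> card B'" using k(2) by blast
      have "U \<subseteq> U'"
      proof
        fix x assume x: "x \<in> U"
        show "x \<in> U'"
        proof (rule ccontr)
          assume nx: "x \<notin> U'"
          then have "V.independent (insert x B')" using B' V.independent_insert[of x B'] by simp
          moreover have "insert x B' \<subseteq> V.span B"
            using x B(3) B'(3) V.span_superset[of B'] cmbU by (auto simp: U'_def)
          ultimately have "card (insert x B') \<le> card B" using V.independent_span_bound[OF B(1)] by blast
          moreover have "x \<notin> B'" using nx B'(3) V.span_base by blast
          ultimately show False using kB' B(4) B'(1) by simp
        qed
      qed
      have "vecs {..<k} \<subseteq> W"
      proof
        fix u assume u: "u \<in> vecs {..<k}"
        have "cmb u \<in> U'" using cmbU \<open>U \<subseteq> U'\<close> by blast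
        then obtain u' where u': "u' \<in> W" "cmb u = cmb u'" by (auto simp: U'_def)
        have "(\<lambda>y. \<Sum>i<k. (u i - u' i) * e i y) = (\<lambda>_. 0)"
          using fun_cong[OF u'(2)] by (auto simp: cmb_def left_diff_distrib sum_subtractf)
        then have "\<forall>i<k. u i - u' i = 0" using uniq[of "\<lambda>i. u i - u' i"] by blast
        moreover have "u' \<in> vecs {..<k}" using u' W0 by blast
        ultimately have "u = u'" using u by (intro ext) (metis (mono_tags, lifting) eq_iff_diff_eq_0 lessThan_iff mem_Collect_eq vecs_def)
        with u' show "u \<in> W" by simp
      qed
      with W0 show ?thesis by blast
    qed simp
  qed
  moreover have "e j \<in> N" "e j \<noteq> 0" if "j < k" for j
    using eU[OF that] U eB[OF that] B(2) V.dependent_zero[of B] by (auto simp: stab_def)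
  ultimately show ?thesis using Ye by (intro exI[of _ k] exI[of _ Y] exI[of _ e]) simp
qed

text \<open>\<open>ratf\<close> is an ordered field, so squares are nonnegative. This formal reality
  plays the part of a positive definite form.\<close>

lemma sum_squares_zero:
  fixes f :: "'a \<Rightarrow> ratf"
  assumes "finite A" "(\<Sum>x\<in>A. f x * f x) = 0" "x \<in> A" shows "f x = 0"
  using sum_nonneg_eq_0_iff[OF assms(1), of "\<lambda>x. f x * f x"] assms by simp

text \<open>The joint kernel \<open>N\<close> is stable under left multiplication and under
  \<open>flat\<close>. A minimal submodule of \<open>N\<close> has the character of some
  \<open>X la\<close> and is therefore annihilated by \<open>N\<close>. For its basis vector
  \<open>e 0\<close> the product of \<open>flat n (e 0)\<close> with \<open>e 0\<close> is then
  zero, although its coefficient at \<open>id\<close> is a sum of squares.\<close>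

lemma faithful:
  assumes irr: "\<And>la. la \<in> L \<Longrightarrow> irreducible_rep n {..<d la} (X la)"
    and all: "\<And>\<chi>. irr_char n \<chi> \<Longrightarrow> \<exists>la\<in>L. \<chi> = hk_char n {..<d la} (X la)"
    and orth: "\<And>la w i j. la \<in> L \<Longrightarrow> w \<in> Sym n \<Longrightarrow> i < d la \<Longrightarrow> j < d la \<Longrightarrow>
       X la (inv w) i j = p la j * X la w j i / p la i"
    and pnz: "\<And>la i. la \<in> L \<Longrightarrow> i < d la \<Longrightarrow> p la i \<noteq> 0"
    and h: "supp_in n h" "\<And>la. la \<in> L \<Longrightarrow> ev n (d la) (X la) h = (\<lambda>_ _. 0)"
  shows "h = (\<lambda>_. 0)"
proof (rule ccontr)
  assume hnz: "h \<noteq> (\<lambda>_. 0)"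
  define N where "N = {f. supp_in n f \<and> (\<forall>la\<in>L. ev n (d la) (X la) f = (\<lambda>_ _. 0))}"
  have rep: "is_rep n {..<d la} (X la)" if "la \<in> L" for la using irr[OF that] by (simp add: irreducible_rep_def)
  have ev0: "ev n (d la) (X la) (\<lambda>_. 0) = (\<lambda>_ _. 0)" for la by (simp add: ev_def)
  have sub: "V.subspace N"
    by (rule V.subspaceI) (auto simp: N_def ev_lin ev0 plus_fun_def zero_fun_def supp_in_def)
  have Nflat: "flat n f \<in> N" if "f \<in> N" for f
  proof -
    have "ev n (d la) (X la) (flat n f) i j = 0" if la: "la \<in> L" for la i j
    proof (cases "i < d la \<and> j < d la")
      case True
      have "ev n (d la) (X la) (flat n f) i j = (\<Sum>w\<in>Sym n. flat n f (inv w) * Mx (d la) (X la) (inv w) i j)"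
        unfolding ev_def by (rule sum_Sym_inv[symmetric])
      also have "\<dots> = (\<Sum>w\<in>Sym n. p la j / p la i * (f w * Mx (d la) (X la) w j i))"
        by (rule sum.cong) (use True orth[OF la] in \<open>auto simp: flat_def Mx_def\<close>)
      also have "\<dots> = p la j / p la i * ev n (d la) (X la) f j i" by (simp add: ev_def sum_distrib_left)
      also have "\<dots> = 0" using \<open>f \<in> N\<close> la by (simp add: N_def)
      finally show ?thesis .
    next
      case False
      then show ?thesis using trunc_ev unfolding trunc_def by blast
    qed
    then show ?thesis by (simp add: N_def fun_eq_iff)
  qed
  have mmz: "mm k A (\<lambda>_ _. 0) = (\<lambda>_ _. 0)" for k A by (simp add: mm_def)
  have mulN: "mulT n deltaK w f \<in> N" if "w \<in> Sym n" "f \<in> N" for w f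
    using that rep by (auto simp: N_def rep_mulT mmz)
  have hN: "h \<in> N" using h by (simp add: N_def)
  have hnz': "h \<noteq> 0" using hnz by (simp add: zero_fun_def)
  have Ns: "supp_in n f" if "f \<in> N" for f using that by (simp add: N_def)
  have ex: "\<exists>k Y e. irreducible_rep n {..<k::nat} Y \<and> (\<forall>j<k. e j \<in> N \<and> e j \<noteq> 0) \<and>
    (\<forall>w\<in>Sym n. \<forall>j<k. mulT n deltaK w (e j) = (\<lambda>y. \<Sum>i<k. Y w i j * e i y))"
    by (rule irreducible_submodule[OF sub _ _ hN hnz']) (fact Ns, fact mulN)
  obtain k Y e where Y: "irreducible_rep n {..<k::nat} Y" and e: "\<forall>j<k. e j \<in> N \<and> e j \<noteq> 0"
    and Ye': "\<forall>w\<in>Sym n. \<forall>j<k. mulT n deltaK w (e j) = (\<lambda>y. \<Sum>i<k. Y w i j * e i y)"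
    using ex by (elim exE conjE)
  have eN: "e j \<in> N" and enz: "e j \<noteq> 0" if "j < k" for j using e that by auto
  have Ye: "mulT n deltaK w (e j) = (\<lambda>y. \<Sum>i<k. Y w i j * e i y)" if "w \<in> Sym n" "j < k" for w j
    using Ye' that by blast
  have "irr_char n (hk_char n {..<k} Y)" unfolding irr_char_def using Y by blast
  then obtain la where la: "la \<in> L" "hk_char n {..<k} Y = hk_char n {..<d la} (X la)" using all by blast
  have k0: "0 < k" using Y by (auto simp: irreducible_rep_def)
  have d0: "0 < d la" using irr[OF la(1)] by (auto simp: irreducible_rep_def)
  let ?M = "Mx (d la) (X la)"
  \<comment> \<open>Equal characters yield a nonzero intertwiner: if all averages vanished, the
    squares of the character values would sum to zero, contradicting the value \<open>d la\<close>
    at \<open>id\<close>.\<close>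
  have "\<exists>j<d la. \<exists>m<k. (\<lambda>i l. \<Sum>w\<in>Sym n. ?M w i j * Mx k Y (inv w) m l) \<noteq> (\<lambda>_ _. 0)"
  proof (rule ccontr)
    assume "\<not> ?thesis"
    then have zz: "(\<lambda>i l. \<Sum>w\<in>Sym n. ?M w i j * Mx k Y (inv w) m l) = (\<lambda>_ _. 0)" if "j < d la" "m < k" for j m
      using that by blast
    have z: "(\<Sum>w\<in>Sym n. ?M w j j * Mx k Y (inv w) m m) = 0" if "j < d la" "m < k" for j m
      using fun_cong[OF fun_cong[OF zz[OF that]], of j m] .
    define \<chi> where "\<chi> = (\<lambda>w. \<Sum>j<d la. ?M w j j)"
    have Yc: "(\<Sum>m<k. Mx k Y w m m) = \<chi> w" if "w \<in> Sym n" for w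
      using fun_cong[OF la(2), of w] that by (simp add: hk_char_eq \<chi>_def)
    have ci: "\<chi> (inv w) = \<chi> w" if "w \<in> Sym n" for w
      unfolding \<chi>_def using orth[OF la(1) that] pnz[OF la(1)] by (intro sum.cong) (auto simp: Mx_def)
    have "(\<Sum>w\<in>Sym n. \<chi> w * \<chi> w) = (\<Sum>w\<in>Sym n. \<chi> w * (\<Sum>m<k. Mx k Y (inv w) m m))"
      by (rule sum.cong) (simp_all add: Yc ci)
    also have "\<dots> = (\<Sum>w\<in>Sym n. \<Sum>j<d la. \<Sum>m<k. ?M w j j * Mx k Y (inv w) m m)"
      unfolding \<chi>_def by (simp add: sum_product)
    also have "\<dots> = (\<Sum>j<d la. \<Sum>m<k. \<Sum>w\<in>Sym n. ?M w j j * Mx k Y (inv w) m m)"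
      by (subst sum.swap, subst sum.swap[of _ "{..<k}"]) simp
    also have "\<dots> = 0" using z by simp
    finally have "\<chi> id = 0" using sum_squares_zero[of "Sym n" \<chi> id] by simp
    moreover have "\<chi> id = of_nat (d la)" unfolding \<chi>_def rep_id[OF rep[OF la(1)]] by (simp add: idm_def)
    ultimately show False using d0 by simp
  qed
  then obtain j m where jm: "j < d la" "m < k"
    and Znz: "(\<lambda>i l. \<Sum>w\<in>Sym n. ?M w i j * Mx k Y (inv w) m l) \<noteq> (\<lambda>_ _. 0)" by blast
  define Z where "Z = (\<lambda>i l. \<Sum>w\<in>Sym n. ?M w i j * Mx k Y (inv w) m l)"
  have Zi: "inter n (d la) (X la) k Y Z"
    unfolding Z_def using Y rep[OF la(1)] jm by (intro inter_average) (auto simp: irreducible_rep_def)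
  \<comment> \<open>The intertwiner into \<open>X la\<close> is injective, so the vanishing of
    \<open>X la\<close> on \<open>N\<close> is carried back to \<open>Y\<close>.\<close>
  have kill: "ev n k Y f = (\<lambda>_ _. 0)" if f: "f \<in> N" for f
  proof -
    have "mm k Z (ev n k Y f) = mm (d la) (ev n (d la) (X la) f) Z"
      using Zi by (simp add: ev_def mm_sum_left mm_sum_right inter_def)
    also have "\<dots> = (\<lambda>_ _. 0)" using f la(1) by (simp add: N_def mm_def)
    finally have z: "mm k Z (ev n k Y f) = (\<lambda>_ _. 0)" .
    have "(\<lambda>i. ev n k Y f i l) = (\<lambda>_. 0)" for l
    proof (rule schur_inj[OF Y Zi])
      show "Z \<noteq> (\<lambda>_ _. 0)" using Znz by (simp add: Z_def)
      show "(\<lambda>i. ev n k Y f i l) \<in> vecs {..<k}" using trunc_ev[of k n Y f] by (auto simp: vecs_def trunc_def)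
      show "mv k Z (\<lambda>i. ev n k Y f i l) = (\<lambda>_. 0)" using fun_cong[OF fun_cong[OF z], of _ l] by (auto simp: mv_def mm_def)
    qed
    then show ?thesis by metis
  qed
  have eS: "supp_in n (e 0)" using Ns eN k0 by blast
  have "hmult n deltaK (flat n (e 0)) (e 0) y = 0" for y
  proof -
    have "hmult n deltaK (flat n (e 0)) (e 0) y = (\<Sum>x\<in>Sym n. flat n (e 0) x * (\<Sum>i<k. Mx k Y x i 0 * e i y))"
      unfolding hmult_def using k0 by (intro sum.cong) (simp_all add: Ye Mx_def)
    also have "\<dots> = (\<Sum>i<k. ev n k Y (flat n (e 0)) i 0 * e i y)"
      unfolding ev_def sum_distrib_left sum_distrib_right by (subst sum.swap) (simp add: mult.assoc)
    also have "\<dots> = 0" using kill[OF Nflat[OF eN[OF k0]]] by simp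
    finally show ?thesis .
  qed
  then have "(\<Sum>x\<in>Sym n. flat n (e 0) x * mulT n deltaK x (e 0) id) = 0" by (simp add: hmult_def)
  moreover have "(\<Sum>x\<in>Sym n. flat n (e 0) x * mulT n deltaK x (e 0) id) = (\<Sum>x\<in>Sym n. e 0 (inv x) * e 0 (inv x))"
    using eS by (intro sum.cong) (simp_all add: mulT_coeff_id flat_def)
  ultimately have "(\<Sum>x\<in>Sym n. e 0 x * e 0 x) = 0" using sum_Sym_inv[of "\<lambda>x. e 0 x * e 0 x" n] by simp
  then have "e 0 x = 0" if "x \<in> Sym n" for x using sum_squares_zero[OF finite_Sym _ that] by blast
  then have "e 0 = 0" using eS by (auto simp: supp_in_def fun_eq_iff zero_fun_def)
  then show False using enz[OF k0] by simp
qed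

section \<open>Splitting\<close>

subsection \<open>Block functions of compositions\<close>

text \<open>The zero-based index of the part containing position \<open>p\<close>, written as a
  count of partial sums so that monotonicity in \<open>p\<close> is immediate.\<close>

definition blk :: "nat list \<Rightarrow> nat \<Rightarrow> nat" where
  "blk la p = card {m \<in> {1..length la}. sum_list (take m la) \<le> p}"

lemma sum_take_mono: "j \<le> k \<Longrightarrow> sum_list (take j la) \<le> sum_list (take k (la :: nat list))"
  by (metis le_add1 le_add_diff_inverse sum_list.append take_add)

lemma sum_take_le: "sum_list (take k la) \<le> sum_list (la :: nat list)"
  by (metis append_take_drop_id le_add1 sum_list.append)

lemma blk_less:
  assumes "p < sum_list la" shows "blk la p < k \<longleftrightarrow> p < sum_list (take k la)"
proof
  let ?A = "{m \<in> {1..length la}. sum_list (take m la) \<le> p}"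
  assume p: "p < sum_list (take k la)"
  have "?A \<subseteq> {1..<k}"
  proof
    fix m assume m: "m \<in> ?A"
    have "m < k"
    proof (rule ccontr)
      assume "\<not> m < k"
      then have "sum_list (take k la) \<le> sum_list (take m la)" by (intro sum_take_mono) simp
      with m p show False by simp
    qed
    with m show "m \<in> {1..<k}" by simp
  qed
  then have "card ?A \<le> k - 1" using card_mono[of "{1..<k}" ?A] by simp
  moreover have "k \<noteq> 0" using p by (cases k) auto
  ultimately show "blk la p < k" by (simp add: blk_def)
next
  let ?A = "{m \<in> {1..length la}. sum_list (take m la) \<le> p}"
  assume b: "blk la p < k"
  show "p < sum_list (take k la)"
  proof (rule ccontr)
    assume n: "\<not> p < sum_list (take k la)"
    then have kl: "k \<le> length la" using assms by (metis linear take_all)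
    have "{1..k} \<subseteq> ?A" using n kl sum_take_mono[of _ k la] by (force intro: order_trans)
    then have "k \<le> card ?A" using card_mono[of ?A "{1..k}"] by simp
    with b show False by (simp add: blk_def)
  qed
qed

lemma blk_mono: "i \<le> j \<Longrightarrow> blk la i \<le> blk la j"
  unfolding blk_def by (rule card_mono) auto

interpretation blk: blocks n "blk la" for n la
  by unfold_locales (rule blk_mono)

lemma card_blk_less: assumes "sum_list la = n" shows "card {p. p < n \<and> blk la p < k} = sum_list (take k la)"
proof -
  have "{p. p < n \<and> blk la p < k} = {..<sum_list (take k la)}"
    using blk_less[of _ la k] sum_take_le[of k la] assms by auto
  then show ?thesis by simp
qed

lemma blk_eqI:
  assumes "sum_list (take j la) \<le> p" "p < sum_list (take (Suc j) la)" shows "blk la p = j"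
proof -
  have p: "p < sum_list la" using assms(2) sum_take_le[of "Suc j" la] by simp
  from blk_less[OF p, of j] blk_less[OF p, of "Suc j"] assms show ?thesis by linarith
qed

lemma blk_bounds:
  assumes "p < sum_list la"
  shows "sum_list (take (blk la p) la) \<le> p" "p < sum_list (take (Suc (blk la p)) la)" "blk la p < length la"
proof -
  show "sum_list (take (blk la p) la) \<le> p" "p < sum_list (take (Suc (blk la p)) la)"
    using blk_less[OF assms, of "blk la p"] blk_less[OF assms, of "Suc (blk la p)"] by auto
  show "blk la p < length la" using blk_less[OF assms, of "length la"] assms by simp
qed

lemma card_blk_eq:
  assumes "sum_list la = n" "j < length la" shows "card {p. p < n \<and> blk la p = j} = la ! j"
proof -
  have key: "p < n \<and> blk la p = j \<longleftrightarrow> sum_list (take j la) \<le> p \<and> p < sum_list (take (Suc j) la)" for p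
  proof (cases "p < n")
    case True
    then have p: "p < sum_list la" using assms(1) by simp
    have "blk la p = j \<longleftrightarrow> \<not> blk la p < j \<and> blk la p < Suc j" by linarith
    with True show ?thesis unfolding blk_less[OF p] by linarith
  next
    case False
    then show ?thesis using sum_take_le[of "Suc j" la] assms(1) by linarith
  qed
  have "{p. p < n \<and> blk la p = j} = {sum_list (take j la)..<sum_list (take (Suc j) la)}"
    unfolding key by auto
  then show ?thesis using assms(2) by (simp add: take_Suc_conv_app_nth)
qed

lemma young_gens_J: assumes "sum_list la = n" shows "young_gens n la = blk.J n la"
proof -
  have "blk la i = blk la (Suc i) \<longleftrightarrow> Suc i \<notin> {sum_list (take m la) | m. 1 \<le> m}" if i: "Suc i < n" for i
  proof
    assume e: "blk la i = blk la (Suc i)"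
    show "Suc i \<notin> {sum_list (take m la) | m. 1 \<le> m}"
    proof
      assume "Suc i \<in> {sum_list (take m la) | m. 1 \<le> m}"
      then obtain m where "Suc i = sum_list (take m la)" by auto
      then show False using e blk_less[of i la m] blk_less[of "Suc i" la m] i assms by simp
    qed
  next
    assume n: "Suc i \<notin> {sum_list (take m la) | m. 1 \<le> m}"
    show "blk la i = blk la (Suc i)"
    proof (rule ccontr)
      assume "blk la i \<noteq> blk la (Suc i)"
      then have lt: "blk la i < blk la (Suc i)" using blk_mono[of i "Suc i" la] by simp
      then have "i < sum_list (take (blk la (Suc i)) la)" using blk_less[of i la] i assms by simp
      moreover have "sum_list (take (blk la (Suc i)) la) \<le> Suc i" using blk_bounds(1)[of "Suc i" la] i assms by simp
      ultimately have "Suc i = sum_list (take (blk la (Suc i)) la)" by simp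
      then show False using n lt by (metis (mono_tags, lifting) One_nat_def Suc_leI mem_Collect_eq not_less0 neq0_conv)
    qed
  qed
  then show ?thesis unfolding young_gens_def blk.J_def by auto
qed

lemma young_Y: assumes "sum_list la = n" shows "young n la = blk.Y n la"
proof
  show "young n la \<subseteq> blk.Y n la"
  proof
    fix w assume "w \<in> young n la"
    then obtain ss where "set ss \<subseteq> blk.J n la" "w = wprod ss" using assms by (auto simp: young_def young_gens_J)
    then show "w \<in> blk.Y n la" by (induction ss arbitrary: w) (auto intro: blk.Y_comp blk.J_Y)
  qed
  show "blk.Y n la \<subseteq> young n la"
  proof
    fix w assume "w \<in> blk.Y n la"
    then show "w \<in> young n la"
    proof (induction rule: blk.Y_induct)
      case id
      show ?case unfolding young_def by (auto intro!: exI[of _ "[]"])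
    next
      case (comp u t)
      then obtain ss where ss: "set ss \<subseteq> young_gens n la" "u = wprod ss" by (auto simp: young_def)
      then have "set (ss @ [t]) \<subseteq> young_gens n la" "u \<circ> t = wprod (ss @ [t])"
        using comp(2) young_gens_J[OF assms] by auto
      then show ?case unfolding young_def by blast
    qed
  qed
qed

lemma dist_reps_D: "sum_list la = n \<Longrightarrow> dist_reps n la = blk.D n la"
  by (simp add: dist_reps_def blk.D_def young_gens_J)

lemma a_fun_wl: "sum_list la = n \<Longrightarrow> a_fun n la = len n (blk.wl n la)"
  by (simp add: a_fun_def young_Y blk.wl(2))

subsection \<open>Functions that are trivial on the left and alternating on the right\<close>

text \<open>Equivalently, the Young subgroup of \<open>b\<close>, conjugated by \<open>y\<close>,
  meets that of \<open>b'\<close> trivially. Only on such \<open>y\<close> can a function live that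
  is trivial on the left and alternating on the right.\<close>

definition Gam :: "nat \<Rightarrow> (nat \<Rightarrow> nat) \<Rightarrow> (nat \<Rightarrow> nat) \<Rightarrow> perm set" where
  "Gam n b b' = {y \<in> Sym n. \<forall>p<n. \<forall>q<n. p \<noteq> q \<longrightarrow> b p = b q \<longrightarrow> b' (y p) \<noteq> b' (y q)}"

locale two_blocks = B: blocks n b + B': blocks n b' for n b b'
begin

text \<open>The two rules obeyed by a matrix coefficient between a trivial covector and a sign
  vector; see \<open>TS_rowact\<close>.\<close>

definition TS :: "(perm \<Rightarrow> ratf) \<Rightarrow> bool" where
  "TS h \<longleftrightarrow> (\<forall>s\<in>B'.J. \<forall>y\<in>Sym n. len n y < len n (s \<circ> y) \<longrightarrow> h (s \<circ> y) = vK * h y) \<and>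
     (\<forall>t\<in>B.J. \<forall>y\<in>Sym n. len n y < len n (y \<circ> t) \<longrightarrow> h (y \<circ> t) = - inverse vK * h y)"

text \<open>The factor depends on \<open>t\<close> and \<open>y\<close> but is common to all
  \<open>h\<close>; this uniformity makes two such functions proportional along a double
  coset.\<close>

lemma TS_right1:
  assumes "t \<in> B.J" "y \<in> Sym n" shows "\<exists>\<kappa>. \<forall>h. TS h \<longrightarrow> h (y \<circ> t) = \<kappa> * h y"
proof (cases "len n y < len n (y \<circ> t)")
  case True
  then show ?thesis using assms by (intro exI[of _ "- inverse vK"]) (simp add: TS_def)
next
  case False
  have tS: "t \<in> sgens n" using assms B.J_sgens by blast
  have yt: "y \<circ> t \<in> Sym n" "y \<circ> t \<circ> t = y" using assms(2) tS by auto
  have "len n (y \<circ> t) < len n (y \<circ> t \<circ> t)" using False len_right_cases[OF assms(2) tS] yt by auto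
  then have "h y = - inverse vK * h (y \<circ> t)" if "TS h" for h
    using that assms(1) yt unfolding TS_def by metis
  then have "h (y \<circ> t) = - vK * h y" if "TS h" for h using that by (metis (no_types) minus_mult_minus mult.assoc mult_1 right_inverse vK_nz)
  then show ?thesis by blast
qed

lemma TS_left1:
  assumes "s \<in> B'.J" "y \<in> Sym n" shows "\<exists>\<kappa>. \<forall>h. TS h \<longrightarrow> h (s \<circ> y) = \<kappa> * h y"
proof (cases "len n y < len n (s \<circ> y)")
  case True
  then show ?thesis using assms by (intro exI[of _ "vK"]) (simp add: TS_def)
next
  case False
  have tS: "s \<in> sgens n" using assms B'.J_sgens by blast
  have yt: "s \<circ> y \<in> Sym n" "s \<circ> (s \<circ> y) = y" using assms(2) tS by auto
  have "len n (s \<circ> y) < len n (s \<circ> (s \<circ> y))" using False len_left_cases[OF assms(2) tS] yt by auto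
  then have "h y = vK * h (s \<circ> y)" if "TS h" for h
    using that assms(1) yt unfolding TS_def by metis
  then have "h (s \<circ> y) = inverse vK * h y" if "TS h" for h using that by (metis (no_types) mult.assoc mult_1 left_inverse vK_nz)
  then show ?thesis by blast
qed

lemma TS_right: assumes "t \<in> B.Y" "y \<in> Sym n" shows "\<exists>\<kappa>. \<forall>h. TS h \<longrightarrow> h (y \<circ> t) = \<kappa> * h y"
  using assms(1)
proof (induction rule: B.Y_induct)
  case id
  show ?case by (intro exI[of _ 1]) simp
next
  case (comp u t)
  then obtain k1 where k1: "\<forall>h. TS h \<longrightarrow> h (y \<circ> u) = k1 * h y" by blast
  obtain k2 where k2: "\<forall>h. TS h \<longrightarrow> h (y \<circ> u \<circ> t) = k2 * h (y \<circ> u)"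
    using TS_right1[OF comp(2), of "y \<circ> u"] assms(2) B.Y_Sym[OF comp(1)] by auto
  have "h (y \<circ> (u \<circ> t)) = k2 * k1 * h y" if "TS h" for h
    unfolding o_assoc using k1[rule_format, OF that] k2[rule_format, OF that] by (simp only: mult.assoc)
  then show ?case by blast
qed

lemma TS_left: assumes "u \<in> B'.Y" "y \<in> Sym n" shows "\<exists>\<kappa>. \<forall>h. TS h \<longrightarrow> h (u \<circ> y) = \<kappa> * h y"
  using assms
proof (induction arbitrary: y rule: B'.Y_induct)
  case id
  show ?case by (intro exI[of _ 1]) simp
next
  case (comp u t)
  have ty: "t \<circ> y \<in> Sym n" using comp(2) B'.J_sgens comp.prems by simp
  obtain k1 where k1: "\<forall>h. TS h \<longrightarrow> h (u \<circ> (t \<circ> y)) = k1 * h (t \<circ> y)" using comp.IH[OF ty] by blast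
  obtain k2 where k2: "\<forall>h. TS h \<longrightarrow> h (t \<circ> y) = k2 * h y" using TS_left1[OF comp(2) comp.prems] by blast
  have "h (u \<circ> t \<circ> y) = k1 * k2 * h y" if "TS h" for h
    unfolding comp_assoc using k1[rule_format, OF that] k2[rule_format, OF that] by (simp only: mult.assoc)
  then show ?case by blast
qed

lemma v_plus_vinv_nz: "vK + inverse vK \<noteq> 0"
proof
  assume "vK + inverse vK = 0"
  then have "vK * (vK + inverse vK) = 0" by simp
  then have "vK * vK + 1 = 0" by (simp add: distrib_left)
  moreover have "vK * vK + 1 > 0" by (simp add: add_nonneg_pos)
  ultimately show False by simp
qed

text \<open>Here \<open>st P \<circ> z = z \<circ> st p\<close>, so one coefficient is both
  \<open>vK\<close> times and \<open>- inverse vK\<close> times another; as \<open>v + v^-1\<close>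
  is nonzero, both vanish.\<close>

lemma TS_crossing:
  assumes h: "TS h" and z: "z \<in> Sym n" and p: "Suc p < n" "b p = b (Suc p)" and P: "Suc P < n" "b' P = b' (Suc P)"
    and im: "{z p, z (Suc p)} = {P, Suc P}"
  shows "h z = 0"
proof -
  have J: "st p \<in> B.J" "st P \<in> B'.J" using p P by (auto simp: B.J_def B'.J_def)
  have e: "st P \<circ> z = z \<circ> st p"
  proof
    fix q
    have inj: "z a = z c \<longleftrightarrow> a = c" for a c using Sym_inj[OF z] .
    show "(st P \<circ> z) q = (z \<circ> st p) q"
      using im inj[of q p] inj[of q "Suc p"] inj[of p "Suc p"] unfolding doubleton_eq_iff
      by (auto simp: transpose_def o_apply)
  qed
  have up: "h y = 0" if y: "y \<in> Sym n" "st P \<circ> y = y \<circ> st p" "len n y < len n (y \<circ> st p)" for y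
  proof -
    have "h (y \<circ> st p) = - inverse vK * h y"
      using h J(1) y(1,3) unfolding TS_def by blast
    moreover have "h (st P \<circ> y) = vK * h y"
      using h J(2) y(1,3) unfolding TS_def y(2)[symmetric] by blast
    ultimately have "(vK + inverse vK) * h y = 0" unfolding y(2) by (simp add: distrib_right)
    then show ?thesis using v_plus_vinv_nz by simp
  qed
  show ?thesis
  proof (cases "len n z < len n (z \<circ> st p)")
    case True then show ?thesis using up z e by blast
  next
    case False
    have ps: "st p \<in> sgens n" "st P \<in> sgens n" using p P by auto
    let ?z = "z \<circ> st p"
    have zz: "?z \<circ> st p = z" by (simp add: comp_assoc)
    have "st P \<circ> ?z = ?z \<circ> st p" unfolding o_assoc e ..
    moreover have "len n ?z < len n (?z \<circ> st p)" using False len_right_cases[OF z ps(1)] zz by auto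
    ultimately have "h ?z = 0" using up[of ?z] z p by simp
    moreover obtain \<kappa> where "h (?z \<circ> st p) = \<kappa> * h ?z" using TS_right1[OF J(1), of ?z] h z p by auto
    ultimately show ?thesis using zz by simp
  qed
qed

text \<open>A pair in one fibre of \<open>b\<close> whose images share a fibre of \<open>b'\<close>
  is moved by elements of the two Young subgroups to adjacent positions with adjacent values, where
  \<open>TS_crossing\<close> applies. The moves only rescale \<open>h\<close>.\<close>

lemma TS_support:
  assumes h: "TS h" and y: "y \<in> Sym n" and nz: "h y \<noteq> 0"
  shows "y \<in> Gam n b b'"
proof (rule ccontr)
  assume "y \<notin> Gam n b b'"
  then obtain p0 q0 where pq0: "p0 < n" "q0 < n" "p0 \<noteq> q0" "b p0 = b q0" "b' (y p0) = b' (y q0)"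
    using y by (auto simp: Gam_def)
  define p where "p = min p0 q0"
  define q where "q = max p0 q0"
  have pq: "p < q" "q < n" "b p = b q" "b' (y p) = b' (y q)"
    using pq0 by (auto simp: p_def q_def min_def max_def)
  define P where "P = min (y p) (y q)"
  define Q where "Q = max (y p) (y q)"
  have "y p \<noteq> y q" using Sym_inj[OF y] pq by auto
  then have PQ: "P < Q" "Q < n" "b' P = b' Q" "{y p, y q} = {P, Q}"
    using pq Sym_less[OF y] by (auto simp: P_def Q_def min_def max_def)
  have midB: "b (Suc p) = b q" using B.b_mono[of p "Suc p"] B.b_mono[of "Suc p" q] pq by simp
  have midB': "b' (Suc P) = b' Q" using B'.b_mono[of P "Suc P"] B'.b_mono[of "Suc P" Q] PQ by simp
  define t where "t = transpose (Suc p) q"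
  define u where "u = transpose (Suc P) Q"
  have tS: "t \<in> Sym n" "u \<in> Sym n" using pq PQ by (auto simp: t_def u_def Sym_def permutes_swap_id)
  have tY: "t \<in> B.Y" using tS midB by (auto simp: B.Y_def t_def transpose_def)
  have uY: "u \<in> B'.Y" using tS midB' by (auto simp: B'.Y_def u_def transpose_def)
  define z where "z = u \<circ> (y \<circ> t)"
  have zS: "z \<in> Sym n" using tS y by (simp add: z_def)
  have "{z p, z (Suc p)} = u ` {y p, y q}"
    using pq by (auto simp: z_def o_apply t_def transpose_def)
  also have "\<dots> = {P, Suc P}" unfolding PQ(4) using PQ(1) by (auto simp: u_def transpose_def)
  finally have "h z = 0" using TS_crossing[OF h zS, of p P] pq PQ midB midB' by simp
  obtain k1 where k1: "h (inv u \<circ> z) = k1 * h z" using TS_left[OF B'.Y_inv[OF uY] zS] h by blast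
  have e1: "inv u \<circ> z = y \<circ> t"
    unfolding z_def o_assoc using Sym_comp_inv(2)[OF tS(2)] by simp
  obtain k2 where k2: "h (y \<circ> t \<circ> inv t) = k2 * h (y \<circ> t)" using TS_right[OF B.Y_inv[OF tY], of "y \<circ> t"] h tS y by auto
  have e2: "y \<circ> t \<circ> inv t = y" unfolding comp_assoc using Sym_comp_inv(1)[OF tS(1)] by simp
  have "h y = 0" using k1 k2 e1 e2 \<open>h z = 0\<close> by simp
  with nz show False by simp
qed

text \<open>The witness that TS has a nonzero element as soon as Gam is nonempty.\<close>

definition tsfun :: "perm \<Rightarrow> ratf" where
  "tsfun y = (if y \<in> Gam n b b' then (- inverse vK) ^ card (binv n b y) * vK ^ card (binv n b' (inv y)) else 0)"

lemma Gam_right: assumes "t \<in> B.Y" "y \<in> Gam n b b'" shows "y \<circ> t \<in> Gam n b b'"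
proof -
  have t: "t \<in> Sym n" "\<And>p. p < n \<Longrightarrow> b (t p) = b p" using assms(1) by (auto simp: B.Y_def)
  have y: "y \<in> Sym n" using assms(2) by (simp add: Gam_def)
  show ?thesis unfolding Gam_def
  proof (intro CollectI conjI allI impI)
    show "y \<circ> t \<in> Sym n" using y t by simp
    fix p q assume "p < n" "q < n" "p \<noteq> q" "b p = b q"
    then have "t p < n" "t q < n" "t p \<noteq> t q" "b (t p) = b (t q)"
      using t Sym_less[OF t(1)] Sym_inj[OF t(1)] by auto
    then show "b' ((y \<circ> t) p) \<noteq> b' ((y \<circ> t) q)" using assms(2) by (simp add: Gam_def o_apply)
  qed
qed

lemma Gam_left: assumes "u \<in> B'.Y" "y \<in> Gam n b b'" shows "u \<circ> y \<in> Gam n b b'"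
proof -
  have u: "u \<in> Sym n" "\<And>p. p < n \<Longrightarrow> b' (u p) = b' p" using assms(1) by (auto simp: B'.Y_def)
  have y: "y \<in> Sym n" using assms(2) by (simp add: Gam_def)
  show ?thesis using u y assms(2) Sym_less[OF y] by (auto simp: Gam_def o_apply)
qed

text \<open>On \<open>Gam\<close> the two exponents do not interfere: a left step in
  \<open>B'.J\<close> exchanges values whose positions lie in different fibres of \<open>b\<close>,
  so it changes only the \<open>b'\<close>-inversions of the inverse. The right side is
  symmetric.\<close>

lemma TS_tsfun: "TS tsfun"
  unfolding TS_def
proof (intro conjI ballI impI)
  fix s y assume s: "s \<in> B'.J" and y: "y \<in> Sym n" and up: "len n y < len n (s \<circ> y)"
  obtain i where i: "Suc i < n" "b' i = b' (Suc i)" "s = st i" using s by (auto simp: B'.J_def)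
  have sg: "s \<in> sgens n" using B'.J_sgens s by blast
  have G: "s \<circ> y \<in> Gam n b b' \<longleftrightarrow> y \<in> Gam n b b'"
    using Gam_left[OF B'.J_Y[OF s], of y] Gam_left[OF B'.J_Y[OF s], of "s \<circ> y"] sg by auto
  show "tsfun (s \<circ> y) = vK * tsfun y"
  proof (cases "y \<in> Gam n b b'")
    case True
    have "len n (inv y) < len n (inv y \<circ> s)" using up len_left_inv[OF y sg] y by (simp add: len_inv)
    then have "inv y i < inv y (Suc i)" using len_comp_st(4)[of "inv y" n i] y i by simp
    then have c1: "card (binv n b' (inv y \<circ> s)) = Suc (card (binv n b' (inv y)))"
      using card_binv_comp_st[of i n b' "inv y"] i by simp
    have "b (inv y i) \<noteq> b (inv y (Suc i))"
    proof
      assume e: "b (inv y i) = b (inv y (Suc i))"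
      have "inv y i \<noteq> inv y (Suc i)" using Sym_inj[OF inv_in_Sym[OF y]] by simp
      moreover have "inv y i < n" "inv y (Suc i) < n" using Sym_less[OF inv_in_Sym[OF y]] i by auto
      ultimately have "b' (y (inv y i)) \<noteq> b' (y (inv y (Suc i)))" using True e by (simp add: Gam_def)
      then show False using i Sym_inv_apply(1)[OF y] by simp
    qed
    then have c2: "binv n b (s \<circ> y) = binv n b y" using binv_st_comp[OF y, of b i] i by simp
    have "inv (s \<circ> y) = inv y \<circ> s" using y sg by (simp add: Sym_inv_comp[of _ n])
    then show ?thesis using True G c1 c2 by (simp add: tsfun_def)
  next
    case False
    then show ?thesis using G by (simp add: tsfun_def)
  qed
next
  fix t y assume t: "t \<in> B.J" and y: "y \<in> Sym n" and up: "len n y < len n (y \<circ> t)"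
  obtain i where i: "Suc i < n" "b i = b (Suc i)" "t = st i" using t by (auto simp: B.J_def)
  have sg: "t \<in> sgens n" using B.J_sgens t by blast
  have G: "y \<circ> t \<in> Gam n b b' \<longleftrightarrow> y \<in> Gam n b b'"
    using Gam_right[OF B.J_Y[OF t], of y] Gam_right[OF B.J_Y[OF t], of "y \<circ> t"] sg by auto
  show "tsfun (y \<circ> t) = - inverse vK * tsfun y"
  proof (cases "y \<in> Gam n b b'")
    case True
    have "y i < y (Suc i)" using len_comp_st(4)[of y n i] y i up by simp
    then have c1: "card (binv n b (y \<circ> t)) = Suc (card (binv n b y))"
      using card_binv_comp_st[of i n b y] i by simp
    have "b' (inv (inv y) i) \<noteq> b' (inv (inv y) (Suc i))" using True i y by (simp add: Gam_def)
    then have c2: "binv n b' (t \<circ> inv y) = binv n b' (inv y)"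
      using binv_st_comp[OF inv_in_Sym[OF y], of b' i] i by simp
    have "inv (y \<circ> t) = t \<circ> inv y" using y sg by (simp add: Sym_inv_comp[of _ n])
    then show ?thesis using True G c1 c2 by (simp add: tsfun_def)
  next
    case False
    then show ?thesis using G by (simp add: tsfun_def)
  qed
qed

lemma supp_tsfun: "supp_in n tsfun"
  by (auto simp: supp_in_def tsfun_def Gam_def)

end

interpretation tb: two_blocks n "blk mu" "blk nu" for n mu nu
  by unfold_locales

text \<open>The conjugate partition, padded with zeros to length n.\<close>

definition cnj :: "nat \<Rightarrow> nat list \<Rightarrow> nat list" where
  "cnj n la = map (\<lambda>j. card {i. i < length la \<and> j < la ! i}) [0..<n]"

lemma down_closed_eq:
  assumes "finite (A :: nat set)" "\<And>i j. j \<in> A \<Longrightarrow> i \<le> j \<Longrightarrow> i \<in> A" shows "A = {..<card A}"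
proof (rule card_subset_eq[symmetric])
  show "{..<card A} \<subseteq> A"
  proof
    fix i assume i: "i \<in> {..<card A}"
    show "i \<in> A"
    proof (rule ccontr)
      assume "i \<notin> A"
      then have "A \<subseteq> {..<i}" using assms(2) by (metis lessThan_iff linorder_not_le subsetI)
      then have "card A \<le> i" using card_mono[of "{..<i}" A] by simp
      with i show False by simp
    qed
  qed
qed (use assms in auto)

lemma length_cnj [simp]: "length (cnj n la) = n"
  by (simp add: cnj_def)

context
  fixes n :: nat and la :: "nat list"
  assumes la: "la \<in> partitions n"
begin

lemma la_sum: "sum_list la = n"
  using la by (simp add: partitions_def)

lemma la_le: "i < length la \<Longrightarrow> la ! i \<le> n"
  using elem_le_sum_list[of i la] la_sum by simp

lemma less_cnj: assumes "j < n" shows "i < cnj n la ! j \<longleftrightarrow> i < length la \<and> j < la ! i"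
proof -
  let ?A = "{i. i < length la \<and> j < la ! i}"
  have A: "?A = {..<card ?A}"
  proof (rule down_closed_eq)
    fix i i' assume a: "i' \<in> ?A" "i \<le> i'"
    have "la ! i' \<le> la ! i"
    proof (cases "i = i'")
      case False
      then have "i < i'" using a by simp
      moreover have "sorted_wrt (\<ge>) la" using la by (simp add: partitions_def)
      ultimately show ?thesis using a sorted_wrt_nth_less[of "(\<ge>)" la i i'] by simp
    qed simp
    with a show "i \<in> ?A" by simp
  qed simp
  have "i \<in> ?A \<longleftrightarrow> i \<in> {..<card ?A}" by (rule arg_cong[OF A, of "\<lambda>S. i \<in> S"])
  moreover have "cnj n la ! j = card ?A" using assms by (simp add: cnj_def)
  ultimately show ?thesis by (simp only: mem_Collect_eq lessThan_iff)
qed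

text \<open>Both sides count the boxes in the first \<open>k\<close> rows of the Young diagram, once
  by columns and once by rows.\<close>

lemma sum_min_cnj: "(\<Sum>j<n. min k (cnj n la ! j)) = sum_list (take k la)"
proof -
  let ?m = "min k (length la)"
  have "min k (cnj n la ! j) = (\<Sum>i<?m. if j < la ! i then 1 else 0)" if "j < n" for j
  proof -
    have "{..<min k (cnj n la ! j)} = {i \<in> {..<?m}. j < la ! i}"
    proof (rule set_eqI)
      fix i
      show "i \<in> {..<min k (cnj n la ! j)} \<longleftrightarrow> i \<in> {i \<in> {..<?m}. j < la ! i}"
        unfolding lessThan_iff mem_Collect_eq min_less_iff_conj less_cnj[OF that] by blast
    qed
    then have "min k (cnj n la ! j) = card {i \<in> {..<?m}. j < la ! i}" using card_lessThan[of "min k (cnj n la ! j)"] by (simp only:)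
    also have "\<dots> = (\<Sum>i<?m. if j < la ! i then 1 else 0)"
      by (simp add: sum.inter_filter[symmetric])
    finally show ?thesis .
  qed
  then have "(\<Sum>j<n. min k (cnj n la ! j)) = (\<Sum>j<n. \<Sum>i<?m. if j < la ! i then 1 else 0)" by simp
  also have "\<dots> = (\<Sum>i<?m. \<Sum>j<n. if j < la ! i then 1 else 0)" by (rule sum.swap)
  also have "\<dots> = (\<Sum>i<?m. la ! i)"
  proof (rule sum.cong)
    fix i assume "i \<in> {..<?m}"
    then have "{j \<in> {..<n}. j < la ! i} = {..<la ! i}" using la_le[of i] by auto
    then show "(\<Sum>j<n. if j < la ! i then 1 else 0) = la ! i"
      by (simp add: sum.inter_filter[symmetric])
  qed simp
  also have "\<dots> = sum_list (take k la)"
    by (simp add: sum_list_sum_nth atLeast0LessThan min.commute)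
  finally show ?thesis .
qed

lemma sum_cnj: "sum_list (cnj n la) = n"
proof -
  have "cnj n la ! j \<le> length la" if "j < n" for j
    using less_cnj[OF that, of "length la"] by (metis less_irrefl not_le)
  then have "(\<Sum>j<n. min (length la) (cnj n la ! j)) = (\<Sum>j<n. cnj n la ! j)" by (intro sum.cong) auto
  then show ?thesis using sum_min_cnj[of "length la"] la_sum by (simp add: sum_list_sum_nth atLeast0LessThan)
qed

context
  fixes mu :: "nat list" and y
  assumes mu: "sum_list mu = n" and y: "y \<in> Gam n (blk mu) (blk (cnj n la))"
begin

definition cnt :: "nat \<Rightarrow> nat \<Rightarrow> nat" where
  "cnt k j = card {p. p < n \<and> blk mu p < k \<and> blk (cnj n la) (y p) = j}"

lemma ySym: "y \<in> Sym n" using y by (simp add: Gam_def)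

lemma sum_cnt: "(\<Sum>j<n. cnt k j) = sum_list (take k mu)"
proof -
  have "{p. p < n \<and> blk mu p < k} = (\<Union>j<n. {p. p < n \<and> blk mu p < k \<and> blk (cnj n la) (y p) = j})"
    using blk_bounds(3)[of _ "cnj n la"] Sym_less[OF ySym] by (auto simp: sum_cnj)
  moreover have "card (\<Union>j<n. {p. p < n \<and> blk mu p < k \<and> blk (cnj n la) (y p) = j}) = (\<Sum>j<n. cnt k j)"
    unfolding cnt_def by (rule card_UN_disjoint) auto
  ultimately show ?thesis using card_blk_less[OF mu, of k] by simp
qed

lemma cnt_le: assumes "j < n" shows "cnt k j \<le> min k (cnj n la ! j)"
proof -
  let ?A = "{p. p < n \<and> blk mu p < k \<and> blk (cnj n la) (y p) = j}"
  have "inj_on (blk mu) ?A"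
  proof (rule inj_onI)
    fix p q assume "p \<in> ?A" "q \<in> ?A" "blk mu p = blk mu q"
    then show "p = q" using y unfolding Gam_def mem_Collect_eq by metis
  qed
  then have "card ?A \<le> card {..<k}" by (rule card_inj_on_le) auto
  moreover have "card ?A \<le> card {q. q < n \<and> blk (cnj n la) q = j}"
    by (rule card_inj_on_le[of y]) (use Sym_inj[OF ySym] Sym_less[OF ySym] in \<open>auto simp: inj_on_def\<close>)
  moreover have "card {q. q < n \<and> blk (cnj n la) q = j} = cnj n la ! j"
    using assms by (intro card_blk_eq) (auto simp: sum_cnj)
  ultimately show ?thesis by (simp add: cnt_def)
qed

text \<open>A Gale-Ryser argument: the number of positions in the first \<open>k\<close> blocks sent
  to column \<open>j\<close> is at most \<open>k\<close>, because \<open>y\<close> separates each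
  block, and at most the column height. Summation over the columns gives dominance.\<close>

lemma Gam_dominates: "dominates mu la"
  unfolding dominates_def
proof
  fix k
  have "(\<Sum>j<n. cnt k j) \<le> (\<Sum>j<n. min k (cnj n la ! j))" using cnt_le by (intro sum_mono) auto
  then show "sum_list (take k mu) \<le> sum_list (take k la)" by (simp only: sum_cnt sum_min_cnj)
qed

end

text \<open>For \<open>mu = la\<close> the bounds of \<open>cnt_le\<close> have equal sums on both
  sides, so each is an equality, and the pairs of row and column indices fill the Young
  diagram.\<close>

lemma Gam_shape:
  assumes y: "y \<in> Gam n (blk la) (blk (cnj n la))"
  shows "(\<lambda>p. (blk la p, blk (cnj n la) (y p))) ` {..<n} = {(i, j). j < n \<and> i < cnj n la ! j}"
    (is "?f ` _ = ?D")
proof -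
  let ?c = "cnt la y"
  have eq: "?c k j = min k (cnj n la ! j)" if "j < n" for k j
    using sum_mono_inv[of "?c k" "{..<n}" "\<lambda>j. min k (cnj n la ! j)" j] cnt_le[OF la_sum y]
      sum_cnt[OF la_sum y, of k] sum_min_cnj[of k] that by auto
  have yS: "y \<in> Sym n" using y by (simp add: Gam_def)
  have fin: "finite {p. p < n \<and> blk la p < k \<and> blk (cnj n la) (y p) = j}" for k j by simp
  show ?thesis
  proof (intro set_eqI iffI)
    fix x assume "x \<in> ?f ` {..<n}"
    then obtain p where p: "p < n" "x = ?f p" by auto
    let ?i = "blk la p" and ?j = "blk (cnj n la) (y p)"
    have j: "?j < n" using blk_bounds(3)[of "y p" "cnj n la"] Sym_less[OF yS, of p] p by (simp add: sum_cnj)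
    have "?c ?i ?j < ?c (Suc ?i) ?j"
      unfolding cnt_def[OF la_sum y] by (rule psubset_card_mono[OF fin]) (use p in auto)
    then have "?i < cnj n la ! ?j" using eq[OF j, of ?i] eq[OF j, of "Suc ?i"] by auto
    then show "x \<in> ?D" using p j by simp
  next
    fix x assume "x \<in> ?D"
    then obtain i j where ij: "x = (i, j)" "j < n" "i < cnj n la ! j" by auto
    have "?c i j \<noteq> ?c (Suc i) j" using eq[OF ij(2), of i] eq[OF ij(2), of "Suc i"] ij(3) by simp
    then have "{p. p < n \<and> blk la p < i \<and> blk (cnj n la) (y p) = j} \<noteq>
       {p. p < n \<and> blk la p < Suc i \<and> blk (cnj n la) (y p) = j}" unfolding cnt_def[OF la_sum y] by metis
    then obtain p where "p < n" "blk la p = i" "blk (cnj n la) (y p) = j"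
      unfolding set_eq_iff mem_Collect_eq less_Suc_eq by blast
    then show "x \<in> ?f ` {..<n}" using ij by auto
  qed
qed

text \<open>\<open>Gam_shape\<close> labels positions bijectively by boxes, for \<open>y\<close> and
  for \<open>y'\<close> alike. \<open>t\<close> sends a position to the one with the same box for
  \<open>y\<close>, so it preserves rows; the remaining discrepancy \<open>u\<close> preserves
  columns.\<close>

lemma Gam_transitive:
  assumes y: "y \<in> Gam n (blk la) (blk (cnj n la))" "y' \<in> Gam n (blk la) (blk (cnj n la))"
  obtains t u where "t \<in> blk.Y n la" "u \<in> blk.Y n (cnj n la)" "y' = u \<circ> (y \<circ> t)"
proof -
  let ?b = "blk la" and ?b' = "blk (cnj n la)"
  define f where "f = (\<lambda>y p. (?b p, ?b' (y p)))"
  have S: "y \<in> Sym n" "y' \<in> Sym n" using y by (auto simp: Gam_def)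
  have inj: "inj_on (f z) {..<n}" if "z \<in> Gam n ?b ?b'" for z
    using that by (auto simp: inj_on_def Gam_def f_def)
  have im: "f y ` {..<n} = f y' ` {..<n}" unfolding f_def using Gam_shape[OF y(1)] Gam_shape[OF y(2)] by simp
  define t where "t = (\<lambda>p. if p < n then the_inv_into {..<n} (f y) (f y' p) else p)"
  have t1: "t p < n" "f y (t p) = f y' p" if "p < n" for p
  proof -
    have "f y' p \<in> f y ` {..<n}" using im that by blast
    then show "t p < n" "f y (t p) = f y' p"
      using that the_inv_into_into[OF inj[OF y(1)], of "f y' p" "{..<n}"] f_the_inv_into_f[OF inj[OF y(1)], of "f y' p"]
      by (auto simp: t_def)
  qed
  have tinj: "inj_on t {..<n}"
  proof (rule inj_onI)
    fix p q assume "p \<in> {..<n}" "q \<in> {..<n}" "t p = t q"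
    then show "p = q" using t1[of p] t1[of q] inj[OF y(2)] by (auto simp: inj_on_def)
  qed
  have tS: "t \<in> Sym n"
    unfolding Sym_def
  proof (rule CollectI, rule bij_imp_permutes)
    have "t ` {..<n} = {..<n}" by (rule endo_inj_surj[OF _ _ tinj]) (auto simp: t1)
    then show "bij_betw t {..<n} {..<n}" using tinj by (simp add: bij_betw_def)
  qed (simp add: t_def)
  have tb: "?b (t p) = ?b p" "?b' (y (t p)) = ?b' (y' p)" if "p < n" for p using t1[OF that] by (auto simp: f_def)
  define u where "u = y' \<circ> inv (y \<circ> t)"
  have uS: "u \<in> Sym n" using S tS by (simp add: u_def)
  have ytS: "y \<circ> t \<in> Sym n" using S tS by simp
  have ub: "?b' (u q) = ?b' q" if "q < n" for q
  proof -
    define p where "p = inv (y \<circ> t) q"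
    have p: "p < n" using Sym_less[OF inv_in_Sym[OF ytS], of q] that by (simp add: p_def)
    have q: "q = y (t p)" using Sym_inv_apply(1)[OF ytS, of q] by (simp add: p_def o_apply)
    have "u q = y' p" by (simp add: u_def o_apply p_def)
    then show ?thesis using tb(2)[OF p] q by simp
  qed
  have "t \<in> blk.Y n la" using tS tb(1) by (simp add: blk.Y_def)
  moreover have "u \<in> blk.Y n (cnj n la)" using uS ub by (simp add: blk.Y_def)
  moreover have "y' = u \<circ> (y \<circ> t)"
    unfolding u_def comp_assoc Sym_comp_inv(2)[OF ytS, unfolded comp_assoc] by simp
  ultimately show ?thesis using that by blast
qed

text \<open>The witness passes from reading the diagram by rows to reading it by columns:
  \<open>S\<close> and \<open>S'\<close> are the starting positions of rows and columns, and
  \<open>c p\<close> is the column of the box at \<open>p\<close>.\<close>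

lemma Gam_nonempty: "Gam n (blk la) (blk (cnj n la)) \<noteq> {}"
proof -
  define S where "S = (\<lambda>i. sum_list (take i la))"
  define S' where "S' = (\<lambda>j. sum_list (take j (cnj n la)))"
  define c where "c = (\<lambda>p. p - S (blk la p))"
  define y where "y = (\<lambda>p. if p < n then S' (c p) + blk la p else p)"
  have k: "c p < n" "blk la p < cnj n la ! c p" "p = S (blk la p) + c p" if "p < n" for p
  proof -
    have b: "S (blk la p) \<le> p" "p < S (Suc (blk la p))" "blk la p < length la"
      using blk_bounds[of p la] that la_sum by (auto simp: S_def)
    have "S (Suc (blk la p)) = S (blk la p) + la ! blk la p" using b(3) by (simp add: S_def take_Suc_conv_app_nth)
    then have c: "c p < la ! blk la p" using b by (simp add: c_def)
    then show "c p < n" using la_le[OF b(3)] by simp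
    then show "blk la p < cnj n la ! c p" using less_cnj[of "c p" "blk la p"] c b(3) by simp
    show "p = S (blk la p) + c p" using b by (simp add: c_def)
  qed
  have yb: "S' (c p) \<le> y p" "y p < S' (Suc (c p))" if "p < n" for p
    using k[OF that] that by (auto simp: y_def S'_def take_Suc_conv_app_nth)
  have yc: "blk (cnj n la) (y p) = c p" if "p < n" for p
    using yb[OF that] by (intro blk_eqI) (auto simp: S'_def)
  have yn: "y p < n" if "p < n" for p
    using yb(2)[OF that] sum_take_le[of "Suc (c p)" "cnj n la"] by (simp add: S'_def sum_cnj)
  have inj: "inj_on y {..<n}"
  proof (rule inj_onI)
    fix p q assume pq: "p \<in> {..<n}" "q \<in> {..<n}" "y p = y q"
    then have "c p = c q" using yc[of p] yc[of q] by simp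
    moreover then have "blk la p = blk la q" using pq by (simp add: y_def)
    ultimately show "p = q" using k(3)[of p] k(3)[of q] pq by simp
  qed
  have "y \<in> Sym n" unfolding Sym_def
  proof (rule CollectI, rule bij_imp_permutes)
    have "y ` {..<n} = {..<n}" by (rule endo_inj_surj[OF _ _ inj]) (auto simp: yn)
    then show "bij_betw y {..<n} {..<n}" using inj by (simp add: bij_betw_def)
  qed (simp add: y_def)
  moreover have "blk (cnj n la) (y p) \<noteq> blk (cnj n la) (y q)" if "p < n" "q < n" "p \<noteq> q" "blk la p = blk la q" for p q
    using yc[of p] yc[of q] k(3)[of p] k(3)[of q] that by auto
  ultimately show ?thesis by (auto simp: Gam_def)
qed

text \<open>Multiplicity one: \<open>Gam\<close> is a single double coset, on which the value at
  \<open>y0\<close> determines all others.\<close>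

lemma TS_proportional:
  assumes "tb.TS n la (cnj n la) h" "tb.TS n la (cnj n la) h'" "y0 \<in> Gam n (blk la) (blk (cnj n la))" "y \<in> Sym n"
  shows "h' y0 * h y = h y0 * h' y"
proof (cases "y \<in> Gam n (blk la) (blk (cnj n la))")
  case True
  obtain t u where tu: "t \<in> blk.Y n la" "u \<in> blk.Y n (cnj n la)" "y = u \<circ> (y0 \<circ> t)"
    using Gam_transitive[OF assms(3) True] .
  have y0: "y0 \<in> Sym n" using assms(3) by (simp add: Gam_def)
  obtain k1 where k1: "\<forall>h. tb.TS n la (cnj n la) h \<longrightarrow> h (y0 \<circ> t) = k1 * h y0" using tb.TS_right[OF tu(1) y0] by blast
  obtain k2 where k2: "\<forall>h. tb.TS n la (cnj n la) h \<longrightarrow> h (u \<circ> (y0 \<circ> t)) = k2 * h (y0 \<circ> t)"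
    using tb.TS_left[OF tu(2), of "y0 \<circ> t"] y0 blk.Y_Sym[OF tu(1)] by auto
  have "h y = k2 * (k1 * h y0)" "h' y = k2 * (k1 * h' y0)"
    unfolding tu(3) using k1[rule_format, OF assms(1)] k1[rule_format, OF assms(2)]
      k2[rule_format, OF assms(1)] k2[rule_format, OF assms(2)] by simp_all
  then show ?thesis by (simp add: algebra_simps)
next
  case False
  then have "h y = 0" "h' y = 0" using tb.TS_support assms by blast+
  then show ?thesis by simp
qed

end

lemma dominates_antisym:
  assumes "la \<in> partitions n" "mu \<in> partitions n" "dominates la mu" "dominates mu la"
  shows "la = mu"
proof -
  have st: "sum_list (take k la) = sum_list (take k mu)" for k
    using assms(3,4) by (auto simp: dominates_def intro: antisym)
  have pos: "sum_list (take k xs) < sum_list (take (Suc k) xs)" if "k < length xs" "0 \<notin> set xs" for k and xs :: "nat list"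
  proof -
    have "xs ! k \<noteq> 0" using that by (metis nth_mem)
    then show ?thesis using that by (simp add: take_Suc_conv_app_nth)
  qed
  have len: "length xs \<le> length ys" if "\<And>k. sum_list (take k xs) = sum_list (take k ys)" "0 \<notin> set xs" for xs ys :: "nat list"
  proof (rule ccontr)
    assume "\<not> length xs \<le> length ys"
    then have "length ys < length xs" by simp
    from pos[OF this that(2)] that(1)[of "length ys"] that(1)[of "Suc (length ys)"] show False by simp
  qed
  have z: "0 \<notin> set la" "0 \<notin> set mu" using assms by (auto simp: partitions_def)
  have l: "length la = length mu" using len[of la mu] len[of mu la] st z by (simp add: antisym)
  show ?thesis
  proof (rule nth_equalityI[OF l])
    fix i assume "i < length la"
    then show "la ! i = mu ! i" using st[of i] st[of "Suc i"] l by (simp add: take_Suc_conv_app_nth)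
  qed
qed

lemma dominates_trans: "dominates a b \<Longrightarrow> dominates b c \<Longrightarrow> dominates a c"
  unfolding dominates_def using le_trans by blast

lemma dominates_refl: "dominates a a"
  by (simp add: dominates_def)

lemma finite_partitions: "finite (partitions n)"
proof (rule finite_subset)
  show "partitions n \<subseteq> {xs. set xs \<subseteq> {..n} \<and> length xs \<le> n}"
  proof
    fix xs assume xs: "xs \<in> partitions n"
    have "x \<le> n" if "x \<in> set xs" for x using member_le_sum_list[OF that] xs by (simp add: partitions_def)
    moreover have "length ys \<le> sum_list ys" if "0 \<notin> set ys" for ys :: "nat list"
      using that by (induction ys) auto
    then have "length xs \<le> n" using xs by (auto simp: partitions_def)
    ultimately show "xs \<in> {xs. set xs \<subseteq> {..n} \<and> length xs \<le> n}" by auto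
  qed
qed (simp add: finite_lists_length_le)

subsection \<open>Absolute irreducibility\<close>

definition rowact :: "nat \<Rightarrow> (nat \<Rightarrow> ratf) \<Rightarrow> (nat \<Rightarrow> nat \<Rightarrow> ratf) \<Rightarrow> (nat \<Rightarrow> ratf) \<Rightarrow> ratf" where
  "rowact d \<phi> A u = (\<Sum>i<d. \<phi> i * mv d A u i)"

text \<open>The vectors annihilated by all functionals \<open>\<phi> T_y\<close> form an invariant
  subspace that misses the basis vector at \<open>k\<close>, so it is zero.\<close>

lemma rowact_separates:
  assumes X: "irreducible_rep n {..<d} X" and u: "u \<in> vecs {..<d}" and \<phi>: "k < d" "\<phi> k \<noteq> 0"
    and z: "\<And>y. y \<in> Sym n \<Longrightarrow> rowact d \<phi> (Mx d X y) u = 0"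
  shows "u = (\<lambda>_. 0)"
proof -
  have rep: "is_rep n {..<d} X" using X by (simp add: irreducible_rep_def)
  define U where "U = {u \<in> vecs {..<d}. \<forall>y\<in>Sym n. rowact d \<phi> (Mx d X y) u = 0}"
  have "invariant_subspace n {..<d} X U"
    unfolding invariant_subspace_def
  proof (intro conjI ballI allI)
    fix w x assume w: "w \<in> Sym n" and x: "x \<in> U"
    have "rowact d \<phi> (Mx d X y) (mv d (Mx d X w) x) = 0" if y: "y \<in> Sym n" for y
    proof -
      have "rowact d \<phi> (Mx d X y) (mv d (Mx d X w) x) = rowact d \<phi> (ev n d X (mulT n deltaK y (Tb w))) x"
        using rep_mult[OF rep y w] by (simp add: rowact_def flip: mm_mv)
      also have "\<dots> = (\<Sum>i<d. \<phi> i * (\<Sum>j<d. (\<Sum>v\<in>Sym n. mulT n deltaK y (Tb w) v * Mx d X v i j) * x j))"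
        by (simp add: rowact_def mv_def ev_def)
      also have "\<dots> = (\<Sum>i<d. \<Sum>j<d. \<Sum>v\<in>Sym n. mulT n deltaK y (Tb w) v * (\<phi> i * (Mx d X v i j * x j)))"
        by (simp add: sum_distrib_left sum_distrib_right algebra_simps)
      also have "\<dots> = (\<Sum>v\<in>Sym n. \<Sum>i<d. \<Sum>j<d. mulT n deltaK y (Tb w) v * (\<phi> i * (Mx d X v i j * x j)))"
        by (subst sum.swap[of _ "{..<d}" "Sym n"])
          (simp add: sum.swap[of _ "Sym n" "{..<d}"])
      also have "\<dots> = (\<Sum>v\<in>Sym n. mulT n deltaK y (Tb w) v * rowact d \<phi> (Mx d X v) x)"
        by (simp add: rowact_def mv_def sum_distrib_left)
      also have "\<dots> = 0" using x by (simp add: U_def)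
      finally show ?thesis .
    qed
    then show "act {..<d} (X w) x \<in> U" by (simp add: U_def act_eq mv_vecs[OF trunc_Mx])
  qed (auto simp: U_def vecs_def rowact_def mv_lin distrib_left sum.distrib mult.left_commute[of _ "c" for c] simp flip: sum_distrib_left)
  then have "U = {\<lambda>_. 0} \<or> U = vecs {..<d}" using X unfolding irreducible_rep_def by blast
  moreover have "evec k \<notin> U"
  proof
    assume "evec k \<in> U"
    then have "rowact d \<phi> (Mx d X id) (evec k) = 0" by (simp add: U_def)
    moreover have "rowact d \<phi> (Mx d X id) (evec k) = (\<Sum>i<d. if i = k then \<phi> k else 0)"
      unfolding rowact_def mv_evec[OF \<phi>(1)] rep_id[OF rep] by (intro sum.cong) (auto simp: idm_def)
    ultimately show False using \<phi> by (simp add: sum.delta)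
  qed
  ultimately have "U = {\<lambda>_. 0}" using evec_vecs[OF \<phi>(1)] by blast
  moreover have "u \<in> U" using u z by (simp add: U_def)
  ultimately show ?thesis by blast
qed

definition sgnvec where
  "sgnvec n d X la u \<longleftrightarrow> u \<in> vecs {..<d} \<and> u \<noteq> (\<lambda>_. 0) \<and>
     (\<forall>t\<in>blk.J n la. mv d (Mx d X t) u = (\<lambda>i. - inverse vK * u i))"

definition trivcov where
  "trivcov n d X la \<phi> \<longleftrightarrow> (\<exists>k<d. \<phi> k \<noteq> 0) \<and>
     (\<forall>s\<in>blk.J n (cnj n la). \<forall>j<d. (\<Sum>i<d. \<phi> i * Mx d X s i j) = vK * \<phi> j)"

lemma TS_rowact:
  assumes rep: "is_rep n {..<d} X" and \<phi>: "trivcov n d X la \<phi>"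
    and u: "\<And>t. t \<in> blk.J n mu \<Longrightarrow> mv d (Mx d X t) u = (\<lambda>i. - inverse vK * u i)"
  shows "tb.TS n mu (cnj n la) (\<lambda>y. rowact d \<phi> (Mx d X y) u)"
  unfolding tb.TS_def
proof (intro conjI ballI impI)
  fix s y assume s: "s \<in> blk.J n (cnj n la)" and y: "y \<in> Sym n" and up: "len n y < len n (s \<circ> y)"
  have sg: "s \<in> sgens n" using blk.J_sgens s by blast
  have "len n (s \<circ> y) = len n s + len n y" using len_left_cases[OF y sg] up sg by simp
  then have "Mx d X (s \<circ> y) = mm d (Mx d X s) (Mx d X y)" using rep_mult_add[OF rep _ y] sg by simp
  then have "rowact d \<phi> (Mx d X (s \<circ> y)) u = (\<Sum>i<d. \<phi> i * mv d (Mx d X s) (mv d (Mx d X y) u) i)"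
    by (simp add: rowact_def mm_mv)
  also have "\<dots> = (\<Sum>j<d. (\<Sum>i<d. \<phi> i * Mx d X s i j) * mv d (Mx d X y) u j)"
    unfolding mv_def[of d "Mx d X s"] sum_distrib_left sum_distrib_right by (subst sum.swap) (simp add: mult.assoc)
  also have "\<dots> = (\<Sum>j<d. vK * \<phi> j * mv d (Mx d X y) u j)"
    using \<phi> s by (simp add: trivcov_def)
  finally show "rowact d \<phi> (Mx d X (s \<circ> y)) u = vK * rowact d \<phi> (Mx d X y) u"
    by (simp add: rowact_def sum_distrib_left mult.assoc)
next
  fix t y assume t: "t \<in> blk.J n mu" and y: "y \<in> Sym n" and up: "len n y < len n (y \<circ> t)"
  have sg: "t \<in> sgens n" using blk.J_sgens t by blast
  have "len n (y \<circ> t) = len n y + len n t" using len_right_cases[OF y sg] up sg by simp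
  then have "Mx d X (y \<circ> t) = mm d (Mx d X y) (Mx d X t)" using rep_mult_add[OF rep y] sg by simp
  then have "mv d (Mx d X (y \<circ> t)) u = (\<lambda>i. - inverse vK * mv d (Mx d X y) u i)"
    using mm_mv[of d d "Mx d X y" "Mx d X t" u] u[OF t] mv_lin(2)[of d "Mx d X y" "- inverse vK" u] by simp
  then show "rowact d \<phi> (Mx d X (y \<circ> t)) u = - inverse vK * rowact d \<phi> (Mx d X y) u"
    by (simp add: rowact_def sum_distrib_left mult.left_commute sum_negf)
qed

text \<open>\<open>Z u\<close> is again a sign vector, so its matrix coefficients against
  \<open>\<phi>\<close> are proportional to those of \<open>u\<close>. Separation gives
  \<open>Z u = c u\<close>, and \<open>Z - c\<close> has a nonzero kernel vector, hence is zero by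
  Schur's lemma.\<close>

lemma scalar_endosI:
  assumes la: "la \<in> partitions n" and X: "irreducible_rep n {..<d} X"
    and u: "sgnvec n d X la u" and \<phi>: "trivcov n d X la \<phi>"
  shows "scalar_endos n d X"
  unfolding scalar_endos_def
proof (intro allI impI)
  fix Z assume Z: "inter n d X d X Z"
  have rep: "is_rep n {..<d} X" using X by (simp add: irreducible_rep_def)
  obtain y0 where y0: "y0 \<in> Gam n (blk la) (blk (cnj n la))" using Gam_nonempty[OF la] by blast
  obtain k where k: "k < d" "\<phi> k \<noteq> 0" using \<phi> by (auto simp: trivcov_def)
  have ut: "mv d (Mx d X t) u = (\<lambda>i. - inverse vK * u i)" if "t \<in> blk.J n la" for t using u that by (simp add: sgnvec_def)
  have Zt: "mv d (Mx d X t) (mv d Z u) = (\<lambda>i. - inverse vK * mv d Z u i)" if t: "t \<in> blk.J n la" for t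
  proof -
    have "t \<in> Sym n" using blk.J_sgens[OF t] by simp
    then have "mm d (Mx d X t) Z = mm d Z (Mx d X t)" using Z by (simp add: inter_def)
    then have "mv d (Mx d X t) (mv d Z u) = mv d Z (mv d (Mx d X t) u)" by (metis mm_mv)
    then show ?thesis using ut[OF t] mv_lin(2)[of d Z "- inverse vK" u] by simp
  qed
  let ?h = "\<lambda>y. rowact d \<phi> (Mx d X y) u" and ?h' = "\<lambda>y. rowact d \<phi> (Mx d X y) (mv d Z u)"
  have propn: "?h' y0 * ?h y = ?h y0 * ?h' y" if "y \<in> Sym n" for y
    using TS_proportional[OF la TS_rowact[OF rep \<phi> ut] TS_rowact[OF rep \<phi> Zt] y0 that] .
  have uv: "u \<in> vecs {..<d}" "u \<noteq> (\<lambda>_. 0)" using u by (auto simp: sgnvec_def)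
  have Zu: "mv d Z u \<in> vecs {..<d}" using Z mv_vecs by (auto simp: inter_def)
  have nz: "?h y0 \<noteq> 0"
  proof
    assume z: "?h y0 = 0"
    have "?h y = 0" if y: "y \<in> Sym n" for y
    proof -
      have "?h y0 * ?h y = ?h y0 * ?h y" by simp
      \<comment> \<open>Comparison with \<open>tsfun\<close>, which is nonzero at \<open>y0\<close>,
        shows that \<open>?h\<close> vanishes identically once it vanishes at
        \<open>y0\<close>.\<close>
      define h0 where "h0 = tb.tsfun n la (cnj n la)"
      have "h0 y0 * ?h y = ?h y0 * h0 y"
        using TS_proportional[OF la TS_rowact[OF rep \<phi> ut] tb.TS_tsfun y0 y] by (simp add: h0_def)
      moreover have "h0 y0 \<noteq> 0" using y0 by (simp add: h0_def tb.tsfun_def)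
      ultimately show ?thesis using z by simp
    qed
    then have "u = (\<lambda>_. 0)" using rowact_separates[where \<phi> = \<phi> and k = k, OF X uv(1) k] by blast
    then show False using uv(2) by simp
  qed
  define c where "c = ?h' y0 / ?h y0"
  define x where "x = (\<lambda>i. mv d Z u i + (- c) * u i)"
  have "x = (\<lambda>_. 0)"
  proof (rule rowact_separates[where \<phi> = \<phi> and k = k, OF X _ k])
    show "x \<in> vecs {..<d}" using uv Zu by (auto simp: x_def vecs_def)
    fix y assume y: "y \<in> Sym n"
    have "rowact d \<phi> (Mx d X y) x = ?h' y - c * ?h y"
      unfolding rowact_def x_def mv_lin by (simp add: algebra_simps sum.distrib sum_subtractf sum_distrib_left)
    also have "\<dots> = 0" using propn[OF y] nz by (simp add: c_def field_simps)
    finally show "rowact d \<phi> (Mx d X y) x = 0" .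
  qed
  define Z' where "Z' = (\<lambda>i j. Z i j - c * idm d i j)"
  have "inter n d X d X Z'" unfolding inter_def
  proof (intro conjI ballI ext)
    show "trunc d d Z'" using Z by (auto simp: inter_def trunc_def Z'_def idm_def)
    fix w i j assume w: "w \<in> Sym n"
    have "mm d (Mx d X w) Z' i j = mm d (Mx d X w) Z i j - c * mm d (Mx d X w) (idm d) i j"
      by (simp add: mm_def Z'_def algebra_simps sum_subtractf sum_distrib_left)
    moreover have "mm d Z' (Mx d X w) i j = mm d Z (Mx d X w) i j - c * mm d (idm d) (Mx d X w) i j"
      by (simp add: mm_def Z'_def algebra_simps sum_subtractf sum_distrib_left)
    ultimately show "mm d (Mx d X w) Z' i j = mm d Z' (Mx d X w) i j"
      using Z w mm_idm[OF trunc_Mx] by (simp add: inter_def)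
  qed
  moreover have "mv d Z' u = (\<lambda>_. 0)"
  proof
    fix i
    have "mv d Z' u i = mv d Z u i - c * mv d (idm d) u i"
      by (simp add: mv_def Z'_def algebra_simps sum_subtractf sum_distrib_left)
    moreover have "mv d (idm d) u i = u i"
    proof -
      have "mv d (idm d) u i = (\<Sum>j<d. if j = i then u i else 0)"
        unfolding mv_def by (intro sum.cong) (auto simp: idm_def)
      then show ?thesis using uv(1) by (auto simp: sum.delta vecs_def)
    qed
    ultimately show "mv d Z' u i = 0" using fun_cong[OF \<open>x = (\<lambda>_. 0)\<close>, of i] by (simp add: x_def)
  qed
  ultimately have "Z' = (\<lambda>_ _. 0)" using schur_inj[OF X _ _ uv(1)] uv(2) by blast
  then have "Z = (\<lambda>i j. c * idm d i j)" unfolding Z'_def by (metis eq_iff_diff_eq_0)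
  then show "\<exists>c. Z = (\<lambda>i j. c * idm d i j)" by blast
qed

text \<open>Some matrix coefficient of \<open>u\<close> against \<open>\<phi>\<close> is nonzero,
  and it can only be so on \<open>Gam\<close>, whose nonemptiness forces dominance.\<close>

lemma pair_dominates:
  assumes la: "la \<in> partitions n" and mu: "mu \<in> partitions n" and X: "irreducible_rep n {..<d} X"
    and u: "sgnvec n d X mu u" and \<phi>: "trivcov n d X la \<phi>"
  shows "dominates mu la"
proof -
  have rep: "is_rep n {..<d} X" using X by (simp add: irreducible_rep_def)
  obtain k where k: "k < d" "\<phi> k \<noteq> 0" using \<phi> by (auto simp: trivcov_def)
  have TS: "tb.TS n mu (cnj n la) (\<lambda>y. rowact d \<phi> (Mx d X y) u)"
    using u by (intro TS_rowact[OF rep \<phi>]) (simp add: sgnvec_def)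
  obtain y where "y \<in> Sym n" "rowact d \<phi> (Mx d X y) u \<noteq> 0"
    using rowact_separates[where \<phi> = \<phi> and k = k and u = u, OF X _ k] u by (auto simp: sgnvec_def)
  then have "y \<in> Gam n (blk mu) (blk (cnj n la))" using tb.TS_support[OF TS] by blast
  then show ?thesis using Gam_dominates[OF la] mu by (simp add: partitions_def)
qed

text \<open>For each \<open>la\<close> the element built from \<open>tsfun\<close> acts nontrivially
  in some representation \<open>f la\<close>, which then has a sign vector and a trivial covector
  for \<open>la\<close>. \<open>pair_dominates\<close> and antisymmetry make \<open>f\<close>
  injective, hence surjective on the finite set of partitions, so every representation is
  reached.\<close>

lemma all_scalar_endos:
  assumes irr: "\<And>la. la \<in> partitions n \<Longrightarrow> irreducible_rep n {..<d la} (X la)"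
    and faith: "\<And>h. supp_in n h \<Longrightarrow> (\<And>la. la \<in> partitions n \<Longrightarrow> ev n (d la) (X la) h = (\<lambda>_ _. 0)) \<Longrightarrow> h = (\<lambda>_. 0)"
    and mu: "mu \<in> partitions n"
  shows "scalar_endos n (d mu) (X mu)"
proof -
  have ex: "\<exists>mu\<in>partitions n. \<exists>u \<phi>. sgnvec n (d mu) (X mu) la u \<and> trivcov n (d mu) (X mu) la \<phi>"
    if la: "la \<in> partitions n" for la
  proof -
    define h where "h = tb.tsfun n la (cnj n la)"
    have hs: "supp_in n h" by (simp add: h_def tb.supp_tsfun)
    obtain y0 where y0: "y0 \<in> Gam n (blk la) (blk (cnj n la))" using Gam_nonempty[OF la] by blast
    have TS: "tb.TS n la (cnj n la) h" by (simp add: h_def tb.TS_tsfun)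
    have q1: "vK * vK = 1 + deltaK * vK" "(- inverse vK) * (- inverse vK) = 1 + deltaK * (- inverse vK)"
      by (simp_all add: deltaK_def field_simps)
    \<comment> \<open>\<open>flat\<close> turns the sides around: \<open>g\<close> is alternating on
      the left and trivial on the right, so the columns of its matrix are sign vectors and the rows
      trivial covectors.\<close>
    define g where "g = flat n h"
    have g: "supp_in n g" by (simp add: g_def)
    have left: "mulTs n deltaK t g = (\<lambda>y. - inverse vK * g y)" if t: "t \<in> blk.J n la" for t
    proof -
      have sg: "t \<in> sgens n" using blk.J_sgens[OF t] .
      have "rmul n deltaK t h = (\<lambda>y. - inverse vK * h y)"
        using TS t by (intro rmul_eigenI[OF sg hs q1(2)]) (simp add: tb.TS_def)
      then have "flat n (rmul n deltaK t h) = (\<lambda>y. - inverse vK * g y)"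
        using lin_scale[OF lin_flat, of n "- inverse vK" h] by (simp add: g_def)
      moreover have "flat n (mulTs n deltaK t g) = rmul n deltaK t h"
        using flat_mulTs[OF sg g] flat_flat[OF hs] by (simp add: g_def)
      ultimately show ?thesis using flat_flat[OF supp_mulTs[OF sg g]] by metis
    qed
    have right: "rmul n deltaK s g = (\<lambda>y. vK * g y)" if s: "s \<in> blk.J n (cnj n la)" for s
    proof -
      have sg: "s \<in> sgens n" using blk.J_sgens[OF s] .
      have "mulTs n deltaK s h = (\<lambda>y. vK * h y)"
        using TS s by (intro mulTs_eigenI[OF sg hs q1(1)]) (simp add: tb.TS_def)
      then have "flat n (mulTs n deltaK s h) = (\<lambda>y. vK * g y)"
        using lin_scale[OF lin_flat, of n vK h] by (simp add: g_def)
      then show ?thesis using flat_mulTs[OF sg hs] by (simp add: g_def)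
    qed
    have "g \<noteq> (\<lambda>_. 0)"
    proof
      assume "g = (\<lambda>_. 0)"
      then have "h = flat n (\<lambda>_. 0)" using flat_flat[OF hs] by (simp add: g_def)
      then have "h y0 = 0" by (simp add: flat_def)
      then show False using y0 by (simp add: h_def tb.tsfun_def)
    qed
    then obtain mu where mu: "mu \<in> partitions n" "ev n (d mu) (X mu) g \<noteq> (\<lambda>_ _. 0)" using faith[OF g] by blast
    let ?d = "d mu" and ?X = "X mu"
    define E where "E = ev n ?d ?X g"
    have rep: "is_rep n {..<?d} ?X" using irr[OF mu(1)] by (simp add: irreducible_rep_def)
    have Et: "trunc ?d ?d E" by (simp add: E_def)
    obtain i j where ij: "E i j \<noteq> 0" using mu(2) by (auto simp: E_def fun_eq_iff)
    then have ijd: "i < ?d" "j < ?d" using Et by (auto simp: trunc_def)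
    have "sgnvec n ?d ?X la (\<lambda>m. E m j)"
      unfolding sgnvec_def
    proof (intro conjI ballI)
      show "(\<lambda>m. E m j) \<in> vecs {..<?d}" using Et by (auto simp: vecs_def trunc_def)
      show "(\<lambda>m. E m j) \<noteq> (\<lambda>_. 0)" using ij by metis
      fix t assume t: "t \<in> blk.J n la"
      have "mm ?d (Mx ?d ?X t) E = (\<lambda>i j. - inverse vK * E i j)"
        using rep_mulTs[OF rep blk.J_sgens[OF t] g] left[OF t] ev_lin(2)[of n ?d ?X "- inverse vK" g] by (simp add: E_def)
      then show "mv ?d (Mx ?d ?X t) (\<lambda>m. E m j) = (\<lambda>m. - inverse vK * E m j)"
        by (simp add: mm_def mv_def fun_eq_iff)
    qed
    moreover have "trivcov n ?d ?X la (\<lambda>m. E i m)"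
      unfolding trivcov_def
    proof (intro conjI ballI allI impI)
      show "\<exists>k<?d. E i k \<noteq> 0" using ij ijd by blast
      fix s m assume s: "s \<in> blk.J n (cnj n la)" and "m < ?d"
      have sg: "s \<in> sgens n" using blk.J_sgens[OF s] .
      have ts: "Tb s = rmul n deltaK s (Tb id)" using sg by (simp add: rmul_Tb)
      have "hmult n deltaK g (Tb s) = rmul n deltaK s g"
        using hmult_rmul[OF sg, of "Tb id" deltaK g] hmult_Tb_id_right[OF g] by (simp add: ts)
      then have "mm ?d E (Mx ?d ?X s) = (\<lambda>i j. vK * E i j)"
        using rep_hmult[OF rep g, of "Tb s"] sg right[OF s] ev_lin(2)[of n ?d ?X vK g] by (simp add: E_def ev_Tb)
      then show "(\<Sum>k<?d. E i k * Mx ?d ?X s k m) = vK * E i m"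
        by (simp add: mm_def fun_eq_iff)
    qed
    ultimately show ?thesis using mu(1) by blast
  qed
  then obtain f where f: "f la \<in> partitions n" "\<exists>u \<phi>. sgnvec n (d (f la)) (X (f la)) la u \<and> trivcov n (d (f la)) (X (f la)) la \<phi>"
    if "la \<in> partitions n" for la by metis
  have "inj_on f (partitions n)"
  proof (rule inj_onI)
    fix a b assume ab: "a \<in> partitions n" "b \<in> partitions n" "f a = f b"
    obtain u \<phi> where 1: "sgnvec n (d (f a)) (X (f a)) a u" "trivcov n (d (f a)) (X (f a)) a \<phi>" using f(2)[OF ab(1)] by blast
    obtain u' \<phi>' where 2: "sgnvec n (d (f a)) (X (f a)) b u'" "trivcov n (d (f a)) (X (f a)) b \<phi>'"
      using f(2)[OF ab(2)] ab(3) by metis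
    show "a = b"
      using pair_dominates[OF ab(1,2) irr[OF f(1)[OF ab(1)]] 2(1) 1(2)] pair_dominates[OF ab(2,1) irr[OF f(1)[OF ab(1)]] 1(1) 2(2)]
        dominates_antisym ab by blast
  qed
  then have "f ` partitions n = partitions n"
    using f(1) by (intro endo_inj_surj[OF finite_partitions]) auto
  then obtain la where la: "la \<in> partitions n" "mu = f la" using mu by blast
  then show ?thesis using f(2)[OF la(1)] scalar_endosI[OF la(1) irr[OF mu]] by blast
qed

section \<open>Schur relations\<close>

abbreviation emb :: "(perm \<Rightarrow> laur) \<Rightarrow> perm \<Rightarrow> ratf" where
  "emb h \<equiv> (\<lambda>y. embA (h y))"

lemma supp_emb [simp]: "supp_in n h \<Longrightarrow> supp_in n (emb h)"
  by (simp add: supp_in_def)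

lemma emb_Tb: "emb (Tb w) = Tb w"
  by (auto simp: Tb_def)

lemma emb_mulTs: "emb (mulTs n deltaA s h) = mulTs n deltaK s (emb h)"
  by (auto simp: mulTs_def)

lemma emb_Lw: "emb (Lw n deltaA ss h) = Lw n deltaK ss (emb h)"
  by (induction ss) (simp_all add: emb_mulTs)

lemma emb_mulT: "emb (mulT n deltaA x h) = mulT n deltaK x (emb h)"
  by (simp add: mulT_def emb_Lw)

lemma emb_hmult: "emb (hmult n deltaA g h) = hmult n deltaK (emb g) (emb h)"
  by (simp add: hmult_def fun_eq_iff) (simp add: fun_cong[OF emb_mulT])

lemma emb_flat: "emb (flat n h) = flat n (emb h)"
  by (auto simp: flat_def)

lemma vadic:
  assumes "f \<noteq> 0" obtains k c where "c \<noteq> 0" "isval (vK powi k * f) c"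
proof -
  obtain p q where f: "f = Fract p q" "q \<noteq> 0" by (cases f)
  have pnz: "p \<noteq> 0" using assms f by (auto simp: Zero_fract_def eq_fract)
  have dec: "\<exists>m p'. p = [:0, 1:] ^ m * p' \<and> poly p' 0 \<noteq> 0" if nz: "p \<noteq> 0" for p :: "real poly"
  proof -
    obtain p' where "p = [:- 0, 1:] ^ order 0 p * p'" "\<not> [:- 0, 1:] dvd p'" using order_decomp[OF nz, of 0] by blast
    then show ?thesis using poly_eq_0_iff_dvd[of p' 0] by auto
  qed
  obtain m p' where p: "p = [:0, 1:] ^ m * p'" "poly p' 0 \<noteq> 0" using dec[OF pnz] by blast
  obtain l q' where q: "q = [:0, 1:] ^ l * q'" "poly q' 0 \<noteq> 0" using dec[OF f(2)] by blast
  have pw: "vK ^ j = Fract ([:0, 1:] ^ j) 1" for j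
    by (induction j) (simp_all add: vK_def One_fract_def)
  have q'nz: "q' \<noteq> 0" using q by auto
  have "f = vK ^ m * Fract p' q' / vK ^ l"
    using f q'nz q by (simp add: pw p eq_fract mult.assoc mult.left_commute)
  then have "vK powi (int l - int m) * f = Fract p' q'"
    by (simp add: power_int_diff)
  moreover have "isval (Fract p' q') (poly p' 0 / poly q' 0)" using q by (intro isvalI) auto
  ultimately show ?thesis using that[of "poly p' 0 / poly q' 0" "int l - int m"] p q by simp
qed

text \<open>The largest exponent shift required by any member makes the whole family regular at v =
  0 and leaves at least one value nonzero.\<close>

lemma vadic_family:
  assumes "finite S" "s0 \<in> S" "f s0 \<noteq> 0"
  obtains k c s where "\<And>s. s \<in> S \<Longrightarrow> isval (vK powi k * f s) (c s)" "s \<in> S" "c s \<noteq> 0"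
proof -
  have "\<exists>k c. f s \<noteq> 0 \<longrightarrow> c \<noteq> 0 \<and> isval (vK powi k * f s) c" for s
    using vadic[of "f s"] by metis
  then obtain K C where KC: "C s \<noteq> 0" "isval (vK powi (K s) * f s) (C s)" if "f s \<noteq> 0" for s by metis
  define S' where "S' = {s \<in> S. f s \<noteq> 0}"
  have S': "finite S'" "S' \<noteq> {}" using assms by (auto simp: S'_def)
  define k where "k = Max (K ` S')"
  have kmax: "K s \<le> k" if "s \<in> S'" for s unfolding k_def using S' that by simp
  have "k \<in> K ` S'" unfolding k_def using S' by (intro Max_in) auto
  then obtain s where s: "s \<in> S'" "k = K s" by auto
  define c where "c = (\<lambda>s. if f s \<noteq> 0 \<and> K s = k then C s else 0)"
  have "isval (vK powi k * f s) (c s)" if "s \<in> S" for s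
  proof (cases "f s = 0")
    case True
    then show ?thesis by (simp add: c_def isval_zero)
  next
    case False
    then have "K s \<le> k" using kmax that by (simp add: S'_def)
    then obtain j where j: "k = int j + K s" using zle_iff_zadd[of "K s" k] by (auto simp: add.commute)
    show ?thesis
    proof (cases "j = 0")
      case True
      then show ?thesis using KC False j by (simp add: c_def)
    next
      case nz: False
      have "isval (vK ^ j * (vK powi K s * f s)) 0" using isval_mult[OF isval_vK_pow[of j] KC(2)[OF False]] nz by simp
      moreover have "vK ^ j * (vK powi K s * f s) = vK powi k * f s"
        by (simp add: j power_int_add mult.assoc)
      ultimately show ?thesis using nz j by (simp add: c_def)
    qed
  qed
  moreover have "s \<in> S" "c s \<noteq> 0" using s KC by (auto simp: S'_def c_def)
  ultimately show ?thesis using that by blast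
qed

lemma isval_nz: "isval f c \<Longrightarrow> c \<noteq> 0 \<Longrightarrow> f \<noteq> 0"
  using isval_unique isval_zero by blast

lemma int_squares_sum_one:
  fixes f :: "'a \<Rightarrow> real"
  assumes "finite A" "\<And>x. x \<in> A \<Longrightarrow> f x \<in> \<int>" "(\<Sum>x\<in>A. f x * f x) = 1"
  shows "\<exists>!x. x \<in> A \<and> f x \<noteq> 0"
proof -
  obtain x where x: "x \<in> A" "f x \<noteq> 0" using assms(3) by (metis mult_zero_left sum.neutral zero_neq_one)
  have ge: "1 \<le> f y * f y" if y: "y \<in> A" "f y \<noteq> 0" for y
  proof -
    obtain m where m: "f y = of_int m" using assms(2)[OF y(1)] by (auto elim: Ints_cases)
    then have "m \<noteq> 0" using y by auto
    then have "1 \<le> m * m" by (simp add: int_one_le_iff_zero_less zero_less_mult_iff) linarith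
    then show ?thesis unfolding m by (metis of_int_1_le_iff of_int_mult)
  qed
  have "y = x" if y: "y \<in> A" "f y \<noteq> 0" for y
  proof (rule ccontr)
    assume "y \<noteq> x"
    then have "(\<Sum>z\<in>{x, y}. f z * f z) = f x * f x + f y * f y" by simp
    moreover have "(\<Sum>z\<in>{x, y}. f z * f z) \<le> (\<Sum>z\<in>A. f z * f z)"
      using x y assms(1) by (intro sum_mono2) auto
    ultimately show False using ge[OF x] ge[OF y] assms(3) by simp
  qed
  with x show ?thesis by blast
qed

text \<open>\<open>p la i\<close> are the diagonal entries of \<open>P\<close>, viewed in the field.
  They have the value 1 at v = 0, so that orthogonality of the representation becomes plain symmetry
  there.\<close>

locale hecke_data =
  fixes n :: nat and X :: "nat list \<Rightarrow> perm \<Rightarrow> nat \<Rightarrow> nat \<Rightarrow> ratf" and d :: "nat list \<Rightarrow> nat"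
    and p :: "nat list \<Rightarrow> nat \<Rightarrow> ratf"
  assumes irr: "la \<in> partitions n \<Longrightarrow> irreducible_rep n {..<d la} (X la)"
    and all: "irr_char n \<chi> \<Longrightarrow> \<exists>la\<in>partitions n. \<chi> = hk_char n {..<d la} (X la)"
    and inj: "la \<in> partitions n \<Longrightarrow> mu \<in> partitions n \<Longrightarrow>
       hk_char n {..<d la} (X la) = hk_char n {..<d mu} (X mu) \<Longrightarrow> la = mu"
    and label: "la \<in> partitions n \<Longrightarrow> \<exists>m :: nat list \<Rightarrow> nat.
        ind_sign_char n la = (\<lambda>w. hk_char n {..<d la} (X la) w +
          (\<Sum>mu\<in>{mu \<in> partitions n. dominates la mu \<and> mu \<noteq> la}.
              of_nat (m mu) * hk_char n {..<d mu} (X mu) w))"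
    and orth: "la \<in> partitions n \<Longrightarrow> w \<in> Sym n \<Longrightarrow> i < d la \<Longrightarrow> j < d la \<Longrightarrow>
       X la (inv w) i j = p la j * X la w j i / p la i"
    and pval: "la \<in> partitions n \<Longrightarrow> i < d la \<Longrightarrow> isval (p la i) 1"
    and reg: "la \<in> partitions n \<Longrightarrow> w \<in> Sym n \<Longrightarrow> i < d la \<Longrightarrow> j < d la \<Longrightarrow>
       regular0 (vK ^ a_fun n la * X la w i j)"
    and intg: "la \<in> partitions n \<Longrightarrow> w \<in> Sym n \<Longrightarrow> i < d la \<Longrightarrow> j < d la \<Longrightarrow>
       value0 (vK ^ a_fun n la * X la w i j) \<in> \<int>"
begin

abbreviation "\<Lambda> \<equiv> partitions n"
abbreviation "M la w \<equiv> Mx (d la) (X la) w"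
abbreviation "E la h \<equiv> ev n (d la) (X la) h"
abbreviation "a la \<equiv> a_fun n la"
abbreviation "c la \<equiv> schur_elt n (X la)"

lemma rep: "la \<in> \<Lambda> \<Longrightarrow> is_rep n {..<d la} (X la)"
  using irr by (simp add: irreducible_rep_def)

lemma d_pos: "la \<in> \<Lambda> \<Longrightarrow> 0 < d la"
  using irr[of la] unfolding irreducible_rep_def by (metis gr0I lessThan_0)

lemma p_nz: "la \<in> \<Lambda> \<Longrightarrow> i < d la \<Longrightarrow> p la i \<noteq> 0"
  using pval isval_nz by (metis zero_neq_one)

lemma faith: "supp_in n h \<Longrightarrow> (\<And>la. la \<in> \<Lambda> \<Longrightarrow> E la h = (\<lambda>_ _. 0)) \<Longrightarrow> h = (\<lambda>_. 0)"
  using faithful[of \<Lambda> n d X p h] irr all orth p_nz by blast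

lemma sc: "la \<in> \<Lambda> \<Longrightarrow> scalar_endos n (d la) (X la)"
  using all_scalar_endos[of n d X la] irr faith by blast

lemma M_inv: "la \<in> \<Lambda> \<Longrightarrow> w \<in> Sym n \<Longrightarrow> i < d la \<Longrightarrow> j < d la \<Longrightarrow> M la (inv w) i j = p la j * M la w j i / p la i"
  using orth by (simp add: Mx_def)

lemma E_flat:
  assumes "la \<in> \<Lambda>" "i < d la" "j < d la"
  shows "E la (flat n h) i j = p la j / p la i * E la h j i"
proof -
  have "E la (flat n h) i j = (\<Sum>w\<in>Sym n. flat n h (inv w) * M la (inv w) i j)"
    unfolding ev_def by (rule sum_Sym_inv[symmetric])
  also have "\<dots> = (\<Sum>w\<in>Sym n. p la j / p la i * (h w * M la w j i))"
    by (rule sum.cong) (use assms in \<open>auto simp: flat_def M_inv\<close>)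
  finally show ?thesis by (simp add: ev_def sum_distrib_left)
qed

lemma schur_M:
  assumes "la \<in> \<Lambda>" "mu \<in> \<Lambda>" "i < d la" "j < d la" "k < d mu" "l < d mu"
  shows "(\<Sum>w\<in>Sym n. M la w i j * M mu (inv w) k l) = (if la = mu \<and> i = l \<and> j = k then c la else 0)"
proof (cases "la = mu")
  case True
  then show ?thesis using schur_rel[OF rep[OF assms(1)] sc[OF assms(1)], of i j k l] assms by simp
next
  case False
  then have "hk_char n {..<d la} (X la) \<noteq> hk_char n {..<d mu} (X mu)" using inj assms by blast
  then show ?thesis using schur_zero[OF irr irr] assms False by simp
qed

lemma schur_M2:
  assumes "la \<in> \<Lambda>" "mu \<in> \<Lambda>" "i < d la" "j < d la" "k < d mu" "l < d mu"
  shows "(\<Sum>w\<in>Sym n. M la w i j * M mu w k l) =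
    (if la = mu \<and> i = k \<and> j = l then c la * p la j / p la i else 0)"
proof -
  have "M mu w k l = p mu l / p mu k * M mu (inv w) l k" if "w \<in> Sym n" for w
    using M_inv[OF assms(2) that assms(6,5)] p_nz[OF assms(2)] assms by simp
  then have "(\<Sum>w\<in>Sym n. M la w i j * M mu w k l) = p mu l / p mu k * (\<Sum>w\<in>Sym n. M la w i j * M mu (inv w) l k)"
    by (simp add: sum_distrib_left mult.left_commute)
  also have "\<dots> = (if la = mu \<and> i = k \<and> j = l then c la * p la j / p la i else 0)"
    unfolding schur_M[OF assms(1-4,6,5)] by auto
  finally show ?thesis .
qed

text \<open>The Schur element is a sum of squares, one of which is the square of the entry 1 at
  \<open>id\<close>.\<close>

lemma c_nz: assumes "la \<in> \<Lambda>" shows "c la \<noteq> 0"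
proof
  assume "c la = 0"
  then have "(\<Sum>w\<in>Sym n. M la w 0 0 * M la w 0 0) = 0" using schur_M2[OF assms assms] d_pos[OF assms] by simp
  then have "M la id 0 0 = 0" using sum_squares_zero[of "Sym n" "\<lambda>w. M la w 0 0" id] by simp
  then show False using rep_id[OF rep[OF assms]] d_pos[OF assms] by (simp add: idm_def)
qed

section \<open>Orthogonality and completeness of matrix coefficients\<close>

definition Ix :: "(nat list \<times> nat \<times> nat) set" where
  "Ix = (SIGMA la:\<Lambda>. {..<d la} \<times> {..<d la})"

lemma finite_Ix [simp]: "finite Ix"
  unfolding Ix_def using finite_partitions by (intro finite_SigmaI) auto

lemma Ix_iff [simp]: "(la, i, j) \<in> Ix \<longleftrightarrow> la \<in> \<Lambda> \<and> i < d la \<and> j < d la"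
  by (auto simp: Ix_def)

definition G :: "nat list \<times> nat \<times> nat \<Rightarrow> perm \<Rightarrow> ratf" where
  "G = (\<lambda>(la, i, j) w. M la w i j)"

definition q :: "nat list \<times> nat \<times> nat \<Rightarrow> ratf" where
  "q = (\<lambda>(la, i, j). c la * p la j / p la i)"

lemma G_orth: "x \<in> Ix \<Longrightarrow> x' \<in> Ix \<Longrightarrow> (\<Sum>w\<in>Sym n. G x w * G x' w) = (if x = x' then q x else 0)"
  by (cases x; cases x') (auto simp: G_def q_def schur_M2)

lemma q_nz: "x \<in> Ix \<Longrightarrow> q x \<noteq> 0"
  by (cases x) (auto simp: q_def c_nz p_nz)

text \<open>The defect \<open>h\<close> is annihilated by every irreducible representation, by the
  first orthogonality relation, so it vanishes by faithfulness.\<close>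

lemma G_complete:
  assumes w: "w \<in> Sym n" and y: "y \<in> Sym n"
  shows "(\<Sum>x\<in>Ix. G x w * G x y / q x) = (if y = w then 1 else 0)"
proof -
  define h where "h = (\<lambda>y. if y \<in> Sym n then (\<Sum>x\<in>Ix. G x w * G x y / q x) - Tb w y else 0)"
  have "E mu h i j = 0" if mu: "mu \<in> \<Lambda>" for mu i j
  proof (cases "i < d mu \<and> j < d mu")
    case True
    define x' where "x' = (mu, i, j)"
    have x': "x' \<in> Ix" using True mu by (simp add: x'_def)
    have Gx': "M mu y i j = G x' y" for y by (simp add: x'_def G_def)
    have "E mu h i j = (\<Sum>y\<in>Sym n. (\<Sum>x\<in>Ix. G x w * G x y / q x) * G x' y) - (\<Sum>y\<in>Sym n. Tb w y * G x' y)"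
      by (simp add: ev_def h_def Gx' left_diff_distrib sum_subtractf)
    also have "(\<Sum>y\<in>Sym n. Tb w y * G x' y) = G x' w" using sum_mult_Tb[OF w, of "G x'"] by (simp add: mult.commute)
    also have "(\<Sum>y\<in>Sym n. (\<Sum>x\<in>Ix. G x w * G x y / q x) * G x' y) =
       (\<Sum>y\<in>Sym n. \<Sum>x\<in>Ix. G x w / q x * (G x y * G x' y))"
      by (simp add: sum_distrib_right mult.assoc)
    also have "\<dots> = (\<Sum>x\<in>Ix. G x w / q x * (\<Sum>y\<in>Sym n. G x y * G x' y))"
      by (subst sum.swap) (simp add: sum_distrib_left)
    also have "\<dots> = (\<Sum>x\<in>Ix. if x = x' then G x' w else 0)"
      using x' q_nz by (intro sum.cong) (auto simp: G_orth)
    also have "\<dots> = G x' w" using x' by (simp add: sum.delta)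
    finally show ?thesis by simp
  next
    case False
    then show ?thesis using trunc_ev unfolding trunc_def by blast
  qed
  then have "h = (\<lambda>_. 0)" by (intro faith) (auto simp: h_def supp_in_def fun_eq_iff)
  then have "h y = 0" by simp
  then show ?thesis using y by (simp add: h_def Tb_def)
qed

definition chi :: "nat list \<Rightarrow> (perm \<Rightarrow> ratf) \<Rightarrow> ratf" where
  "chi la h = (\<Sum>i<d la. E la h i i)"

text \<open>The symmetrizing trace is the sum of the irreducible characters divided by their Schur
  elements: this is \<open>G_complete\<close> with one argument at \<open>id\<close>.\<close>

lemma tau:
  assumes "supp_in n h" shows "(\<Sum>la\<in>\<Lambda>. chi la h / c la) = h id"
proof -
  have cw: "(\<Sum>la\<in>\<Lambda>. (\<Sum>i<d la. M la w i i) / c la) = (if id = w then 1 else 0)" if w: "w \<in> Sym n" for w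
  proof -
    have "(\<Sum>x\<in>Ix. G x w * G x id / q x) = (\<Sum>la\<in>\<Lambda>. \<Sum>(i, j)\<in>{..<d la} \<times> {..<d la}. G (la, i, j) w * G (la, i, j) id / q (la, i, j))"
      unfolding Ix_def by (subst sum.Sigma) (auto simp: finite_partitions case_prod_unfold)
    also have "\<dots> = (\<Sum>la\<in>\<Lambda>. \<Sum>i<d la. \<Sum>j<d la. if j = i then M la w i i / c la else 0)"
    proof (rule sum.cong[OF refl])
      fix la assume la: "la \<in> \<Lambda>"
      have "(\<Sum>(i, j)\<in>{..<d la} \<times> {..<d la}. G (la, i, j) w * G (la, i, j) id / q (la, i, j)) =
        (\<Sum>i<d la. \<Sum>j<d la. G (la, i, j) w * G (la, i, j) id / q (la, i, j))"
        by (simp add: sum.cartesian_product)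
      also have "\<dots> = (\<Sum>i<d la. \<Sum>j<d la. if j = i then M la w i i / c la else 0)"
        using p_nz[OF la] rep_id[OF rep[OF la]] by (intro sum.cong) (auto simp: G_def q_def idm_def)
      finally show "(\<Sum>(i, j)\<in>{..<d la} \<times> {..<d la}. G (la, i, j) w * G (la, i, j) id / q (la, i, j)) =
        (\<Sum>i<d la. \<Sum>j<d la. if j = i then M la w i i / c la else 0)" .
    qed
    also have "\<dots> = (\<Sum>la\<in>\<Lambda>. (\<Sum>i<d la. M la w i i) / c la)"
      by (simp add: sum.delta sum_divide_distrib)
    finally show ?thesis using G_complete[OF w, of id] by simp
  qed
  have "chi la h / c la = (\<Sum>w\<in>Sym n. h w * ((\<Sum>i<d la. M la w i i) / c la))" for la
    unfolding chi_def ev_def by (subst sum.swap) (simp add: sum_distrib_left sum_divide_distrib)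
  then have "(\<Sum>la\<in>\<Lambda>. chi la h / c la) = (\<Sum>w\<in>Sym n. h w * (\<Sum>la\<in>\<Lambda>. (\<Sum>i<d la. M la w i i) / c la))"
    by simp (subst sum.swap, simp add: sum_distrib_left)
  also have "\<dots> = (\<Sum>w\<in>Sym n. if w = id then h id else 0)" by (intro sum.cong) (auto simp: cw)
  finally show ?thesis by (simp add: sum.delta)
qed

section \<open>The sign quasi-idempotents and induced characters\<close>

abbreviation "eK la \<equiv> emb (blk.eb n la)"
abbreviation "piK la \<equiv> embA (blk.piY n la)"

lemma tr_sandwich:
  assumes "la \<in> \<Lambda>" and A: "trunc (d la) (d la) A"
  shows "(\<Sum>w\<in>Sym n. \<Sum>i<d la. mm (d la) (mm (d la) (M la w) A) (M la (inv w)) i i) =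
    of_nat (d la) * c la * (\<Sum>j<d la. A j j)"
proof -
  let ?d = "d la"
  have "(\<Sum>w\<in>Sym n. \<Sum>i<?d. mm ?d (mm ?d (M la w) A) (M la (inv w)) i i) =
     (\<Sum>w\<in>Sym n. \<Sum>i<?d. \<Sum>k<?d. \<Sum>j<?d. A j k * (M la w i j * M la (inv w) k i))"
    by (simp add: mm_def sum_distrib_left sum_distrib_right algebra_simps)
  also have "\<dots> = (\<Sum>i<?d. \<Sum>k<?d. \<Sum>j<?d. \<Sum>w\<in>Sym n. A j k * (M la w i j * M la (inv w) k i))"
    by (subst sum.swap, intro sum.cong refl, subst sum.swap, intro sum.cong refl, subst sum.swap, simp)
  also have "\<dots> = (\<Sum>i<?d. \<Sum>k<?d. \<Sum>j<?d. A j k * (if j = k then c la else 0))"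
    using assms(1) by (intro sum.cong refl) (simp add: schur_M flip: sum_distrib_left)
  also have "\<dots> = (\<Sum>i<?d. \<Sum>k<?d. A k k * c la)"
    by (simp add: if_distrib[of "\<lambda>x. _ * x"] sum.delta cong: if_cong)
  finally show ?thesis by (simp add: sum_distrib_left sum_distrib_right algebra_simps)
qed

lemma chi_orth:
  assumes "nu \<in> \<Lambda>" "mu \<in> \<Lambda>"
  shows "(\<Sum>w\<in>Sym n. (\<Sum>i<d nu. M nu w i i) * (\<Sum>k<d mu. M mu (inv w) k k)) =
    (if nu = mu then of_nat (d mu) * c mu else 0)"
proof -
  have "(\<Sum>w\<in>Sym n. (\<Sum>i<d nu. M nu w i i) * (\<Sum>k<d mu. M mu (inv w) k k)) =
     (\<Sum>w\<in>Sym n. \<Sum>i<d nu. \<Sum>k<d mu. M nu w i i * M mu (inv w) k k)" by (simp add: sum_product)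
  also have "\<dots> = (\<Sum>i<d nu. \<Sum>k<d mu. \<Sum>w\<in>Sym n. M nu w i i * M mu (inv w) k k)"
    by (subst sum.swap, intro sum.cong refl, subst sum.swap, simp)
  also have "\<dots> = (\<Sum>i<d nu. \<Sum>k<d mu. if nu = mu \<and> k = i then c nu else 0)"
    using assms by (intro sum.cong refl) (auto simp: schur_M)
  also have "\<dots> = (if nu = mu then of_nat (d mu) * c mu else 0)"
    by (auto simp: sum.delta)
  finally show ?thesis .
qed

lemma E_eK:
  assumes la: "la \<in> \<Lambda>" and mu: "mu \<in> \<Lambda>" and u: "u \<in> blk.Y n la"
  shows "mm (d mu) (M mu u) (E mu (eK la)) = (\<lambda>i j. (- inverse vK) ^ len n u * E mu (eK la) i j)"
    "mm (d mu) (E mu (eK la)) (M mu u) = (\<lambda>i j. (- inverse vK) ^ len n u * E mu (eK la) i j)"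
proof -
  have uS: "u \<in> Sym n" using blk.Y_Sym[OF u] .
  have es: "supp_in n (eK la)" by simp
  have left: "mulT n deltaK w (eK la) = (\<lambda>y. (- inverse vK) ^ len n w * eK la y)" if "w \<in> blk.Y n la" for w
    using blk.mulT_Y_eb[OF that] by (simp add: emb_mulT[symmetric])
  show "mm (d mu) (M mu u) (E mu (eK la)) = (\<lambda>i j. (- inverse vK) ^ len n u * E mu (eK la) i j)"
    using rep_mulT[OF rep[OF mu] uS es] left[OF u] by (simp add: ev_lin)
  have fe: "flat n (eK la) = eK la" using emb_flat[of n "blk.eb n la"] blk.flat_eb[of n la] by simp
  have "hmult n deltaK (eK la) (Tb u) = flat n (hmult n deltaK (Tb (inv u)) (eK la))"
    using flat_hmult[of n "Tb (inv u)" "eK la" deltaK] uS fe by (simp add: flat_Tb)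
  also have "\<dots> = (\<lambda>y. (- inverse vK) ^ len n u * eK la y)"
    using left[OF blk.Y_inv[OF u]] uS lin_scale[OF lin_flat, of n "(- inverse vK) ^ len n u" "eK la"] fe
    by (simp add: hmult_Tb_left len_inv)
  finally show "mm (d mu) (E mu (eK la)) (M mu u) = (\<lambda>i j. (- inverse vK) ^ len n u * E mu (eK la) i j)"
    using rep_hmult[OF rep[OF mu] es, of "Tb u"] uS by (simp add: ev_Tb ev_lin)
qed

text \<open>Frobenius reciprocity: up to the scalar \<open>piK la\<close>, the trace of the sign
  quasi-idempotent on \<open>mu\<close> is the multiplicity of \<open>mu\<close> in the induced sign
  character. The pairing \<open>S\<close> of the two characters is evaluated once by orthogonality
  and once in the coset basis of the induced module.\<close>

lemma chi_eK:
  assumes la: "la \<in> \<Lambda>"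
  shows "\<exists>m :: nat list \<Rightarrow> nat. m la = 1 \<and> (\<forall>mu. \<not> dominates la mu \<longrightarrow> m mu = 0) \<and>
    (\<forall>mu\<in>\<Lambda>. chi mu (eK la) = piK la * of_nat (m mu))"
proof -
  have sl: "sum_list la = n" using la by (simp add: partitions_def)
  obtain m where m: "ind_sign_char n la = (\<lambda>w. hk_char n {..<d la} (X la) w +
          (\<Sum>mu\<in>{mu \<in> partitions n. dominates la mu \<and> mu \<noteq> la}.
              of_nat (m mu) * hk_char n {..<d mu} (X mu) w))" using label[OF la] by blast
  define m' where "m' = (\<lambda>mu. if mu = la then 1 else if dominates la mu then m mu else 0 :: nat)"
  have ind: "ind_sign_char n la w = (\<Sum>nu\<in>\<Lambda>. of_nat (m' nu) * (\<Sum>i<d nu. M nu w i i))" if w: "w \<in> Sym n" for w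
  proof -
    have "(\<Sum>nu\<in>\<Lambda>. of_nat (m' nu) * (\<Sum>i<d nu. M nu w i i)) = (\<Sum>i<d la. M la w i i) +
       (\<Sum>nu\<in>\<Lambda> - {la}. of_nat (m' nu) * (\<Sum>i<d nu. M nu w i i))"
      using la by (subst sum.remove[OF finite_partitions la]) (simp add: m'_def)
    also have "(\<Sum>nu\<in>\<Lambda> - {la}. of_nat (m' nu) * (\<Sum>i<d nu. M nu w i i)) =
       (\<Sum>nu\<in>{mu \<in> partitions n. dominates la mu \<and> mu \<noteq> la}. of_nat (m nu) * (\<Sum>i<d nu. M nu w i i))"
      using finite_partitions by (intro sum.mono_neutral_cong_right) (auto simp: m'_def)
    finally show ?thesis unfolding m using w by (simp add: hk_char_eq)
  qed
  have main: "chi mu (eK la) = piK la * of_nat (m' mu)" if mu: "mu \<in> \<Lambda>" for mu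
  proof -
    let ?d = "d mu" and ?Y = "blk.Y n la" and ?D = "blk.D n la" and ?e = "E mu (eK la)"
    define S where "S = (\<Sum>w\<in>Sym n. ind_sign_char n la w * (\<Sum>k<?d. M mu (inv w) k k))"
    define sand where "sand = (\<lambda>x. \<Sum>i<?d. mm ?d (mm ?d (M mu x) ?e) (M mu (inv x)) i i)"
    have "S = (\<Sum>w\<in>Sym n. \<Sum>nu\<in>\<Lambda>. of_nat (m' nu) * ((\<Sum>i<d nu. M nu w i i) * (\<Sum>k<?d. M mu (inv w) k k)))"
      unfolding S_def by (intro sum.cong refl) (simp add: ind sum_distrib_right mult.assoc)
    also have "\<dots> = (\<Sum>nu\<in>\<Lambda>. of_nat (m' nu) * (if nu = mu then of_nat (d mu) * c mu else 0))"
      by (subst sum.swap) (simp add: chi_orth mu flip: sum_distrib_left)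
    also have "\<dots> = of_nat (m' mu) * (of_nat ?d * c mu)"
      using mu finite_partitions by (simp add: if_distrib[of "\<lambda>x. _ * x"] sum.delta cong: if_cong)
    finally have S1: "S = of_nat (m' mu) * (of_nat ?d * c mu)" .
    have xu: "x \<circ> u \<in> Sym n" "x \<in> Sym n" "u \<in> Sym n" "len n (x \<circ> u) = len n x + len n u"
      if "x \<in> ?D" "u \<in> ?Y" for x u
      using that blk.D_Sym blk.Y_Sym blk.len_D_Y by auto
    have Minv: "M mu (inv (x \<circ> u)) = mm ?d (M mu (inv u)) (M mu (inv x))" if "x \<in> ?D" "u \<in> ?Y" for x u
      using rep_mult_add[OF rep[OF mu], of "inv u" "inv x"] xu[OF that] len_inv[OF xu(1)[OF that]]
      by (simp add: Sym_inv_comp[of _ n] len_inv)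
    have indw: "ind_sign_char n la w = (\<Sum>x\<in>?D. \<Sum>u\<in>?Y. (- inverse vK) ^ len n u * mulT n deltaK w (Tb x) (x \<circ> u))"
      if w: "w \<in> Sym n" for w
    proof -
      have "ind_sign_char n la w = (\<Sum>x\<in>?D. \<Sum>u\<in>?Y. embA (mulT n deltaA w (Tb x) (x \<circ> u)) * of_int (sgnp n u) * inverse vK ^ len n u)"
        using w by (simp add: ind_sign_char_def dist_reps_D[OF sl] young_Y[OF sl] hmult_Tb_left)
      also have "\<dots> = (\<Sum>x\<in>?D. \<Sum>u\<in>?Y. (- inverse vK) ^ len n u * mulT n deltaK w (Tb x) (x \<circ> u))"
      proof (intro sum.cong refl)
        fix x u
        have "embA (mulT n deltaA w (Tb x) (x \<circ> u)) = mulT n deltaK w (Tb x) (x \<circ> u)"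
          using fun_cong[OF emb_mulT[of n w "Tb x"], of "x \<circ> u"] by (simp add: emb_Tb)
        then show "embA (mulT n deltaA w (Tb x) (x \<circ> u)) * of_int (sgnp n u) * inverse vK ^ len n u =
          (- inverse vK) ^ len n u * mulT n deltaK w (Tb x) (x \<circ> u)"
          by (simp add: sgnp_def power_minus[of "inverse vK"])
      qed
      finally show ?thesis .
    qed
    \<comment> \<open>Cyclicity of the trace moves \<open>w\<close> from the first factor to the
      index of the coefficient, where summation over \<open>w\<close> reassembles a matrix.\<close>
    have rot: "(\<Sum>w\<in>Sym n. mulT n deltaK w (Tb x) z * (\<Sum>k<?d. M mu (inv w) k k)) = (\<Sum>k<?d. mm ?d (M mu x) (M mu (inv z)) k k)"
      if x: "x \<in> Sym n" and z: "z \<in> Sym n" for x z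
    proof -
      have "(\<Sum>w\<in>Sym n. mulT n deltaK w (Tb x) z * (\<Sum>k<?d. M mu (inv w) k k)) =
         (\<Sum>w\<in>Sym n. mulT n deltaK x (Tb (inv z)) (inv w) * (\<Sum>k<?d. M mu (inv w) k k))"
        by (intro sum.cong refl) (simp only: mulT_Tb_coeff_rotate[OF _ x z])
      also have "\<dots> = (\<Sum>w\<in>Sym n. mulT n deltaK x (Tb (inv z)) w * (\<Sum>k<?d. M mu w k k))" by (rule sum_Sym_inv)
      also have "\<dots> = (\<Sum>k<?d. E mu (mulT n deltaK x (Tb (inv z))) k k)"
        unfolding ev_def sum_distrib_left by (rule sum.swap)
      finally show ?thesis using rep_mult[OF rep[OF mu] x, of "inv z"] z by simp
    qed
    have "S = (\<Sum>w\<in>Sym n. \<Sum>x\<in>?D. \<Sum>u\<in>?Y. (- inverse vK) ^ len n u * (mulT n deltaK w (Tb x) (x \<circ> u) * (\<Sum>k<?d. M mu (inv w) k k)))"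
      unfolding S_def by (intro sum.cong refl) (simp add: indw sum_distrib_right mult.assoc)
    also have "\<dots> = (\<Sum>x\<in>?D. \<Sum>w\<in>Sym n. \<Sum>u\<in>?Y. (- inverse vK) ^ len n u * (mulT n deltaK w (Tb x) (x \<circ> u) * (\<Sum>k<?d. M mu (inv w) k k)))" by (rule sum.swap)
    also have "\<dots> = (\<Sum>x\<in>?D. \<Sum>u\<in>?Y. \<Sum>w\<in>Sym n. (- inverse vK) ^ len n u * (mulT n deltaK w (Tb x) (x \<circ> u) * (\<Sum>k<?d. M mu (inv w) k k)))"
      by (rule sum.cong[OF refl]) (rule sum.swap)
    also have "\<dots> = (\<Sum>x\<in>?D. \<Sum>u\<in>?Y. (- inverse vK) ^ len n u * (\<Sum>w\<in>Sym n. mulT n deltaK w (Tb x) (x \<circ> u) * (\<Sum>k<?d. M mu (inv w) k k)))"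
      by (simp only: sum_distrib_left)
    also have "\<dots> = (\<Sum>x\<in>?D. \<Sum>u\<in>?Y. (- inverse vK) ^ len n u * (\<Sum>k<?d. mm ?d (M mu x) (M mu (inv (x \<circ> u))) k k))"
      by (intro sum.cong refl) (simp add: rot xu)
    also have "\<dots> = (\<Sum>x\<in>?D. sand x)"
    proof (rule sum.cong[OF refl])
      fix x assume x: "x \<in> ?D"
      have ee: "?e = (\<lambda>i j. \<Sum>u\<in>?Y. (- inverse vK) ^ len n u * M mu (inv u) i j)"
      proof (intro ext)
        fix i j
        have "?e i j = (\<Sum>u\<in>?Y. (- inverse vK) ^ len n u * M mu u i j)"
          unfolding ev_def using blk.Y_Sym by (intro sum.mono_neutral_cong_right) (auto simp: blk.eb_def)
        also have "\<dots> = (\<Sum>u\<in>?Y. (- inverse vK) ^ len n (inv u) * M mu (inv u) i j)"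
          using blk.Y_inv blk.Y_Sym by (intro sum.reindex_bij_witness[of _ inv inv]) (auto dest: blk.Y_Sym)
        finally show "?e i j = (\<Sum>u\<in>?Y. (- inverse vK) ^ len n u * M mu (inv u) i j)"
          using len_inv[OF blk.Y_Sym] by simp
      qed
      have "sand x = (\<Sum>i<?d. \<Sum>u\<in>?Y. (- inverse vK) ^ len n u * mm ?d (mm ?d (M mu x) (M mu (inv u))) (M mu (inv x)) i i)"
        unfolding sand_def ee by (simp add: mm_sum_right mm_sum_left)
      also have "\<dots> = (\<Sum>u\<in>?Y. (- inverse vK) ^ len n u * (\<Sum>k<?d. mm ?d (M mu x) (M mu (inv (x \<circ> u))) k k))"
        by (subst sum.swap) (simp add: sum_distrib_left Minv[OF x] mm_assoc)
      finally show "(\<Sum>u\<in>?Y. (- inverse vK) ^ len n u * (\<Sum>k<?d. mm ?d (M mu x) (M mu (inv (x \<circ> u))) k k)) = sand x" ..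
    qed
    finally have S2: "S = (\<Sum>x\<in>?D. sand x)" .
    \<comment> \<open>The sum over all permutations is a multiple of the trace by Schur's relations.
      Split along cosets, each \<open>x \<circ> u\<close> contributes \<open>v^(-2 l(u))\<close>
      times its representative \<open>x\<close>, so the sum is also
      \<open>piK la * S\<close>.\<close>
    have "of_nat ?d * c mu * chi mu (eK la) = (\<Sum>w\<in>Sym n. sand w)"
      unfolding sand_def chi_def using tr_sandwich[OF mu, of ?e] by simp
    also have "\<dots> = (\<Sum>x\<in>?D. \<Sum>u\<in>?Y. sand (x \<circ> u))" by (rule blk.sum_D_Y)
    also have "\<dots> = (\<Sum>x\<in>?D. \<Sum>u\<in>?Y. inverse vK ^ (2 * len n u) * sand x)"
    proof (intro sum.cong refl)
      fix x u assume x: "x \<in> ?D" and u: "u \<in> ?Y"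
      have "M mu (x \<circ> u) = mm ?d (M mu x) (M mu u)" using rep_mult_add[OF rep[OF mu]] xu[OF x u] by simp
      then have "mm ?d (mm ?d (M mu (x \<circ> u)) ?e) (M mu (inv (x \<circ> u))) =
         mm ?d (mm ?d (M mu x) (mm ?d (mm ?d (M mu u) ?e) (M mu (inv u)))) (M mu (inv x))"
        by (simp add: Minv[OF x u] mm_assoc)
      also have "mm ?d (mm ?d (M mu u) ?e) (M mu (inv u)) = (\<lambda>i j. inverse vK ^ (2 * len n u) * ?e i j)"
        unfolding E_eK(1)[OF la mu u] mm_scale E_eK(2)[OF la mu blk.Y_inv[OF u]]
        using len_inv[OF blk.Y_Sym[OF u]]
        by (simp add: mult.assoc[symmetric] power_mult_distrib[symmetric] power_mult power2_eq_square)
      finally have eq: "mm ?d (mm ?d (M mu (x \<circ> u)) ?e) (M mu (inv (x \<circ> u))) =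
         (\<lambda>i j. inverse vK ^ (2 * len n u) * mm ?d (mm ?d (M mu x) ?e) (M mu (inv x)) i j)"
        unfolding mm_scale .
      show "sand (x \<circ> u) = inverse vK ^ (2 * len n u) * sand x"
        unfolding sand_def eq by (simp only: sum_distrib_left)
    qed
    also have "\<dots> = piK la * S" unfolding S2 blk.piY_def by (simp add: sum_product) (subst sum.swap, simp)
    finally have "of_nat ?d * c mu * chi mu (eK la) = of_nat ?d * c mu * (piK la * of_nat (m' mu))"
      unfolding S1 by (simp add: algebra_simps)
    moreover have "of_nat ?d * c mu \<noteq> 0" using c_nz[OF mu] d_pos[OF mu] by simp
    ultimately show ?thesis by (metis mult_left_cancel)
  qed
  then show ?thesis by (intro exI[of _ m']) (auto simp: m'_def dominates_refl)
qed

end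

section \<open>Leading coefficients\<close>

lemma power_double_split: "l \<le> k \<Longrightarrow> (x :: ratf) ^ (2 * k) = x ^ (2 * (k - l)) * x ^ (2 * l)"
  by (metis distrib_left le_add_diff_inverse2 power_add)

lemma power_double: "(x :: ratf) ^ (2 * k) = x ^ k * x ^ k"
  by (simp add: mult_2 power_add)

lemma vadic_family_ex:
  assumes "finite S" "s0 \<in> S" "f s0 \<noteq> 0"
  shows "\<exists>k c. (\<forall>s\<in>S. isval (vK powi k * f s) (c s)) \<and> (\<exists>s\<in>S. c s \<noteq> 0)"
  by (rule vadic_family[where f = f, OF assms]) blast

context hecke_data
begin

lemma la_sum': "la \<in> \<Lambda> \<Longrightarrow> sum_list la = n"
  by (simp add: partitions_def)

definition cv :: "nat list \<Rightarrow> nat \<Rightarrow> nat \<Rightarrow> perm \<Rightarrow> real" where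
  "cv la i j w = value0 (vK ^ a la * M la w i j)"

lemma isval_M:
  assumes "la \<in> \<Lambda>" "w \<in> Sym n" shows "isval (vK ^ a la * M la w i j) (cv la i j w)"
proof (cases "i < d la \<and> j < d la")
  case True
  then show ?thesis unfolding cv_def using reg[OF assms] by (intro regular0_isval) (simp add: Mx_def)
next
  case False
  then have "vK ^ a la * M la w i j = 0" by (auto simp: Mx_def)
  then show ?thesis unfolding cv_def using isval_zero value0_isval[OF isval_zero] by simp
qed

lemma cv_int: assumes "la \<in> \<Lambda>" "w \<in> Sym n" "i < d la" "j < d la" shows "cv la i j w \<in> \<int>"
  unfolding cv_def using intg[OF assms] assms by (simp add: Mx_def)

abbreviation "wl la \<equiv> blk.wl n la"
abbreviation "C w \<equiv> KL_C n w"
abbreviation "EC la w \<equiv> E la (emb (C w))"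

lemma a_wl: "la \<in> \<Lambda> \<Longrightarrow> a la = len n (wl la)"
  using a_fun_wl[OF la_sum'] by simp

lemma wl_Sym: "wl la \<in> Sym n"
  using blk.Y_Sym[OF blk.wl(1)] .

text \<open>Only the longest element of the Young subgroup attains the exponent
  \<open>- 2 * a la\<close>.\<close>

lemma piK_val: assumes "la \<in> \<Lambda>" shows "isval (vK ^ (2 * a la) * piK la) 1"
proof -
  let ?Y = "blk.Y n la"
  have "vK ^ (2 * a la) * piK la = (\<Sum>u\<in>?Y. vK ^ (2 * a la) * inverse vK ^ (2 * len n u))"
    by (simp add: blk.piY_def sum_distrib_left)
  moreover have "isval (\<Sum>u\<in>?Y. vK ^ (2 * a la) * inverse vK ^ (2 * len n u)) (\<Sum>u\<in>?Y. if u = wl la then 1 else 0)"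
  proof (rule isval_sum)
    fix u assume u: "u \<in> ?Y"
    show "isval (vK ^ (2 * a la) * inverse vK ^ (2 * len n u)) (if u = wl la then 1 else 0)"
    proof (cases "u = wl la")
      case True
      then have "vK ^ (2 * a la) * inverse vK ^ (2 * len n u) = 1"
        using a_wl[OF assms] by (simp add: power_mult_distrib[symmetric])
      then show ?thesis using True isval_one by simp
    next
      case False
      then have lt: "len n u < a la" using blk.wl(3)[OF u] a_wl[OF assms] by simp
      then have "vK ^ (2 * a la) = vK ^ (2 * (a la - len n u)) * vK ^ (2 * len n u)"
        by (intro power_double_split) simp
      then have "vK ^ (2 * a la) * inverse vK ^ (2 * len n u) = vK ^ (2 * (a la - len n u))"
        by (simp add: mult.assoc power_mult_distrib[symmetric])
      then show ?thesis using False lt isval_vK_pow[of "2 * (a la - len n u)"] by simp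
    qed
  qed
  ultimately show ?thesis using blk.wl(1)[of n la] by (simp add: sum.delta)
qed

lemma E_val:
  assumes la: "la \<in> \<Lambda>" and h: "\<And>y. in_Zv (h y)"
  shows "isval (vK ^ a la * E la (emb h) i j) (\<Sum>w\<in>Sym n. of_int (Poly_Mapping.lookup (h w) 0) * cv la i j w)"
proof -
  have "vK ^ a la * E la (emb h) i j = (\<Sum>w\<in>Sym n. embA (h w) * (vK ^ a la * M la w i j))"
    by (simp add: ev_def sum_distrib_left mult.left_commute)
  then show ?thesis using isval_M[OF la] by (auto intro!: isval_sum isval_mult isval_embA h)
qed

text \<open>\<open>C_w\<close> differs from \<open>T_w\<close> by coefficients in
  \<open>vZ[v]\<close>, which are invisible at v = 0.\<close>

lemma EC_val:
  assumes la: "la \<in> \<Lambda>" and w: "w \<in> Sym n" shows "isval (vK ^ a la * EC la w i j) (cv la i j w)"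
proof -
  have l: "Poly_Mapping.lookup (C w y) k = (if y = w \<and> k = 0 then 1 else 0)" if "k \<le> 0" for y k
  proof -
    have "Poly_Mapping.lookup (C w y - Tb w y) k = 0" using KL_C(3)[OF w, of y] that by (simp add: in_vZv_iff)
    then show ?thesis by (auto simp: lookup_minus Tb_def lookup_one)
  qed
  have "in_Zv (C w y)" for y using l by (simp add: in_Zv_def)
  then have "isval (vK ^ a la * EC la w i j) (\<Sum>y\<in>Sym n. of_int (Poly_Mapping.lookup (C w y) 0) * cv la i j y)"
    by (rule E_val[OF la])
  also have "(\<Sum>y\<in>Sym n. of_int (Poly_Mapping.lookup (C w y) 0) * cv la i j y) = (\<Sum>y\<in>Sym n. if y = w then cv la i j w else 0)"
    by (intro sum.cong) (auto simp: l)
  finally show ?thesis using w by (simp add: sum.delta)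
qed

lemma emb_C_wl: "la \<in> \<Lambda> \<Longrightarrow> emb (C (wl la)) = (\<lambda>y. (- vK) ^ a la * eK la y)"
  using blk.KL_C_wl[of n la] by (simp add: a_wl)

lemma EC_wl: "la \<in> \<Lambda> \<Longrightarrow> EC mu (wl la) = (\<lambda>i j. (- vK) ^ a la * E mu (eK la) i j)"
  unfolding emb_C_wl ev_lin ..

lemma chi_C_wl: "la \<in> \<Lambda> \<Longrightarrow> (\<Sum>i<d mu. EC mu (wl la) i i) = (- vK) ^ a la * chi mu (eK la)"
  by (simp add: EC_wl chi_def sum_distrib_left)

lemma trace_val:
  assumes la: "la \<in> \<Lambda>" and that: "isval f \<phi>"
  shows "isval (vK ^ a la * ((- vK) ^ a la * (piK la * f))) ((-1) ^ a la * \<phi>)"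
proof -
  have "isval ((-1) ^ a la * (vK ^ (2 * a la) * piK la * f)) ((-1) ^ a la * (1 * \<phi>))"
    using isval_uminus[OF isval_one] by (intro isval_mult isval_power piK_val[OF la] that) simp
  moreover have "vK ^ a la * ((- vK) ^ a la * (piK la * f)) = (-1) ^ a la * (vK ^ (2 * a la) * piK la * f)"
    unfolding power_double power_minus[of vK] by (simp add: algebra_simps)
  ultimately show ?thesis by (simp only: mult_1)
qed

text \<open>If \<open>a mu\<close> were smaller, the trace of \<open>C_(w_la)\<close> on
  \<open>mu\<close>, regular after multiplication by \<open>v^(a mu)\<close>, would vanish at v = 0
  after multiplication by \<open>v^(a la)\<close>; but that value is the multiplicity
  \<open>k\<close> up to sign.\<close>

lemma mult_a_le:
  assumes la: "la \<in> \<Lambda>" and mu: "mu \<in> \<Lambda>" and m: "chi mu (eK la) = piK la * of_nat k" "k \<noteq> 0"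
  shows "a la \<le> a mu"
proof (rule ccontr)
  assume "\<not> a la \<le> a mu"
  then have lt: "a mu < a la" by simp
  define t where "t = (\<Sum>i<d mu. EC mu (wl la) i i)"
  have "isval (\<Sum>i<d mu. vK ^ a mu * EC mu (wl la) i i) (\<Sum>i<d mu. cv mu i i (wl la))"
    by (intro isval_sum EC_val mu wl_Sym)
  then have "isval (vK ^ a mu * t) (\<Sum>i<d mu. cv mu i i (wl la))" by (simp add: t_def sum_distrib_left)
  then have "isval (vK ^ (a la - a mu) * (vK ^ a mu * t)) 0"
    using isval_mult[OF isval_vK_pow[of "a la - a mu"]] lt by fastforce
  moreover have "vK ^ (a la - a mu) * (vK ^ a mu * t) = vK ^ a la * t"
    using lt by (simp add: mult.assoc[symmetric] power_add[symmetric])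
  moreover have "isval (vK ^ a la * t) ((-1) ^ a la * of_nat k)"
    unfolding t_def chi_C_wl[OF la] m(1) by (rule trace_val[OF la isval_of_nat])
  ultimately have "(-1) ^ a la * (of_nat k :: real) = 0" using isval_unique by metis
  then show False using m(2) by simp
qed

text \<open>The value \<open>f\<close> of \<open>v^(2a) c\<close> is a sum of real squares.
  \<open>tau\<close>, applied to the sign quasi-idempotent with its coefficient 1 at
  \<open>id\<close>, expresses the inverse of the same quantity through partitions above
  \<open>la\<close>, to which induction applies. At v = 0 this reads \<open>f * (1 - g) = 1\<close>
  with \<open>g\<close> natural, so \<open>g = 0\<close> and \<open>f = 1\<close>.\<close>

lemma schur_val: "la \<in> \<Lambda> \<Longrightarrow> isval (vK ^ (2 * a la) * c la) 1"
proof (induction "card {mu \<in> \<Lambda>. dominates la mu}" arbitrary: la rule: less_induct)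
  case less
  note la = less.prems
  have IH: "isval (vK ^ (2 * a mu) * c mu) 1" if mu: "mu \<in> \<Lambda>" "dominates la mu" "mu \<noteq> la" for mu
  proof (rule less.hyps[OF _ mu(1)])
    have "{nu \<in> \<Lambda>. dominates mu nu} \<subset> {nu \<in> \<Lambda>. dominates la nu}"
      using mu la dominates_trans[OF mu(2)] dominates_antisym[OF la mu(1,2)] dominates_refl[of la] by blast
    then show "card {nu \<in> \<Lambda>. dominates mu nu} < card {nu \<in> \<Lambda>. dominates la nu}"
      using finite_partitions by (intro psubset_card_mono) auto
  qed
  define f where "f = (\<Sum>w\<in>Sym n. cv la 0 0 w * cv la 0 0 w)"
  define \<kappa> where "\<kappa> = (\<lambda>mu. vK ^ (2 * a mu) * c mu)"
  have d0: "0 < d la" using d_pos[OF la] .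
  have "c la = (\<Sum>w\<in>Sym n. M la w 0 0 * M la w 0 0)" using schur_M2[OF la la d0 d0 d0 d0] p_nz[OF la d0] by simp
  then have "\<kappa> la = (\<Sum>w\<in>Sym n. (vK ^ a la * M la w 0 0) * (vK ^ a la * M la w 0 0))"
    unfolding \<kappa>_def power_double by (simp add: sum_distrib_left algebra_simps)
  then have \<kappa>f: "isval (\<kappa> la) f" unfolding f_def by (auto intro!: isval_sum isval_mult isval_M la)
  have f0: "0 \<le> f" unfolding f_def by (intro sum_nonneg) simp
  have \<kappa>nz: "\<kappa> mu \<noteq> 0" if "mu \<in> \<Lambda>" for mu using c_nz[OF that] by (simp add: \<kappa>_def)
  obtain m :: "nat list \<Rightarrow> nat" where m: "m la = 1" "\<forall>mu. \<not> dominates la mu \<longrightarrow> m mu = 0"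
    "\<forall>mu\<in>\<Lambda>. chi mu (eK la) = piK la * of_nat (m mu)" using chi_eK[OF la] by blast
  define U where "U = vK ^ (2 * a la) * piK la"
  have U: "isval U 1" using piK_val[OF la] by (simp add: U_def)
  have Unz: "U \<noteq> 0" using isval_nz[OF U] by simp
  \<comment> \<open>Normalised so that \<open>chi mu (eK la) / c mu = U * r mu\<close>. The
    truncated subtraction in the exponent is harmless: \<open>m mu\<close> vanishes unless
    \<open>a la \<le> a mu\<close>.\<close>
  define r where "r = (\<lambda>mu. of_nat (m mu) * (vK ^ (2 * (a mu - a la)) * inverse (\<kappa> mu)))"
  have trm: "chi mu (eK la) / c mu = U * r mu" if mu: "mu \<in> \<Lambda>" for mu
  proof (cases "m mu = 0")
    case True
    then show ?thesis using m(3) mu by (simp add: r_def)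
  next
    case False
    then have le: "a la \<le> a mu" using mult_a_le[OF la mu] m(3) mu by blast
    have e: "vK ^ (2 * a mu) = vK ^ (2 * (a mu - a la)) * vK ^ (2 * a la)" using le by (rule power_double_split)
    have "U * r mu = piK la * of_nat (m mu) * ((vK ^ (2 * a la) * vK ^ (2 * (a mu - a la))) / \<kappa> mu)"
      by (simp add: U_def r_def field_simps)
    also have "(vK ^ (2 * a la) * vK ^ (2 * (a mu - a la))) / \<kappa> mu = 1 / c mu"
      unfolding \<kappa>_def e using c_nz[OF mu] by simp
    finally show ?thesis using m(3) mu by simp
  qed
  have "(\<Sum>mu\<in>\<Lambda>. U * r mu) = eK la id"
    using tau[of "eK la"] trm by simp
  then have "U * (\<Sum>mu\<in>\<Lambda>. r mu) = 1" by (simp add: blk.eb_def sum_distrib_left)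
  moreover have "(\<Sum>mu\<in>\<Lambda>. r mu) = inverse (\<kappa> la) + (\<Sum>mu\<in>\<Lambda> - {la}. r mu)"
    by (subst sum.remove[OF finite_partitions la]) (simp add: r_def m(1))
  ultimately have ik: "inverse (\<kappa> la) = inverse U + - (\<Sum>mu\<in>\<Lambda> - {la}. r mu)"
    using Unz by (simp add: field_simps)
  define g where "g = (\<Sum>mu\<in>\<Lambda> - {la}. m mu * (if a mu - a la = 0 then 1 else 0))"
  have "isval (\<Sum>mu\<in>\<Lambda> - {la}. r mu) (\<Sum>mu\<in>\<Lambda> - {la}. of_nat (m mu) * (if a mu - a la = 0 then 1 else 0))"
  proof (rule isval_sum)
    fix mu assume mu: "mu \<in> \<Lambda> - {la}"
    show "isval (r mu) (of_nat (m mu) * (if a mu - a la = 0 then 1 else 0))"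
    proof (cases "m mu = 0")
      case True
      then show ?thesis by (simp add: r_def isval_zero)
    next
      case False
      then have dm: "dominates la mu" using spec[OF m(2), of mu] by argo
      have k0: "isval (\<kappa> mu) 1" unfolding \<kappa>_def using IH[OF _ dm] mu by simp
      have k1: "isval (inverse (\<kappa> mu)) 1" using isval_inverse[OF k0] by simp
      have v: "isval (vK ^ (2 * (a mu - a la))) (if a mu - a la = 0 then 1 else 0)"
        using isval_vK_pow[of "2 * (a mu - a la)"] isval_one by auto
      show ?thesis unfolding r_def using isval_mult[OF isval_of_nat isval_mult[OF v k1]] by simp
    qed
  qed
  moreover have "(\<Sum>mu\<in>\<Lambda> - {la}. of_nat (m mu) * (if a mu - a la = 0 then 1 else 0 :: real)) = of_nat g"
    unfolding g_def of_nat_sum by (intro sum.cong) auto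
  ultimately have "isval (inverse (\<kappa> la)) (inverse 1 + - of_nat g)"
    unfolding ik using isval_add[OF isval_inverse[OF U] isval_uminus] by simp
  then have "isval (\<kappa> la * inverse (\<kappa> la)) (f * (1 - of_nat g))" using isval_mult[OF \<kappa>f] by simp
  then have fg: "f * (1 - of_nat g) = 1" using isval_unique[OF _ isval_one] \<kappa>nz[OF la] by simp
  have "g = 0"
  proof (rule ccontr)
    assume "g \<noteq> 0"
    then have "1 - (of_nat g :: real) \<le> 0" by simp
    then have "f * (1 - of_nat g) \<le> 0" using f0 by (simp add: mult_nonneg_nonpos)
    with fg show False by simp
  qed
  then have "f = 1" using fg by simp
  then show ?case using \<kappa>f by (simp add: \<kappa>_def)
qed

section \<open>Orthonormality of the leading coefficients\<close>

definition cvx :: "nat list \<times> nat \<times> nat \<Rightarrow> perm \<Rightarrow> real" where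
  "cvx = (\<lambda>(la, i, j). cv la i j)"

lemma isval_G: "x \<in> Ix \<Longrightarrow> w \<in> Sym n \<Longrightarrow> isval (vK ^ a (fst x) * G x w) (cvx x w)"
  by (cases x) (auto simp: G_def cvx_def isval_M)

lemma isval_q: assumes "x \<in> Ix" shows "isval (vK ^ (2 * a (fst x)) * q x) 1"
proof -
  obtain la i j where x: "x = (la, i, j)" "la \<in> \<Lambda>" "i < d la" "j < d la" using assms by (cases x) auto
  have "isval (vK ^ (2 * a la) * c la * (p la j * inverse (p la i))) (1 * (1 * inverse 1))"
    using x by (intro isval_mult isval_inverse schur_val pval) auto
  then show ?thesis by (simp add: x q_def field_simps)
qed

lemma cvx_int: "x \<in> Ix \<Longrightarrow> w \<in> Sym n \<Longrightarrow> cvx x w \<in> \<int>"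
  by (cases x) (auto simp: cvx_def cv_int)

lemma cvx_orth: assumes x: "x \<in> Ix" shows "(\<Sum>w\<in>Sym n. cvx x w * cvx x w) = 1"
proof -
  have "isval (\<Sum>w\<in>Sym n. (vK ^ a (fst x) * G x w) * (vK ^ a (fst x) * G x w)) (\<Sum>w\<in>Sym n. cvx x w * cvx x w)"
    using x by (intro isval_sum isval_mult isval_G)
  moreover have "(\<Sum>w\<in>Sym n. (vK ^ a (fst x) * G x w) * (vK ^ a (fst x) * G x w)) = vK ^ (2 * a (fst x)) * q x"
    unfolding power_double G_orth[OF x x, simplified, symmetric] sum_distrib_left by (simp add: algebra_simps)
  ultimately show ?thesis using isval_q[OF x] isval_unique by metis
qed

lemma cvx_complete: assumes w: "w \<in> Sym n" shows "(\<Sum>x\<in>Ix. cvx x w * cvx x w) = 1"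
proof -
  have "isval (\<Sum>x\<in>Ix. (vK ^ a (fst x) * G x w) * (vK ^ a (fst x) * G x w) * inverse (vK ^ (2 * a (fst x)) * q x))
     (\<Sum>x\<in>Ix. cvx x w * cvx x w * inverse 1)"
    using w by (intro isval_sum isval_mult isval_G isval_inverse isval_q) auto
  moreover have "(\<Sum>x\<in>Ix. (vK ^ a (fst x) * G x w) * (vK ^ a (fst x) * G x w) * inverse (vK ^ (2 * a (fst x)) * q x)) =
    (\<Sum>x\<in>Ix. G x w * G x w / q x)"
    unfolding power_double by (intro sum.cong refl) (simp add: field_simps)
  ultimately show ?thesis using G_complete[OF w w] isval_unique[OF _ isval_one] by simp
qed

text \<open>Integers whose squares sum to 1 have exactly one nonzero member. Applied to fixed
  triples and to fixed permutations, this makes the correspondence between them bijective.\<close>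

lemma ex1_w: "x \<in> Ix \<Longrightarrow> \<exists>!w. w \<in> Sym n \<and> cvx x w \<noteq> 0"
  by (rule int_squares_sum_one) (auto simp: cvx_int cvx_orth)

lemma ex1_x: "w \<in> Sym n \<Longrightarrow> \<exists>!x. x \<in> Ix \<and> cvx x w \<noteq> 0"
  by (rule int_squares_sum_one) (auto simp: cvx_int cvx_complete)

text \<open>The permutation denoted in the paper by a bold w, with index (la; i, j).\<close>

definition wx :: "nat list \<times> nat \<times> nat \<Rightarrow> perm" where
  "wx x = (THE w. w \<in> Sym n \<and> cvx x w \<noteq> 0)"

lemma wx: "x \<in> Ix \<Longrightarrow> wx x \<in> Sym n" "x \<in> Ix \<Longrightarrow> cvx x (wx x) \<noteq> 0"
  using theI'[OF ex1_w] unfolding wx_def by auto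

lemma wx_eqI: "x \<in> Ix \<Longrightarrow> w \<in> Sym n \<Longrightarrow> cvx x w \<noteq> 0 \<Longrightarrow> w = wx x"
  using ex1_w wx by blast

lemma wx_inj: "x \<in> Ix \<Longrightarrow> x' \<in> Ix \<Longrightarrow> wx x = wx x' \<Longrightarrow> x = x'"
  using ex1_x[OF wx(1)] wx(2) by metis

lemma wx_surj: assumes "w \<in> Sym n" obtains x where "x \<in> Ix" "w = wx x"
  using ex1_x[OF assms] wx_eqI assms by blast

lemma cvx_sq: assumes x: "x \<in> Ix" shows "cvx x (wx x) * cvx x (wx x) = 1"
proof -
  have "(\<Sum>w\<in>Sym n. cvx x w * cvx x w) = (\<Sum>w\<in>Sym n. if w = wx x then cvx x (wx x) * cvx x (wx x) else 0)"
    using wx_eqI[OF x] by (intro sum.cong refl) auto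
  then show ?thesis using cvx_orth[OF x] wx(1)[OF x] by (simp add: sum.delta)
qed

lemma cv_wx:
  assumes "(la, i, j) \<in> Ix" "(mu, k, l) \<in> Ix"
  shows "cv mu k l (wx (la, i, j)) = (if (mu, k, l) = (la, i, j) then cv la i j (wx (la, i, j)) else 0)"
proof (cases "cv mu k l (wx (la, i, j)) = 0")
  case True
  then show ?thesis by auto
next
  case False
  then have "wx (la, i, j) = wx (mu, k, l)" using wx_eqI[OF assms(2) wx(1)[OF assms(1)]] by (simp add: cvx_def)
  then have "(la, i, j) = (mu, k, l)" using wx_inj assms by blast
  then show ?thesis by simp
qed

lemma cv_sq: "(la, i, j) \<in> Ix \<Longrightarrow> cv la i j (wx (la, i, j)) * cv la i j (wx (la, i, j)) = 1"
  using cvx_sq by (auto simp: cvx_def)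

lemma Rset_eq: assumes "la \<in> \<Lambda>" shows "Rset n X d la = {wx (la, i, j) | i j. i < d la \<and> j < d la}"
proof
  show "Rset n X d la \<subseteq> {wx (la, i, j) | i j. i < d la \<and> j < d la}"
  proof
    fix w assume "w \<in> Rset n X d la"
    then obtain i j where ij: "w \<in> Sym n" "i < d la" "j < d la" "value0 (vK ^ a la * X la w i j) \<noteq> 0" by (auto simp: Rset_def)
    then have "cvx (la, i, j) w \<noteq> 0" by (simp add: cvx_def cv_def Mx_def)
    then have "w = wx (la, i, j)" using wx_eqI ij assms by simp
    then show "w \<in> {wx (la, i, j) | i j. i < d la \<and> j < d la}" using ij by blast
  qed
  show "{wx (la, i, j) | i j. i < d la \<and> j < d la} \<subseteq> Rset n X d la"
  proof
    fix w assume "w \<in> {wx (la, i, j) | i j. i < d la \<and> j < d la}"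
    then obtain i j where ij: "w = wx (la, i, j)" "i < d la" "j < d la" by blast
    then have I: "(la, i, j) \<in> Ix" using assms by simp
    have "value0 (vK ^ a la * X la w i j) \<noteq> 0" using wx(2)[OF I] ij by (simp add: cvx_def cv_def Mx_def)
    then show "w \<in> Rset n X d la" using wx(1)[OF I] ij by (auto simp: Rset_def)
  qed
qed

text \<open>\<open>la\<close> occurs once in its own induced character, so at v = 0 the rescaled
  trace of \<open>C_(w_la)\<close> on \<open>la\<close> is a sign; hence some diagonal leading
  coefficient at \<open>w_la\<close> is nonzero.\<close>

lemma ex_ic: assumes la: "la \<in> \<Lambda>" shows "\<exists>i<d la. wx (la, i, i) = wl la"
proof -
  obtain m :: "nat list \<Rightarrow> nat" where m: "m la = 1" "\<forall>mu\<in>\<Lambda>. chi mu (eK la) = piK la * of_nat (m mu)"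
    using chi_eK[OF la] by blast
  have "isval (\<Sum>i<d la. vK ^ a la * EC la (wl la) i i) (\<Sum>i<d la. cv la i i (wl la))"
    by (intro isval_sum EC_val la wl_Sym)
  moreover have "(\<Sum>i<d la. vK ^ a la * EC la (wl la) i i) = vK ^ a la * ((- vK) ^ a la * (piK la * 1))"
    using chi_C_wl[OF la, of la] m la by (simp flip: sum_distrib_left)
  ultimately have "(\<Sum>i<d la. cv la i i (wl la)) = (-1) ^ a la * 1" using trace_val[OF la isval_one] isval_unique by metis
  then have "(\<Sum>i<d la. cv la i i (wl la)) \<noteq> 0" by simp
  then obtain i where "i \<in> {..<d la}" "cv la i i (wl la) \<noteq> 0" by (rule sum.not_neutral_contains_not_neutral)
  then have "i < d la" "wl la = wx (la, i, i)" using wx_eqI[of "(la, i, i)" "wl la"] la wl_Sym by (simp_all add: cvx_def)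
  then show ?thesis by metis
qed

definition ic :: "nat list \<Rightarrow> nat" where "ic la = (SOME i. i < d la \<and> wx (la, i, i) = wl la)"

lemma ic: "la \<in> \<Lambda> \<Longrightarrow> ic la < d la" "la \<in> \<Lambda> \<Longrightarrow> wx (la, ic la, ic la) = wl la"
  using someI_ex[OF ex_ic] unfolding ic_def by auto

lemma EC_wl_sq:
  assumes la: "la \<in> \<Lambda>" and mu: "mu \<in> \<Lambda>"
  shows "mm (d mu) (EC mu (wl la)) (EC mu (wl la)) = (\<lambda>i j. ((- vK) ^ a la * piK la) * EC mu (wl la) i j)"
proof -
  have "hmult n deltaK (eK la) (eK la) = (\<lambda>y. piK la * eK la y)"
    using emb_hmult[of n "blk.eb n la" "blk.eb n la"] blk.eb_eb[of n la] by simp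
  then have e: "mm (d mu) (E mu (eK la)) (E mu (eK la)) = (\<lambda>i j. piK la * E mu (eK la) i j)"
    using rep_hmult[OF rep[OF mu], of "eK la" "eK la"] by (simp add: ev_lin)
  show ?thesis unfolding EC_wl[OF la] mm_scale e by (intro ext) (simp add: algebra_simps)
qed

text \<open>The square of the sign quasi-idempotent has trace zero on \<open>mu\<close>. Its matrix
  is symmetric up to \<open>P\<close>, which is the identity at v = 0, so after rescaling the
  entries that trace turns into a sum of real squares, not all zero.\<close>

lemma EC_wl_zero:
  assumes la: "la \<in> \<Lambda>" and mu: "mu \<in> \<Lambda>" and nd: "\<not> dominates la mu"
  shows "EC mu (wl la) = (\<lambda>_ _. 0)"
proof (rule ccontr)
  assume nz: "EC mu (wl la) \<noteq> (\<lambda>_ _. 0)"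
  let ?d = "d mu" and ?e = "E mu (eK la)"
  have "?e \<noteq> (\<lambda>_ _. 0)" using nz unfolding EC_wl[OF la] by auto
  then obtain i j where ij: "?e i j \<noteq> 0" by (auto simp: fun_eq_iff)
  then have ijd: "i < ?d" "j < ?d" using trunc_ev[of ?d n "X mu" "eK la"] by (auto simp: trunc_def)
  define S where "S = {..<?d} \<times> {..<?d}"
  have S: "finite S" "(i, j) \<in> S" "case_prod ?e (i, j) \<noteq> 0" using ij ijd by (auto simp: S_def)
  obtain k cc s where k': "\<forall>s\<in>S. isval (vK powi k * case_prod ?e s) (cc s)" and k: "s \<in> S" "cc s \<noteq> 0"
    using vadic_family_ex[where f = "case_prod (E mu (eK la))", OF S] by (elim exE conjE bexE)
  have "hmult n deltaK (eK la) (eK la) = (\<lambda>y. piK la * eK la y)"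
    using emb_hmult[of n "blk.eb n la" "blk.eb n la"] blk.eb_eb[of n la] by simp
  then have e: "mm ?d ?e ?e = (\<lambda>i j. piK la * ?e i j)"
    using rep_hmult[OF rep[OF mu], of "eK la" "eK la"] by (simp add: ev_lin)
  obtain m :: "nat list \<Rightarrow> nat" where "\<forall>mu. \<not> dominates la mu \<longrightarrow> m mu = 0"
    "\<forall>mu\<in>\<Lambda>. chi mu (eK la) = piK la * of_nat (m mu)" using chi_eK[OF la] by blast
  then have "chi mu (eK la) = 0" using nd mu by simp
  then have "(\<Sum>i<?d. mm ?d ?e ?e i i) = 0" unfolding e by (simp add: chi_def flip: sum_distrib_left)
  then have z: "(\<Sum>s\<in>S. ?e (fst s) (snd s) * ?e (snd s) (fst s)) = 0"
    by (simp add: mm_def S_def sum.cartesian_product case_prod_unfold)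
  have fe: "flat n (eK la) = eK la" using emb_flat[of n "blk.eb n la"] blk.flat_eb[of n la] by simp
  have "isval (\<Sum>s\<in>S. (vK powi k * case_prod ?e s) * (vK powi k * case_prod ?e s) * (p mu (fst s) * inverse (p mu (snd s))))
     (\<Sum>s\<in>S. cc s * cc s * (1 * inverse 1))"
    by (intro isval_sum isval_mult bspec[OF k'] isval_inverse pval mu) (auto simp: S_def)
  moreover have "(\<Sum>s\<in>S. (vK powi k * case_prod ?e s) * (vK powi k * case_prod ?e s) * (p mu (fst s) * inverse (p mu (snd s)))) =
     (\<Sum>s\<in>S. vK powi k * vK powi k * (?e (fst s) (snd s) * ?e (snd s) (fst s)))"
  proof (rule sum.cong[OF refl])
    fix s assume s: "s \<in> S"
    have "?e (snd s) (fst s) = p mu (fst s) / p mu (snd s) * ?e (fst s) (snd s)"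
      using E_flat[OF mu, of "snd s" "fst s" "eK la"] s fe by (auto simp: S_def)
    then show "(vK powi k * case_prod ?e s) * (vK powi k * case_prod ?e s) * (p mu (fst s) * inverse (p mu (snd s))) =
      vK powi k * vK powi k * (?e (fst s) (snd s) * ?e (snd s) (fst s))"
      by (simp add: case_prod_unfold divide_inverse algebra_simps)
  qed
  moreover have "\<dots> = 0" using z by (simp flip: sum_distrib_left)
  ultimately have "(\<Sum>s\<in>S. cc s * cc s) = 0" using isval_unique isval_zero by fastforce
  then have "\<forall>s\<in>S. cc s * cc s = 0" using sum_nonneg_eq_0_iff[OF S(1), of "\<lambda>s. cc s * cc s"] by simp
  then have "cc s * cc s = 0" using k(1) by blast
  then show False using k(2) by simp
qed

text \<open>The elements of maximal length in their left cosets of the Young subgroup.\<close>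

definition DJ :: "nat list \<Rightarrow> perm set" where
  "DJ la = {y \<in> Sym n. \<forall>t\<in>blk.J n la. len n (y \<circ> t) < len n y}"

text \<open>If \<open>t\<close> were not a descent of \<open>y\<close>, then
  \<open>T_y C_(w_la)\<close> would act as \<open>-v\<close> times \<open>T_(yt) C_(w_la)\<close>.
  The factor \<open>v\<close> would annihilate the leading coefficient at \<open>(k, ic la)\<close>,
  which is a sign.\<close>

lemma column_DJ:
  assumes la: "la \<in> \<Lambda>" and k: "k < d la" shows "wx (la, k, ic la) \<in> DJ la"
proof -
  let ?y = "wx (la, k, ic la)" and ?d = "d la"
  have I: "(la, k, ic la) \<in> Ix" "(la, ic la, ic la) \<in> Ix" using la k ic by auto
  have y: "?y \<in> Sym n" using wx(1)[OF I(1)] .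
  have "len n (?y \<circ> t) < len n ?y" if t: "t \<in> blk.J n la" for t
  proof (rule ccontr)
    assume "\<not> len n (?y \<circ> t) < len n ?y"
    have tg: "t \<in> sgens n" using blk.J_sgens[OF t] .
    then have up: "len n (?y \<circ> t) = len n ?y + len n t" using len_right_cases[OF y tg] \<open>\<not> _\<close> by simp
    have yt: "?y \<circ> t \<in> Sym n" using y tg by simp
    define \<alpha> where "\<alpha> = (\<lambda>j. vK ^ a la * EC la (wl la) j (ic la))"
    have \<alpha>v: "isval (\<alpha> j) (cv la j (ic la) (wl la))" for j unfolding \<alpha>_def by (rule EC_val[OF la wl_Sym])
    have tE: "mm ?d (M la t) (EC la (wl la)) = (\<lambda>i j. - inverse vK * EC la (wl la) i j)"
      using E_eK(1)[OF la la blk.J_Y[OF t]] tg by (simp add: EC_wl[OF la] mm_scale mult.left_commute)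
    have "M la (?y \<circ> t) = mm ?d (M la ?y) (M la t)" using rep_mult_add[OF rep[OF la] y _ up] tg by simp
    then have "mm ?d (M la (?y \<circ> t)) (EC la (wl la)) = mm ?d (M la ?y) (mm ?d (M la t) (EC la (wl la)))"
      by (simp only: mm_assoc)
    then have "mm ?d (M la (?y \<circ> t)) (EC la (wl la)) = (\<lambda>i j. - inverse vK * mm ?d (M la ?y) (EC la (wl la)) i j)"
      unfolding tE mm_scale .
    then have "mm ?d (M la ?y) (EC la (wl la)) k (ic la) = - vK * mm ?d (M la (?y \<circ> t)) (EC la (wl la)) k (ic la)"
      by (simp add: field_simps)
    moreover have sm: "(\<Sum>j<?d. (vK ^ a la * M la z k j) * \<alpha> j) = vK ^ a la * vK ^ a la * mm ?d (M la z) (EC la (wl la)) k (ic la)" for z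
      by (simp add: mm_def \<alpha>_def sum_distrib_left algebra_simps)
    ultimately have eq: "(\<Sum>j<?d. (vK ^ a la * M la ?y k j) * \<alpha> j) = - (vK * (\<Sum>j<?d. (vK ^ a la * M la (?y \<circ> t) k j) * \<alpha> j))"
      unfolding sm by simp
    have "isval (\<Sum>j<?d. (vK ^ a la * M la ?y k j) * \<alpha> j) (\<Sum>j<?d. cv la k j ?y * cv la j (ic la) (wl la))"
      by (intro isval_sum isval_mult isval_M la y \<alpha>v)
    moreover have "isval (- (vK * (\<Sum>j<?d. (vK ^ a la * M la (?y \<circ> t) k j) * \<alpha> j))) (- (0 * (\<Sum>j<?d. cv la k j (?y \<circ> t) * cv la j (ic la) (wl la))))"
      by (intro isval_uminus isval_mult isval_vK isval_sum isval_M la yt \<alpha>v)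
    ultimately have "(\<Sum>j<?d. cv la k j ?y * cv la j (ic la) (wl la)) = 0" using eq isval_unique by fastforce
    moreover have "(\<Sum>j<?d. cv la k j ?y * cv la j (ic la) (wl la)) =
       (\<Sum>j<?d. if j = ic la then cv la k (ic la) ?y * cv la (ic la) (ic la) (wl la) else 0)"
    proof (rule sum.cong[OF refl])
      fix j assume "j \<in> {..<?d}"
      then have "(la, k, j) \<in> Ix" using la k by simp
      then show "cv la k j ?y * cv la j (ic la) (wl la) = (if j = ic la then cv la k (ic la) ?y * cv la (ic la) (ic la) (wl la) else 0)"
        using cv_wx[OF I(1), of la k j] by auto
    qed
    ultimately have "cv la k (ic la) ?y * cv la (ic la) (ic la) (wl la) = 0" using ic(1)[OF la] by (simp add: sum.delta)
    then show False using cv_sq[OF I(1)] cv_sq[OF I(2)] ic(2)[OF la] by auto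
  qed
  then show ?thesis using y by (simp add: DJ_def)
qed

text \<open>The left factor in C_y = gf * C_{w_la}, for y maximal in its coset of the Young subgroup.\<close>

definition gf :: "nat list \<Rightarrow> perm \<Rightarrow> perm \<Rightarrow> laur" where
  "gf la y = (\<lambda>x. (- vAinv) ^ a la * blk.Dpart n la (C y) x)"

lemma supp_gf [simp]: "supp_in n (gf la y)"
  by (simp add: gf_def)

lemma DJ_Fr: assumes "y \<in> DJ la" "t \<in> blk.J n la" shows "Fr n t (C y)"
  using assms by (intro Fr_KL_C blk.J_sgens) (auto simp: DJ_def)

lemma gf_factor:
  assumes la: "la \<in> \<Lambda>" and y: "y \<in> DJ la" shows "hmult n deltaA (gf la y) (C (wl la)) = C y"
proof -
  have yS: "y \<in> Sym n" using y by (simp add: DJ_def)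
  have "hmult n deltaA (gf la y) (C (wl la)) =
     (\<lambda>z. (- vAinv) ^ a la * ((- vA) ^ a la * hmult n deltaA (blk.Dpart n la (C y)) (blk.eb n la) z))"
    unfolding gf_def blk.KL_C_wl a_wl[OF la]
    by (simp add: lin_scale[OF lin_hmult_left] lin_scale[OF lin_hmult_right])
  also have "\<dots> = hmult n deltaA (blk.Dpart n la (C y)) (blk.eb n la)"
    by (simp add: mult.assoc[symmetric] blk.vA_vAinv_power)
  also have "\<dots> = C y"
    using blk.Fr_factor[OF KL_C(1)[OF yS], of la] DJ_Fr[OF y] by metis
  finally show ?thesis .
qed

lemma E_mult_emb:
  assumes "mu \<in> \<Lambda>" "supp_in n g" "supp_in n h"
  shows "E mu (emb (hmult n deltaA g h)) = mm (d mu) (E mu (emb g)) (E mu (emb h))"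
  using assms by (simp add: emb_hmult rep_hmult[OF rep])

lemma DJ_EC:
  assumes la: "la \<in> \<Lambda>" and mu: "mu \<in> \<Lambda>" and y: "y \<in> DJ la"
  shows "EC mu y = mm (d mu) (E mu (emb (gf la y))) (EC mu (wl la))"
  using E_mult_emb[OF mu supp_gf KL_C(1)[OF wl_Sym], of la y la] gf_factor[OF la y] by simp

text \<open>For \<open>y\<close> in \<open>DJ la\<close> the element \<open>C_y\<close> is a left
  multiple of \<open>C_(w_la)\<close>, which excludes shapes on which \<open>C_(w_la)\<close>
  vanishes. On \<open>la\<close> itself, right multiplication by \<open>C_(w_la)\<close> rescales
  \<open>C_y\<close>, while at v = 0 it retains only the column \<open>ic la\<close>.\<close>

lemma DJ_shape:
  assumes la: "la \<in> \<Lambda>" and I: "(nu, i, j) \<in> Ix" and y: "wx (nu, i, j) \<in> DJ la"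
  shows "dominates la nu" "nu = la \<Longrightarrow> j = ic la"
proof -
  let ?y = "wx (nu, i, j)"
  have nu: "nu \<in> \<Lambda>" using I by simp
  have yS: "?y \<in> Sym n" using wx(1)[OF I] .
  have cnz: "cv nu i j ?y \<noteq> 0" using wx(2)[OF I] by (simp add: cvx_def)
  show "dominates la nu"
  proof (rule ccontr)
    assume nd: "\<not> dominates la nu"
    have "EC nu ?y = (\<lambda>_ _. 0)" unfolding DJ_EC[OF la nu y] EC_wl_zero[OF la nu nd] by (simp add: mm_def)
    then show False using EC_val[OF nu yS, of i j] isval_unique[OF _ isval_zero] cnz by simp
  qed
  show "j = ic la" if "nu = la"
  proof (rule ccontr)
    assume jn: "j \<noteq> ic la"
    let ?d = "d la" and ?s = "(- vK) ^ a la * piK la"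
    have I': "(la, i, j) \<in> Ix" "(la, ic la, ic la) \<in> Ix" using I that la ic by auto
    have "mm ?d (EC la ?y) (EC la (wl la)) = (\<lambda>i j. ?s * EC la ?y i j)"
      unfolding DJ_EC[OF la la y] mm_assoc EC_wl_sq[OF la la] mm_scale ..
    then have "mm ?d (EC la ?y) (EC la (wl la)) i j = ?s * EC la ?y i j" by metis
    moreover have "(\<Sum>m<?d. (vK ^ a la * EC la ?y i m) * (vK ^ a la * EC la (wl la) m j)) =
       vK ^ a la * vK ^ a la * mm ?d (EC la ?y) (EC la (wl la)) i j"
      by (simp add: mm_def sum_distrib_left algebra_simps)
    ultimately have eq: "(\<Sum>m<?d. (vK ^ a la * EC la ?y i m) * (vK ^ a la * EC la (wl la) m j)) =
       (vK ^ a la * ((- vK) ^ a la * (piK la * 1))) * (vK ^ a la * EC la ?y i j)"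
      by (simp add: algebra_simps)
    have v1: "isval (\<Sum>m<?d. (vK ^ a la * EC la ?y i m) * (vK ^ a la * EC la (wl la) m j)) (\<Sum>m<?d. cv la i m ?y * cv la m j (wl la))"
      using yS by (intro isval_sum isval_mult EC_val la wl_Sym)
    have v2: "isval ((vK ^ a la * ((- vK) ^ a la * (piK la * 1))) * (vK ^ a la * EC la ?y i j)) ((-1) ^ a la * 1 * cv la i j ?y)"
      using yS by (intro isval_mult trace_val la isval_one EC_val)
    have z: "(\<Sum>m<?d. cv la i m ?y * cv la m j (wl la)) = 0"
    proof (rule sum.neutral, rule ballI)
      fix m assume "m \<in> {..<?d}"
      then have "(la, m, j) \<in> Ix" using I' by simp
      then show "cv la i m ?y * cv la m j (wl la) = 0" using cv_wx[OF I'(2), of la m j] ic(2)[OF la] jn by auto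
    qed
    have "(-1) ^ a la * 1 * cv la i j ?y = 0"
      using isval_unique[OF v2[folded eq] v1] unfolding z .
    then show False using cnz that by simp
  qed
qed

end

section \<open>Columns\<close>

lemma bar_invariant_const:
  assumes "barA b = b" "in_Zv b" shows "b = of_int (Poly_Mapping.lookup b 0)"
proof (rule poly_mapping_eqI)
  fix k
  have s: "Poly_Mapping.lookup b (- k) = Poly_Mapping.lookup b k" using lookup_barA[of b k] unfolding assms(1) by simp
  have "Poly_Mapping.lookup b k = 0" if "k \<noteq> 0"
    using assms(2) s that unfolding in_Zv_def by (cases "k < 0") auto
  then show "Poly_Mapping.lookup b k = Poly_Mapping.lookup (of_int (Poly_Mapping.lookup b 0)) k"
    by (auto simp: lookup_of_int when_def)
qed

context hecke_data
begin

definition Up :: "nat list \<Rightarrow> nat list set" where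
  "Up la = {mu \<in> \<Lambda>. dominates la mu \<and> mu \<noteq> la}"

text \<open>These triples index both the unknowns and the equations of the linear systems below:
  coordinates at shapes strictly above \<open>la\<close> are left undetermined.\<close>

definition Xc :: "nat list \<Rightarrow> (nat list \<times> nat \<times> nat) set" where
  "Xc la = {x \<in> Ix. fst x \<notin> Up la}"

text \<open>Matrix entries as linear functionals, rescaled so that they are regular at v = 0 on the
  basis \<open>C\<close>.\<close>

definition Eh :: "nat list \<times> nat \<times> nat \<Rightarrow> (perm \<Rightarrow> laur) \<Rightarrow> ratf" where
  "Eh = (\<lambda>(nu, i, j) h. vK ^ a nu * E nu (emb h) i j)"

text \<open>For w of shape strictly above la, the element C_w is invisible to every representation whose label
  is not strictly above la; proved by downward induction along the dominance order.\<close>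

definition kills :: "nat list \<Rightarrow> bool" where
  "kills la \<longleftrightarrow> (\<forall>y\<in>Ix. fst y \<in> Up la \<longrightarrow> (\<forall>nu\<in>\<Lambda> - Up la. EC nu (wx y) = (\<lambda>_ _. 0)))"

lemma finite_Xc [simp]: "finite (Xc la)"
  using finite_Ix by (simp add: Xc_def)

lemma Xc_Ix: "x \<in> Xc la \<Longrightarrow> x \<in> Ix"
  by (simp add: Xc_def)

lemma Xc_iff: "(nu, i, j) \<in> Xc la \<longleftrightarrow> nu \<in> \<Lambda> - Up la \<and> i < d nu \<and> j < d nu"
  by (auto simp: Xc_def)

lemma Up_la: "la \<notin> Up la"
  by (simp add: Up_def)

lemma bij_wx: "bij_betw wx Ix (Sym n)"
  unfolding bij_betw_def
proof
  show "inj_on wx Ix" by (rule inj_onI) (rule wx_inj)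
  show "wx ` Ix = Sym n"
  proof
    show "wx ` Ix \<subseteq> Sym n" using wx(1) by blast
    show "Sym n \<subseteq> wx ` Ix"
    proof
      fix w assume "w \<in> Sym n"
      then obtain x where "x \<in> Ix" "w = wx x" by (rule wx_surj)
      then show "w \<in> wx ` Ix" by simp
    qed
  qed
qed

lemma E_expand:
  assumes "supp_in n h"
  shows "E nu (emb h) i j = (\<Sum>x\<in>Ix. embA (cC n h (wx x)) * EC nu (wx x) i j)"
proof -
  have "emb h = (\<lambda>y. \<Sum>z\<in>Sym n. embA (cC n h z) * emb (C z) y)"
  proof
    fix y
    have "embA (h y) = embA (\<Sum>z\<in>Sym n. cC n h z * C z y)" using cC_sum[OF assms, of y] by simp
    then show "embA (h y) = (\<Sum>z\<in>Sym n. embA (cC n h z) * emb (C z) y)" by simp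
  qed
  then have "E nu (emb h) i j = (\<Sum>z\<in>Sym n. embA (cC n h z) * EC nu z i j)"
    by (simp only: ev_sum[OF finite_Sym])
  also have "\<dots> = (\<Sum>x\<in>Ix. embA (cC n h (wx x)) * EC nu (wx x) i j)"
    by (rule sum.reindex_bij_betw[OF bij_wx, symmetric])
  finally show ?thesis .
qed

lemma E_expand_Xc:
  assumes K: "kills la" and h: "supp_in n h" and nu: "nu \<in> \<Lambda> - Up la"
  shows "E nu (emb h) i j = (\<Sum>x\<in>Xc la. embA (cC n h (wx x)) * EC nu (wx x) i j)"
  unfolding E_expand[OF h]
proof (rule sum.mono_neutral_right[OF finite_Ix])
  show "\<forall>x\<in>Ix - Xc la. embA (cC n h (wx x)) * EC nu (wx x) i j = 0"
  proof
    fix x assume "x \<in> Ix - Xc la"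
    then have "EC nu (wx x) = (\<lambda>_ _. 0)" using K nu unfolding kills_def Xc_def by blast
    then show "embA (cC n h (wx x)) * EC nu (wx x) i j = 0" by (simp only: mult_zero_right)
  qed
qed (auto simp: Xc_def)

lemma Eh_expand:
  assumes K: "kills la" and h: "supp_in n h" and x: "x \<in> Xc la"
  shows "(\<Sum>y\<in>Xc la. embA (cC n h (wx y)) * Eh x (C (wx y))) = Eh x h"
proof -
  obtain nu i j where xe: "x = (nu, i, j)" by (cases x)
  have nu: "nu \<in> \<Lambda> - Up la" using x by (simp add: xe Xc_iff)
  show ?thesis unfolding xe Eh_def prod.case E_expand_Xc[OF K h nu] sum_distrib_left
    by (simp only: mult.left_commute)
qed

lemma Eh_C_val: "x \<in> Ix \<Longrightarrow> w \<in> Sym n \<Longrightarrow> isval (Eh x (C w)) (cvx x w)"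
  by (cases x) (simp add: Eh_def cvx_def EC_val)

text \<open>At v = 0 the matrix of these functionals on the basis \<open>C\<close> is diagonal with
  nonzero entries, as \<open>system_at_zero\<close> demands.\<close>

lemma Eh_wx_val:
  assumes "x \<in> Ix" "y \<in> Ix" shows "isval (Eh x (C (wx y))) (if y = x then cvx x (wx x) else 0)"
proof -
  have "cvx x (wx y) = (if y = x then cvx x (wx x) else 0)"
    using wx_eqI[OF assms(1) wx(1)[OF assms(2)]] wx_inj[OF assms(2,1)] by auto
  then show ?thesis using Eh_C_val[OF assms(1) wx(1)[OF assms(2)]] by simp
qed

lemma system_val:
  assumes K: "kills la" and h: "supp_in n h" and g: "\<And>x. x \<in> Xc la \<Longrightarrow> isval (Eh x h) (\<gamma> x)" and y: "y \<in> Xc la"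
  shows "in_Zv (cC n h (wx y))" "of_int (Poly_Mapping.lookup (cC n h (wx y)) 0) * cvx y (wx y) = \<gamma> y"
  by (rule system_at_zero[where W = "Xc la" and a = "\<lambda>y. cC n h (wx y)" and m = "\<lambda>x y. Eh x (C (wx y))"
        and g = "\<lambda>x. Eh x h" and \<gamma> = \<gamma> and \<sigma> = "\<lambda>x. cvx x (wx x)",
        OF finite_Xc Eh_wx_val[OF Xc_Ix Xc_Ix] wx(2)[OF Xc_Ix] Eh_expand[OF K h] g y]; assumption)+

lemma system_ker:
  fixes b :: "nat list \<times> nat \<times> nat \<Rightarrow> laur"
  assumes eq: "\<And>x. x \<in> Xc la \<Longrightarrow> (\<Sum>y\<in>Xc la. embA (b y) * Eh x (C (wx y))) = 0" and y: "y \<in> Xc la"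
  shows "b y = 0"
  by (rule system_at_zero(3)[where W = "Xc la" and a = b and m = "\<lambda>x y. Eh x (C (wx y))"
        and g = "\<lambda>_. 0" and \<gamma> = "\<lambda>_. 0" and \<sigma> = "\<lambda>x. cvx x (wx x)",
        OF finite_Xc Eh_wx_val[OF Xc_Ix Xc_Ix] wx(2)[OF Xc_Ix] eq isval_zero y]) (rule refl | assumption)+

text \<open>The matrix of the right factor that carries the column \<open>ic la\<close> to the
  column \<open>l\<close>.\<close>

definition Nl :: "nat list \<Rightarrow> nat \<Rightarrow> nat \<Rightarrow> nat \<Rightarrow> ratf" where
  "Nl la l = E la (emb (flat n (gf la (wx (la, l, ic la)))))"

lemma flat_C_wl: "flat n (C (wl la)) = C (wl la)"
  unfolding blk.KL_C_wl using lin_scale[OF lin_flat, of n _ "blk.eb n la"] blk.flat_eb[of n la] by simp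

text \<open>Replacing the right factor \<open>g_l^flat\<close> by \<open>flat n (C_(y_l))\<close>
  only introduces the scalar \<open>s\<close>, which comes from the square of
  \<open>C_(w_la)\<close>. Both factors then have known leading coefficients, and symmetry up to
  \<open>p\<close> turns their product at v = 0 into a single matrix unit. \<open>kills la\<close>
  removes the coordinates at shapes strictly above \<open>la\<close> from the equations.\<close>

lemma column_factor:
  assumes la: "la \<in> \<Lambda>" and K: "kills la" and kl: "k < d la" "l < d la"
  shows "\<exists>e :: int. e * e = 1 \<and>
    (\<forall>nu\<in>\<Lambda>. \<not> dominates la nu \<longrightarrow> EC nu (wx (la, k, l)) = (\<lambda>_ _. 0)) \<and>
    EC la (wx (la, k, l)) = (\<lambda>i j. of_int e * mm (d la) (EC la (wx (la, k, ic la))) (Nl la l) i j)"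
proof -
  let ?yk = "wx (la, k, ic la)" and ?yl = "wx (la, l, ic la)" and ?d = "d la"
  define gk where "gk = gf la ?yk"
  define gl where "gl = gf la ?yl"
  have yk: "?yk \<in> DJ la" and yl: "?yl \<in> DJ la" using column_DJ[OF la] kl by auto
  have S: "?yk \<in> Sym n" "?yl \<in> Sym n" using yk yl by (auto simp: DJ_def)
  have Ik: "(la, k, ic la) \<in> Ix" and Il: "(la, l, ic la) \<in> Ix" and Ikl: "(la, k, l) \<in> Ix" using la kl ic by auto
  have sg [simp]: "supp_in n gk" "supp_in n gl" by (simp_all add: gk_def gl_def)
  have sC [simp]: "supp_in n (C (wl la))" "supp_in n (C ?yk)" "supp_in n (C ?yl)" using KL_C(1) wl_Sym S by auto
  have fk: "hmult n deltaA gk (C (wl la)) = C ?yk" and fl: "hmult n deltaA gl (C (wl la)) = C ?yl"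
    using gf_factor[OF la yk] gf_factor[OF la yl] by (simp_all add: gk_def gl_def)
  have ffl: "hmult n deltaA (C (wl la)) (flat n gl) = flat n (C ?yl)"
    using flat_hmult[of n gl "C (wl la)" deltaA] fl by (simp add: flat_C_wl)
  define h where "h = hmult n deltaA gk (flat n (C ?yl))"
  have h1: "h = hmult n deltaA (C ?yk) (flat n gl)"
    unfolding h_def ffl[symmetric] fk[symmetric] by (rule hmult_assoc[symmetric]) simp_all
  have hs: "supp_in n h" by (simp add: h_def)
  have bk: "hmult n deltaA (barH n gk) (C (wl la)) = C ?yk"
    using barH_hmult[OF sg(1) sC(1)] unfolding fk KL_C(2)[OF wl_Sym] KL_C(2)[OF S(1)] by simp
  have bl: "hmult n deltaA (C (wl la)) (flat n (barH n gl)) = flat n (C ?yl)"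
  proof -
    have "hmult n deltaA (barH n gl) (C (wl la)) = C ?yl"
      using barH_hmult[OF sg(2) sC(1)] unfolding fl KL_C(2)[OF wl_Sym] KL_C(2)[OF S(2)] by simp
    then show ?thesis using flat_hmult[of n "barH n gl" "C (wl la)" deltaA] by (simp add: flat_C_wl)
  qed
  \<comment> \<open>\<open>gl\<close> itself may fail to be bar invariant; what counts is that its
    bar image has the same product with \<open>C_(w_la)\<close>, as recorded in
    \<open>bl\<close>.\<close>
  have hb: "barH n h = h"
  proof -
    have "barH n h = hmult n deltaA (barH n (C ?yk)) (barH n (flat n gl))" unfolding h1 by (rule barH_hmult) simp_all
    also have "\<dots> = hmult n deltaA (hmult n deltaA gk (C (wl la))) (flat n (barH n gl))"
      unfolding KL_C(2)[OF S(1)] barH_flat[OF sg(2)] fk ..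
    also have "\<dots> = hmult n deltaA gk (hmult n deltaA (C (wl la)) (flat n (barH n gl)))"
      by (rule hmult_assoc) simp_all
    finally show ?thesis unfolding bl h_def .
  qed
  have E1: "E nu (emb h) = mm (d nu) (EC nu ?yk) (E nu (emb (flat n gl)))" if nu: "nu \<in> \<Lambda>" for nu
    unfolding h1 by (rule E_mult_emb[OF nu]) simp_all
  have E0: "E nu (emb h) = (\<lambda>_ _. 0)" if nu: "nu \<in> \<Lambda>" and nd: "\<not> dominates la nu" for nu
    unfolding E1[OF nu] DJ_EC[OF la nu yk] EC_wl_zero[OF la nu nd] by (simp add: mm_def)
  define s where "s = (- vK) ^ a la * piK la"
  have Es: "mm ?d (EC la ?yk) (E la (emb (flat n (C ?yl)))) = (\<lambda>i j. s * E la (emb h) i j)"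
  proof -
    have "E la (emb (flat n (C ?yl))) = mm ?d (EC la (wl la)) (E la (emb (flat n gl)))"
      unfolding ffl[symmetric] by (rule E_mult_emb[OF la]) simp_all
    then have "mm ?d (EC la ?yk) (E la (emb (flat n (C ?yl)))) =
       mm ?d (mm ?d (E la (emb (gf la ?yk))) (mm ?d (EC la (wl la)) (EC la (wl la)))) (E la (emb (flat n gl)))"
      unfolding DJ_EC[OF la la yk] by (simp only: mm_assoc)
    also have "\<dots> = (\<lambda>i j. s * mm ?d (EC la ?yk) (E la (emb (flat n gl))) i j)"
      unfolding EC_wl_sq[OF la la] mm_scale DJ_EC[OF la la yk, symmetric] s_def ..
    finally show ?thesis unfolding E1[OF la] .
  qed
  \<comment> \<open>The product of the two leading coefficients, corrected by the value
    \<open>(-1) ^ a la\<close> of the rescaled scalar \<open>s\<close>.\<close>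
  define c0 where "c0 = (-1) ^ a la * (cv la k (ic la) ?yk * cv la l (ic la) ?yl)"
  have c0: "c0 * c0 = 1"
  proof -
    have "c0 * c0 = ((-1) ^ a la * (-1) ^ a la) * ((cv la k (ic la) ?yk * cv la k (ic la) ?yk) * (cv la l (ic la) ?yl * cv la l (ic la) ?yl))"
      unfolding c0_def by (simp only: mult_ac)
    then show ?thesis unfolding cv_sq[OF Ik] cv_sq[OF Il] by (simp add: power_mult_distrib[symmetric])
  qed
  have Ev: "isval (vK ^ a la * E la (emb h) i j) (if i = k \<and> j = l then c0 else 0)" if ij: "i < ?d" "j < ?d" for i j
  proof -
    let ?v = "vK ^ a la"
    have "isval (\<Sum>m<?d. (?v * EC la ?yk i m) * ((p la j * inverse (p la m)) * (?v * EC la ?yl j m)))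
       (\<Sum>m<?d. cv la i m ?yk * ((1 * inverse 1) * cv la j m ?yl))"
      using ij S by (intro isval_sum isval_mult EC_val la pval isval_inverse) auto
    moreover have "(\<Sum>m<?d. (?v * EC la ?yk i m) * ((p la j * inverse (p la m)) * (?v * EC la ?yl j m))) =
       (?v * (s * 1)) * (?v * E la (emb h) i j)"
    proof -
      have "s * E la (emb h) i j = (\<Sum>m<?d. EC la ?yk i m * E la (emb (flat n (C ?yl))) m j)"
        using fun_cong[OF fun_cong[OF Es, of i], of j] by (simp add: mm_def)
      also have "\<dots> = (\<Sum>m<?d. EC la ?yk i m * ((p la j * inverse (p la m)) * EC la ?yl j m))"
        unfolding emb_flat by (intro sum.cong refl) (use ij in \<open>simp add: E_flat[OF la] divide_inverse\<close>)
      finally have "?v * ?v * (s * E la (emb h) i j) = ?v * ?v * (\<Sum>m<?d. EC la ?yk i m * ((p la j * inverse (p la m)) * EC la ?yl j m))"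
        by (simp only:)
      then show ?thesis by (simp only: sum_distrib_left mult_ac mult_1_right mult_1_left)
    qed
    moreover have "(\<Sum>m<?d. cv la i m ?yk * ((1 * inverse 1) * cv la j m ?yl)) =
       (if i = k \<and> j = l then cv la k (ic la) ?yk * cv la l (ic la) ?yl else 0)"
    proof -
      have "(\<Sum>m<?d. cv la i m ?yk * ((1 * inverse 1) * cv la j m ?yl)) =
         (\<Sum>m<?d. if m = ic la then (if i = k \<and> j = l then cv la k (ic la) ?yk * cv la l (ic la) ?yl else 0) else 0)"
      proof (rule sum.cong[OF refl])
        fix m assume "m \<in> {..<?d}"
        then have "(la, i, m) \<in> Ix" "(la, j, m) \<in> Ix" using la ij by auto
        then show "cv la i m ?yk * ((1 * inverse 1) * cv la j m ?yl) =
           (if m = ic la then (if i = k \<and> j = l then cv la k (ic la) ?yk * cv la l (ic la) ?yl else 0) else 0)"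
          unfolding cv_wx[OF Ik \<open>(la, i, m) \<in> Ix\<close>] cv_wx[OF Il \<open>(la, j, m) \<in> Ix\<close>] by auto
      qed
      then show ?thesis using ic(1)[OF la] by (simp add: sum.delta)
    qed
    ultimately have A: "isval ((?v * (s * 1)) * (?v * E la (emb h) i j))
       (if i = k \<and> j = l then cv la k (ic la) ?yk * cv la l (ic la) ?yl else 0)" by (simp only:)
    have B: "isval (?v * (s * 1)) ((-1) ^ a la)"
      using trace_val[OF la isval_one] by (simp add: s_def mult.assoc)
    have nz: "?v * (s * 1) \<noteq> 0" by (rule isval_nz[OF B]) simp
    have "isval (inverse (?v * (s * 1)) * ((?v * (s * 1)) * (?v * E la (emb h) i j)))
       (inverse ((-1) ^ a la) * (if i = k \<and> j = l then cv la k (ic la) ?yk * cv la l (ic la) ?yl else 0))"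
      by (rule isval_mult[OF isval_inverse[OF B] A]) simp
    moreover have "inverse (?v * (s * 1)) * ((?v * (s * 1)) * (?v * E la (emb h) i j)) = ?v * E la (emb h) i j"
    proof -
      have "inverse f * (f * g) = g" if "f \<noteq> 0" for f g :: ratf using that by simp
      from this[OF nz] show ?thesis .
    qed
    moreover have "inverse ((-1) ^ a la) * (if i = k \<and> j = l then cv la k (ic la) ?yk * cv la l (ic la) ?yl else 0) =
       (if i = k \<and> j = l then c0 else 0)"
      by (simp add: c0_def power_inverse[symmetric])
    ultimately show ?thesis by (simp only:)
  qed
  have nd: "\<not> dominates la nu" if "nu \<in> \<Lambda> - Up la" "nu \<noteq> la" for nu using that by (auto simp: Up_def)
  have gval: "isval (Eh x h) (if x = (la, k, l) then c0 else 0)" if x: "x \<in> Xc la" for x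
  proof -
    obtain nu i j where xe: "x = (nu, i, j)" by (cases x)
    have nu: "nu \<in> \<Lambda> - Up la" "i < d nu" "j < d nu" using x by (simp_all add: xe Xc_iff)
    show ?thesis
    proof (cases "nu = la")
      case True
      then show ?thesis using Ev nu by (simp add: xe Eh_def)
    next
      case False
      then show ?thesis using E0[OF _ nd[OF nu(1) False]] nu isval_zero by (simp add: xe Eh_def)
    qed
  qed
  \<comment> \<open>Bar invariance of \<open>h\<close> passes to its coordinates; those on
    \<open>Xc la\<close> also have no negative exponents and are therefore integers.\<close>
  have bc: "cC n h (wx y) = of_int (Poly_Mapping.lookup (cC n h (wx y)) 0)" if "y \<in> Xc la" for y
    by (rule bar_invariant_const[OF cC_bar_invariant[OF hs hb] system_val(1)[OF K hs gval that]])
  have klX: "(la, k, l) \<in> Xc la" using la kl Up_la by (simp add: Xc_iff)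
  define e where "e = Poly_Mapping.lookup (cC n h (wx (la, k, l))) 0"
  have zero: "cC n h (wx y) = 0" if y: "y \<in> Xc la" "y \<noteq> (la, k, l)" for y
    using system_val(2)[OF K hs gval y(1)] wx(2)[OF Xc_Ix[OF y(1)]] y(2) bc[OF y(1)] by simp
  have ee: "e * e = 1"
  proof -
    have er: "of_int e * cv la k l (wx (la, k, l)) = c0"
      using system_val(2)[OF K hs gval klX] by (simp add: e_def cvx_def)
    have "(of_int e * of_int e) * (cv la k l (wx (la, k, l)) * cv la k l (wx (la, k, l))) = (1 :: real)"
      using c0 unfolding er[symmetric] by (simp only: mult_ac)
    then have "real_of_int (e * e) = 1" unfolding cv_sq[OF Ikl] by simp
    then show ?thesis by linarith
  qed
  have Ek: "EC nu (wx (la, k, l)) = (\<lambda>i j. of_int e * E nu (emb h) i j)" if nu: "nu \<in> \<Lambda> - Up la" for nu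
  proof (intro ext)
    fix i j
    have "E nu (emb h) i j = (\<Sum>x\<in>Xc la. if x = (la, k, l) then of_int e * EC nu (wx (la, k, l)) i j else 0)"
      unfolding E_expand_Xc[OF K hs nu]
    proof (rule sum.cong[OF refl])
      fix x assume x: "x \<in> Xc la"
      show "embA (cC n h (wx x)) * EC nu (wx x) i j = (if x = (la, k, l) then of_int e * EC nu (wx (la, k, l)) i j else 0)"
      proof (cases "x = (la, k, l)")
        case True
        then show ?thesis using arg_cong[OF bc[OF klX], of embA] by (simp add: e_def)
      next
        case False
        then show ?thesis using zero[OF x False] by simp
      qed
    qed
    also have "\<dots> = of_int e * EC nu (wx (la, k, l)) i j" using klX by (simp add: sum.delta)
    finally have "of_int e * E nu (emb h) i j = of_int (e * e) * EC nu (wx (la, k, l)) i j" by (simp add: mult.assoc)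
    then show "EC nu (wx (la, k, l)) i j = of_int e * E nu (emb h) i j" using ee by simp
  qed
  have "EC nu (wx (la, k, l)) = (\<lambda>_ _. 0)" if nu: "nu \<in> \<Lambda>" "\<not> dominates la nu" for nu
  proof -
    have "nu \<in> \<Lambda> - Up la" using nu by (simp add: Up_def)
    then show ?thesis unfolding Ek[OF \<open>nu \<in> \<Lambda> - Up la\<close>] E0[OF nu] by simp
  qed
  moreover have "EC la (wx (la, k, l)) = (\<lambda>i j. of_int e * mm ?d (EC la ?yk) (Nl la l) i j)"
    using Ek[of la] la Up_la unfolding E1[OF la] Nl_def gl_def by blast
  ultimately show ?thesis using ee by blast
qed

text \<open>A shape \<open>mu\<close> strictly above \<open>la\<close> has fewer shapes above it, so
  induction makes \<open>column_factor\<close> available for \<open>mu\<close>; and a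
  \<open>nu\<close> outside \<open>Up la\<close> cannot dominate \<open>mu\<close>.\<close>

lemma kills: "la \<in> \<Lambda> \<Longrightarrow> kills la"
proof (induction "card {mu \<in> \<Lambda>. dominates la mu}" arbitrary: la rule: less_induct)
  case less
  note la = less.prems
  have IH: "kills mu" if mu: "mu \<in> \<Lambda>" "dominates la mu" "mu \<noteq> la" for mu
  proof (rule less.hyps[OF _ mu(1)])
    have "{nu \<in> \<Lambda>. dominates mu nu} \<subset> {nu \<in> \<Lambda>. dominates la nu}"
      using mu la dominates_trans[OF mu(2)] dominates_antisym[OF la mu(1,2)] dominates_refl[of la] by blast
    then show "card {nu \<in> \<Lambda>. dominates mu nu} < card {nu \<in> \<Lambda>. dominates la nu}"
      using finite_partitions by (intro psubset_card_mono) auto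
  qed
  show ?case unfolding kills_def
  proof (intro ballI impI)
    fix y nu assume y: "y \<in> Ix" "fst y \<in> Up la" and nu: "nu \<in> \<Lambda> - Up la"
    obtain mu k l where ye: "y = (mu, k, l)" by (cases y)
    have mu: "mu \<in> \<Lambda>" "dominates la mu" "mu \<noteq> la" "k < d mu" "l < d mu" using y by (auto simp: ye Up_def)
    have "\<not> dominates mu nu"
    proof
      assume m: "dominates mu nu"
      then have "nu = la" using nu dominates_trans[OF mu(2) m] by (auto simp: Up_def)
      then show False using dominates_antisym[OF la mu(1,2)] m mu(3) by simp
    qed
    then show "EC nu (wx y) = (\<lambda>_ _. 0)"
      using column_factor[OF mu(1) IH[OF mu(1-3)] mu(4,5)] nu unfolding ye by blast
  qed
qed

end

section \<open>Left cells\<close>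

lemma cC_sum_lin:
  assumes "finite A" "\<And>x. x \<in> A \<Longrightarrow> supp_in n (f x)"
  shows "cC n (\<lambda>y. \<Sum>x\<in>A. b x * f x y) z = (\<Sum>x\<in>A. b x * cC n (f x) z)"
  using assms
proof (induction A rule: finite_induct)
  case empty
  have "cC n (\<lambda>_. 0) = (\<lambda>_. 0)" by (rule coordsI[OF tri_KL_C]) (simp_all add: supp_in_def)
  then show ?case by simp
next
  case (insert x A)
  have "cC n (\<lambda>y. \<Sum>x\<in>insert x A. b x * f x y) = cC n (\<lambda>y. (\<Sum>x\<in>A. b x * f x y) + b x * f x y)"
    using insert by (simp add: add.commute)
  also have "\<dots> = (\<lambda>z. cC n (\<lambda>y. \<Sum>x\<in>A. b x * f x y) z + b x * cC n (f x) z)"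
    using insert by (intro coords_add[OF tri_KL_C]) simp_all
  finally show ?case using insert by (simp add: add.commute)
qed

text \<open>\<open>T_s C_y\<close> and \<open>(T_s - v) C_y\<close> differ by a multiple of
  \<open>C_y\<close>, which has no coordinate at \<open>x\<close> different from
  \<open>y\<close>.\<close>

lemma leftedge_mulTs:
  assumes "x \<in> Sym n" "y \<in> Sym n" "x \<noteq> y"
  shows "leftedge n x y \<longleftrightarrow> (\<exists>s\<in>sgens n. cC n (mulTs n deltaA s (KL_C n y)) x \<noteq> 0)"
proof -
  have "cC n (\<lambda>u. mulTs n deltaA s (KL_C n y) u - vA * KL_C n y u) x = cC n (mulTs n deltaA s (KL_C n y)) x"
    if s: "s \<in> sgens n" for s
  proof -
    have "cC n (\<lambda>u. mulTs n deltaA s (KL_C n y) u + (- vA) * KL_C n y u) =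
       (\<lambda>z. cC n (mulTs n deltaA s (KL_C n y)) z + (- vA) * cC n (KL_C n y) z)"
      using s KL_C(1)[OF assms(2)] by (intro coords_add[OF tri_KL_C]) simp_all
    then show ?thesis using coords_basis[OF tri_KL_C assms(2)] assms(3) by (simp add: Tb_def)
  qed
  then show ?thesis unfolding leftedge_iff using assms by auto
qed

lemma leL_mulTs:
  assumes s: "s \<in> sgens n" and f: "supp_in n f" and y: "\<And>x. x \<in> Sym n \<Longrightarrow> cC n f x \<noteq> 0 \<Longrightarrow> leL n x y"
    and x: "x \<in> Sym n" "cC n (mulTs n deltaA s f) x \<noteq> 0"
  shows "leL n x y"
proof -
  have fe: "f = (\<lambda>u. \<Sum>z\<in>Sym n. cC n f z * KL_C n z u)" by (rule coords(2)[OF tri_KL_C f])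
  have "mulTs n deltaA s f = mulTs n deltaA s (\<lambda>u. \<Sum>z\<in>Sym n. cC n f z * KL_C n z u)"
    by (rule arg_cong[OF fe])
  also have "\<dots> = (\<lambda>u. \<Sum>z\<in>Sym n. cC n f z * mulTs n deltaA s (KL_C n z) u)"
    by (rule lin_sum[OF lin_mulTs finite_Sym])
  finally have "cC n (mulTs n deltaA s f) x = (\<Sum>z\<in>Sym n. cC n f z * cC n (mulTs n deltaA s (KL_C n z)) x)"
    by (simp only: cC_sum_lin[OF finite_Sym supp_mulTs[OF s KL_C(1)]])
  with x(2) have "(\<Sum>z\<in>Sym n. cC n f z * cC n (mulTs n deltaA s (KL_C n z)) x) \<noteq> 0" by (simp only: not_False_eq_True)
  then have "\<exists>z\<in>Sym n. cC n f z * cC n (mulTs n deltaA s (KL_C n z)) x \<noteq> 0"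
    by (rule contrapos_np) (rule sum.neutral, blast)
  then obtain z where z: "z \<in> Sym n" "cC n f z * cC n (mulTs n deltaA s (KL_C n z)) x \<noteq> 0" by (rule bexE)
  have zy: "leL n z y" using y[OF z(1)] z(2) by auto
  show ?thesis
  proof (cases "x = z")
    case True
    then show ?thesis using zy by simp
  next
    case False
    then have "leftedge n x z" using leftedge_mulTs[OF x(1) z(1)] s z(2) by auto
    then show ?thesis using zy unfolding leL_def by (rule converse_rtranclp_into_rtranclp)
  qed
qed

text \<open>Edges come from single generators. Expanding \<open>T_w\<close> letter by letter shows
  that every \<open>C_x\<close> occurring in \<open>T_w C_y\<close> has \<open>x\<close> below
  \<open>y\<close>.\<close>

lemma leL_mulT:
  assumes w: "w \<in> Sym n" and y: "y \<in> Sym n" and x: "x \<in> Sym n" "cC n (mulT n deltaA w (KL_C n y)) x \<noteq> 0"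
  shows "leL n x y"
proof -
  have "\<forall>x\<in>Sym n. cC n (Lw n deltaA ss (KL_C n y)) x \<noteq> 0 \<longrightarrow> leL n x y" if "set ss \<subseteq> sgens n" for ss
    using that
  proof (induction ss)
    case Nil
    then show ?case using coords_basis[OF tri_KL_C y] by (simp add: Tb_def leL_def foldr.simps id_apply)
  next
    case (Cons s ss)
    have IH: "\<And>x. x \<in> Sym n \<Longrightarrow> cC n (Lw n deltaA ss (KL_C n y)) x \<noteq> 0 \<Longrightarrow> leL n x y" using Cons by simp
    have "supp_in n (Lw n deltaA ss (KL_C n y))" using Cons.prems KL_C(1)[OF y] by simp
    moreover have "s \<in> sgens n" using Cons.prems by simp
    ultimately have "leL n x y"
      if "x \<in> Sym n" "cC n (mulTs n deltaA s (Lw n deltaA ss (KL_C n y))) x \<noteq> 0" for x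
      using leL_mulTs[OF _ _ IH that] by blast
    then show ?case by (simp add: foldr.simps o_apply)
  qed
  then show ?thesis using x rword(1)[OF w] unfolding mulT_def by blast
qed

context hecke_data
begin

section \<open>The action of the algebra on the columns\<close>

definition sg :: "nat list \<Rightarrow> nat \<Rightarrow> nat \<Rightarrow> int" where
  "sg la k l = (SOME e. e * e = 1 \<and>
    EC la (wx (la, k, l)) = (\<lambda>i j. of_int e * mm (d la) (EC la (wx (la, k, ic la))) (Nl la l) i j))"

lemma sg:
  assumes "la \<in> \<Lambda>" "k < d la" "l < d la"
  shows "sg la k l * sg la k l = 1"
    "EC la (wx (la, k, l)) = (\<lambda>i j. of_int (sg la k l) * mm (d la) (EC la (wx (la, k, ic la))) (Nl la l) i j)"
proof -
  have "\<exists>e :: int. e * e = 1 \<and>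
    EC la (wx (la, k, l)) = (\<lambda>i j. of_int e * mm (d la) (EC la (wx (la, k, ic la))) (Nl la l) i j)"
    using column_factor[OF assms(1) kills[OF assms(1)] assms(2,3)] by blast
  from someI_ex[OF this] show "sg la k l * sg la k l = 1"
    "EC la (wx (la, k, l)) = (\<lambda>i j. of_int (sg la k l) * mm (d la) (EC la (wx (la, k, ic la))) (Nl la l) i j)"
    unfolding sg_def[symmetric] by simp_all
qed

lemma EC_column_zero:
  assumes "la \<in> \<Lambda>" "k < d la" "l < d la" "nu \<in> \<Lambda>" "\<not> dominates la nu"
  shows "EC nu (wx (la, k, l)) = (\<lambda>_ _. 0)"
  using column_factor[OF assms(1) kills[OF assms(1)] assms(2,3)] assms(4,5) by blast

text \<open>Coordinates inside the column \<open>ic la\<close>. All columns of shape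
  \<open>la\<close> turn out to share them up to signs.\<close>

definition aW :: "nat list \<Rightarrow> perm \<Rightarrow> nat \<Rightarrow> nat \<Rightarrow> laur" where
  "aW la w k' k = cC n (mulT n deltaA w (C (wx (la, k, ic la)))) (wx (la, k', ic la))"

lemma wx_Sym: "la \<in> \<Lambda> \<Longrightarrow> k < d la \<Longrightarrow> l < d la \<Longrightarrow> wx (la, k, l) \<in> Sym n"
  using wx(1) by simp

lemma sum_Xc_column:
  assumes la: "la \<in> \<Lambda>" and l: "l < d la"
    and z: "\<And>nu k' j. (nu, k', j) \<in> Xc la \<Longrightarrow> \<not> (nu = la \<and> j = l) \<Longrightarrow> g (nu, k', j) = 0"
  shows "(\<Sum>y\<in>Xc la. g y) = (\<Sum>k'<d la. g (la, k', l))"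
proof -
  have sub: "(\<lambda>k'. (la, k', l)) ` {..<d la} \<subseteq> Xc la" using la l Up_la by (auto simp: Xc_iff)
  have "(\<Sum>y\<in>Xc la. g y) = (\<Sum>y\<in>(\<lambda>k'. (la, k', l)) ` {..<d la}. g y)"
  proof (rule sum.mono_neutral_right[OF finite_Xc sub], rule ballI)
    fix y assume y: "y \<in> Xc la - (\<lambda>k'. (la, k', l)) ` {..<d la}"
    obtain nu k' j where ye: "y = (nu, k', j)" by (cases y)
    have "\<not> (nu = la \<and> j = l)" using y by (auto simp: ye Xc_iff)
    then show "g y = 0" using z y ye by simp
  qed
  also have "\<dots> = (\<Sum>k'<d la. g (la, k', l))" by (subst sum.reindex) (simp_all add: inj_on_def)
  finally show ?thesis .
qed

lemma E_mulT:
  assumes "nu \<in> \<Lambda>" "w \<in> Sym n" "supp_in n h"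
  shows "E nu (emb (mulT n deltaA w h)) = mm (d nu) (M nu w) (E nu (emb h))"
  unfolding emb_mulT by (rule rep_mulT[OF rep[OF assms(1)] assms(2)]) (simp add: assms(3))

text \<open>\<open>T_w C_y\<close> stays in the right eigenspaces for the Young generators, so by
  \<open>Fr_cC_zero\<close> only elements of \<open>DJ la\<close> occur; by \<open>DJ_shape\<close>
  those whose shape is not strictly above \<open>la\<close> lie in the column
  \<open>ic la\<close>.\<close>

lemma first_column_action:
  assumes la: "la \<in> \<Lambda>" and w: "w \<in> Sym n" and k: "k < d la"
  shows "mm (d la) (M la w) (EC la (wx (la, k, ic la))) =
    (\<lambda>i j. \<Sum>k'<d la. embA (aW la w k' k) * EC la (wx (la, k', ic la)) i j)"
proof (intro ext)
  fix i j
  let ?y = "wx (la, k, ic la)"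
  define f where "f = mulT n deltaA w (C ?y)"
  have yD: "?y \<in> DJ la" using column_DJ[OF la k] .
  have yS: "?y \<in> Sym n" using yD by (simp add: DJ_def)
  have fs: "supp_in n f" unfolding f_def by (rule supp_mulT[OF w KL_C(1)[OF yS]])
  have Fr: "Fr n t f" if "t \<in> blk.J n la" for t
    unfolding f_def by (rule Fr_mulT[OF blk.J_sgens[OF that] w DJ_Fr[OF yD that]])
  have z: "embA (cC n f (wx x)) * EC la (wx x) i j = 0" if x: "x = (nu, k', j')" "x \<in> Xc la" "\<not> (nu = la \<and> j' = ic la)" for x nu k' j'
  proof -
    have xI: "(nu, k', j') \<in> Ix" using x Xc_Ix by blast
    have xS: "wx x \<in> Sym n" using wx(1)[OF Xc_Ix[OF x(2)]] .
    have "wx x \<notin> DJ la"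
    proof
      assume "wx x \<in> DJ la"
      then have dj: "wx (nu, k', j') \<in> DJ la" using x(1) by simp
      have "dominates la nu" using DJ_shape(1)[OF la xI dj] .
      then have "nu = la" using x(1,2) by (auto simp: Xc_iff Up_def)
      then show False using DJ_shape(2)[OF la xI dj] x(3) by simp
    qed
    then obtain t where t: "t \<in> blk.J n la" "\<not> len n (wx x \<circ> t) < len n (wx x)" using xS unfolding DJ_def by blast
    then have "len n (wx x) < len n (wx x \<circ> t)" using len_right_cases[OF xS blk.J_sgens[OF t(1)]] by linarith
    then have "cC n f (wx x) = 0" by (rule Fr_cC_zero[OF blk.J_sgens[OF t(1)] Fr[OF t(1)] xS])
    then show ?thesis by simp
  qed
  have "mm (d la) (M la w) (EC la ?y) i j = E la (emb f) i j"
    unfolding f_def E_mulT[OF la w KL_C(1)[OF yS]] ..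
  also have "\<dots> = (\<Sum>x\<in>Xc la. embA (cC n f (wx x)) * EC la (wx x) i j)"
    by (rule E_expand_Xc[OF kills[OF la] fs]) (simp add: la Up_la)
  also have "\<dots> = (\<Sum>k'<d la. embA (cC n f (wx (la, k', ic la))) * EC la (wx (la, k', ic la)) i j)"
    by (rule sum_Xc_column[OF la ic(1)[OF la]]) (rule z[OF refl])
  finally show "mm (d la) (M la w) (EC la ?y) i j =
    (\<Sum>k'<d la. embA (aW la w k' k) * EC la (wx (la, k', ic la)) i j)"
    by (simp only: aW_def f_def)
qed

text \<open>Right multiplication by \<open>Nl la l\<close> commutes with the left action and carries
  the column \<open>ic la\<close> to column \<open>l\<close>, up to the signs
  \<open>sg\<close>.\<close>

lemma column_action:
  assumes la: "la \<in> \<Lambda>" and w: "w \<in> Sym n" and kl: "k < d la" "l < d la"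
  shows "mm (d la) (M la w) (EC la (wx (la, k, l))) =
    (\<lambda>i j. \<Sum>k'<d la. of_int (sg la k l * sg la k' l) * embA (aW la w k' k) * EC la (wx (la, k', l)) i j)"
proof (intro ext)
  fix i j
  let ?d = "d la"
  have "mm ?d (M la w) (EC la (wx (la, k, l))) i j =
     of_int (sg la k l) * mm ?d (mm ?d (M la w) (EC la (wx (la, k, ic la)))) (Nl la l) i j"
    unfolding sg(2)[OF la kl] mm_scale mm_assoc ..
  also have "\<dots> = of_int (sg la k l) * (\<Sum>k'<?d. embA (aW la w k' k) * mm ?d (EC la (wx (la, k', ic la))) (Nl la l) i j)"
    unfolding first_column_action[OF la w kl(1)] mm_sum_left[OF finite_lessThan] ..
  also have "\<dots> = (\<Sum>k'<?d. of_int (sg la k l * sg la k' l) * embA (aW la w k' k) * EC la (wx (la, k', l)) i j)"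
    unfolding sum_distrib_left
  proof (rule sum.cong[OF refl])
    fix k' assume "k' \<in> {..<?d}"
    then have k': "k' < ?d" by simp
    let ?m = "mm ?d (EC la (wx (la, k', ic la))) (Nl la l) i j"
    have "of_int (sg la k l * sg la k' l) * embA (aW la w k' k) * EC la (wx (la, k', l)) i j =
      of_int (sg la k l) * (of_int (sg la k' l * sg la k' l) * (embA (aW la w k' k) * ?m))"
      unfolding sg(2)[OF la k' kl(2)] of_int_mult by (simp only: mult_ac)
    then show "of_int (sg la k l) * (embA (aW la w k' k) * ?m) =
      of_int (sg la k l * sg la k' l) * embA (aW la w k' k) * EC la (wx (la, k', l)) i j"
      unfolding sg(1)[OF la k' kl(2)] of_int_1 mult_1_left by (rule sym)
  qed
  finally show "mm ?d (M la w) (EC la (wx (la, k, l))) i j =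
    (\<Sum>k'<?d. of_int (sg la k l * sg la k' l) * embA (aW la w k' k) * EC la (wx (la, k', l)) i j)" .
qed

text \<open>\<open>column_action\<close> is only an identity of matrices. The true coordinates and
  the candidate \<open>r\<close> have the same image under all functionals indexed by
  \<open>Xc la\<close>, and \<open>system_ker\<close> makes them equal.\<close>

lemma column_coeff:
  assumes la: "la \<in> \<Lambda>" and w: "w \<in> Sym n" and kl: "k < d la" "l < d la" and y: "(nu, k', j') \<in> Xc la"
  shows "cC n (mulT n deltaA w (C (wx (la, k, l)))) (wx (nu, k', j')) =
    (if nu = la \<and> j' = l then of_int (sg la k l * sg la k' l) * aW la w k' k else 0)"
proof -
  let ?y = "wx (la, k, l)" and ?d = "d la"
  define f where "f = mulT n deltaA w (C ?y)"
  define r where "r = (\<lambda>(nu, k', j'). if nu = la \<and> j' = l then of_int (sg la k l * sg la k' l) * aW la w k' k else 0)"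
  have yS: "?y \<in> Sym n" by (rule wx_Sym[OF la kl])
  have fs: "supp_in n f" unfolding f_def by (rule supp_mulT[OF w KL_C(1)[OF yS]])
  have "cC n f (wx y) - r y = 0" if y: "y \<in> Xc la" for y
  proof (rule system_ker[where b = "\<lambda>y. cC n f (wx y) - r y", OF _ y])
    fix x assume x: "x \<in> Xc la"
    obtain nu i j where xe: "x = (nu, i, j)" by (cases x)
    have nu: "nu \<in> \<Lambda> - Up la" using x by (simp add: xe Xc_iff)
    have "(\<Sum>y\<in>Xc la. embA (r y) * Eh x (C (wx y))) = (\<Sum>k'<?d. embA (r (la, k', l)) * Eh x (C (wx (la, k', l))))"
      by (rule sum_Xc_column[OF la kl(2)]) (auto simp: r_def)
    also have "\<dots> = Eh x f"
    proof (cases "nu = la")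
      case True
      have "(\<Sum>k'<?d. embA (r (la, k', l)) * Eh x (C (wx (la, k', l)))) =
         vK ^ a la * (\<Sum>k'<?d. of_int (sg la k l * sg la k' l) * embA (aW la w k' k) * EC la (wx (la, k', l)) i j)"
        unfolding xe True Eh_def r_def prod.case sum_distrib_left by (intro sum.cong refl) simp
      also have "\<dots> = vK ^ a la * mm ?d (M la w) (EC la ?y) i j" unfolding column_action[OF la w kl] ..
      also have "\<dots> = Eh x f" unfolding xe True Eh_def prod.case f_def E_mulT[OF la w KL_C(1)[OF yS]] ..
      finally show ?thesis .
    next
      case False
      then have nd: "nu \<in> \<Lambda>" "\<not> dominates la nu" using nu by (auto simp: Up_def)
      have "Eh x f = 0" unfolding xe Eh_def prod.case f_def E_mulT[OF nd(1) w KL_C(1)[OF yS]] EC_column_zero[OF la kl nd]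
        by (simp add: mm_def)
      moreover have "Eh x (C (wx (la, k', l))) = 0" if "k' < ?d" for k'
        unfolding xe Eh_def prod.case EC_column_zero[OF la that kl(2) nd] by simp
      ultimately show ?thesis by simp
    qed
    finally show "(\<Sum>y\<in>Xc la. embA (cC n f (wx y) - r y) * Eh x (C (wx y))) = 0"
      using Eh_expand[OF kills[OF la] fs x] by (simp add: left_diff_distrib sum_subtractf)
  qed
  from this[OF y] show ?thesis by (simp add: f_def r_def)
qed

text \<open>Column \<open>k\<close> is the vector obtained by applying the \<open>C\<close> element
  of the triple \<open>(la, k, ic la)\<close> to the basis vector \<open>ic la\<close>.\<close>

definition Gm :: "nat list \<Rightarrow> nat \<Rightarrow> nat \<Rightarrow> ratf" where
  "Gm la j k = (if k < d la then EC la (wx (la, k, ic la)) j (ic la) else 0)"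

abbreviation "aK la \<equiv> (\<lambda>w i j. embA (aW la w i j))"

lemma inter_Gm: assumes la: "la \<in> \<Lambda>" shows "inter n (d la) (X la) (d la) (aK la) (Gm la)"
  unfolding inter_def
proof (intro conjI ballI ext)
  show "trunc (d la) (d la) (Gm la)"
    unfolding trunc_def
  proof (intro allI impI)
    fix i j assume "\<not> (i < d la \<and> j < d la)"
    then show "Gm la i j = 0" using trunc_ev[of "d la" n "X la"] unfolding trunc_def Gm_def by auto
  qed
  fix w j k assume w: "w \<in> Sym n"
  show "mm (d la) (M la w) (Gm la) j k = mm (d la) (Gm la) (Mx (d la) (aK la) w) j k"
  proof (cases "k < d la")
    case True
    have "mm (d la) (M la w) (Gm la) j k = mm (d la) (M la w) (EC la (wx (la, k, ic la))) j (ic la)"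
      using True by (simp add: mm_def Gm_def)
    also have "\<dots> = (\<Sum>k'<d la. embA (aW la w k' k) * EC la (wx (la, k', ic la)) j (ic la))"
      unfolding first_column_action[OF la w True] ..
    also have "\<dots> = mm (d la) (Gm la) (Mx (d la) (aK la) w) j k"
      using True unfolding mm_def by (intro sum.cong) (auto simp: Gm_def Mx_def)
    finally show ?thesis .
  qed (simp add: mm_def Gm_def Mx_def)
qed

text \<open>After rescaling, \<open>Gm\<close> is a diagonal matrix of signs at v = 0. A nonzero
  kernel vector, normalised to have a nonzero value there, would contradict this.\<close>

lemma Gm_inj:
  assumes la: "la \<in> \<Lambda>" and u: "u \<in> vecs {..<d la}" and z: "mv (d la) (Gm la) u = (\<lambda>_. 0)"
  shows "u = (\<lambda>_. 0)"
proof (rule ccontr)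
  assume "u \<noteq> (\<lambda>_. 0)"
  then obtain s0 where "u s0 \<noteq> 0" by blast
  then have s0: "s0 \<in> {..<d la}" "u s0 \<noteq> 0" using u unfolding vecs_def by blast+
  obtain m \<gamma> s1 where m: "\<forall>s\<in>{..<d la}. isval (vK powi m * u s) (\<gamma> s)" and s1: "s1 \<in> {..<d la}" "\<gamma> s1 \<noteq> 0"
    using vadic_family_ex[of "{..<d la}" s0 u, OF finite_lessThan s0] by (elim exE conjE bexE)
  have I1: "(la, s1, ic la) \<in> Ix" using la s1 ic by simp
  have "isval (\<Sum>k<d la. (vK ^ a la * EC la (wx (la, k, ic la)) s1 (ic la)) * (vK powi m * u k))
     (\<Sum>k<d la. cv la s1 (ic la) (wx (la, k, ic la)) * \<gamma> k)"
    using m ic(1)[OF la] by (intro isval_sum isval_mult EC_val la wx_Sym) auto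
  moreover have "(\<Sum>k<d la. (vK ^ a la * EC la (wx (la, k, ic la)) s1 (ic la)) * (vK powi m * u k)) = 0"
  proof -
    have "(\<Sum>k<d la. Gm la s1 k * u k) = 0" using fun_cong[OF z, of s1] by (simp add: mv_def)
    then have "vK ^ a la * vK powi m * (\<Sum>k<d la. EC la (wx (la, k, ic la)) s1 (ic la) * u k) = 0"
      by (simp add: Gm_def)
    then show ?thesis unfolding sum_distrib_left by (simp only: mult_ac)
  qed
  ultimately have "isval 0 (\<Sum>k<d la. cv la s1 (ic la) (wx (la, k, ic la)) * \<gamma> k)" by (simp only:)
  then have v: "(\<Sum>k<d la. cv la s1 (ic la) (wx (la, k, ic la)) * \<gamma> k) = 0"
    by (rule isval_unique[OF _ isval_zero])
  have "(\<Sum>k<d la. cv la s1 (ic la) (wx (la, k, ic la)) * \<gamma> k) =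
     (\<Sum>k<d la. if k = s1 then cv la s1 (ic la) (wx (la, s1, ic la)) * \<gamma> s1 else 0)"
  proof (rule sum.cong[OF refl])
    fix k assume "k \<in> {..<d la}"
    then have Ik: "(la, k, ic la) \<in> Ix" using la ic by simp
    show "cv la s1 (ic la) (wx (la, k, ic la)) * \<gamma> k =
      (if k = s1 then cv la s1 (ic la) (wx (la, s1, ic la)) * \<gamma> s1 else 0)"
      unfolding cv_wx[OF Ik I1] by simp
  qed
  then have "cv la s1 (ic la) (wx (la, s1, ic la)) * \<gamma> s1 = 0" using v s1 by (simp add: sum.delta)
  then show False using cv_sq[OF I1] s1 by auto
qed

lemma aW_char:
  assumes la: "la \<in> \<Lambda>" and w: "w \<in> Sym n"
  shows "(\<Sum>i<d la. M la w i i) = (\<Sum>i<d la. embA (aW la w i i))"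
  using schur_char[OF irr[OF la] inter_Gm[OF la] d_pos[OF la] Gm_inj[OF la] w] by (simp add: Mx_def)

text \<open>An outer bound for the left preorder on triples: going down in that preorder either
  makes the shape strictly larger in dominance or keeps shape and column.\<close>

definition below :: "nat list \<times> nat \<times> nat \<Rightarrow> nat list \<times> nat \<times> nat \<Rightarrow> bool" where
  "below = (\<lambda>(mu, k', l') (la, k, l). mu \<in> Up la \<or> mu = la \<and> l' = l)"

lemma Up_trans: "la \<in> \<Lambda> \<Longrightarrow> mu \<in> Up la \<Longrightarrow> nu \<in> Up mu \<Longrightarrow> nu \<in> Up la"
  unfolding Up_def using dominates_trans[of la mu nu] dominates_antisym[of la n mu] by blast

lemma leftedge_below:
  assumes x: "x \<in> Ix" and y: "y \<in> Ix" and e: "leftedge n (wx x) (wx y)" shows "below x y"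
proof (cases "x = y")
  case True
  then show ?thesis by (cases y) (simp add: below_def)
next
  case False
  obtain la k l where ye: "y = (la, k, l)" by (cases y)
  obtain nu k' j' where xe: "x = (nu, k', j')" by (cases x)
  have la: "la \<in> \<Lambda>" "k < d la" "l < d la" using y by (simp_all add: ye)
  have "wx x \<noteq> wx y" using wx_inj[OF x y] False by blast
  then obtain s where s: "s \<in> sgens n" "cC n (mulTs n deltaA s (C (wx y))) (wx x) \<noteq> 0"
    using leftedge_mulTs[OF wx(1)[OF x] wx(1)[OF y]] e by blast
  have sS: "s \<in> Sym n" using s(1) by simp
  have nz: "cC n (mulT n deltaA s (C (wx y))) (wx x) \<noteq> 0"
    using s(2) unfolding mulT_sgen[OF s(1) KL_C(1)[OF wx(1)[OF y]]] .
  show ?thesis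
  proof (cases "nu \<in> Up la")
    case False
    then have "(nu, k', j') \<in> Xc la" using x by (simp add: xe Xc_def)
    from column_coeff[OF la(1) sS la(2,3) this] nz show ?thesis
      unfolding ye xe below_def by (auto split: if_splits)
  qed (simp add: xe ye below_def)
qed

lemma below_trans:
  assumes "below t x" "below x y" "y \<in> Ix" shows "below t y"
proof -
  obtain nu k l mu k' l' la k'' l'' where e: "t = (nu, k, l)" "x = (mu, k', l')" "y = (la, k'', l'')"
    by (cases t, cases x, cases y)
  have "la \<in> \<Lambda>" using assms(3) by (simp add: e)
  from Up_trans[OF this, of mu nu] show ?thesis using assms(1,2) unfolding e below_def prod.case by blast
qed

lemma leL_below:
  assumes "leL n u (wx y)" and y: "y \<in> Ix" shows "\<exists>x\<in>Ix. u = wx x \<and> below x y"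
  using assms(1) unfolding leL_def
proof (induction rule: converse_rtranclp_induct)
  case base
  have "below y y" by (cases y) (simp add: below_def)
  then show ?case using y by blast
next
  case (step u z)
  obtain x where x: "x \<in> Ix" "z = wx x" "below x y" using step.IH by blast
  have "u \<in> Sym n" using step.hyps(1) by (simp add: leftedge_def)
  then obtain t where t: "t \<in> Ix" "u = wx t" by (rule wx_surj)
  have "below t x" using leftedge_below[OF t(1) x(1)] step.hyps(1) t x by simp
  then have "below t y" by (rule below_trans[OF _ x(3) y])
  then show ?case using t by blast
qed

definition col :: "nat list \<Rightarrow> nat \<Rightarrow> perm set" where
  "col la l = (\<lambda>k. wx (la, k, l)) ` {..<d la}"

text \<open>\<open>S\<close> collects the rows whose elements lie below the given one. The columns
  of \<open>Gm\<close> indexed by \<open>S\<close> span a nonzero invariant subspace, which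
  irreducibility forces to be the whole space, and injectivity of \<open>Gm\<close> then puts every
  row into \<open>S\<close>.\<close>

lemma leL_column:
  assumes la: "la \<in> \<Lambda>" and l: "l < d la" and k: "k < d la" and k': "k' < d la"
  shows "leL n (wx (la, k', l)) (wx (la, k, l))"
proof -
  let ?d = "d la"
  define S where "S = {m. m < ?d \<and> leL n (wx (la, m, l)) (wx (la, k, l))}"
  have kS: "k \<in> S" using k by (simp add: S_def leL_def)
  have Sd: "S \<subseteq> {..<?d}" by (auto simp: S_def)
  \<comment> \<open>The signs \<open>sg\<close> are units, so a nonzero entry of \<open>aW\<close>
    means an occurrence in column \<open>l\<close> too, and hence a relation in the left
    preorder.\<close>
  have zero: "aW la w m2 m1 = 0" if w: "w \<in> Sym n" and m: "m1 \<in> S" "m2 < ?d" "m2 \<notin> S" for w m1 m2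
  proof (rule ccontr)
    assume nz: "aW la w m2 m1 \<noteq> 0"
    have m1: "m1 < ?d" "leL n (wx (la, m1, l)) (wx (la, k, l))" using m(1) by (simp_all add: S_def)
    have X2: "(la, m2, l) \<in> Xc la" using la l m Up_la by (simp add: Xc_iff)
    have "cC n (mulT n deltaA w (C (wx (la, m1, l)))) (wx (la, m2, l)) = of_int (sg la m1 l * sg la m2 l) * aW la w m2 m1"
      using column_coeff[OF la w m1(1) l X2] by simp
    moreover have "sg la m1 l * sg la m2 l \<noteq> 0" using sg(1)[OF la m1(1) l] sg(1)[OF la m(2) l] by auto
    ultimately have "cC n (mulT n deltaA w (C (wx (la, m1, l)))) (wx (la, m2, l)) \<noteq> 0" using nz by simp
    then have "leL n (wx (la, m2, l)) (wx (la, m1, l))"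
      by (rule leL_mulT[OF w wx_Sym[OF la m1(1) l] wx_Sym[OF la m(2) l]])
    then have "leL n (wx (la, m2, l)) (wx (la, k, l))" using m1(2) unfolding leL_def by (rule rtranclp_trans)
    then show False using m by (simp add: S_def)
  qed
  define V where "V = mv ?d (Gm la) ` vecs S"
  have tr: "trunc ?d ?d (Gm la)" using inter_Gm[OF la] by (simp add: inter_def)
  have "invariant_subspace n {..<?d} (X la) V"
    unfolding invariant_subspace_def
  proof (intro conjI ballI allI)
    show "V \<subseteq> vecs {..<?d}" unfolding V_def using mv_vecs[OF tr] by blast
    have "(\<lambda>_. 0) \<in> vecs S" by (simp add: vecs_def)
    from imageI[OF this, of "mv ?d (Gm la)"] show "(\<lambda>_. 0) \<in> V" by (simp add: V_def)
    fix u assume "u \<in> V"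
    then obtain b where b: "b \<in> vecs S" "u = mv ?d (Gm la) b" by (auto simp: V_def)
    show "(\<lambda>i. u i + u' i) \<in> V" if u': "u' \<in> V" for u'
    proof -
      obtain b' where b': "b' \<in> vecs S" "u' = mv ?d (Gm la) b'" using u' by (auto simp: V_def)
      have "(\<lambda>i. b i + b' i) \<in> vecs S" using b b' by (simp add: vecs_def)
      then show ?thesis unfolding b(2) b'(2) mv_lin[symmetric] V_def by (rule imageI)
    qed
    show "(\<lambda>i. r * u i) \<in> V" for r
    proof -
      have "(\<lambda>i. r * b i) \<in> vecs S" using b by (simp add: vecs_def)
      then show ?thesis unfolding b(2) mv_lin[symmetric] V_def by (rule imageI)
    qed
    show "act {..<?d} (X la w) u \<in> V" if w: "w \<in> Sym n" for w
    proof -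
      have "act {..<?d} (X la w) u = mv ?d (mm ?d (M la w) (Gm la)) b" unfolding act_eq b(2) mm_mv ..
      also have "\<dots> = mv ?d (Gm la) (mv ?d (Mx ?d (aK la) w) b)"
        using inter_Gm[OF la] w by (simp add: inter_def mm_mv)
      finally have e: "act {..<?d} (X la w) u = mv ?d (Gm la) (mv ?d (Mx ?d (aK la) w) b)" .
      have "mv ?d (Mx ?d (aK la) w) b \<in> vecs S"
        unfolding vecs_def mem_Collect_eq
      proof (intro allI impI)
        fix m assume m: "m \<notin> S"
        show "mv ?d (Mx ?d (aK la) w) b m = 0" unfolding mv_def
        proof (rule sum.neutral, rule ballI)
          fix j assume "j \<in> {..<?d}"
          show "Mx ?d (aK la) w m j * b j = 0"
          proof (cases "j \<in> S")
            case True
            then show ?thesis using zero[OF w True _ m] by (simp add: Mx_def)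
          next
            case False
            then show ?thesis using b(1) by (simp add: vecs_def)
          qed
        qed
      qed
      then show ?thesis unfolding e V_def by (rule imageI)
    qed
  qed
  then have "V = {\<lambda>_. 0} \<or> V = vecs {..<?d}" using irr[OF la] unfolding irreducible_rep_def by blast
  then show ?thesis
  proof
    assume V: "V = {\<lambda>_. 0}"
    have "evec k \<in> vecs S" using kS by (auto simp: vecs_def)
    then have "mv ?d (Gm la) (evec k) \<in> V" unfolding V_def by (rule imageI)
    then have "mv ?d (Gm la) (evec k) = (\<lambda>_. 0)" using V by (simp only: singleton_iff)
    from Gm_inj[OF la evec_vecs[OF k] this] have "(1 :: ratf) = 0" using fun_cong[of "evec k" "\<lambda>_. 0" k] by simp
    then show ?thesis by simp
  next
    assume V: "V = vecs {..<?d}"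
    have "mv ?d (Gm la) (evec k') \<in> V" unfolding V by (rule mv_vecs[OF tr])
    then obtain b where b: "b \<in> vecs S" "mv ?d (Gm la) (evec k') = mv ?d (Gm la) b" unfolding V_def by (rule imageE)
    define u where "u = (\<lambda>i. evec k' i + (- 1) * b i)"
    have "mv ?d (Gm la) u = (\<lambda>_. 0)" unfolding u_def mv_lin b(2) by simp
    moreover have bz: "b i = 0" if "i \<notin> S" for i using b(1) that by (simp add: vecs_def)
    moreover have "u i = 0" if "i \<notin> {..<?d}" for i
    proof -
      have "i \<notin> S" "i \<noteq> k'" using that Sd k' by auto
      then show ?thesis using bz by (simp add: u_def)
    qed
    then have "u \<in> vecs {..<?d}" unfolding vecs_def by simp
    ultimately have "u = (\<lambda>_. 0)" using Gm_inj[OF la, of u] by simp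
    then have "u k' = 0" by (rule fun_cong)
    then have "b k' \<noteq> 0" unfolding u_def by simp
    then have "k' \<in> S" using bz[of k'] by argo
    then show ?thesis by (simp add: S_def)
  qed
qed

text \<open>\<open>leL_column\<close> gives one inclusion. For the other, \<open>below\<close> holds
  in both directions, and antisymmetry of dominance rules out a strict increase of the
  shape.\<close>

lemma simL_column:
  assumes la: "la \<in> \<Lambda>" and k: "k < d la" and l: "l < d la"
  shows "{y \<in> Sym n. simL n (wx (la, k, l)) y} = col la l"
proof
  have I: "(la, k, l) \<in> Ix" using assms by simp
  show "col la l \<subseteq> {y \<in> Sym n. simL n (wx (la, k, l)) y}"
    using leL_column[OF la l] k wx_Sym[OF la _ l] by (auto simp: col_def simL_def)
  show "{y \<in> Sym n. simL n (wx (la, k, l)) y} \<subseteq> col la l"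
  proof
    fix y assume "y \<in> {y \<in> Sym n. simL n (wx (la, k, l)) y}"
    then have y: "leL n (wx (la, k, l)) y" "leL n y (wx (la, k, l))" by (simp_all add: simL_def)
    obtain x where x: "x \<in> Ix" "y = wx x" "below x (la, k, l)" using leL_below[OF y(2) I] by blast
    obtain x' where x': "x' \<in> Ix" "wx (la, k, l) = wx x'" "below x' x" using leL_below[of "wx (la, k, l)" x] y(1) x by blast
    have "x' = (la, k, l)" using wx_inj[OF I x'(1,2)] by simp
    obtain mu k' l' where xe: "x = (mu, k', l')" by (cases x)
    have mu: "mu \<in> \<Lambda>" "k' < d mu" using x(1) by (simp_all add: xe)
    have "mu = la \<and> l' = l"
      using x(3) x'(3) dominates_antisym[OF la mu(1)] unfolding \<open>x' = (la, k, l)\<close> xe below_def Up_def by auto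
    then show "y \<in> col la l" using x(2) mu by (simp add: xe col_def)
  qed
qed

lemma left_cells_eq: "left_cells n = (\<lambda>(la, l). col la l) ` (SIGMA la:\<Lambda>. {..<d la})"
proof
  show "left_cells n \<subseteq> (\<lambda>(la, l). col la l) ` (SIGMA la:\<Lambda>. {..<d la})"
  proof
    fix D assume "D \<in> left_cells n"
    then obtain w where w: "w \<in> Sym n" "D = {y \<in> Sym n. simL n w y}" unfolding left_cells_def by blast
    obtain x where x: "x \<in> Ix" "w = wx x" by (rule wx_surj[OF w(1)])
    obtain la k l where xe: "x = (la, k, l)" by (cases x)
    have *: "la \<in> \<Lambda>" "k < d la" "l < d la" using x(1) by (simp_all add: xe)
    have "D = col la l" using simL_column[OF *] w(2) x(2) xe by simp
    then show "D \<in> (\<lambda>(la, l). col la l) ` (SIGMA la:\<Lambda>. {..<d la})" using * by (intro image_eqI[of _ _ "(la, l)"]) auto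
  qed
  show "(\<lambda>(la, l). col la l) ` (SIGMA la:\<Lambda>. {..<d la}) \<subseteq> left_cells n"
  proof
    fix D assume "D \<in> (\<lambda>(la, l). col la l) ` (SIGMA la:\<Lambda>. {..<d la})"
    then obtain la l where D: "la \<in> \<Lambda>" "l < d la" "D = col la l" by auto
    have "wx (la, 0, l) \<in> Sym n" using wx_Sym[OF D(1) d_pos[OF D(1)] D(2)] .
    then show "D \<in> left_cells n"
      using simL_column[OF D(1) d_pos[OF D(1)] D(2)] unfolding D(3) left_cells_def by blast
  qed
qed

lemma col_eqD:
  assumes "la \<in> \<Lambda>" "l < d la" "mu \<in> \<Lambda>" "l' < d mu" "col la l = col mu l'" shows "la = mu \<and> l = l'"
proof -
  have "wx (la, 0, l) \<in> col mu l'" using assms d_pos[OF assms(1)] unfolding assms(5)[symmetric] by (simp add: col_def)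
  then obtain k where k: "k < d mu" "wx (la, 0, l) = wx (mu, k, l')" by (auto simp: col_def)
  have "(la, 0, l) \<in> Ix" "(mu, k, l') \<in> Ix" using assms k d_pos[OF assms(1)] by auto
  from wx_inj[OF this k(2)] show ?thesis by simp
qed

lemma card_left_cells: "card (left_cells n) = (\<Sum>la\<in>\<Lambda>. d la)"
proof -
  have "inj_on (\<lambda>(la, l). col la l) (SIGMA la:\<Lambda>. {..<d la})"
    unfolding inj_on_def using col_eqD by auto
  then show ?thesis unfolding left_cells_eq by (simp add: card_image finite_partitions)
qed

lemma col_subset_Rset:
  assumes la: "la \<in> \<Lambda>" and l: "l < d la" and mu: "mu \<in> \<Lambda>"
  shows "col la l \<subseteq> Rset n X d mu \<longleftrightarrow> la = mu"
proof
  assume "col la l \<subseteq> Rset n X d mu"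
  moreover have "wx (la, 0, l) \<in> col la l" using d_pos[OF la] by (simp add: col_def)
  ultimately have "wx (la, 0, l) \<in> Rset n X d mu" by (rule subsetD)
  then obtain i j where ij: "i < d mu" "j < d mu" "wx (la, 0, l) = wx (mu, i, j)" unfolding Rset_eq[OF mu] by blast
  have "(la, 0, l) \<in> Ix" "(mu, i, j) \<in> Ix" using la l mu ij d_pos[OF la] by auto
  from wx_inj[OF this ij(3)] show "la = mu" by simp
next
  assume "la = mu"
  then show "col la l \<subseteq> Rset n X d mu" using l unfolding Rset_eq[OF mu] col_def by auto
qed

text \<open>On the diagonal both the signs \<open>sg\<close> and those in \<open>cell_rep\<close>
  appear squared, so the trace is that of \<open>aW\<close>, which the intertwiner \<open>Gm\<close>
  identifies with the trace of \<open>X la\<close>.\<close>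

lemma cell_char_col:
  assumes la: "la \<in> \<Lambda>" and l: "l < d la"
  shows "cell_char n (col la l) = hk_char n {..<d la} (X la)"
proof
  fix w
  show "cell_char n (col la l) w = hk_char n {..<d la} (X la) w"
  proof (cases "w \<in> Sym n")
    case True
    have inj: "inj_on (\<lambda>k. wx (la, k, l)) {..<d la}"
    proof (rule inj_onI)
      fix k k' assume "k \<in> {..<d la}" "k' \<in> {..<d la}" and e: "wx (la, k, l) = wx (la, k', l)"
      then have "(la, k, l) \<in> Ix" "(la, k', l) \<in> Ix" using la l by auto
      from wx_inj[OF this e] show "k = k'" by simp
    qed
    have "cell_char n (col la l) w = (\<Sum>k<d la. cell_rep n (col la l) w (wx (la, k, l)) (wx (la, k, l)))"
      using True unfolding cell_char_def hk_char_def col_def sum.reindex[OF inj] by simp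
    also have "\<dots> = (\<Sum>k<d la. embA (aW la w k k))"
    proof (rule sum.cong[OF refl])
      fix k assume "k \<in> {..<d la}"
      then have k: "k < d la" by simp
      have X: "(la, k, l) \<in> Xc la" using la l k Up_la by (simp add: Xc_iff)
      have "cC n (hmult n deltaA (Tb w) (C (wx (la, k, l)))) (wx (la, k, l)) = aW la w k k"
        unfolding hmult_Tb_left[OF True] using column_coeff[OF la True k l X] sg(1)[OF la k l] by simp
      then show "cell_rep n (col la l) w (wx (la, k, l)) (wx (la, k, l)) = embA (aW la w k k)"
        unfolding cell_rep_def by simp
    qed
    also have "\<dots> = hk_char n {..<d la} (X la) w" using True by (simp add: hk_char_eq aW_char[OF la])
    finally show ?thesis .
  qed (simp add: cell_char_def hk_char_def)
qed

lemma cell_theorem: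
  "(\<forall>C\<in>left_cells n. irr_char n (cell_char n C)) \<and>
   (\<forall>C\<in>left_cells n. \<forall>C'\<in>left_cells n. cell_char n C = cell_char n C' \<longleftrightarrow>
      (\<exists>la\<in>\<Lambda>. C \<subseteq> Rset n X d la \<and> C' \<subseteq> Rset n X d la)) \<and>
   card (left_cells n) = (\<Sum>la\<in>\<Lambda>. d la)"
proof (intro conjI ballI card_left_cells)
  fix D assume "D \<in> left_cells n"
  then obtain la l where D: "la \<in> \<Lambda>" "l < d la" "D = col la l" unfolding left_cells_eq by auto
  show "irr_char n (cell_char n D)"
    unfolding D(3) cell_char_col[OF D(1,2)] irr_char_def using irr[OF D(1)] by blast
  fix D' assume "D' \<in> left_cells n"
  then obtain mu l' where D': "mu \<in> \<Lambda>" "l' < d mu" "D' = col mu l'" unfolding left_cells_eq by auto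
  show "cell_char n D = cell_char n D' \<longleftrightarrow> (\<exists>la\<in>\<Lambda>. D \<subseteq> Rset n X d la \<and> D' \<subseteq> Rset n X d la)"
    unfolding D(3) D'(3) cell_char_col[OF D(1,2)] cell_char_col[OF D'(1,2)]
    using col_subset_Rset[OF D(1,2)] col_subset_Rset[OF D'(1,2)] inj[OF D(1) D'(1)] D(1) by blast
qed

end

theorem theorem5p4:
  fixes n :: nat
    and X :: "nat list \<Rightarrow> perm \<Rightarrow> nat \<Rightarrow> nat \<Rightarrow> ratf"
    and d :: "nat list \<Rightarrow> nat"
  assumes irr: "\<forall>la\<in>partitions n. irreducible_rep n {..<d la} (X la)"
    and all_irr: "bij_betw (\<lambda>la. hk_char n {..<d la} (X la)) (partitions n) {\<chi>. irr_char n \<chi>}"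
    and label: "\<forall>la\<in>partitions n. \<exists>m :: nat list \<Rightarrow> nat.
        ind_sign_char n la = (\<lambda>w. hk_char n {..<d la} (X la) w +
          (\<Sum>mu\<in>{mu \<in> partitions n. dominates la mu \<and> mu \<noteq> la}.
              of_nat (m mu) * hk_char n {..<d mu} (X mu) w))"
    and orth: "\<forall>la\<in>partitions n. \<exists>P :: nat \<Rightarrow> real poly. (\<forall>i<d la. poly (P i) 0 = 1) \<and>
        (\<forall>w\<in>Sym n. \<forall>i<d la. \<forall>j<d la.
           X la (inv w) i j = Fract (P j) 1 * X la w j i / Fract (P i) 1)"
    and integ: "\<forall>la\<in>partitions n. \<forall>w\<in>Sym n. \<forall>i<d la. \<forall>j<d la.
        regular0 (vK ^ a_fun n la * X la w i j) \<and>
        value0 (vK ^ a_fun n la * X la w i j) \<in> \<int>"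
  shows "(\<forall>C\<in>left_cells n. irr_char n (cell_char n C)) \<and>
         (\<forall>C\<in>left_cells n. \<forall>C'\<in>left_cells n.
            cell_char n C = cell_char n C' \<longleftrightarrow>
            (\<exists>la\<in>partitions n. C \<subseteq> Rset n X d la \<and> C' \<subseteq> Rset n X d la)) \<and>
         card (left_cells n) = (\<Sum>la\<in>partitions n. d la)"
proof -
  from bchoice[OF orth] obtain P :: "nat list \<Rightarrow> nat \<Rightarrow> real poly" where
    P: "\<forall>la\<in>partitions n. (\<forall>i<d la. poly (P la i) 0 = 1) \<and>
        (\<forall>w\<in>Sym n. \<forall>i<d la. \<forall>j<d la.
           X la (inv w) i j = Fract (P la j) 1 * X la w j i / Fract (P la i) 1)" by (rule exE)
  interpret hecke_data n X d "\<lambda>la i. Fract (P la i) 1"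
  proof
    show "\<exists>la\<in>partitions n. \<chi> = hk_char n {..<d la} (X la)" if "irr_char n \<chi>" for \<chi>
      using bij_betw_imp_surj_on[OF all_irr] that by blast
    show "la = mu" if "la \<in> partitions n" "mu \<in> partitions n"
      "hk_char n {..<d la} (X la) = hk_char n {..<d mu} (X mu)" for la mu
      using inj_onD[OF bij_betw_imp_inj_on[OF all_irr] that(3,1,2)] .
    show "isval (Fract (P la i) 1) 1" if "la \<in> partitions n" "i < d la" for la i
      using isval_Fract[of "P la i"] P that by simp
  qed (use irr label P integ in \<open>simp_all\<close>)
  show ?thesis by (rule cell_theorem)
qed

end
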